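(* The association $\mathcal{E}\mapsto \operatorname{mod}_{\mathsf{adm}}(\mathcal{E})$ induces a $2$-functor $$\operatorname{mod}_{\mathsf{adm}}(-)\colon \mathsf{Ex}_L\to \mathsf{Ex}$$ which is left adjoint to the inclusion $\mathsf{Ex}\subseteq \mathsf{Ex}_L$, i.e. for which, for all exact categories $\mathcal{E}$ and $\mathcal{E}'$, the restriction $$\operatorname{Hom}_{\mathsf{Ex}}(\operatorname{mod}_{\mathsf{adm}}(\mathcal{E}),\mathcal{E}')\to \operatorname{Hom}_{\mathsf{Ex}_L}(\mathcal{E},\mathcal{E}')$$ via $\Upsilon\colon \mathcal{E}\to \operatorname{mod}_{\mathsf{adm}}(\mathcal{E})$ is an equivalence of categories.
   Context: All categories are essentially small and additive; subcategories are full and closed under isomorphisms. Exact categories are in the sense of Quillen, with conflations, inflations and deflations; no idempotent completeness is assumed. A functor is exact if it is additive and maps conflations to conflations. A morphism is admissible if it is a composite $m\circ p$ with $p$ a deflation and $m$ an inflation. An additive functor $F\colon\mathcal{E}\to\mathcal{E}'$ of exact categories is left exact if for each conflation $X\xrightarrow{f}Y\xrightarrow{g}Z$ in $\mathcal{E}$, $F(g)$ is admissible and $F(f)$ is an inflation which is a kernel of $F(g)$. $\operatorname{Mod}(\mathcal{E})$ is the category of additive contravariant functors $\mathcal{E}\to\mathsf{Ab}$ and $\Upsilon(X)=\operatorname{Hom}_{\mathcal{E}}(-,X)$ is the Yoneda functor. $\operatorname{mod}_{\mathsf{adm}}(\mathcal{E})\subseteq\operatorname{Mod}(\mathcal{E})$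 is the full subcategory of functors $F$ with an exact sequence $\Upsilon(X)\xrightarrow{\Upsilon(f)}\Upsilon(Y)\to F\to 0$ with $f$ admissible in $\mathcal{E}$. It is extension-closed in $\operatorname{Mod}(\mathcal{E})$ and carries the inherited exact structure. $\mathsf{Ex}$ (resp. $\mathsf{Ex}_L$) is the 2-category whose objects are exact categories, whose 1-morphisms are exact (resp. left exact) functors, and whose 2-morphisms are natural transformations. 2-functors are understood up to coherent isomorphism (pseudofunctors). *)

theory Defs
  imports "HOL-Algebra.Coset"
begin

section \<open>Categories, functors, natural transformations\<close>

text \<open>
  Objects and arrows form subsets of two types, so every category here is small relative to
  its pair of types. Each arrow determines its domain and codomain.
\<close>

record ('o, 'm) cat =
  Ob :: "'o set"
  Ar :: "'m set"
  Dom :: "'m \<Rightarrow> 'o"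
  Cod :: "'m \<Rightarrow> 'o"
  Idn :: "'o \<Rightarrow> 'm"
  Cmp :: "'m \<Rightarrow> 'm \<Rightarrow> 'm"  (infixl \<open>\<cdot>\<index>\<close> 70)

definition Hom :: "('o, 'm, 'z) cat_scheme \<Rightarrow> 'o \<Rightarrow> 'o \<Rightarrow> 'm set" where
  "Hom C X Y = {f \<in> Ar C. Dom C f = X \<and> Cod C f = Y}"

locale category =
  fixes C :: "('o, 'm, 'z) cat_scheme" (structure)
  assumes dom_ob: "f \<in> Ar C \<Longrightarrow> Dom C f \<in> Ob C"
    and cod_ob: "f \<in> Ar C \<Longrightarrow> Cod C f \<in> Ob C"
    and id_hom: "X \<in> Ob C \<Longrightarrow> Idn C X \<in> Hom C X X"
    and cmp_hom: "\<lbrakk>f \<in> Hom C X Y; g \<in> Hom C Y Z\<rbrakk> \<Longrightarrow> g \<cdot> f \<in> Hom C X Z"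
    and cmp_id_left: "f \<in> Hom C X Y \<Longrightarrow> Idn C Y \<cdot> f = f"
    and cmp_id_right: "f \<in> Hom C X Y \<Longrightarrow> f \<cdot> Idn C X = f"
    and cmp_assoc:
      "\<lbrakk>f \<in> Hom C W X; g \<in> Hom C X Y; h \<in> Hom C Y Z\<rbrakk> \<Longrightarrow> (h \<cdot> g) \<cdot> f = h \<cdot> (g \<cdot> f)"

definition is_iso :: "('o, 'm, 'z) cat_scheme \<Rightarrow> 'm \<Rightarrow> bool" where
  "is_iso C f \<longleftrightarrow> f \<in> Ar C \<and>
    (\<exists>g \<in> Hom C (Cod C f) (Dom C f).
       g \<cdot>\<^bsub>C\<^esub> f = Idn C (Dom C f) \<and> f \<cdot>\<^bsub>C\<^esub> g = Idn C (Cod C f))"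

definition isomorphic :: "('o, 'm, 'z) cat_scheme \<Rightarrow> 'o \<Rightarrow> 'o \<Rightarrow> bool" where
  "isomorphic C X Y \<longleftrightarrow> (\<exists>f \<in> Hom C X Y. is_iso C f)"

definition full_subcat :: "('o, 'm) cat \<Rightarrow> 'o set \<Rightarrow> ('o, 'm) cat" where
  "full_subcat C S =
    C\<lparr>Ob := Ob C \<inter> S, Ar := {f \<in> Ar C. Dom C f \<in> S \<and> Cod C f \<in> S}\<rparr>"

definition prod_cat :: "('o, 'm) cat \<Rightarrow> ('p, 'n) cat \<Rightarrow> ('o \<times> 'p, 'm \<times> 'n) cat" where
  "prod_cat C D =
    \<lparr>Ob = Ob C \<times> Ob D,
     Ar = Ar C \<times> Ar D,
     Dom = (\<lambda>(f, g). (Dom C f, Dom D g)),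
     Cod = (\<lambda>(f, g). (Cod C f, Cod D g)),
     Idn = (\<lambda>(X, Y). (Idn C X, Idn D Y)),
     Cmp = (\<lambda>(f', g') (f, g). (f' \<cdot>\<^bsub>C\<^esub> f, g' \<cdot>\<^bsub>D\<^esub> g))\<rparr>"

text \<open>
  Functors and natural transformations are extensional (they take the value
  \<^const>\<open>undefined\<close> outside their domain), so that HOL equality is the usual equality and
  composition is strictly associative and unital.
\<close>

record ('o, 'm, 'p, 'n) ftr =
  Fob :: "'o \<Rightarrow> 'p"
  Far :: "'m \<Rightarrow> 'n"

definition is_functor ::
  "('o, 'm, 'y) cat_scheme \<Rightarrow> ('p, 'n, 'z) cat_scheme \<Rightarrow> ('o, 'm, 'p, 'n) ftr \<Rightarrow> bool" where
  "is_functor C D F \<longleftrightarrow>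
     category C \<and> category D \<and>
     Fob F \<in> Ob C \<rightarrow>\<^sub>E Ob D \<and> Far F \<in> Ar C \<rightarrow>\<^sub>E Ar D \<and>
     (\<forall>f \<in> Ar C. Far F f \<in> Hom D (Fob F (Dom C f)) (Fob F (Cod C f))) \<and>
     (\<forall>X \<in> Ob C. Far F (Idn C X) = Idn D (Fob F X)) \<and>
     (\<forall>f \<in> Ar C. \<forall>g \<in> Ar C. Cod C f = Dom C g \<longrightarrow>
        Far F (g \<cdot>\<^bsub>C\<^esub> f) = Far F g \<cdot>\<^bsub>D\<^esub> Far F f)"

definition fid :: "('o, 'm, 'z) cat_scheme \<Rightarrow> ('o, 'm, 'o, 'm) ftr" where
  "fid C = \<lparr>Fob = (\<lambda>X\<in>Ob C. X), Far = (\<lambda>f\<in>Ar C. f)\<rparr>"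

text \<open>The category argument is the source of \<open>F\<close>.\<close>

definition fcomp ::
  "('o, 'm, 'z) cat_scheme \<Rightarrow> ('p, 'n, 'q, 'l) ftr \<Rightarrow> ('o, 'm, 'p, 'n) ftr \<Rightarrow> ('o, 'm, 'q, 'l) ftr"
where
  "fcomp C G F =
    \<lparr>Fob = compose (Ob C) (Fob G) (Fob F), Far = compose (Ar C) (Far G) (Far F)\<rparr>"

record ('o, 'm, 'p, 'n) nt =
  src :: "('o, 'm, 'p, 'n) ftr"
  tgt :: "('o, 'm, 'p, 'n) ftr"
  at :: "'o \<Rightarrow> 'n"

definition is_nt ::
  "('o, 'm, 'y) cat_scheme \<Rightarrow> ('p, 'n, 'z) cat_scheme \<Rightarrow> ('o, 'm, 'p, 'n) nt \<Rightarrow> bool" where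
  "is_nt C D \<eta> \<longleftrightarrow>
     is_functor C D (src \<eta>) \<and> is_functor C D (tgt \<eta>) \<and>
     at \<eta> \<in> Ob C \<rightarrow>\<^sub>E Ar D \<and>
     (\<forall>X \<in> Ob C. at \<eta> X \<in> Hom D (Fob (src \<eta>) X) (Fob (tgt \<eta>) X)) \<and>
     (\<forall>f \<in> Ar C. at \<eta> (Cod C f) \<cdot>\<^bsub>D\<^esub> Far (src \<eta>) f = Far (tgt \<eta>) f \<cdot>\<^bsub>D\<^esub> at \<eta> (Dom C f))"

definition Fun ::
  "('o, 'm, 'y) cat_scheme \<Rightarrow> ('p, 'n, 'z) cat_scheme \<Rightarrow>
   (('o, 'm, 'p, 'n) ftr, ('o, 'm, 'p, 'n) nt) cat" where
  "Fun C D =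
    \<lparr>Ob = {F. is_functor C D F},
     Ar = {\<eta>. is_nt C D \<eta>},
     Dom = src,
     Cod = tgt,
     Idn = (\<lambda>F. \<lparr>src = F, tgt = F, at = (\<lambda>X\<in>Ob C. Idn D (Fob F X))\<rparr>),
     Cmp = (\<lambda>\<nu> \<eta>. \<lparr>src = src \<eta>, tgt = tgt \<nu>, at = (\<lambda>X\<in>Ob C. at \<nu> X \<cdot>\<^bsub>D\<^esub> at \<eta> X)\<rparr>)\<rparr>"

text \<open>
  Horizontal composite (Godement product) of \<open>\<sigma> : F \<rightarrow> F'\<close>, with \<open>F, F' : C \<rightarrow> _\<close>, and
  \<open>\<tau> : G \<rightarrow> G'\<close>, with \<open>G, G' : _ \<rightarrow> D\<close>; it is a transformation \<open>G F \<rightarrow> G' F'\<close>.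
\<close>

definition nt_hcomp ::
  "('o, 'm, 'y) cat_scheme \<Rightarrow> ('q, 'l, 'z) cat_scheme \<Rightarrow>
   ('p, 'n, 'q, 'l) nt \<Rightarrow> ('o, 'm, 'p, 'n) nt \<Rightarrow> ('o, 'm, 'q, 'l) nt" where
  "nt_hcomp C D \<tau> \<sigma> =
    \<lparr>src = fcomp C (src \<tau>) (src \<sigma>),
     tgt = fcomp C (tgt \<tau>) (tgt \<sigma>),
     at = (\<lambda>X\<in>Ob C. at \<tau> (Fob (tgt \<sigma>) X) \<cdot>\<^bsub>D\<^esub> Far (src \<tau>) (at \<sigma> X))\<rparr>"

definition cat_equivalence ::
  "('o, 'm) cat \<Rightarrow> ('p, 'n) cat \<Rightarrow> ('o, 'm, 'p, 'n) ftr \<Rightarrow> bool" where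
  "cat_equivalence C D F \<longleftrightarrow>
     is_functor C D F \<and>
     (\<exists>G. is_functor D C G \<and>
          isomorphic (Fun C C) (fcomp C G F) (fid C) \<and>
          isomorphic (Fun D D) (fcomp D F G) (fid D))"


section \<open>Additive categories\<close>

record ('o, 'm) acat = "('o, 'm) cat" +
  Add :: "'m \<Rightarrow> 'm \<Rightarrow> 'm"  (infixl \<open>\<boxplus>\<index>\<close> 65)
  Zer :: "'o \<Rightarrow> 'o \<Rightarrow> 'm"

definition hom_grp :: "('o, 'm, 'z) acat_scheme \<Rightarrow> 'o \<Rightarrow> 'o \<Rightarrow> 'm monoid" where
  "hom_grp A X Y = \<lparr>carrier = Hom A X Y, monoid.mult = Add A, one = Zer A X Y\<rparr>"

locale preadditive_category = category A
  for A :: "('o, 'm, 'z) acat_scheme" (structure) +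
  assumes hom_comm_group: "\<lbrakk>X \<in> Ob A; Y \<in> Ob A\<rbrakk> \<Longrightarrow> comm_group (hom_grp A X Y)"
    and add_cmp: "\<lbrakk>f \<in> Hom A X Y; g \<in> Hom A Y Z; g' \<in> Hom A Y Z\<rbrakk> \<Longrightarrow>
      (g \<boxplus> g') \<cdot> f = g \<cdot> f \<boxplus> g' \<cdot> f"
    and cmp_add: "\<lbrakk>f \<in> Hom A X Y; f' \<in> Hom A X Y; g \<in> Hom A Y Z\<rbrakk> \<Longrightarrow>
      g \<cdot> (f \<boxplus> f') = g \<cdot> f \<boxplus> g \<cdot> f'"

definition is_zero_ob :: "('o, 'm, 'z) cat_scheme \<Rightarrow> 'o \<Rightarrow> bool" where
  "is_zero_ob C Z \<longleftrightarrow>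
     Z \<in> Ob C \<and> (\<forall>X \<in> Ob C. (\<exists>!f. f \<in> Hom C X Z) \<and> (\<exists>!f. f \<in> Hom C Z X))"

definition is_biproduct ::
  "('o, 'm, 'z) acat_scheme \<Rightarrow> 'o \<Rightarrow> 'o \<Rightarrow> 'o \<Rightarrow> 'm \<Rightarrow> 'm \<Rightarrow> 'm \<Rightarrow> 'm \<Rightarrow> bool" where
  "is_biproduct A X Y S i j p q \<longleftrightarrow>
     S \<in> Ob A \<and> i \<in> Hom A X S \<and> j \<in> Hom A Y S \<and> p \<in> Hom A S X \<and> q \<in> Hom A S Y \<and>
     p \<cdot>\<^bsub>A\<^esub> i = Idn A X \<and> q \<cdot>\<^bsub>A\<^esub> j = Idn A Y \<and>
     q \<cdot>\<^bsub>A\<^esub> i = Zer A X Y \<and> p \<cdot>\<^bsub>A\<^esub> j = Zer A Y X \<and>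
     i \<cdot>\<^bsub>A\<^esub> p \<boxplus>\<^bsub>A\<^esub> j \<cdot>\<^bsub>A\<^esub> q = Idn A S"

locale additive_category = preadditive_category +
  assumes has_zero_ob: "\<exists>Z. is_zero_ob A Z"
    and has_biproducts: "\<lbrakk>X \<in> Ob A; Y \<in> Ob A\<rbrakk> \<Longrightarrow> \<exists>S i j p q. is_biproduct A X Y S i j p q"

definition additive_functor ::
  "('o, 'm, 'y) acat_scheme \<Rightarrow> ('p, 'n, 'z) acat_scheme \<Rightarrow> ('o, 'm, 'p, 'n) ftr \<Rightarrow> bool" where
  "additive_functor A B F \<longleftrightarrow>
     is_functor A B F \<and>
     (\<forall>X \<in> Ob A. \<forall>Y \<in> Ob A. \<forall>f \<in> Hom A X Y. \<forall>g \<in> Hom A X Y.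
        Far F (f \<boxplus>\<^bsub>A\<^esub> g) = Far F f \<boxplus>\<^bsub>B\<^esub> Far F g)"

definition is_kernel :: "('o, 'm, 'z) acat_scheme \<Rightarrow> 'm \<Rightarrow> 'm \<Rightarrow> bool" where
  "is_kernel A f g \<longleftrightarrow>
     f \<in> Ar A \<and> g \<in> Ar A \<and> Cod A f = Dom A g \<and>
     g \<cdot>\<^bsub>A\<^esub> f = Zer A (Dom A f) (Cod A g) \<and>
     (\<forall>h \<in> Ar A. Cod A h = Dom A g \<and> g \<cdot>\<^bsub>A\<^esub> h = Zer A (Dom A h) (Cod A g) \<longrightarrow>
        (\<exists>!u. u \<in> Hom A (Dom A h) (Dom A f) \<and> f \<cdot>\<^bsub>A\<^esub> u = h))"

definition is_cokernel :: "('o, 'm, 'z) acat_scheme \<Rightarrow> 'm \<Rightarrow> 'm \<Rightarrow> bool" where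
  "is_cokernel A g f \<longleftrightarrow>
     f \<in> Ar A \<and> g \<in> Ar A \<and> Cod A f = Dom A g \<and>
     g \<cdot>\<^bsub>A\<^esub> f = Zer A (Dom A f) (Cod A g) \<and>
     (\<forall>h \<in> Ar A. Dom A h = Cod A f \<and> h \<cdot>\<^bsub>A\<^esub> f = Zer A (Dom A f) (Cod A h) \<longrightarrow>
        (\<exists>!u. u \<in> Hom A (Cod A g) (Cod A h) \<and> u \<cdot>\<^bsub>A\<^esub> g = h))"

text \<open>
  Squares \<open>f' : B \<rightarrow> D\<close>, \<open>g' : C \<rightarrow> D\<close> completing \<open>f : A \<rightarrow> B\<close>, \<open>g : A \<rightarrow> C\<close> (pushout), and
  \<open>f' : D \<rightarrow> B\<close>, \<open>g' : D \<rightarrow> C\<close> completing \<open>f : B \<rightarrow> A\<close>, \<open>g : C \<rightarrow> A\<close> (pullback).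
\<close>

definition is_pushout :: "('o, 'm, 'z) cat_scheme \<Rightarrow> 'm \<Rightarrow> 'm \<Rightarrow> 'm \<Rightarrow> 'm \<Rightarrow> bool" where
  "is_pushout C f g f' g' \<longleftrightarrow>
     f \<in> Ar C \<and> g \<in> Ar C \<and> f' \<in> Ar C \<and> g' \<in> Ar C \<and>
     Dom C f = Dom C g \<and> Dom C f' = Cod C f \<and> Dom C g' = Cod C g \<and> Cod C f' = Cod C g' \<and>
     f' \<cdot>\<^bsub>C\<^esub> f = g' \<cdot>\<^bsub>C\<^esub> g \<and>
     (\<forall>a \<in> Ar C. \<forall>b \<in> Ar C.
        Dom C a = Cod C f \<and> Dom C b = Cod C g \<and> Cod C a = Cod C b \<and> a \<cdot>\<^bsub>C\<^esub> f = b \<cdot>\<^bsub>C\<^esub> g \<longrightarrow>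
        (\<exists>!u. u \<in> Hom C (Cod C f') (Cod C a) \<and> u \<cdot>\<^bsub>C\<^esub> f' = a \<and> u \<cdot>\<^bsub>C\<^esub> g' = b))"

definition is_pullback :: "('o, 'm, 'z) cat_scheme \<Rightarrow> 'm \<Rightarrow> 'm \<Rightarrow> 'm \<Rightarrow> 'm \<Rightarrow> bool" where
  "is_pullback C f g f' g' \<longleftrightarrow>
     f \<in> Ar C \<and> g \<in> Ar C \<and> f' \<in> Ar C \<and> g' \<in> Ar C \<and>
     Cod C f = Cod C g \<and> Cod C f' = Dom C f \<and> Cod C g' = Dom C g \<and> Dom C f' = Dom C g' \<and>
     f \<cdot>\<^bsub>C\<^esub> f' = g \<cdot>\<^bsub>C\<^esub> g' \<and>
     (\<forall>a \<in> Ar C. \<forall>b \<in> Ar C.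
        Cod C a = Dom C f \<and> Cod C b = Dom C g \<and> Dom C a = Dom C b \<and> f \<cdot>\<^bsub>C\<^esub> a = g \<cdot>\<^bsub>C\<^esub> b \<longrightarrow>
        (\<exists>!u. u \<in> Hom C (Dom C a) (Dom C f') \<and> f' \<cdot>\<^bsub>C\<^esub> u = a \<and> g' \<cdot>\<^bsub>C\<^esub> u = b))"


section \<open>Exact categories\<close>

record ('o, 'm) ecat = "('o, 'm) acat" +
  Conf :: "('m \<times> 'm) set"

definition inflation :: "('o, 'm, 'z) ecat_scheme \<Rightarrow> 'm \<Rightarrow> bool" where
  "inflation E f \<longleftrightarrow> (\<exists>g. (f, g) \<in> Conf E)"

definition deflation :: "('o, 'm, 'z) ecat_scheme \<Rightarrow> 'm \<Rightarrow> bool" where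
  "deflation E g \<longleftrightarrow> (\<exists>f. (f, g) \<in> Conf E)"

locale exact_category = additive_category E
  for E :: "('o, 'm, 'z) ecat_scheme" (structure) +
  assumes conf_kernel: "(f, g) \<in> Conf E \<Longrightarrow> is_kernel E f g"
    and conf_cokernel: "(f, g) \<in> Conf E \<Longrightarrow> is_cokernel E g f"
    and conf_iso_closed:
      "\<lbrakk>(f, g) \<in> Conf E; f' \<in> Ar E; g' \<in> Ar E; Cod E f' = Dom E g';
        a \<in> Hom E (Dom E f) (Dom E f'); b \<in> Hom E (Cod E f) (Cod E f');
        c \<in> Hom E (Cod E g) (Cod E g'); is_iso E a; is_iso E b; is_iso E c;
        b \<cdot> f = f' \<cdot> a; c \<cdot> g = g' \<cdot> b\<rbrakk> \<Longrightarrow> (f', g') \<in> Conf E"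
    and id_inflation: "X \<in> Ob E \<Longrightarrow> inflation E (Idn E X)"
    and id_deflation: "X \<in> Ob E \<Longrightarrow> deflation E (Idn E X)"
    and inflation_cmp:
      "\<lbrakk>inflation E f; inflation E g; Cod E f = Dom E g\<rbrakk> \<Longrightarrow> inflation E (g \<cdot> f)"
    and deflation_cmp:
      "\<lbrakk>deflation E f; deflation E g; Cod E f = Dom E g\<rbrakk> \<Longrightarrow> deflation E (g \<cdot> f)"
    and inflation_pushout:
      "\<lbrakk>inflation E f; g \<in> Ar E; Dom E g = Dom E f\<rbrakk> \<Longrightarrow>
       \<exists>f' g'. is_pushout E f g f' g' \<and> inflation E g'"
    and deflation_pullback:
      "\<lbrakk>deflation E f; g \<in> Ar E; Cod E g = Cod E f\<rbrakk> \<Longrightarrow>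
       \<exists>f' g'. is_pullback E f g f' g' \<and> deflation E g'"

definition admissible :: "('o, 'm, 'z) ecat_scheme \<Rightarrow> 'm \<Rightarrow> bool" where
  "admissible E f \<longleftrightarrow>
     (\<exists>m p. inflation E m \<and> deflation E p \<and> Cod E p = Dom E m \<and> f = m \<cdot>\<^bsub>E\<^esub> p)"

definition exact_functor ::
  "('o, 'm) ecat \<Rightarrow> ('p, 'n) ecat \<Rightarrow> ('o, 'm, 'p, 'n) ftr \<Rightarrow> bool" where
  "exact_functor E E' F \<longleftrightarrow>
     additive_functor E E' F \<and> (\<forall>(f, g) \<in> Conf E. (Far F f, Far F g) \<in> Conf E')"

definition left_exact_functor ::
  "('o, 'm) ecat \<Rightarrow> ('p, 'n) ecat \<Rightarrow> ('o, 'm, 'p, 'n) ftr \<Rightarrow> bool" where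
  "left_exact_functor E E' F \<longleftrightarrow>
     additive_functor E E' F \<and>
     (\<forall>(f, g) \<in> Conf E.
        admissible E' (Far F g) \<and> inflation E' (Far F f) \<and> is_kernel E' (Far F f) (Far F g))"


section \<open>Modules over an additive category\<close>

definition opp :: "('o, 'm, 'z) acat_scheme \<Rightarrow> ('o, 'm) acat" where
  "opp A =
    \<lparr>Ob = Ob A, Ar = Ar A, Dom = Cod A, Cod = Dom A, Idn = Idn A,
     Cmp = (\<lambda>g f. f \<cdot>\<^bsub>A\<^esub> g), Add = Add A, Zer = (\<lambda>X Y. Zer A Y X)\<rparr>"

text \<open>
  Abelian groups with elements of type \<open>'g\<close>, written multiplicatively as in \<open>HOL-Algebra\<close>;
  \<open>(G, H, h)\<close> is the homomorphism \<open>h : G \<rightarrow> H\<close>. Records differing only in the value of the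
  multiplication outside the carrier are distinct but isomorphic objects.
\<close>

type_synonym 'g ab_hom = "'g monoid \<times> 'g monoid \<times> ('g \<Rightarrow> 'g)"

definition Ab :: "('g monoid, 'g ab_hom) acat" where
  "Ab =
    \<lparr>Ob = {G. comm_group G},
     Ar = {(G, H, h). comm_group G \<and> comm_group H \<and> h \<in> hom G H \<and> h \<in> extensional (carrier G)},
     Dom = (\<lambda>(G, H, h). G),
     Cod = (\<lambda>(G, H, h). H),
     Idn = (\<lambda>G. (G, G, \<lambda>x\<in>carrier G. x)),
     Cmp = (\<lambda>(H, K, k) (G, H', h). (G, K, compose (carrier G) k h)),
     Add = (\<lambda>(G, H, h) (G', H', k). (G, H, \<lambda>x\<in>carrier G. h x \<otimes>\<^bsub>H\<^esub> k x)),
     Zer = (\<lambda>G H. (G, H, \<lambda>x\<in>carrier G. \<one>\<^bsub>H\<^esub>))\<rparr>"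

definition AFun ::
  "('o, 'm, 'y) acat_scheme \<Rightarrow> ('p, 'n, 'z) acat_scheme \<Rightarrow>
   (('o, 'm, 'p, 'n) ftr, ('o, 'm, 'p, 'n) nt) acat" where
  "AFun A B =
    \<lparr>Ob = {F. additive_functor A B F},
     Ar = {\<eta>. is_nt A B \<eta> \<and> additive_functor A B (src \<eta>) \<and> additive_functor A B (tgt \<eta>)},
     Dom = src,
     Cod = tgt,
     Idn = Idn (Fun A B),
     Cmp = Cmp (Fun A B),
     Add = (\<lambda>\<eta> \<nu>. \<lparr>src = src \<eta>, tgt = tgt \<eta>, at = (\<lambda>X\<in>Ob A. at \<eta> X \<boxplus>\<^bsub>B\<^esub> at \<nu> X)\<rparr>),
     Zer = (\<lambda>F G. \<lparr>src = F, tgt = G, at = (\<lambda>X\<in>Ob A. Zer B (Fob F X) (Fob G X))\<rparr>)\<rparr>"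

type_synonym ('o, 'm) md = "('o, 'm, 'm monoid, 'm ab_hom) ftr"
type_synonym ('o, 'm) md_hom = "('o, 'm, 'm monoid, 'm ab_hom) nt"

text \<open>
  The groups in the image of a module have elements in the arrow type \<open>'m\<close>, where the values of
  representable functors live. Choosing coset representatives, every quotient of a
  representable functor is isomorphic to such a module.
\<close>

definition Mod_cat :: "('o, 'm, 'z) acat_scheme \<Rightarrow> (('o, 'm) md, ('o, 'm) md_hom) acat" where
  "Mod_cat A = AFun (opp A) (Ab :: ('m monoid, 'm ab_hom) acat)"

definition yoneda_ob :: "('o, 'm, 'z) acat_scheme \<Rightarrow> 'o \<Rightarrow> ('o, 'm) md" where
  "yoneda_ob A X =
    \<lparr>Fob = (\<lambda>W\<in>Ob A. hom_grp A W X),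
     Far = (\<lambda>f\<in>Ar A. (hom_grp A (Cod A f) X, hom_grp A (Dom A f) X,
                       \<lambda>g\<in>Hom A (Cod A f) X. g \<cdot>\<^bsub>A\<^esub> f))\<rparr>"

definition yoneda_ar :: "('o, 'm, 'z) acat_scheme \<Rightarrow> 'm \<Rightarrow> ('o, 'm) md_hom" where
  "yoneda_ar A f =
    \<lparr>src = yoneda_ob A (Dom A f),
     tgt = yoneda_ob A (Cod A f),
     at = (\<lambda>W\<in>Ob A. (hom_grp A W (Dom A f), hom_grp A W (Cod A f),
                      \<lambda>g\<in>Hom A W (Dom A f). f \<cdot>\<^bsub>A\<^esub> g))\<rparr>"

definition yoneda ::
  "('o, 'm, 'z) acat_scheme \<Rightarrow> ('o, 'm, ('o, 'm) md, ('o, 'm) md_hom) ftr"  (\<open>\<Upsilon>\<close>) where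
  "\<Upsilon> A = \<lparr>Fob = (\<lambda>X\<in>Ob A. yoneda_ob A X), Far = (\<lambda>f\<in>Ar A. yoneda_ar A f)\<rparr>"

text \<open>Exactness of sequences of modules is exactness of their values at every object.\<close>

definition ab_kernel :: "'g ab_hom \<Rightarrow> 'g set" where
  "ab_kernel = (\<lambda>(G, H, h). kernel G H h)"

definition ab_image :: "'g ab_hom \<Rightarrow> 'g set" where
  "ab_image = (\<lambda>(G, H, h). h ` carrier G)"

definition mod_mono :: "('o, 'm, 'z) acat_scheme \<Rightarrow> ('o, 'm) md_hom \<Rightarrow> bool" where
  "mod_mono A \<alpha> \<longleftrightarrow> (\<forall>W \<in> Ob A. ab_kernel (at \<alpha> W) = {\<one>\<^bsub>Fob (src \<alpha>) W\<^esub>})"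

definition mod_epi :: "('o, 'm, 'z) acat_scheme \<Rightarrow> ('o, 'm) md_hom \<Rightarrow> bool" where
  "mod_epi A \<beta> \<longleftrightarrow> (\<forall>W \<in> Ob A. ab_image (at \<beta> W) = carrier (Fob (tgt \<beta>) W))"

definition mod_exact_at ::
  "('o, 'm, 'z) acat_scheme \<Rightarrow> ('o, 'm) md_hom \<Rightarrow> ('o, 'm) md_hom \<Rightarrow> bool" where
  "mod_exact_at A \<alpha> \<beta> \<longleftrightarrow>
     \<alpha> \<in> Ar (Mod_cat A) \<and> \<beta> \<in> Ar (Mod_cat A) \<and> tgt \<alpha> = src \<beta> \<and>
     (\<forall>W \<in> Ob A. ab_image (at \<alpha> W) = ab_kernel (at \<beta> W))"

definition adm_presented :: "('o, 'm, 'z) ecat_scheme \<Rightarrow> ('o, 'm) md set" where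
  "adm_presented E =
     {F \<in> Ob (Mod_cat E). \<exists>f \<pi>. admissible E f \<and> \<pi> \<in> Hom (Mod_cat E) (Fob (\<Upsilon> E) (Cod E f)) F \<and>
        mod_exact_at E (Far (\<Upsilon> E) f) \<pi> \<and> mod_epi E \<pi>}"

definition mod_adm :: "('o, 'm, 'z) ecat_scheme \<Rightarrow> (('o, 'm) md, ('o, 'm) md_hom) ecat" where
  "mod_adm E =
    \<lparr>Ob = adm_presented E,
     Ar = {\<eta> \<in> Ar (Mod_cat E). src \<eta> \<in> adm_presented E \<and> tgt \<eta> \<in> adm_presented E},
     Dom = src,
     Cod = tgt,
     Idn = Idn (Mod_cat E),
     Cmp = Cmp (Mod_cat E),
     Add = Add (Mod_cat E),
     Zer = Zer (Mod_cat E),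
     Conf = {(\<alpha>, \<beta>). src \<alpha> \<in> adm_presented E \<and> tgt \<alpha> \<in> adm_presented E \<and>
                     tgt \<beta> \<in> adm_presented E \<and>
                     mod_mono E \<alpha> \<and> mod_exact_at E \<alpha> \<beta> \<and> mod_epi E \<beta>}\<rparr>"


section \<open>2-categories and pseudofunctors\<close>

text \<open>
  \<open>HComp T x y z\<close> is the composition functor
  \<open>HomC T y z \<times> HomC T x y \<rightarrow> HomC T x z\<close>, the later 1-cell coming first.
\<close>

record ('x, 'f, 't) twocat =
  Cells0 :: "'x set"
  HomC :: "'x \<Rightarrow> 'x \<Rightarrow> ('f, 't) cat"
  Id1 :: "'x \<Rightarrow> 'f"
  HComp :: "'x \<Rightarrow> 'x \<Rightarrow> 'x \<Rightarrow> ('f \<times> 'f, 't \<times> 't, 'f, 't) ftr"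

abbreviation hc1 :: "('x, 'f, 't) twocat \<Rightarrow> 'x \<Rightarrow> 'x \<Rightarrow> 'x \<Rightarrow> 'f \<Rightarrow> 'f \<Rightarrow> 'f" where
  "hc1 T x y z g f \<equiv> Fob (HComp T x y z) (g, f)"

abbreviation hc2 :: "('x, 'f, 't) twocat \<Rightarrow> 'x \<Rightarrow> 'x \<Rightarrow> 'x \<Rightarrow> 't \<Rightarrow> 't \<Rightarrow> 't" where
  "hc2 T x y z \<tau> \<sigma> \<equiv> Far (HComp T x y z) (\<tau>, \<sigma>)"

locale two_category =
  fixes T :: "('x, 'f, 't) twocat"
  assumes hom_category: "\<lbrakk>x \<in> Cells0 T; y \<in> Cells0 T\<rbrakk> \<Longrightarrow> category (HomC T x y)"
    and id1_ob: "x \<in> Cells0 T \<Longrightarrow> Id1 T x \<in> Ob (HomC T x x)"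
    and hcomp_functor:
      "\<lbrakk>x \<in> Cells0 T; y \<in> Cells0 T; z \<in> Cells0 T\<rbrakk> \<Longrightarrow>
       is_functor (prod_cat (HomC T y z) (HomC T x y)) (HomC T x z) (HComp T x y z)"
    and hc1_assoc:
      "\<lbrakk>w \<in> Cells0 T; x \<in> Cells0 T; y \<in> Cells0 T; z \<in> Cells0 T;
        f \<in> Ob (HomC T w x); g \<in> Ob (HomC T x y); h \<in> Ob (HomC T y z)\<rbrakk> \<Longrightarrow>
       hc1 T w x z (hc1 T x y z h g) f = hc1 T w y z h (hc1 T w x y g f)"
    and hc2_assoc:
      "\<lbrakk>w \<in> Cells0 T; x \<in> Cells0 T; y \<in> Cells0 T; z \<in> Cells0 T;
        \<rho> \<in> Ar (HomC T w x); \<sigma> \<in> Ar (HomC T x y); \<tau> \<in> Ar (HomC T y z)\<rbrakk> \<Longrightarrow>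
       hc2 T w x z (hc2 T x y z \<tau> \<sigma>) \<rho> = hc2 T w y z \<tau> (hc2 T w x y \<sigma> \<rho>)"
    and hc1_unit:
      "\<lbrakk>x \<in> Cells0 T; y \<in> Cells0 T; f \<in> Ob (HomC T x y)\<rbrakk> \<Longrightarrow>
       hc1 T x y y (Id1 T y) f = f \<and> hc1 T x x y f (Id1 T x) = f"
    and hc2_unit:
      "\<lbrakk>x \<in> Cells0 T; y \<in> Cells0 T; \<sigma> \<in> Ar (HomC T x y)\<rbrakk> \<Longrightarrow>
       hc2 T x y y (Idn (HomC T y y) (Id1 T y)) \<sigma> = \<sigma> \<and>
       hc2 T x x y \<sigma> (Idn (HomC T x x) (Id1 T x)) = \<sigma>"

text \<open>
  \<open>PC P x y z g f : P g \<cdot> P f \<rightarrow> P (g \<cdot> f)\<close>, for \<open>f : x \<rightarrow> y\<close> and \<open>g : y \<rightarrow> z\<close>, and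
  \<open>PU P x : id \<rightarrow> P id\<close> are the structure 2-cells of a pseudofunctor.
\<close>

record ('x, 'f, 't, 'y, 'g, 's) pseudo =
  P0 :: "'x \<Rightarrow> 'y"
  P1 :: "'x \<Rightarrow> 'x \<Rightarrow> ('f, 't, 'g, 's) ftr"
  PC :: "'x \<Rightarrow> 'x \<Rightarrow> 'x \<Rightarrow> 'f \<Rightarrow> 'f \<Rightarrow> 's"
  PU :: "'x \<Rightarrow> 's"

locale pseudofunctor =
  dom: two_category S + cod: two_category T
  for S :: "('x, 'f, 't) twocat" and T :: "('y, 'g, 's) twocat" +
  fixes P :: "('x, 'f, 't, 'y, 'g, 's) pseudo"
  assumes P0_cell: "x \<in> Cells0 S \<Longrightarrow> P0 P x \<in> Cells0 T"
    and P1_functor: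
      "\<lbrakk>x \<in> Cells0 S; y \<in> Cells0 S\<rbrakk> \<Longrightarrow>
       is_functor (HomC S x y) (HomC T (P0 P x) (P0 P y)) (P1 P x y)"
    and PC_hom:
      "\<lbrakk>x \<in> Cells0 S; y \<in> Cells0 S; z \<in> Cells0 S; f \<in> Ob (HomC S x y); g \<in> Ob (HomC S y z)\<rbrakk> \<Longrightarrow>
       PC P x y z g f \<in> Hom (HomC T (P0 P x) (P0 P z))
         (hc1 T (P0 P x) (P0 P y) (P0 P z) (Fob (P1 P y z) g) (Fob (P1 P x y) f))
         (Fob (P1 P x z) (hc1 S x y z g f))"
    and PC_iso:
      "\<lbrakk>x \<in> Cells0 S; y \<in> Cells0 S; z \<in> Cells0 S; f \<in> Ob (HomC S x y); g \<in> Ob (HomC S y z)\<rbrakk> \<Longrightarrow>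
       is_iso (HomC T (P0 P x) (P0 P z)) (PC P x y z g f)"
    and PC_natural:
      "\<lbrakk>x \<in> Cells0 S; y \<in> Cells0 S; z \<in> Cells0 S;
        \<sigma> \<in> Hom (HomC S x y) f f'; \<tau> \<in> Hom (HomC S y z) g g'\<rbrakk> \<Longrightarrow>
       PC P x y z g' f' \<cdot>\<^bsub>HomC T (P0 P x) (P0 P z)\<^esub>
         hc2 T (P0 P x) (P0 P y) (P0 P z) (Far (P1 P y z) \<tau>) (Far (P1 P x y) \<sigma>)
       = Far (P1 P x z) (hc2 S x y z \<tau> \<sigma>) \<cdot>\<^bsub>HomC T (P0 P x) (P0 P z)\<^esub> PC P x y z g f"
    and PU_hom:
      "x \<in> Cells0 S \<Longrightarrow>
       PU P x \<in> Hom (HomC T (P0 P x) (P0 P x)) (Id1 T (P0 P x)) (Fob (P1 P x x) (Id1 S x))"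
    and PU_iso: "x \<in> Cells0 S \<Longrightarrow> is_iso (HomC T (P0 P x) (P0 P x)) (PU P x)"
    and assoc_coherence:
      "\<lbrakk>w \<in> Cells0 S; x \<in> Cells0 S; y \<in> Cells0 S; z \<in> Cells0 S;
        f \<in> Ob (HomC S w x); g \<in> Ob (HomC S x y); h \<in> Ob (HomC S y z)\<rbrakk> \<Longrightarrow>
       PC P w x z (hc1 S x y z h g) f \<cdot>\<^bsub>HomC T (P0 P w) (P0 P z)\<^esub>
         hc2 T (P0 P w) (P0 P x) (P0 P z) (PC P x y z h g)
           (Idn (HomC T (P0 P w) (P0 P x)) (Fob (P1 P w x) f))
       = PC P w y z h (hc1 S w x y g f) \<cdot>\<^bsub>HomC T (P0 P w) (P0 P z)\<^esub>
         hc2 T (P0 P w) (P0 P y) (P0 P z)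
           (Idn (HomC T (P0 P y) (P0 P z)) (Fob (P1 P y z) h)) (PC P w x y g f)"
    and left_unit_coherence:
      "\<lbrakk>x \<in> Cells0 S; y \<in> Cells0 S; f \<in> Ob (HomC S x y)\<rbrakk> \<Longrightarrow>
       PC P x y y (Id1 S y) f \<cdot>\<^bsub>HomC T (P0 P x) (P0 P y)\<^esub>
         hc2 T (P0 P x) (P0 P y) (P0 P y) (PU P y)
           (Idn (HomC T (P0 P x) (P0 P y)) (Fob (P1 P x y) f))
       = Idn (HomC T (P0 P x) (P0 P y)) (Fob (P1 P x y) f)"
    and right_unit_coherence:
      "\<lbrakk>x \<in> Cells0 S; y \<in> Cells0 S; f \<in> Ob (HomC S x y)\<rbrakk> \<Longrightarrow>
       PC P x x y f (Id1 S x) \<cdot>\<^bsub>HomC T (P0 P x) (P0 P y)\<^esub>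
         hc2 T (P0 P x) (P0 P x) (P0 P y)
           (Idn (HomC T (P0 P x) (P0 P y)) (Fob (P1 P x y) f)) (PU P x)
       = Idn (HomC T (P0 P x) (P0 P y)) (Fob (P1 P x y) f)"


section \<open>The 2-categories of exact categories\<close>

definition Hom_Ex ::
  "('o, 'm) ecat \<Rightarrow> ('p, 'n) ecat \<Rightarrow> (('o, 'm, 'p, 'n) ftr, ('o, 'm, 'p, 'n) nt) cat" where
  "Hom_Ex E E' = full_subcat (Fun E E') {F. exact_functor E E' F}"

definition Hom_ExL ::
  "('o, 'm) ecat \<Rightarrow> ('p, 'n) ecat \<Rightarrow> (('o, 'm, 'p, 'n) ftr, ('o, 'm, 'p, 'n) nt) cat" where
  "Hom_ExL E E' = full_subcat (Fun E E') {F. left_exact_functor E E' F}"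

text \<open>
  The 2-category whose 0-cells are all exact categories with objects in \<open>'o\<close> and arrows in
  \<open>'m\<close>, with given hom-categories of functors and natural transformations.
\<close>

definition exact_twocat ::
  "(('o, 'm) ecat \<Rightarrow> ('o, 'm) ecat \<Rightarrow> (('o, 'm, 'o, 'm) ftr, ('o, 'm, 'o, 'm) nt) cat) \<Rightarrow>
   (('o, 'm) ecat, ('o, 'm, 'o, 'm) ftr, ('o, 'm, 'o, 'm) nt) twocat" where
  "exact_twocat H =
    \<lparr>Cells0 = {E. exact_category E},
     HomC = H,
     Id1 = fid,
     HComp = (\<lambda>E E' E''.
       \<lparr>Fob = (\<lambda>(G, F)\<in>Ob (H E' E'') \<times> Ob (H E E'). fcomp E G F),
        Far = (\<lambda>(\<tau>, \<sigma>)\<in>Ar (H E' E'') \<times> Ar (H E E'). nt_hcomp E E'' \<tau> \<sigma>)\<rparr>)\<rparr>"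

definition Ex2 :: "(('o, 'm) ecat, ('o, 'm, 'o, 'm) ftr, ('o, 'm, 'o, 'm) nt) twocat" where
  "Ex2 = exact_twocat Hom_Ex"

definition ExL2 :: "(('o, 'm) ecat, ('o, 'm, 'o, 'm) ftr, ('o, 'm, 'o, 'm) nt) twocat" where
  "ExL2 = exact_twocat Hom_ExL"


section \<open>The Yoneda embedding as unit\<close>

definition yoneda_restriction ::
  "('o, 'm) ecat \<Rightarrow> ('p, 'n) ecat \<Rightarrow>
   ((('o, 'm) md, ('o, 'm) md_hom, 'p, 'n) ftr, (('o, 'm) md, ('o, 'm) md_hom, 'p, 'n) nt,
    ('o, 'm, 'p, 'n) ftr, ('o, 'm, 'p, 'n) nt) ftr" where
  "yoneda_restriction E E' =
    \<lparr>Fob = (\<lambda>G\<in>Ob (Hom_Ex (mod_adm E) E'). fcomp E G (\<Upsilon> E)),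
     Far = (\<lambda>\<eta>\<in>Ar (Hom_Ex (mod_adm E) E').
              \<lparr>src = fcomp E (src \<eta>) (\<Upsilon> E), tgt = fcomp E (tgt \<eta>) (\<Upsilon> E),
               at = (\<lambda>X\<in>Ob E. at \<eta> (Fob (\<Upsilon> E) X))\<rparr>)\<rparr>"

text \<open>
  Invertible 2-cells \<open>\<theta> F : P F \<cdot> \<Upsilon> E \<rightarrow> \<Upsilon> E' \<cdot> F\<close>, for \<open>F : E \<rightarrow> E'\<close> left exact, making
  \<open>\<Upsilon>\<close> a pseudonatural transformation from the identity of \<^const>\<open>ExL2\<close> to \<open>P\<close> followed by the
  inclusion of \<^const>\<open>Ex2\<close>. Both sides are viewed in the 2-category of exact categories of all
  types, as \<open>E\<close> and \<open>mod_adm E\<close> have different object and arrow types.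
\<close>

locale yoneda_pseudonatural =
  fixes P :: "(('o, 'm) ecat, ('o, 'm, 'o, 'm) ftr, ('o, 'm, 'o, 'm) nt,
      (('o, 'm) md, ('o, 'm) md_hom) ecat,
      (('o, 'm) md, ('o, 'm) md_hom, ('o, 'm) md, ('o, 'm) md_hom) ftr,
      (('o, 'm) md, ('o, 'm) md_hom, ('o, 'm) md, ('o, 'm) md_hom) nt) pseudo"
    and \<theta> :: "('o, 'm) ecat \<Rightarrow> ('o, 'm) ecat \<Rightarrow> ('o, 'm, 'o, 'm) ftr \<Rightarrow>
      ('o, 'm, ('o, 'm) md, ('o, 'm) md_hom) nt"
  assumes yoneda_left_exact:
      "exact_category E \<Longrightarrow> left_exact_functor E (mod_adm E) (\<Upsilon> E)"
    and theta_hom: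
      "\<lbrakk>exact_category E; exact_category E'; left_exact_functor E E' F\<rbrakk> \<Longrightarrow>
       \<theta> E E' F \<in> Hom (Hom_ExL E (mod_adm E'))
         (fcomp E (Fob (P1 P E E') F) (\<Upsilon> E)) (fcomp E (\<Upsilon> E') F)"
    and theta_iso:
      "\<lbrakk>exact_category E; exact_category E'; left_exact_functor E E' F\<rbrakk> \<Longrightarrow>
       is_iso (Hom_ExL E (mod_adm E')) (\<theta> E E' F)"
    and theta_natural:
      "\<lbrakk>exact_category E; exact_category E'; \<sigma> \<in> Hom (Hom_ExL E E') F F'\<rbrakk> \<Longrightarrow>
       \<theta> E E' F' \<cdot>\<^bsub>Hom_ExL E (mod_adm E')\<^esub>
         nt_hcomp E (mod_adm E') (Far (P1 P E E') \<sigma>) (Idn (Fun E (mod_adm E)) (\<Upsilon> E))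
       = nt_hcomp E (mod_adm E') (Idn (Fun E' (mod_adm E')) (\<Upsilon> E')) \<sigma>
         \<cdot>\<^bsub>Hom_ExL E (mod_adm E')\<^esub> \<theta> E E' F"
    and theta_cmp:
      "\<lbrakk>exact_category E; exact_category E'; exact_category E'';
        left_exact_functor E E' F; left_exact_functor E' E'' G\<rbrakk> \<Longrightarrow>
       \<theta> E E'' (fcomp E G F) \<cdot>\<^bsub>Hom_ExL E (mod_adm E'')\<^esub>
         nt_hcomp E (mod_adm E'') (PC P E E' E'' G F) (Idn (Fun E (mod_adm E)) (\<Upsilon> E))
       = nt_hcomp E (mod_adm E'') (\<theta> E' E'' G) (Idn (Fun E E') F)
         \<cdot>\<^bsub>Hom_ExL E (mod_adm E'')\<^esub>
         nt_hcomp E (mod_adm E'')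
           (Idn (Fun (mod_adm E') (mod_adm E'')) (Fob (P1 P E' E'') G)) (\<theta> E E' F)"
    and theta_id:
      "exact_category E \<Longrightarrow>
       \<theta> E E (fid E) \<cdot>\<^bsub>Hom_ExL E (mod_adm E)\<^esub>
         nt_hcomp E (mod_adm E) (PU P E) (Idn (Fun E (mod_adm E)) (\<Upsilon> E))
       = Idn (Fun E (mod_adm E)) (\<Upsilon> E)"

end

theory Submission
  imports Defs
begin

text \<open>An admissibly presented \<open>M\<close> is given by a universal element \<open>y \<in> M Y\<close> together with an admissible
  \<open>f: X \<rightarrow> Y\<close> generating the relations of \<open>y\<close>. A left exact \<open>F\<close> preserves admissible morphisms and kernels of
  them, so \<open>F f\<close> has a cokernel, and this cokernel carries the universal natural family
  \<open>M W \<rightarrow> Hom (F W) T\<close>; hence it does not depend on the presentation and gives a functor extending \<open>F\<close>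
  along \<open>\<Upsilon>\<close>. Presentations of the ends of a short exact sequence combine to a presentation of the middle by
  a horseshoe lemma valid in any exact category; it shows that admissibly presented modules are closed
  under extensions and that the extension of \<open>F\<close> is exact. Conversely an exact functor turns the
  factorization \<open>\<Upsilon> X \<rightarrow> K \<rightarrow> \<Upsilon> Y \<rightarrow> M\<close> of a presentation into a cokernel sequence, so natural
  transformations between exact functors are determined on representables and extend uniquely from them.
  The same uniqueness yields all the coherence laws of the pseudofunctor.\<close>

section \<open>Preadditive categories and duality\<close>

text \<open>A left exact functor need not send deflations to deflations, so conflations, and with
  them the usual argument for extensions, cannot simply be carried along. What survives is a kernel
  \<open>k\<close> of \<open>f''\<close> and an equation \<open>h k = f' t\<close>. This dictates
  the form of the horseshoe lemma: for a triangular matrix with admissible diagonal entries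
  \<open>f'\<close>, \<open>f''\<close> and corner \<open>h\<close>, that equation makes the matrix
  admissible and the cokernels a conflation. It is applied three times: to present an extension,
  with zero corner to present a biproduct, and after a left exact functor to see that its extension
  is exact. Idempotents need not split, so inflations and deflations are not recognized by
  cancelling factors; in the horseshoe lemma each is a pushout of an inflation, a pullback of a
  deflation, or a composite of such. For modules the obstacle is the fixed element type: kernels and
  quotients fit into it, direct sums of values need not. Kernels and cokernels are formed among all
  modules and then placed between two admissibly presented ones.\<close>

abbreviation (input) cmp_in (\<open>_ \<cdot>[_] _\<close> [70, 0, 71] 70) where "g \<cdot>[C] f \<equiv> Cmp C g f"
abbreviation (input) add_in (\<open>_ \<boxplus>[_] _\<close> [65, 0, 66] 65) where "f \<boxplus>[A] g \<equiv> Add A f g"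
abbreviation (input) mult_in (\<open>_ \<otimes>[_] _\<close> [70, 0, 71] 70) where "x \<otimes>[G] y \<equiv> monoid.mult G x y"
abbreviation (input) one_in (\<open>\<one>[_]\<close>) where "\<one>[G] \<equiv> monoid.one G"
abbreviation (input) inv_in (\<open>inv[_] _\<close> [0, 81] 80) where "inv[G] x \<equiv> m_inv G x"
abbreviation (input) coset_in (\<open>_ #>[_] _\<close> [60, 0, 61] 60) where "H #>[G] x \<equiv> r_coset G H x"

abbreviation (input) "\<A> \<equiv> mod_adm"
abbreviation (input) "\<M> \<equiv> Mod_cat"
abbreviation (input) "\<Y> \<equiv> yoneda_ob"
abbreviation (input) "\<y> \<equiv> yoneda_ar"
abbreviation (input) "adm \<equiv> adm_presented"

section \<open>Arrows, composites and isomorphisms in a category\<close>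

lemma hom_iff: "f \<in> Hom C X Y \<longleftrightarrow> f \<in> Ar C \<and> Dom C f = X \<and> Cod C f = Y" by (simp add: Hom_def)

context category
begin

lemma ar_cmp [simp]: "\<lbrakk>f \<in> Ar C; g \<in> Ar C; Cod C f = Dom C g\<rbrakk> \<Longrightarrow> g \<cdot> f \<in> Ar C"
  and dom_cmp [simp]: "\<lbrakk>f \<in> Ar C; g \<in> Ar C; Cod C f = Dom C g\<rbrakk> \<Longrightarrow> Dom C (g \<cdot> f) = Dom C f"
  and cod_cmp [simp]: "\<lbrakk>f \<in> Ar C; g \<in> Ar C; Cod C f = Dom C g\<rbrakk> \<Longrightarrow> Cod C (g \<cdot> f) = Cod C g"
  using cmp_hom[of f "Dom C f" "Cod C f" g "Cod C g"] by (auto simp: hom_iff)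

lemma ar_idn [simp]: "X \<in> Ob C \<Longrightarrow> Idn C X \<in> Ar C" and dom_idn [simp]: "X \<in> Ob C \<Longrightarrow> Dom C (Idn C X) = X"
  and cod_idn [simp]: "X \<in> Ob C \<Longrightarrow> Cod C (Idn C X) = X" using id_hom[of X] by (auto simp: hom_iff)

lemma cmp_idn_left [simp]: "\<lbrakk>f \<in> Ar C; Cod C f = X\<rbrakk> \<Longrightarrow> Idn C X \<cdot> f = f"
  and cmp_idn_right [simp]: "\<lbrakk>f \<in> Ar C; Dom C f = X\<rbrakk> \<Longrightarrow> f \<cdot> Idn C X = f"
  using cmp_id_left[of f "Dom C f" X] cmp_id_right[of f X "Cod C f"] by (auto simp: hom_iff)

lemma assoc: "\<lbrakk>f \<in> Ar C; g \<in> Ar C; h \<in> Ar C; Cod C f = Dom C g; Cod C g = Dom C h\<rbrakk> \<Longrightarrow>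
    (h \<cdot> g) \<cdot> f = h \<cdot> (g \<cdot> f)"
  by (rule cmp_assoc[of f "Dom C f" "Cod C f" g "Cod C g" h "Cod C h"]) (auto simp: hom_iff)

declare dom_ob [simp] cod_ob [simp]

lemma hom_ob: assumes "f \<in> Hom C X Y" shows "X \<in> Ob C" "Y \<in> Ob C"
  using assms by (auto simp: hom_iff)

lemma isoE: assumes "is_iso C f" "f \<in> Hom C X Y"
  obtains g where "g \<in> Hom C Y X" "g \<cdot> f = Idn C X" "f \<cdot> g = Idn C Y"
  using assms unfolding is_iso_def by (auto simp: hom_iff)

lemma isoI: assumes "f \<in> Hom C X Y" "g \<in> Hom C Y X" "g \<cdot> f = Idn C X" "f \<cdot> g = Idn C Y" shows "is_iso C f"
  using assms unfolding is_iso_def by (auto simp: hom_iff)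

lemma is_iso_idn: "X \<in> Ob C \<Longrightarrow> is_iso C (Idn C X)"
  by (rule isoI[where g = "Idn C X" and X = X and Y = X]) (auto simp: hom_iff)

lemma iso_cancel_left: assumes "is_iso C f" "f \<in> Hom C X Y" "g \<in> Hom C W X" "h \<in> Hom C W X" "f \<cdot> g = f \<cdot> h"
  shows "g = h"
proof -
  obtain k where k: "k \<in> Hom C Y X" "k \<cdot> f = Idn C X" using isoE[OF assms(1,2)] by metis
  have "(k \<cdot> f) \<cdot> g = (k \<cdot> f) \<cdot> h" using assms k(1) by (simp add: hom_iff assoc)
  thus ?thesis using k assms by (simp add: hom_iff)
qed

lemma is_iso_cmp: assumes "is_iso C f" "is_iso C g" "f \<in> Hom C X Y" "g \<in> Hom C Y Z" shows "is_iso C (g \<cdot> f)"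
proof -
  obtain f' where f': "f' \<in> Hom C Y X" "f' \<cdot> f = Idn C X" "f \<cdot> f' = Idn C Y"
    using isoE[OF assms(1,3)] by metis
  obtain g' where g': "g' \<in> Hom C Z Y" "g' \<cdot> g = Idn C Y" "g \<cdot> g' = Idn C Z"
    using isoE[OF assms(2,4)] by metis
  have "(f' \<cdot> g') \<cdot> (g \<cdot> f) = f' \<cdot> ((g' \<cdot> g) \<cdot> f)" "(g \<cdot> f) \<cdot> (f' \<cdot> g') = g \<cdot> ((f \<cdot> f') \<cdot> g')"
    using assms f'(1) g'(1) by (simp_all add: hom_iff assoc)
  thus ?thesis using assms f' g'
    by (intro isoI[where X = X and Y = Z and g = "f' \<cdot> g'"]) (simp_all add: hom_iff)
qed

lemma iso_inverse: assumes "is_iso C f" "f \<in> Hom C X Y"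
  obtains g where "g \<in> Hom C Y X" "g \<cdot> f = Idn C X" "f \<cdot> g = Idn C Y" "is_iso C g"
  using isoE[OF assms] isoI assms(2) by metis

end

section \<open>Calculus in the hom groups\<close>

definition Neg :: "('o, 'm, 'z) acat_scheme \<Rightarrow> 'm \<Rightarrow> 'm" where
  "Neg A f = m_inv (hom_grp A (Dom A f) (Cod A f)) f"

context preadditive_category
begin

lemma hom_grp_simps [simp]: "carrier (hom_grp A X Y) = Hom A X Y" "monoid.mult (hom_grp A X Y) = Add A"
  "one (hom_grp A X Y) = Zer A X Y" by (simp_all add: hom_grp_def)

lemma zer_hom: "\<lbrakk>X \<in> Ob A; Y \<in> Ob A\<rbrakk> \<Longrightarrow> Zer A X Y \<in> Hom A X Y"
  using monoid.one_closed[OF group.is_monoid[OF comm_group.axioms(2)[OF hom_comm_group]], of X Y] by simp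

lemma add_hom: "\<lbrakk>f \<in> Hom A X Y; g \<in> Hom A X Y\<rbrakk> \<Longrightarrow> f \<boxplus> g \<in> Hom A X Y"
  using monoid.m_closed[OF group.is_monoid[OF comm_group.axioms(2)[OF hom_comm_group]], of X Y f g]
    hom_ob[of f X Y] by simp

lemma neg_hom: assumes "f \<in> Hom A X Y" shows "Neg A f \<in> Hom A X Y"
  using group.inv_closed[OF comm_group.axioms(2)[OF hom_comm_group], of X Y f]
    hom_ob[OF assms] assms by (simp add: Neg_def hom_iff)

lemma hom_add_comm: assumes "f \<in> Hom A X Y" "g \<in> Hom A X Y" shows "f \<boxplus> g = g \<boxplus> f"
  using comm_monoid.m_comm[OF comm_group.axioms(1)[OF hom_comm_group], of X Y f g]
    hom_ob[OF assms(1)] assms by simp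

lemma hom_add_assoc: assumes "f \<in> Hom A X Y" "g \<in> Hom A X Y" "h \<in> Hom A X Y" shows "(f \<boxplus> g) \<boxplus> h = f \<boxplus> (g \<boxplus> h)"
  using monoid.m_assoc[OF group.is_monoid[OF comm_group.axioms(2)[OF hom_comm_group]], of X Y f g h]
    hom_ob[OF assms(1)] assms by simp

lemma hom_add_zer: assumes "f \<in> Hom A X Y" shows "f \<boxplus> Zer A X Y = f" "Zer A X Y \<boxplus> f = f"
  using monoid.r_one[OF group.is_monoid[OF comm_group.axioms(2)[OF hom_comm_group]], of X Y f]
    monoid.l_one[OF group.is_monoid[OF comm_group.axioms(2)[OF hom_comm_group]], of X Y f]
    hom_ob[OF assms(1)] assms by simp_all

lemma hom_add_neg: assumes "f \<in> Hom A X Y" shows "f \<boxplus> Neg A f = Zer A X Y" "Neg A f \<boxplus> f = Zer A X Y"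
  using group.r_inv[OF comm_group.axioms(2)[OF hom_comm_group], of X Y f]
    group.l_inv[OF comm_group.axioms(2)[OF hom_comm_group], of X Y f]
    hom_ob[OF assms] assms by (simp_all add: Neg_def hom_iff)

lemma hom_add_cancel: assumes "f \<in> Hom A X Y" "g \<in> Hom A X Y" "h \<in> Hom A X Y"
  shows "f \<boxplus> g = f \<boxplus> h \<longleftrightarrow> g = h" "g \<boxplus> f = h \<boxplus> f \<longleftrightarrow> g = h"
proof -
  show "g \<boxplus> f = h \<boxplus> f \<longleftrightarrow> g = h"
    using group.right_cancel[OF comm_group.axioms(2)[OF hom_comm_group], of X Y f g h]
      hom_ob[OF assms(1)] assms by simp
  thus "f \<boxplus> g = f \<boxplus> h \<longleftrightarrow> g = h" using assms hom_add_comm by metis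
qed

lemma hom_diff_add: assumes "f \<in> Hom A X Y" "g \<in> Hom A X Y" shows "(f \<boxplus> Neg A g) \<boxplus> g = f"
  using assms hom_add_assoc[OF assms(1) neg_hom[OF assms(2)] assms(2)] hom_add_neg(2)[OF assms(2)]
    hom_add_zer by simp

text \<open>Zero equals its own double, hence so does its composite with \<open>g\<close>, and
  cancellation in the hom group leaves zero.\<close>

lemma cmp_zer: assumes "g \<in> Hom A Y Z" "X \<in> Ob A" shows "g \<cdot> Zer A X Y = Zer A X Z"
proof -
  have z: "Zer A X Y \<in> Hom A X Y" using assms hom_ob zer_hom by blast
  have c: "g \<cdot> Zer A X Y \<in> Hom A X Z" using z assms cmp_hom by blast
  have "g \<cdot> Zer A X Y \<boxplus> g \<cdot> Zer A X Y = g \<cdot> Zer A X Y \<boxplus> Zer A X Z"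
    using cmp_add[OF z z assms(1)] hom_add_zer[OF z] hom_add_zer[OF c] by simp
  thus ?thesis using hom_add_cancel(1)[OF c c zer_hom] hom_ob c by blast
qed

lemma zer_cmp: assumes "g \<in> Hom A X Y" "Z \<in> Ob A" shows "Zer A Y Z \<cdot> g = Zer A X Z"
proof -
  have z: "Zer A Y Z \<in> Hom A Y Z" using assms hom_ob zer_hom by blast
  have c: "Zer A Y Z \<cdot> g \<in> Hom A X Z" using z assms cmp_hom by blast
  have "Zer A Y Z \<cdot> g \<boxplus> Zer A Y Z \<cdot> g = Zer A Y Z \<cdot> g \<boxplus> Zer A X Z"
    using add_cmp[OF assms(1) z z] hom_add_zer[OF z] hom_add_zer[OF c] by simp
  thus ?thesis using hom_add_cancel(1)[OF c c zer_hom] hom_ob c by blast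
qed

lemma cmp_neg: assumes "f \<in> Hom A X Y" "g \<in> Hom A Y Z" shows "g \<cdot> Neg A f = Neg A (g \<cdot> f)"
proof -
  have c: "g \<cdot> f \<in> Hom A X Z" using assms cmp_hom by blast
  have n: "g \<cdot> Neg A f \<in> Hom A X Z" using assms cmp_hom neg_hom by blast
  have "g \<cdot> f \<boxplus> g \<cdot> Neg A f = g \<cdot> f \<boxplus> Neg A (g \<cdot> f)"
    using cmp_add[OF assms(1) neg_hom[OF assms(1)] assms(2)] hom_add_neg[OF assms(1)]
      hom_add_neg[OF c] cmp_zer[OF assms(2), of X] hom_ob[OF assms(1)] by simp
  thus ?thesis using hom_add_cancel(1)[OF c n neg_hom[OF c]] by blast
qed

lemma neg_cmp: assumes "f \<in> Hom A X Y" "g \<in> Hom A Y Z" shows "Neg A g \<cdot> f = Neg A (g \<cdot> f)"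
proof -
  have c: "g \<cdot> f \<in> Hom A X Z" using assms cmp_hom by blast
  have n: "Neg A g \<cdot> f \<in> Hom A X Z" using assms cmp_hom neg_hom by blast
  have "g \<cdot> f \<boxplus> Neg A g \<cdot> f = g \<cdot> f \<boxplus> Neg A (g \<cdot> f)"
    using add_cmp[OF assms(1) assms(2) neg_hom[OF assms(2)]] hom_add_neg[OF assms(2)]
      hom_add_neg[OF c] zer_cmp[OF assms(1), of Z] hom_ob[OF assms(2)] by simp
  thus ?thesis using hom_add_cancel(1)[OF c n neg_hom[OF c]] by blast
qed

lemma ar_add [simp]: "\<lbrakk>f \<in> Ar A; g \<in> Ar A; Dom A f = Dom A g; Cod A f = Cod A g\<rbrakk> \<Longrightarrow> f \<boxplus> g \<in> Ar A"
  and dom_add [simp]: "\<lbrakk>f \<in> Ar A; g \<in> Ar A; Dom A f = Dom A g; Cod A f = Cod A g\<rbrakk> \<Longrightarrow> Dom A (f \<boxplus> g) = Dom A f"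
  and cod_add [simp]: "\<lbrakk>f \<in> Ar A; g \<in> Ar A; Dom A f = Dom A g; Cod A f = Cod A g\<rbrakk> \<Longrightarrow> Cod A (f \<boxplus> g) = Cod A f"
  using add_hom[of f "Dom A f" "Cod A f" g] by (auto simp: hom_iff)

lemma ar_neg [simp]: "f \<in> Ar A \<Longrightarrow> Neg A f \<in> Ar A" and dom_neg [simp]: "f \<in> Ar A \<Longrightarrow> Dom A (Neg A f) = Dom A f"
  and cod_neg [simp]: "f \<in> Ar A \<Longrightarrow> Cod A (Neg A f) = Cod A f"
  using neg_hom[of f "Dom A f" "Cod A f"] by (auto simp: hom_iff)

lemma ar_zer [simp]: "\<lbrakk>X \<in> Ob A; Y \<in> Ob A\<rbrakk> \<Longrightarrow> Zer A X Y \<in> Ar A"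
  and dom_zer [simp]: "\<lbrakk>X \<in> Ob A; Y \<in> Ob A\<rbrakk> \<Longrightarrow> Dom A (Zer A X Y) = X"
  and cod_zer [simp]: "\<lbrakk>X \<in> Ob A; Y \<in> Ob A\<rbrakk> \<Longrightarrow> Cod A (Zer A X Y) = Y"
  using zer_hom[of X Y] by (auto simp: hom_iff)

lemma distr_left: "\<lbrakk>f \<in> Ar A; g \<in> Ar A; h \<in> Ar A; Dom A f = Dom A g; Cod A f = Cod A g;
    Cod A h = Dom A g\<rbrakk> \<Longrightarrow> (f \<boxplus> g) \<cdot> h = f \<cdot> h \<boxplus> g \<cdot> h"
  by (rule add_cmp[of h "Dom A h" "Cod A h" f "Cod A f" g]) (auto simp: hom_iff)

lemma distr_right: "\<lbrakk>f \<in> Ar A; g \<in> Ar A; h \<in> Ar A; Dom A f = Dom A g; Cod A f = Cod A g;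
    Dom A h = Cod A g\<rbrakk> \<Longrightarrow> h \<cdot> (f \<boxplus> g) = h \<cdot> f \<boxplus> h \<cdot> g"
  by (rule cmp_add[of f "Dom A f" "Cod A f" g h "Cod A h"]) (auto simp: hom_iff)

lemma cmp_zer' [simp]: "\<lbrakk>g \<in> Ar A; X \<in> Ob A; Dom A g = Y\<rbrakk> \<Longrightarrow> g \<cdot> Zer A X Y = Zer A X (Cod A g)"
  by (rule cmp_zer) (auto simp: hom_iff)

lemma zer_cmp' [simp]: "\<lbrakk>g \<in> Ar A; Z \<in> Ob A; Cod A g = Y\<rbrakk> \<Longrightarrow> Zer A Y Z \<cdot> g = Zer A (Dom A g) Z"
  by (rule zer_cmp) (auto simp: hom_iff)

lemma add_zer' [simp]: "\<lbrakk>f \<in> Ar A; Dom A f = X; Cod A f = Y\<rbrakk> \<Longrightarrow> f \<boxplus> Zer A X Y = f"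
  "\<lbrakk>f \<in> Ar A; Dom A f = X; Cod A f = Y\<rbrakk> \<Longrightarrow> Zer A X Y \<boxplus> f = f" by (auto simp: hom_iff intro: hom_add_zer)

lemmas hom_simps = hom_iff assoc distr_left distr_right

section \<open>Arrows out of biproducts and cokernels\<close>

lemma biproduct_out: assumes "is_biproduct A X Y S i j p q" "a \<in> Hom A X T" "b \<in> Hom A Y T"
  shows "a \<cdot> p \<boxplus> b \<cdot> q \<in> Hom A S T" "(a \<cdot> p \<boxplus> b \<cdot> q) \<cdot> i = a" "(a \<cdot> p \<boxplus> b \<cdot> q) \<cdot> j = b"
  using assms hom_ob[OF assms(2)] hom_ob[OF assms(3)] unfolding is_biproduct_def by (simp_all add: hom_simps)

lemma biproduct_out_decomp: assumes "is_biproduct A X Y S i j p q" "u \<in> Hom A S T"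
  shows "u = (u \<cdot> i) \<cdot> p \<boxplus> (u \<cdot> j) \<cdot> q"
proof -
  have "u = u \<cdot> (i \<cdot> p \<boxplus> j \<cdot> q)" using assms unfolding is_biproduct_def by (simp add: hom_iff)
  also have "\<dots> = u \<cdot> (i \<cdot> p) \<boxplus> u \<cdot> (j \<cdot> q)"
    using assms unfolding is_biproduct_def by (subst distr_right) (simp_all add: hom_iff)
  finally show ?thesis using assms unfolding is_biproduct_def by (simp add: hom_iff assoc)
qed

lemma biproduct_out_ext: assumes "is_biproduct A X Y S i j p q" "u \<in> Hom A S T" "v \<in> Hom A S T"
    "u \<cdot> i = v \<cdot> i" "u \<cdot> j = v \<cdot> j" shows "u = v"
  using biproduct_out_decomp[OF assms(1,2)] biproduct_out_decomp[OF assms(1,3)] assms(4,5) by simp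

lemma cokernelE: assumes "is_cokernel A g f" "h \<in> Hom A (Cod A f) W" "h \<cdot> f = Zer A (Dom A f) W"
  obtains u where "u \<in> Hom A (Cod A g) W" "u \<cdot> g = h"
proof -
  have "h \<in> Ar A" "Dom A h = Cod A f \<and> h \<cdot> f = Zer A (Dom A f) (Cod A h)" "Cod A h = W"
    using assms(2,3) by (simp_all add: hom_iff)
  thus ?thesis using assms(1) that unfolding is_cokernel_def by metis
qed

text \<open>The composite \<open>u \<cdot> g\<close> kills \<open>f\<close>, so the uniqueness half
  of the universal property, applied to it, identifies \<open>u\<close> and
  \<open>v\<close>.\<close>

lemma cokernel_epi:
  assumes "is_cokernel A g f" "u \<in> Hom A (Cod A g) W" "v \<in> Hom A (Cod A g) W" "u \<cdot> g = v \<cdot> g" shows "u = v"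
proof -
  have f: "f \<in> Ar A" "g \<in> Ar A" "Cod A f = Dom A g" "g \<cdot> f = Zer A (Dom A f) (Cod A g)"
    using assms(1) unfolding is_cokernel_def by auto
  have *: "u \<cdot> g \<in> Ar A" "Dom A (u \<cdot> g) = Cod A f" "Cod A (u \<cdot> g) = W"
    using assms(2) f by (simp_all add: hom_iff)
  have "(u \<cdot> g) \<cdot> f = u \<cdot> (g \<cdot> f)" using assms(2) f(1-3) by (simp add: hom_iff assoc)
  hence z: "(u \<cdot> g) \<cdot> f = Zer A (Dom A f) (Cod A (u \<cdot> g))" using assms(2) f by (simp add: hom_iff)
  have "\<exists>!w. w \<in> Hom A (Cod A g) (Cod A (u \<cdot> g)) \<and> w \<cdot> g = u \<cdot> g"
    using assms(1) * z unfolding is_cokernel_def by blast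
  thus ?thesis using assms(2-4) * by metis
qed

text \<open>Unique existence is split into existence of a factorization and right cancellability of
  \<open>g\<close>; in applications these have separate reasons.\<close>

lemma cokernelI: assumes "f \<in> Hom A X Y" "g \<in> Hom A Y Z" "g \<cdot> f = Zer A X Z"
    "\<And>W h. \<lbrakk>h \<in> Hom A Y W; h \<cdot> f = Zer A X W\<rbrakk> \<Longrightarrow> \<exists>u. u \<in> Hom A Z W \<and> u \<cdot> g = h"
    "\<And>W u v. \<lbrakk>u \<in> Hom A Z W; v \<in> Hom A Z W; u \<cdot> g = v \<cdot> g\<rbrakk> \<Longrightarrow> u = v" shows "is_cokernel A g f"
  unfolding is_cokernel_def
proof (intro conjI ballI impI)
  fix h assume "h \<in> Ar A" "Dom A h = Cod A f \<and> h \<cdot> f = Zer A (Dom A f) (Cod A h)"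
  hence h: "h \<in> Hom A Y (Cod A h)" "h \<cdot> f = Zer A X (Cod A h)" using assms(1) by (auto simp: hom_iff)
  then obtain u where "u \<in> Hom A Z (Cod A h) \<and> u \<cdot> g = h" using assms(4) by metis
  moreover have "Cod A g = Z" using assms(2) by (simp add: hom_iff)
  ultimately show "\<exists>!u. u \<in> Hom A (Cod A g) (Cod A h) \<and> u \<cdot> g = h" using assms(5) by metis
qed (use assms(1-3) in \<open>simp_all add: hom_iff\<close>)

end

section \<open>Duality through the opposite category\<close>

lemma opp_simps: "Ob (opp A) = Ob A" "Ar (opp A) = Ar A" "Dom (opp A) = Cod A" "Cod (opp A) = Dom A"
  "Idn (opp A) = Idn A" "g \<cdot>[opp A] f = f \<cdot>[A] g" "Add (opp A) = Add A" "Zer (opp A) X Y = Zer A Y X"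
  by (simp_all add: opp_def)

lemma Hom_opp: "Hom (opp A) X Y = Hom A Y X" by (auto simp: hom_iff opp_simps)

lemma category_opp: assumes "category A" shows "category (opp A)"
proof -
  interpret category A by fact
  show ?thesis
    by unfold_locales (auto simp: opp_simps Hom_opp id_hom cmp_hom cmp_id_left cmp_id_right cmp_assoc)
qed

lemma preadditive_opp: assumes "preadditive_category A" shows "preadditive_category (opp A)"
proof -
  interpret preadditive_category A by fact
  have "hom_grp (opp A) X Y = hom_grp A Y X" for X Y by (simp add: hom_grp_def Hom_opp opp_simps)
  thus ?thesis
    by (intro preadditive_category.intro preadditive_category_axioms.intro category_opp category_axioms)
      (auto simp: opp_simps Hom_opp hom_comm_group add_cmp cmp_add)
qed

lemma cokernel_opp: "is_cokernel (opp A) f g \<longleftrightarrow> is_kernel A f g"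
  and kernel_opp: "is_kernel (opp A) f g \<longleftrightarrow> is_cokernel A f g"
  unfolding is_cokernel_def is_kernel_def opp_simps Hom_opp by (simp_all only: conj_ac eq_commute)

lemma pushout_opp: "is_pushout (opp A) f g f' g' \<longleftrightarrow> is_pullback A f g f' g'"
  and pullback_opp: "is_pullback (opp A) f g f' g' \<longleftrightarrow> is_pushout A f g f' g'"
  unfolding is_pushout_def is_pullback_def opp_simps Hom_opp by simp_all

lemma biproduct_opp: "is_biproduct (opp A) X Y S i j p q \<longleftrightarrow> is_biproduct A X Y S p q i j"
  unfolding is_biproduct_def opp_simps Hom_opp by blast

lemma iso_opp: "is_iso (opp A) f \<longleftrightarrow> is_iso A f" unfolding is_iso_def opp_simps Hom_opp by blast

lemmas op_simps = opp_simps Hom_opp cokernel_opp kernel_opp pushout_opp pullback_opp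
  biproduct_opp iso_opp

context preadditive_category
begin

interpretation op: preadditive_category "opp A" by (rule preadditive_opp) (rule preadditive_category_axioms)

text \<open>Statements about arrows into an object are those about arrows out of it in
  \<open>opp A\<close>; \<open>op_simps\<close> rewrites them back into \<open>A\<close>, so each
  pair of dual facts has a single proof.\<close>

lemmas biproduct_in = op.biproduct_out[unfolded op_simps]
lemmas biproduct_in_ext = op.biproduct_out_ext[unfolded op_simps]
lemmas biproduct_in_decomp = op.biproduct_out_decomp[unfolded op_simps]
lemmas kernelE = op.cokernelE[unfolded op_simps]
lemmas kernel_mono = op.cokernel_epi[unfolded op_simps]

lemma kernelI: assumes "f \<in> Hom A X Y" "g \<in> Hom A Y Z" "g \<cdot> f = Zer A X Z"
    "\<And>W h. \<lbrakk>h \<in> Hom A W Y; g \<cdot> h = Zer A W Z\<rbrakk> \<Longrightarrow> \<exists>u. u \<in> Hom A W X \<and> f \<cdot> u = h"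
    "\<And>W u v. \<lbrakk>u \<in> Hom A W X; v \<in> Hom A W X; f \<cdot> u = f \<cdot> v\<rbrakk> \<Longrightarrow> u = v" shows "is_kernel A f g"
  by (rule op.cokernelI[of g Z Y f X, unfolded op_simps]) (use assms in blast)+

end

section \<open>Exact categories and the horseshoe lemma\<close>

context category
begin

lemma pushoutD: assumes "is_pushout C f g f' g'"
  shows "f \<in> Ar C" "g \<in> Ar C" "f' \<in> Ar C" "g' \<in> Ar C" "Dom C g = Dom C f" "Dom C f' = Cod C f"
    "Dom C g' = Cod C g" "Cod C g' = Cod C f'" "f' \<cdot> f = g' \<cdot> g"
  using assms unfolding is_pushout_def by simp_all

lemma pushoutE:
  assumes "is_pushout C f g f' g'" "a \<in> Hom C (Cod C f) T" "b \<in> Hom C (Cod C g) T" "a \<cdot> f = b \<cdot> g"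
  obtains u where "u \<in> Hom C (Cod C f') T" "u \<cdot> f' = a" "u \<cdot> g' = b"
proof -
  have "a \<in> Ar C" "b \<in> Ar C" "Dom C a = Cod C f \<and> Dom C b = Cod C g \<and> Cod C a = Cod C b \<and> a \<cdot> f = b \<cdot> g"
    using assms by (simp_all add: hom_iff)
  hence "\<exists>!u. u \<in> Hom C (Cod C f') (Cod C a) \<and> u \<cdot> f' = a \<and> u \<cdot> g' = b"
    using assms(1) unfolding is_pushout_def by blast
  thus ?thesis using that assms(2) by (auto simp: hom_iff)
qed

lemma pushout_ext: assumes "is_pushout C f g f' g'" "u \<in> Hom C (Cod C f') T" "v \<in> Hom C (Cod C f') T"
    "u \<cdot> f' = v \<cdot> f'" "u \<cdot> g' = v \<cdot> g'" shows "u = v"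
proof -
  note D = pushoutD[OF assms(1)]
  have m: "u \<cdot> f' \<in> Ar C" "u \<cdot> g' \<in> Ar C" "Dom C (u \<cdot> f') = Cod C f" "Dom C (u \<cdot> g') = Cod C g"
    "Cod C (u \<cdot> f') = T" "Cod C (u \<cdot> g') = T" using D assms(2) by (simp_all add: hom_iff)
  have c: "(u \<cdot> f') \<cdot> f = (u \<cdot> g') \<cdot> g" using D assms(2) by (simp add: hom_iff assoc)
  have *: "Dom C (u \<cdot> f') = Cod C f \<and> Dom C (u \<cdot> g') = Cod C g \<and>
      Cod C (u \<cdot> f') = Cod C (u \<cdot> g') \<and> (u \<cdot> f') \<cdot> f = (u \<cdot> g') \<cdot> g" using m c by simp
  have "\<exists>!w. w \<in> Hom C (Cod C f') (Cod C (u \<cdot> f')) \<and> w \<cdot> f' = u \<cdot> f' \<and> w \<cdot> g' = u \<cdot> g'"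
    using assms(1) m(1,2) * unfolding is_pushout_def by blast
  thus ?thesis using assms(2-5) m(5) by metis
qed

lemma pushoutI: assumes "f \<in> Hom C A X" "g \<in> Hom C A Y" "f' \<in> Hom C X Z" "g' \<in> Hom C Y Z" "f' \<cdot> f = g' \<cdot> g"
    "\<And>T a b. \<lbrakk>a \<in> Hom C X T; b \<in> Hom C Y T; a \<cdot> f = b \<cdot> g\<rbrakk> \<Longrightarrow>
       \<exists>u. u \<in> Hom C Z T \<and> u \<cdot> f' = a \<and> u \<cdot> g' = b"
    "\<And>T u v. \<lbrakk>u \<in> Hom C Z T; v \<in> Hom C Z T; u \<cdot> f' = v \<cdot> f'; u \<cdot> g' = v \<cdot> g'\<rbrakk> \<Longrightarrow> u = v"
  shows "is_pushout C f g f' g'" unfolding is_pushout_def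
proof (intro conjI ballI impI)
  fix a b assume "a \<in> Ar C" "b \<in> Ar C"
    "Dom C a = Cod C f \<and> Dom C b = Cod C g \<and> Cod C a = Cod C b \<and> a \<cdot> f = b \<cdot> g"
  hence h: "a \<in> Hom C X (Cod C a)" "b \<in> Hom C Y (Cod C a)" "a \<cdot> f = b \<cdot> g"
    using assms(1,2) by (simp_all add: hom_iff)
  then obtain u where "u \<in> Hom C Z (Cod C a) \<and> u \<cdot> f' = a \<and> u \<cdot> g' = b" using assms(6) by metis
  moreover have "Cod C f' = Z" using assms(3) by (simp add: hom_iff)
  ultimately show "\<exists>!u. u \<in> Hom C (Cod C f') (Cod C a) \<and> u \<cdot> f' = a \<and> u \<cdot> g' = b" using assms(7) by metis
qed (use assms(1-5) in \<open>simp_all add: hom_iff\<close>)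

lemma pushout_unique: assumes "is_pushout C f g f1 g1" "is_pushout C f g f2 g2"
  obtains u where "u \<in> Hom C (Cod C f1) (Cod C f2)" "is_iso C u" "u \<cdot> f1 = f2" "u \<cdot> g1 = g2"
proof -
  note D1 = pushoutD[OF assms(1)] note D2 = pushoutD[OF assms(2)]
  obtain u where u: "u \<in> Hom C (Cod C f1) (Cod C f2)" "u \<cdot> f1 = f2" "u \<cdot> g1 = g2"
    using pushoutE[OF assms(1), of f2 "Cod C f2" g2] D2 by (auto simp: hom_iff)
  obtain v where v: "v \<in> Hom C (Cod C f2) (Cod C f1)" "v \<cdot> f2 = f1" "v \<cdot> g2 = g1"
    using pushoutE[OF assms(2), of f1 "Cod C f1" g1] D1 by (auto simp: hom_iff)
  have "(v \<cdot> u) \<cdot> f1 = f1" "(v \<cdot> u) \<cdot> g1 = g1" "(u \<cdot> v) \<cdot> f2 = f2" "(u \<cdot> v) \<cdot> g2 = g2"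
    using u v D1 D2 by (simp_all add: hom_iff assoc)
  note e = this
  have "v \<cdot> u = Idn C (Cod C f1)"
    by (rule pushout_ext[OF assms(1), of _ "Cod C f1"]) (use u(1) v(1) D1 e in \<open>simp_all add: hom_iff\<close>)
  moreover have "u \<cdot> v = Idn C (Cod C f2)"
    by (rule pushout_ext[OF assms(2), of _ "Cod C f2"]) (use u(1) v(1) D2 e in \<open>simp_all add: hom_iff\<close>)
  ultimately show ?thesis using that[of u] u v(1) isoI by metis
qed

end

context preadditive_category
begin

interpretation op: preadditive_category "opp A" by (rule preadditive_opp) (rule preadditive_category_axioms)

lemmas pullbackD = op.pushoutD[unfolded op_simps]
lemmas pullbackI = op.pushoutI[unfolded op_simps]
lemmas pullback_unique = op.pushout_unique[unfolded op_simps]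

lemma kernelD: assumes "is_kernel A f g"
  shows "f \<in> Ar A" "g \<in> Ar A" "Cod A f = Dom A g" "g \<cdot> f = Zer A (Dom A f) (Cod A g)"
  using assms unfolding is_kernel_def by simp_all

lemma cokernelD: assumes "is_cokernel A g f"
  shows "f \<in> Ar A" "g \<in> Ar A" "Cod A f = Dom A g" "g \<cdot> f = Zer A (Dom A f) (Cod A g)"
  using assms unfolding is_cokernel_def by simp_all

text \<open>An arrow out of the pushout that kills \<open>g'\<close> is determined by its
  restriction along \<open>f'\<close>; this restriction kills \<open>f\<close>, so it factors
  through \<open>c\<close>. Hence a pushout square does not change the cokernel.\<close>

lemma pushout_cokernel: assumes po: "is_pushout A f g f' g'" and c: "is_cokernel A c f"
    and w: "w \<in> Hom A (Cod A f') (Cod A c)" "w \<cdot> f' = c" "w \<cdot> g' = Zer A (Cod A g) (Cod A c)"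
  shows "is_cokernel A w g'"
proof -
  note D = pushoutD[OF po] cokernelD[OF c]
  show ?thesis
  proof (rule cokernelI[of _ "Cod A g" "Cod A f'" _ "Cod A c"])
    fix T h assume h: "h \<in> Hom A (Cod A f') T" "h \<cdot> g' = Zer A (Cod A g) T"
    have "h \<cdot> f' \<cdot> f = h \<cdot> g' \<cdot> g" using D h(1) by (simp add: hom_iff assoc)
    also have "\<dots> = Zer A (Dom A f) T" using D h by (auto simp: hom_iff)
    finally obtain u where u: "u \<in> Hom A (Cod A c) T" "u \<cdot> c = h \<cdot> f'"
      using cokernelE[OF c, of "h \<cdot> f'" T] D h(1) by (auto simp: hom_iff)
    have "u \<cdot> w = h"
    proof (rule pushout_ext[OF po, of _ T])
      show "u \<cdot> w \<cdot> f' = h \<cdot> f'" using D u w by (simp add: hom_iff assoc)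
      have "u \<cdot> w \<cdot> g' = u \<cdot> (w \<cdot> g')" using D u(1) w(1) by (simp add: hom_iff assoc)
      also have "\<dots> = Zer A (Cod A g) T" unfolding w(3) using D u(1) by (simp add: hom_iff)
      finally show "u \<cdot> w \<cdot> g' = h \<cdot> g'" using h by simp
    qed (use D u w h in \<open>simp_all add: hom_iff\<close>)
    thus "\<exists>u. u \<in> Hom A (Cod A c) T \<and> u \<cdot> w = h" using u by blast
  next
    fix T u v assume uv: "u \<in> Hom A (Cod A c) T" "v \<in> Hom A (Cod A c) T" "u \<cdot> w = v \<cdot> w"
    have "u \<cdot> w \<cdot> f' = u \<cdot> c" "v \<cdot> w \<cdot> f' = v \<cdot> c" using uv(1,2) w(1) D by (simp_all add: hom_iff assoc w(2))
    thus "u = v" using cokernel_epi[OF c uv(1,2)] uv(3) by simp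
  qed (use D w in \<open>simp_all add: hom_iff\<close>)
qed

lemma cokernel_unique: assumes "is_cokernel A c f" "is_cokernel A d f"
  obtains u where "u \<in> Hom A (Cod A c) (Cod A d)" "is_iso A u" "u \<cdot> c = d"
proof -
  note D = cokernelD[OF assms(1)] cokernelD[OF assms(2)]
  obtain u where u: "u \<in> Hom A (Cod A c) (Cod A d)" "u \<cdot> c = d"
    using cokernelE[OF assms(1), of d "Cod A d"] D by (auto simp: hom_iff)
  obtain v where v: "v \<in> Hom A (Cod A d) (Cod A c)" "v \<cdot> d = c"
    using cokernelE[OF assms(2), of c "Cod A c"] D by (auto simp: hom_iff)
  have "(v \<cdot> u) \<cdot> c = c" "(u \<cdot> v) \<cdot> d = d" using u v D by (simp_all add: hom_iff assoc)
  note e = this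
  have "v \<cdot> u = Idn A (Cod A c)"
    by (rule cokernel_epi[OF assms(1), of _ "Cod A c"]) (use u(1) v(1) D e in \<open>simp_all add: hom_iff\<close>)
  moreover have "u \<cdot> v = Idn A (Cod A d)"
    by (rule cokernel_epi[OF assms(2), of _ "Cod A d"]) (use u(1) v(1) D e in \<open>simp_all add: hom_iff\<close>)
  ultimately show ?thesis using that[of u] u v(1) isoI by metis
qed

text \<open>Since \<open>p\<close> can be cancelled on the right, an arrow kills
  \<open>m \<cdot> p\<close> exactly when it kills \<open>m\<close>, so the two universal problems
  coincide.\<close>

lemma cokernel_cmp_epi: assumes "p \<in> Hom A X I" "m \<in> Hom A I Y"
    and epi: "\<And>T u v. \<lbrakk>u \<in> Hom A I T; v \<in> Hom A I T; u \<cdot> p = v \<cdot> p\<rbrakk> \<Longrightarrow> u = v"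
  shows "is_cokernel A c (m \<cdot> p) \<longleftrightarrow> is_cokernel A c m"
proof -
  have z: "h \<cdot> (m \<cdot> p) = Zer A X (Cod A h) \<longleftrightarrow> h \<cdot> m = Zer A I (Cod A h)" if "h \<in> Ar A" "Dom A h = Y" for h
  proof -
    have "h \<cdot> (m \<cdot> p) = (h \<cdot> m) \<cdot> p" "Zer A I (Cod A h) \<cdot> p = Zer A X (Cod A h)"
      "h \<cdot> m \<in> Hom A I (Cod A h)" "Zer A I (Cod A h) \<in> Hom A I (Cod A h)"
      using that assms(1,2) by (auto simp: hom_iff assoc)
    thus ?thesis using epi[of "h \<cdot> m" "Cod A h" "Zer A I (Cod A h)"] by metis
  qed
  have "m \<cdot> p \<in> Ar A" "m \<in> Ar A" "Cod A (m \<cdot> p) = Y" "Dom A (m \<cdot> p) = X" "Cod A m = Y" "Dom A m = I"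
    using assms(1,2) by (simp_all add: hom_iff)
  thus ?thesis unfolding is_cokernel_def by (simp add: z cong: conj_cong)
qed

end

context preadditive_category
begin

interpretation op: preadditive_category "opp A" by (rule preadditive_opp) (rule preadditive_category_axioms)

lemmas kernel_cmp_mono = op.cokernel_cmp_epi[unfolded op_simps]
lemmas kernel_unique = op.cokernel_unique[unfolded op_simps]

lemma biproduct_swap: "is_biproduct A X Y S i j p q \<Longrightarrow> is_biproduct A Y X S j i q p"
  unfolding is_biproduct_def using hom_add_comm[of "i \<cdot> p" S S "j \<cdot> q"] cmp_hom by auto

text \<open>The pushout as cokernel of \<open>f\<close> and minus \<open>g\<close> into the
  biproduct. The negative of \<open>g\<close> is any \<open>n\<close> with
  \<open>g \<boxplus> n\<close> zero, so that in a full subcategory the negative formed in the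
  ambient category can be supplied.\<close>

lemma pushout_of_cokernel:
  assumes b: "is_biproduct A M N S i j p q" and f: "f \<in> Hom A L M" and g: "g \<in> Hom A L N"
    and n: "n \<in> Hom A L N" "g \<boxplus> n = Zer A L N" and c: "is_cokernel A c (i \<cdot> f \<boxplus> j \<cdot> n)"
  shows "is_pushout A f g (c \<cdot> i) (c \<cdot> j)"
proof -
  note B = b[unfolded is_biproduct_def]
  define d where "d = i \<cdot> f \<boxplus> j \<cdot> n"
  have d: "d \<in> Hom A L S" unfolding d_def using biproduct_in(1)[OF b f n(1)] .
  have ch: "c \<in> Hom A S (Cod A c)" using cokernelD[OF c[folded d_def]] d by (simp add: hom_iff)
  \<comment> \<open>Adding the same arrow \<open>h \<cdot> j \<cdot> n\<close> to both sides shows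
    that killing \<open>d\<close> means being compatible with \<open>f\<close> and
    \<open>g\<close>.\<close>
  have iff: "h \<cdot> d = Zer A L T \<longleftrightarrow> h \<cdot> i \<cdot> f = h \<cdot> j \<cdot> g" if h: "h \<in> Hom A S T" for h T
  proof -
    have hj: "h \<cdot> j \<in> Hom A N T" using B h cmp_hom by blast
    have k: "h \<cdot> j \<cdot> n \<in> Hom A L T" "h \<cdot> i \<cdot> f \<in> Hom A L T" "h \<cdot> j \<cdot> g \<in> Hom A L T"
      using B h f g n(1) by (simp_all add: hom_iff)
    have "h \<cdot> d = h \<cdot> i \<cdot> f \<boxplus> h \<cdot> j \<cdot> n" unfolding d_def using B h f n(1) by (simp add: hom_iff assoc distr_right)
    moreover have "h \<cdot> j \<cdot> g \<boxplus> h \<cdot> j \<cdot> n = Zer A L T"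
      using cmp_add[OF g n(1) hj] n(2) cmp_zer[OF hj hom_ob(1)[OF f]] by simp
    ultimately show ?thesis using hom_add_cancel(2)[OF k] by metis
  qed
  show ?thesis
  proof (rule pushoutI[OF f g cmp_hom[OF _ ch] cmp_hom[OF _ ch]])
    show "i \<in> Hom A M S" "j \<in> Hom A N S" using B by blast+
    show "c \<cdot> i \<cdot> f = c \<cdot> j \<cdot> g" using iff[OF ch] cokernelD(4)[OF c[folded d_def]] d by (simp add: hom_iff)
  next
    fix T a b' assume ab: "a \<in> Hom A M T" "b' \<in> Hom A N T" "a \<cdot> f = b' \<cdot> g"
    note o = biproduct_out[OF b ab(1,2)]
    have z: "(a \<cdot> p \<boxplus> b' \<cdot> q) \<cdot> d = Zer A L T" unfolding iff[OF o(1)] o(2,3) by (rule ab(3))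
    obtain u where u: "u \<in> Hom A (Cod A c) T" "u \<cdot> c = a \<cdot> p \<boxplus> b' \<cdot> q"
      using cokernelE[OF c[folded d_def], of "a \<cdot> p \<boxplus> b' \<cdot> q" T] o(1) z d by (auto simp: hom_iff)
    thus "\<exists>u. u \<in> Hom A (Cod A c) T \<and> u \<cdot> (c \<cdot> i) = a \<and> u \<cdot> (c \<cdot> j) = b'"
      using o(2,3) cmp_assoc[OF _ ch u(1)] B by metis
  next
    fix T u v assume uv: "u \<in> Hom A (Cod A c) T" "v \<in> Hom A (Cod A c) T" "u \<cdot> (c \<cdot> i) = v \<cdot> (c \<cdot> i)" "u \<cdot> (c \<cdot> j) = v \<cdot> (c \<cdot> j)"
    have "u \<cdot> c = v \<cdot> c" by (rule biproduct_out_ext[OF b cmp_hom[OF ch uv(1)] cmp_hom[OF ch uv(2)]])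
        (use uv(3,4) cmp_assoc[OF _ ch uv(1)] cmp_assoc[OF _ ch uv(2)] B in metis)+
    thus "u = v" using cokernel_epi[OF c uv(1,2)] by blast
  qed
qed

text \<open>Two arrows into \<open>I\<close> with the same composite with \<open>w\<close> differ by
  an arrow through the kernel \<open>v\<close>, so compatible pairs correspond to arbitrary arrows
  into \<open>I'\<close> and \<open>X\<close>. In an exact category this makes
  \<open>v \<cdot> p \<boxplus> u \<cdot> q\<close> a deflation whenever \<open>w \<cdot> u\<close>
  is one.\<close>

lemma kernel_pullback: assumes k: "is_kernel A v w" "v \<in> Hom A I' I" "w \<in> Hom A I J" and u: "u \<in> Hom A X I"
    and b: "is_biproduct A I' X B i j p q" shows "is_pullback A (w \<cdot> u) w q (v \<cdot> p \<boxplus> u \<cdot> q)"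
proof -
  note B = b[unfolded is_biproduct_def] and d = biproduct_out[OF b k(2) u]
  have zw: "w \<cdot> v = Zer A I' J" using kernelD(4)[OF k(1)] k(2,3) by (simp add: hom_iff)
  have ob: "I' \<in> Ob A" "J \<in> Ob A" "X \<in> Ob A" using hom_ob k u by auto
  have app: "(v \<cdot> p \<boxplus> u \<cdot> q) \<cdot> x = v \<cdot> (p \<cdot> x) \<boxplus> u \<cdot> (q \<cdot> x)" if "x \<in> Hom A T B" for x T
    using that B k(2) u by (simp add: hom_simps)
  show ?thesis
  proof (rule pullbackI[OF cmp_hom[OF u k(3)] k(3) _ d(1)])
    show "q \<in> Hom A B X" using B by blast
    show "w \<cdot> u \<cdot> q = w \<cdot> (v \<cdot> p \<boxplus> u \<cdot> q)"
    proof (rule biproduct_out_ext[OF b, of _ J])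
      have "w \<cdot> (v \<cdot> p \<boxplus> u \<cdot> q) \<cdot> x = w \<cdot> ((v \<cdot> p \<boxplus> u \<cdot> q) \<cdot> x)" "w \<cdot> u \<cdot> q \<cdot> x = w \<cdot> u \<cdot> (q \<cdot> x)"
        if "x \<in> Hom A T B" for x T
        using cmp_assoc[OF that d(1) k(3)] cmp_assoc[OF that _ cmp_hom[OF u k(3)], of q] B by blast+
      thus "w \<cdot> u \<cdot> q \<cdot> i = w \<cdot> (v \<cdot> p \<boxplus> u \<cdot> q) \<cdot> i" "w \<cdot> u \<cdot> q \<cdot> j = w \<cdot> (v \<cdot> p \<boxplus> u \<cdot> q) \<cdot> j"
        using B d(2,3) zw ob k(3) u by (simp_all add: hom_iff)
    qed (use B d(1) k(3) u in \<open>simp_all add: hom_iff\<close>)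
  next
    fix T x y assume xy: "x \<in> Hom A T X" "y \<in> Hom A T I" "w \<cdot> u \<cdot> x = w \<cdot> y"
    have ux: "u \<cdot> x \<in> Hom A T I" using cmp_hom[OF xy(1) u] .
    have "w \<cdot> (u \<cdot> x) = w \<cdot> y" using xy(3) cmp_assoc[OF xy(1) u k(3)] by simp
    hence "w \<cdot> (y \<boxplus> Neg A (u \<cdot> x)) = Zer A T J"
      using xy k(3) ux hom_add_neg(1)[of "w \<cdot> y" T J] cmp_neg[OF ux k(3)] by (simp add: hom_simps)
    then obtain r where r: "r \<in> Hom A T I'" "v \<cdot> r = y \<boxplus> Neg A (u \<cdot> x)"
      using kernelE[OF k(1), of "y \<boxplus> Neg A (u \<cdot> x)" T] xy(2) ux k(2,3) by (auto simp: hom_iff)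
    note bi = biproduct_in[OF b r(1) xy(1)]
    have "(v \<cdot> p \<boxplus> u \<cdot> q) \<cdot> (i \<cdot> r \<boxplus> j \<cdot> x) = y"
      using app[OF bi(1)] bi(2,3) r(2) hom_diff_add[OF xy(2) ux] by simp
    thus "\<exists>U. U \<in> Hom A T B \<and> q \<cdot> U = x \<and> (v \<cdot> p \<boxplus> u \<cdot> q) \<cdot> U = y" using bi by blast
  next
    fix T U V assume UV: "U \<in> Hom A T B" "V \<in> Hom A T B" "q \<cdot> U = q \<cdot> V" "(v \<cdot> p \<boxplus> u \<cdot> q) \<cdot> U = (v \<cdot> p \<boxplus> u \<cdot> q) \<cdot> V"
    have h: "p \<cdot> U \<in> Hom A T I'" "p \<cdot> V \<in> Hom A T I'" "u \<cdot> (q \<cdot> V) \<in> Hom A T I"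
      "v \<cdot> (p \<cdot> U) \<in> Hom A T I" "v \<cdot> (p \<cdot> V) \<in> Hom A T I" using UV B k(2) u by (simp_all add: hom_iff)
    have "v \<cdot> (p \<cdot> U) = v \<cdot> (p \<cdot> V)" using app[OF UV(1)] app[OF UV(2)] UV(3,4) hom_add_cancel(2)[OF h(3,4,5)] by simp
    hence "p \<cdot> U = p \<cdot> V" using kernel_mono[OF k(1)] h(1,2) k(2) by (simp add: hom_iff)
    thus "U = V" using biproduct_in_ext[OF b UV(1,2)] UV(3) by blast
  qed
qed

text \<open>Over the projection to \<open>I\<close> the component in \<open>Z\<close> is free on
  both sides. The square serves to see that the sum of a deflation with an identity is a
  deflation.\<close>

lemma biproduct_pullback:
  assumes f: "f \<in> Hom A X I" and s: "is_biproduct A X Z S i1 i2 p1 p2" and b: "is_biproduct A I Z B i j p q"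
  shows "is_pullback A f p p1 ((i \<cdot> f) \<cdot> p1 \<boxplus> j \<cdot> p2)"
proof -
  note S = s[unfolded is_biproduct_def] and B = b[unfolded is_biproduct_def]
  define e where "e = (i \<cdot> f) \<cdot> p1 \<boxplus> j \<cdot> p2"
  have eh: "e \<in> Hom A S B" unfolding e_def using f S B by (simp add: hom_simps)
  have ex: "p \<cdot> (e \<cdot> x) = f \<cdot> (p1 \<cdot> x)" "q \<cdot> (e \<cdot> x) = p2 \<cdot> x" if x: "x \<in> Hom A T S" for x T
  proof -
    have "f \<cdot> (p1 \<cdot> x) \<in> Hom A T I" "p2 \<cdot> x \<in> Hom A T Z" using x f S by (simp_all add: hom_iff)
    note bi = biproduct_in[OF b this]
    have "e \<cdot> x = i \<cdot> (f \<cdot> (p1 \<cdot> x)) \<boxplus> j \<cdot> (p2 \<cdot> x)" unfolding e_def using x f S B by (simp add: hom_simps)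
    thus "p \<cdot> (e \<cdot> x) = f \<cdot> (p1 \<cdot> x)" "q \<cdot> (e \<cdot> x) = p2 \<cdot> x" using bi(2,3) by simp_all
  qed
  show ?thesis unfolding e_def[symmetric]
  proof (rule pullbackI[OF f _ _ eh])
    show "p \<in> Hom A B I" "p1 \<in> Hom A S X" using B S by blast+
    show "f \<cdot> p1 = p \<cdot> e" using ex(1)[OF id_hom] S eh by (simp add: hom_iff)
  next
    fix T x y assume xy: "x \<in> Hom A T X" "y \<in> Hom A T B" "f \<cdot> x = p \<cdot> y"
    have qy: "q \<cdot> y \<in> Hom A T Z" using B xy by (simp add: hom_iff)
    note bi = biproduct_in[OF s xy(1) qy]
    have "e \<cdot> (i1 \<cdot> x \<boxplus> i2 \<cdot> (q \<cdot> y)) = y"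
      by (rule biproduct_in_ext[OF b cmp_hom[OF bi(1) eh] xy(2)]) (use ex[OF bi(1)] bi(2,3) xy(3) in simp_all)
    thus "\<exists>U. U \<in> Hom A T S \<and> p1 \<cdot> U = x \<and> e \<cdot> U = y" using bi by blast
  next
    fix T U V assume UV: "U \<in> Hom A T S" "V \<in> Hom A T S" "p1 \<cdot> U = p1 \<cdot> V" "e \<cdot> U = e \<cdot> V"
    thus "U = V" using biproduct_in_ext[OF s UV(1-3)] ex(2)[OF UV(1)] ex(2)[OF UV(2)] by simp
  qed
qed

end

context preadditive_category
begin

interpretation op: preadditive_category "opp A" by (rule preadditive_opp) (rule preadditive_category_axioms)

lemmas pullback_of_kernel = op.pushout_of_cokernel[unfolded op_simps]
text \<open>The horseshoe lemma needs both directions: the pullback versions make the first half of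
  a factorization a deflation, these pushout versions make the second half an inflation.\<close>

lemmas cokernel_pushout = op.kernel_pullback[unfolded op_simps]
lemmas biproduct_pushout = op.biproduct_pullback[unfolded op_simps]

end

section \<open>First consequences of the axioms of an exact category\<close>

context exact_category
begin

lemma conf_hom: assumes "(f, g) \<in> Conf E" shows "f \<in> Ar E" "g \<in> Ar E" "Cod E f = Dom E g"
  using conf_kernel[OF assms] unfolding is_kernel_def by simp_all

lemma inflation_ar: "inflation E f \<Longrightarrow> f \<in> Ar E" and deflation_ar: "deflation E f \<Longrightarrow> f \<in> Ar E"
  unfolding inflation_def deflation_def using conf_hom by blast+

lemma inflation_mono: assumes "inflation E f" "u \<in> Hom E W (Dom E f)" "v \<in> Hom E W (Dom E f)" "f \<cdot> u = f \<cdot> v"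
  shows "u = v" using assms kernel_mono conf_kernel unfolding inflation_def by metis

lemma deflation_epi: assumes "deflation E g" "u \<in> Hom E (Cod E g) W" "v \<in> Hom E (Cod E g) W" "u \<cdot> g = v \<cdot> g"
  shows "u = v" using assms cokernel_epi conf_cokernel unfolding deflation_def by metis

text \<open>\<open>f\<close> belongs to some conflation; its deflation and \<open>g\<close> are both
  cokernels of \<open>f\<close>, so closure under isomorphism replaces one by the other.\<close>

lemma conf_if_cokernel: assumes "inflation E f" "is_cokernel E g f" shows "(f, g) \<in> Conf E"
proof -
  obtain g' where g': "(f, g') \<in> Conf E" using assms(1) unfolding inflation_def by blast
  note D = cokernelD[OF assms(2)] conf_hom[OF g']
  obtain u where u: "u \<in> Hom E (Cod E g') (Cod E g)" "is_iso E u" "u \<cdot> g' = g"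
    using cokernel_unique[OF conf_cokernel[OF g'] assms(2)] by blast
  show ?thesis by (rule conf_iso_closed[OF g', of _ _ "Idn E (Dom E f)" "Idn E (Cod E f)" u])
      (use D u in \<open>simp_all add: hom_iff is_iso_idn\<close>)
qed

lemma conf_if_kernel: assumes "deflation E g" "is_kernel E f g" shows "(f, g) \<in> Conf E"
proof -
  obtain f' where f': "(f', g) \<in> Conf E" using assms(1) unfolding deflation_def by blast
  note D = kernelD[OF assms(2)] conf_hom[OF f']
  obtain u where u: "u \<in> Hom E (Dom E f') (Dom E f)" "is_iso E u" "f \<cdot> u = f'"
    using kernel_unique[OF assms(2) conf_kernel[OF f']] by blast
  show ?thesis by (rule conf_iso_closed[OF f', of _ _ u "Idn E (Dom E g)" "Idn E (Cod E g)"])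
      (use D u in \<open>simp_all add: hom_iff is_iso_idn\<close>)
qed

lemma inflation_iso: assumes "inflation E f" "is_iso E u" "Dom E u = Cod E f" shows "inflation E (u \<cdot> f)"
proof -
  obtain g where g: "(f, g) \<in> Conf E" using assms(1) unfolding inflation_def by blast
  note D = conf_hom[OF g]
  have "u \<in> Ar E" using assms(2) unfolding is_iso_def by blast
  hence u: "u \<in> Hom E (Cod E f) (Cod E u)" using assms by (simp add: hom_iff)
  obtain v where v: "v \<in> Hom E (Cod E u) (Cod E f)" "v \<cdot> u = Idn E (Cod E f)" "u \<cdot> v = Idn E (Cod E u)"
    using isoE[OF assms(2) u] by metis
  have "(u \<cdot> f, g \<cdot> v) \<in> Conf E" by (rule conf_iso_closed[OF g, of _ _ "Idn E (Dom E f)" u "Idn E (Cod E g)"])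
      (use D u v assms in \<open>simp_all add: hom_iff assoc is_iso_idn\<close>)
  thus ?thesis unfolding inflation_def by blast
qed

lemma deflation_iso: assumes "deflation E g" "is_iso E u" "Cod E u = Dom E g" shows "deflation E (g \<cdot> u)"
proof -
  obtain f where f: "(f, g) \<in> Conf E" using assms(1) unfolding deflation_def by blast
  note D = conf_hom[OF f]
  have "u \<in> Ar E" using assms(2) unfolding is_iso_def by blast
  hence u: "u \<in> Hom E (Dom E u) (Dom E g)" using assms by (simp add: hom_iff)
  obtain v where v: "v \<in> Hom E (Dom E g) (Dom E u)" "v \<cdot> u = Idn E (Dom E u)" "u \<cdot> v = Idn E (Dom E g)"
      "is_iso E v" using iso_inverse[OF assms(2) u] by metis
  have "(v \<cdot> f, g \<cdot> u) \<in> Conf E" by (rule conf_iso_closed[OF f, of _ _ "Idn E (Dom E f)" v "Idn E (Cod E g)"])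
      (use D u v in \<open>simp_all add: hom_iff assoc is_iso_idn\<close>)
  thus ?thesis unfolding deflation_def by blast
qed

text \<open>The axiom speaks of some pushout; uniqueness up to isomorphism moves the conclusion to
  the given one.\<close>

lemma pushout_inflation: assumes "is_pushout E f g f' g'" "inflation E f" shows "inflation E g'"
proof -
  note D = pushoutD[OF assms(1)]
  obtain f1 g1 where 1: "is_pushout E f g f1 g1" "inflation E g1"
    using inflation_pushout[OF assms(2), of g] D by blast
  then obtain u where "u \<in> Hom E (Cod E f1) (Cod E f')" "is_iso E u" "u \<cdot> g1 = g'"
    using pushout_unique[OF 1(1) assms(1)] by metis
  thus ?thesis using inflation_iso[OF 1(2), of u] pushoutD[OF 1(1)] by (simp add: hom_iff)
qed

lemma pullback_deflation: assumes "is_pullback E f g f' g'" "deflation E f" shows "deflation E g'"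
proof -
  note D = pullbackD[OF assms(1)]
  obtain f1 g1 where 1: "is_pullback E f g f1 g1" "deflation E g1"
    using deflation_pullback[OF assms(2), of g] D by blast
  then obtain u where "u \<in> Hom E (Dom E f') (Dom E f1)" "is_iso E u" "g1 \<cdot> u = g'"
    using pullback_unique[OF 1(1) assms(1)] by metis
  thus ?thesis using deflation_iso[OF 1(2), of u] pullbackD[OF 1(1)] by (simp add: hom_iff)
qed

lemma admissibleE: assumes "admissible E f" "f \<in> Hom E X Y"
  obtains I m p where "inflation E m" "deflation E p" "p \<in> Hom E X I" "m \<in> Hom E I Y" "f = m \<cdot> p"
proof -
  obtain m p where "inflation E m" "deflation E p" "Cod E p = Dom E m" "f = m \<cdot> p"
    using assms(1) unfolding admissible_def by blast
  thus ?thesis using that[of m p "Dom E m"] assms(2) inflation_ar[of m] deflation_ar[of p]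
    by (auto simp: hom_iff)
qed

lemma admissibleI: assumes "inflation E m" "deflation E p" "Cod E p = Dom E m" shows "admissible E (m \<cdot> p)"
  using assms unfolding admissible_def by blast

text \<open>Think of \<open>f\<close> as the triangular matrix with diagonal \<open>f'\<close>,
  \<open>f''\<close> and corner \<open>h\<close>. The equation
  \<open>h \<cdot> k = f' \<cdot> t\<close> lets the images \<open>I'\<close> and \<open>I''\<close>
  of the diagonal entries be glued to an extension \<open>I\<close>, through which \<open>f\<close>
  factors as a deflation followed by an inflation. For the second claim the cokernels are followed
  along the same factorization: \<open>a\<close> becomes a pushout of an inflation and
  \<open>b\<close> its cokernel.\<close>

lemma horseshoe_admissible: assumes adm: "admissible E f'" "admissible E f''"
    and hom: "f' \<in> Hom E X' Y'" "f'' \<in> Hom E X'' Y''" "h \<in> Hom E X'' Y'"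
    and bX: "is_biproduct E X' X'' SX i1 i2 p1 p2" and bY: "is_biproduct E Y' Y'' SY j1 j2 q1 q2"
    and k: "is_kernel E k f''" and t: "t \<in> Hom E (Dom E k) X'" "h \<cdot> k = f' \<cdot> t"
    and f: "f \<in> Hom E SX SY" "f \<cdot> i1 = j1 \<cdot> f'" "f \<cdot> i2 = j1 \<cdot> h \<boxplus> j2 \<cdot> f''"
    and c': "is_cokernel E c' f'" and c'': "is_cokernel E c'' f''" shows "admissible E f"
    and "\<lbrakk>is_cokernel E c f; a \<in> Hom E (Cod E c') (Cod E c); a \<cdot> c' = c \<cdot> j1;
          b \<in> Hom E (Cod E c) (Cod E c''); b \<cdot> c = c'' \<cdot> q2\<rbrakk> \<Longrightarrow> (a, b) \<in> Conf E"
proof -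
  obtain I' m' p' where f': "inflation E m'" "deflation E p'" "p' \<in> Hom E X' I'" "m' \<in> Hom E I' Y'"
      "f' = m' \<cdot> p'" using admissibleE[OF adm(1) hom(1)] by blast
  obtain I'' m'' p'' where f'': "inflation E m''" "deflation E p''" "p'' \<in> Hom E X'' I''"
      "m'' \<in> Hom E I'' Y''" "f'' = m'' \<cdot> p''" using admissibleE[OF adm(2) hom(2)] by blast
  note BX = bX[unfolded is_biproduct_def] note BY = bY[unfolded is_biproduct_def]
  \<comment> \<open>Pushouts are provided along inflations, so the given kernel \<open>k\<close> is
    replaced by the inflation \<open>k0\<close> paired with \<open>p''\<close>; it factors through
    \<open>k\<close> because \<open>f''\<close> kills it.\<close>
  obtain k0 where k0: "(k0, p'') \<in> Conf E" using f''(2) unfolding deflation_def by blast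
  note K0 = conf_hom[OF k0] note kk0 = kernelD(4)[OF conf_kernel[OF k0]]
  define A where "A = Dom E k0"
  have k0_hom: "k0 \<in> Hom E A X''" using K0 f''(3) by (simp add: hom_iff A_def)
  have AO: "A \<in> Ob E" using hom_ob[OF k0_hom] by blast
  have pk0: "p'' \<cdot> k0 = Zer E A I''" using kk0 f''(3) by (simp add: hom_iff A_def)
  have obs: "X' \<in> Ob E" "X'' \<in> Ob E" "Y' \<in> Ob E" "Y'' \<in> Ob E" "I' \<in> Ob E" "I'' \<in> Ob E"
    using hom_ob[OF hom(1)] hom_ob[OF hom(2)] hom_ob[OF f'(3)] hom_ob[OF f''(3)] by auto
  note KD = kernelD[OF k]
  have k_hom: "k \<in> Hom E (Dom E k) X''" using KD hom(2) by (simp add: hom_iff)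
  have "f'' \<cdot> k0 = m'' \<cdot> (p'' \<cdot> k0)" using k0_hom f''(3-5) by (simp add: hom_iff assoc)
  hence "f'' \<cdot> k0 = Zer E A Y''" using pk0 f''(4) AO by (simp add: hom_iff)
  then obtain s where s: "s \<in> Hom E A (Dom E k)" "k \<cdot> s = k0"
    using kernelE[OF k, of k0 A] k0_hom hom(2) by (auto simp: hom_iff)
  \<comment> \<open>Chosen so that \<open>h \<cdot> k0 = m' \<cdot> t0\<close>: the corner
    \<open>h\<close> sends the kernel of \<open>f''\<close> into the image \<open>I'\<close> of
    \<open>f'\<close>.\<close>
  define t0 where "t0 = p' \<cdot> (t \<cdot> s)"
  have t0: "t0 \<in> Hom E A I'" using s t(1) f'(3) by (simp add: hom_iff t0_def)
  have hk0: "h \<cdot> k0 = m' \<cdot> t0"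
  proof -
    have "h \<cdot> k0 = (h \<cdot> k) \<cdot> s" using hom(3) k_hom s(1) by (simp add: hom_iff assoc flip: s(2))
    also have "\<dots> = m' \<cdot> t0" unfolding t(2) t0_def f'(5) using f'(3,4) t(1) s(1) by (simp add: hom_iff assoc)
    finally show ?thesis .
  qed
  have "inflation E k0" using k0 unfolding inflation_def by blast
  \<comment> \<open>The image of \<open>f\<close>: pushing out \<open>k0\<close> along
    \<open>t0\<close> gives an extension \<open>I\<close> of \<open>I''\<close> by
    \<open>I'\<close>. The induced arrows \<open>w\<close> and \<open>kk\<close> lead from
    \<open>I\<close> to \<open>I''\<close> and to \<open>Y'\<close>.\<close>
  then obtain u v where po: "is_pushout E k0 t0 u v" "inflation E v"
    using inflation_pushout[of k0 t0] k0_hom t0 by (auto simp: hom_iff)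
  define I where "I = Cod E u"
  note PO = pushoutD[OF po(1)]
  have uv: "u \<in> Hom E X'' I" "v \<in> Hom E I' I" "u \<cdot> k0 = v \<cdot> t0"
    using PO k0_hom t0 by (simp_all add: hom_iff I_def)
  have IO: "I \<in> Ob E" using hom_ob[OF uv(1)] by blast
  obtain w where w: "w \<in> Hom E I I''" "w \<cdot> u = p''" "w \<cdot> v = Zer E I' I''"
    using pushoutE[OF po(1), of p'' I'' "Zer E I' I''"] f''(3) k0_hom pk0 t0 obs by (auto simp: hom_iff I_def)
  obtain kk where kk: "kk \<in> Hom E I Y'" "kk \<cdot> u = h" "kk \<cdot> v = m'"
    using pushoutE[OF po(1), of h Y' m'] hom(3) k0_hom t0 hk0 f'(4) by (auto simp: hom_iff I_def)
  \<comment> \<open>The pushout has the same cokernel as \<open>k0\<close>, namely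
    \<open>p''\<close>; so \<open>v\<close> and \<open>w\<close> form a conflation with ends
    \<open>I'\<close> and \<open>I''\<close>.\<close>
  have "is_cokernel E w v" by (rule pushout_cokernel[OF po(1) conf_cokernel[OF k0]])
      (use w f''(3) t0 in \<open>simp_all add: hom_iff I_def\<close>)
  with po(2) have vw: "(v, w) \<in> Conf E" using conf_if_cokernel by blast
  hence defw: "deflation E w" unfolding deflation_def by blast
  note kerw = conf_kernel[OF vw] and cokv = conf_cokernel[OF vw]

  \<comment> \<open>The deflation \<open>SX \<rightarrow> I\<close> goes through \<open>B1\<close>,
    the sum of \<open>I'\<close> and \<open>X''\<close>: \<open>e1\<close> is a pullback of
    \<open>p'\<close> and \<open>d1\<close> one of \<open>p''\<close>.\<close>
  obtain B1 i j p q where b1: "is_biproduct E I' X'' B1 i j p q" using has_biproducts obs by metis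
  note B1 = b1[unfolded is_biproduct_def]
  define d1 where "d1 = v \<cdot> p \<boxplus> u \<cdot> q"
  have d1: "d1 \<in> Hom E B1 I" "d1 \<cdot> i = v" "d1 \<cdot> j = u"
    unfolding d1_def using biproduct_out[OF b1 uv(2,1)] by blast+
  have "is_pullback E p'' w q d1" using kernel_pullback[OF kerw uv(2) w(1) uv(1) b1] unfolding w(2) d1_def .
  hence defd1: "deflation E d1" using pullback_deflation f''(2) by blast

  define e1 where "e1 = (i \<cdot> p') \<cdot> p1 \<boxplus> j \<cdot> p2"
  have ip': "i \<cdot> p' \<in> Hom E X' B1" "j \<in> Hom E X'' B1" using f'(3) B1 by (auto simp: hom_iff)
  note e1 = biproduct_out[OF bX ip', folded e1_def]
  have "is_pullback E p' p p1 e1" unfolding e1_def by (rule biproduct_pullback[OF f'(3) bX b1])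
  hence defe1: "deflation E e1" using pullback_deflation f'(2) by blast
  define d where "d = d1 \<cdot> e1"
  have defd: "deflation E d" unfolding d_def using deflation_cmp[OF defe1 defd1] e1 d1 by (simp add: hom_iff)
  have d: "d \<in> Hom E SX I" using d1 e1 by (simp add: hom_iff d_def)

  \<comment> \<open>The inflation \<open>I \<rightarrow> SY\<close> goes through \<open>B2\<close>,
    the sum of \<open>I''\<close> and \<open>Y'\<close>: \<open>a1\<close> is a pushout of
    \<open>m'\<close> and \<open>b1\<close> one of \<open>m''\<close>.\<close>
  obtain B2 x1 x2 y1 y2 where b2: "is_biproduct E I'' Y' B2 x2 x1 y2 y1" using has_biproducts obs by metis
  note B2 = b2[unfolded is_biproduct_def]
  define a1 where "a1 = x2 \<cdot> w \<boxplus> x1 \<cdot> kk"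
  have a1: "a1 \<in> Hom E I B2" unfolding a1_def using biproduct_in(1)[OF b2 w(1) kk(1)] .
  have po_a1: "is_pushout E m' v x1 a1"
    using cokernel_pushout[OF cokv w(1) uv(2) kk(1) b2] unfolding kk(3) a1_def .
  hence infa1: "inflation E a1" using pushout_inflation f'(1) by blast

  define b1 where "b1 = (j2 \<cdot> m'') \<cdot> y2 \<boxplus> j1 \<cdot> y1"
  have jm: "j2 \<cdot> m'' \<in> Hom E I'' SY" "j1 \<in> Hom E Y' SY" using f''(4) BY by (auto simp: hom_iff)
  note b1 = biproduct_out(1)[OF b2 jm, folded b1_def] and b1x = biproduct_out(3,2)[OF b2 jm, folded b1_def]
  have "j2 \<cdot> (m'' \<cdot> y2) = (j2 \<cdot> m'') \<cdot> y2" using f''(4) BY B2 by (simp add: hom_iff assoc)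
  hence po_b1: "is_pushout E m'' x2 j2 b1"
    unfolding b1_def using biproduct_pushout[OF f''(4) biproduct_swap[OF bY] b2] by simp
  hence infb1: "inflation E b1" using pushout_inflation f''(1) by blast
  define m where "m = b1 \<cdot> a1"
  have infm: "inflation E m" unfolding m_def using inflation_cmp[OF infa1 infb1] a1 b1 by (simp add: hom_iff)
  have m: "m \<in> Hom E I SY" using a1 b1 by (simp add: hom_iff m_def)
  have di: "d \<cdot> i1 = v \<cdot> p'" "d \<cdot> i2 = u"
    unfolding d_def using cmp_assoc[OF _ e1(1) d1(1)] e1(2,3) d1(2,3) BX cmp_assoc[OF f'(3) _ d1(1)] B1 by metis+
  have mv: "m \<cdot> v = j1 \<cdot> m'"
    unfolding m_def using cmp_assoc[OF uv(2) a1 b1] pushoutD(9)[OF po_a1] cmp_assoc[OF f'(4) _ b1, of x1] B2 b1x(1) by simp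
  have mu: "m \<cdot> u = j1 \<cdot> h \<boxplus> j2 \<cdot> f''"
  proof -
    have "a1 \<cdot> u = x2 \<cdot> p'' \<boxplus> x1 \<cdot> h"
      unfolding a1_def using B2 w(1) kk(1) uv(1) by (simp add: hom_simps w(2) kk(2))
    moreover have "b1 \<cdot> (x2 \<cdot> p'' \<boxplus> x1 \<cdot> h) = (b1 \<cdot> x2) \<cdot> p'' \<boxplus> (b1 \<cdot> x1) \<cdot> h"
      using B2 b1 f''(3) hom(3) by (simp add: hom_simps)
    ultimately have "m \<cdot> u = (j2 \<cdot> m'') \<cdot> p'' \<boxplus> j1 \<cdot> h" unfolding m_def using cmp_assoc[OF uv(1) a1 b1] b1x by simp
    also have "(j2 \<cdot> m'') \<cdot> p'' = j2 \<cdot> f''" unfolding f''(5) using cmp_assoc[OF f''(3,4)] BY by blast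
    finally show ?thesis using hom_add_comm[of "j2 \<cdot> f''" X'' SY "j1 \<cdot> h"] BY hom by (simp add: hom_iff)
  qed
  \<comment> \<open>Both sides have the same columns: \<open>j1 \<cdot> f'\<close> on the first
    summand and \<open>j1 \<cdot> h \<boxplus> j2 \<cdot> f''\<close> on the second.\<close>
  have fmd: "f = m \<cdot> d"
  proof (rule biproduct_out_ext[OF bX f(1)])
    show "m \<cdot> d \<in> Hom E SX SY" using m d cmp_hom by blast
    have "m \<cdot> d \<cdot> i1 = m \<cdot> (d \<cdot> i1)" "m \<cdot> d \<cdot> i2 = m \<cdot> (d \<cdot> i2)" "m \<cdot> (v \<cdot> p') = (m \<cdot> v) \<cdot> p'" "(j1 \<cdot> m') \<cdot> p' = j1 \<cdot> f'"
      using m d uv(2) f'(3-5) jm BX by (simp_all add: hom_iff assoc)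
    thus "f \<cdot> i1 = m \<cdot> d \<cdot> i1" "f \<cdot> i2 = m \<cdot> d \<cdot> i2" using f(2,3) di mv mu by simp_all
  qed
  show "admissible E f" unfolding fmd using admissibleI[OF infm defd] m d by (simp add: hom_iff)

  assume c: "is_cokernel E c f" and a: "a \<in> Hom E (Cod E c') (Cod E c)" "a \<cdot> c' = c \<cdot> j1"
    and b: "b \<in> Hom E (Cod E c) (Cod E c'')" "b \<cdot> c = c'' \<cdot> q2"
  \<comment> \<open>Cancelling the deflation parts turns all three cokernels into cokernels of
    inflations: of \<open>m\<close>, \<open>m'\<close> and \<open>m''\<close>.\<close>
  have cm: "is_cokernel E c m"
    using c fmd cokernel_cmp_epi[OF d m] deflation_epi[OF defd] d by (auto simp: hom_iff)
  have cm': "is_cokernel E c' m'"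
    using c' f'(5) cokernel_cmp_epi[OF f'(3,4)] deflation_epi[OF f'(2)] f'(3) by (auto simp: hom_iff)
  have cm'': "is_cokernel E c'' m''"
    using c'' f''(5) cokernel_cmp_epi[OF f''(3,4)] deflation_epi[OF f''(2)] f''(3) by (auto simp: hom_iff)
  define C where "C = Cod E c" define C' where "C' = Cod E c'" define C'' where "C'' = Cod E c''"
  have ch: "c \<in> Hom E SY C" "c' \<in> Hom E Y' C'" "c'' \<in> Hom E Y'' C''"
    using cokernelD[OF cm] cokernelD[OF cm'] cokernelD[OF cm''] m f'(4) f''(4)
    by (simp_all add: hom_iff C_def C'_def C''_def)
  have CO: "C \<in> Ob E" "C' \<in> Ob E" "C'' \<in> Ob E" using hom_ob ch by blast+
  have ah: "a \<in> Hom E C' C" and bh: "b \<in> Hom E C C''" using a b by (simp_all add: C_def C'_def C''_def)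
  have cm0: "c \<cdot> m = Zer E I C" using cokernelD(4)[OF cm] m by (simp add: hom_iff C_def)
  have cm0': "c' \<cdot> m' = Zer E I' C'" using cokernelD(4)[OF cm'] f'(4) by (simp add: hom_iff C'_def)
  have cm0'': "c'' \<cdot> m'' = Zer E I'' C''" using cokernelD(4)[OF cm''] f''(4) by (simp add: hom_iff C''_def)
  \<comment> \<open>As \<open>a1\<close> is a pushout of \<open>m'\<close>, its cokernel is that of
    \<open>m'\<close>: the arrow \<open>z\<close> to \<open>C'\<close>.\<close>
  obtain z where z: "z \<in> Hom E B2 C'" "z \<cdot> x1 = c'" "z \<cdot> a1 = Zer E I C'"
    using pushoutE[OF po_a1, of c' C' "Zer E I C'"] ch(2) cm0' f'(4) uv(2) B2 CO IO by (auto simp: hom_iff)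
  have cokz: "is_cokernel E z a1"
    by (rule pushout_cokernel[OF po_a1 cm']) (use z B2 uv(2) in \<open>simp_all add: hom_iff C'_def\<close>)
  obtain a2 where a2: "a2 \<in> Hom E C' C" "a2 \<cdot> z = c \<cdot> b1"
  proof -
    have "c \<cdot> b1 \<cdot> a1 = Zer E I C" using cm0 ch(1) b1 a1 by (simp add: hom_iff assoc m_def)
    thus ?thesis using that cokernelE[OF cokz, of "c \<cdot> b1" C] ch(1) b1 a1 z(1) by (auto simp: hom_iff)
  qed
  \<comment> \<open>\<open>a\<close> is given only through \<open>c'\<close>; cancelling
    \<open>c'\<close> identifies it with the arrow induced on the cokernel \<open>z\<close> of
    \<open>a1\<close>.\<close>
  have "a2 \<cdot> c' = a \<cdot> c'"
  proof -
    have "a2 \<cdot> c' = (a2 \<cdot> z) \<cdot> x1" using a2(1) z(1) B2 by (simp add: hom_iff assoc flip: z(2))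
    also have "\<dots> = c \<cdot> (b1 \<cdot> x1)" unfolding a2(2) using ch(1) b1 B2 by (simp add: hom_iff assoc)
    finally show ?thesis using b1x a(2) by simp
  qed
  hence "a2 = a" using cokernel_epi[OF cm', of a2 C a] a2(1) ah by (simp add: C'_def)
  hence az: "a \<cdot> z = c \<cdot> b1" using a2 by simp
  \<comment> \<open>\<open>c\<close> is a cokernel of \<open>m = b1 \<cdot> a1\<close> and
    \<open>z\<close> one of \<open>a1\<close>; hence \<open>a\<close> is the pushout of
    \<open>b1\<close> along \<open>z\<close>, in particular an inflation.\<close>
  have po_a: "is_pushout E b1 z c a"
  proof (rule pushoutI[OF b1 z(1) ch(1) ah az[symmetric]])
    fix T x y assume xy: "x \<in> Hom E SY T" "y \<in> Hom E C' T" "x \<cdot> b1 = y \<cdot> z"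
    have "x \<cdot> m = (x \<cdot> b1) \<cdot> a1" unfolding m_def using xy(1) b1 a1 by (simp add: hom_iff assoc)
    also have "\<dots> = y \<cdot> (z \<cdot> a1)" unfolding xy(3) using xy(2) z(1) a1 by (simp add: hom_iff assoc)
    also have "\<dots> = Zer E I T" unfolding z(3) using xy IO by (simp add: hom_iff)
    finally obtain U where U: "U \<in> Hom E C T" "U \<cdot> c = x"
      using cokernelE[OF cm, of x T] xy(1) m by (auto simp: hom_iff C_def)
    have "(U \<cdot> a) \<cdot> z = (U \<cdot> c) \<cdot> b1" using U(1) ah z(1) ch(1) b1 by (simp add: hom_iff assoc az)
    hence "(U \<cdot> a) \<cdot> z = y \<cdot> z" using U(2) xy(3) by simp
    hence "U \<cdot> a = y" using cokernel_epi[OF cokz, of "U \<cdot> a" T y] U(1) ah z(1) xy(2) by (simp add: hom_iff)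
    thus "\<exists>U. U \<in> Hom E C T \<and> U \<cdot> c = x \<and> U \<cdot> a = y" using U by blast
  next
    fix T U V assume "U \<in> Hom E C T" "V \<in> Hom E C T" "U \<cdot> c = V \<cdot> c"
    thus "U = V" using cokernel_epi[OF cm, of U T V] by (simp add: C_def)
  qed
  have infa: "inflation E a" using pushout_inflation[OF po_a infb1] .
  \<comment> \<open>In the same way \<open>b1\<close> has the cokernel \<open>C''\<close> of
    \<open>m''\<close>, and the pushout along \<open>z\<close> preserves it; this identifies
    \<open>b\<close> as a cokernel of \<open>a\<close>.\<close>
  obtain c2 where c2: "c2 \<in> Hom E SY C''" "c2 \<cdot> j2 = c''" "c2 \<cdot> b1 = Zer E B2 C''"
    using pushoutE[OF po_b1, of c'' C'' "Zer E B2 C''"] ch(3) cm0'' f''(4) B2 BY CO by (auto simp: hom_iff)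
  have cb: "c'' \<cdot> q2 = c2"
  proof (rule biproduct_out_ext[OF bY, of _ C''])
    have "c2 \<cdot> j1 = (c2 \<cdot> b1) \<cdot> x1" using c2(1) b1 B2 by (simp add: hom_iff assoc flip: b1x(1))
    hence 1: "c2 \<cdot> j1 = Zer E Y' C''" unfolding c2(3) using B2 CO by (simp add: hom_iff)
    have "c'' \<cdot> q2 \<cdot> j1 = c'' \<cdot> (q2 \<cdot> j1)" "c'' \<cdot> q2 \<cdot> j2 = c'' \<cdot> (q2 \<cdot> j2)"
      using ch(3) BY by (simp_all add: hom_iff assoc)
    thus "c'' \<cdot> q2 \<cdot> j1 = c2 \<cdot> j1" "c'' \<cdot> q2 \<cdot> j2 = c2 \<cdot> j2"
      unfolding 1 c2(2) using BY ch(3) obs by (simp_all add: hom_iff)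
  qed (use ch(3) BY c2(1) in \<open>simp_all add: hom_iff\<close>)
  have cokc2: "is_cokernel E c2 b1"
    by (rule pushout_cokernel[OF po_b1 cm'']) (use c2 B2 BY in \<open>simp_all add: hom_iff C''_def\<close>)
  have "is_cokernel E b a"
  proof (rule pushout_cokernel[OF po_a cokc2])
    show "b \<in> Hom E (Cod E c) (Cod E c2)" using bh c2(1) ch(1) by (simp add: hom_iff)
    show "b \<cdot> c = c2" using b(2) cb by simp
    have "b \<cdot> a \<cdot> z = (b \<cdot> c) \<cdot> b1" using bh ah z(1) ch(1) b1 by (simp add: hom_iff assoc az)
    also have "\<dots> = Zer E B2 C''" using b(2) cb c2(3) by simp
    also have "\<dots> = Zer E C' C'' \<cdot> z" using z(1) CO by (simp add: hom_iff)
    finally have e: "b \<cdot> a \<cdot> z = Zer E C' C'' \<cdot> z" .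
    have "b \<cdot> a = Zer E C' C''"
      by (rule cokernel_epi[OF cokz _ _ e]) (use z(1) ah bh CO in \<open>simp_all add: hom_iff\<close>)
    thus "b \<cdot> a = Zer E (Cod E z) (Cod E c2)" using z(1) c2(1) by (simp add: hom_iff)
  qed
  thus "(a, b) \<in> Conf E" using conf_if_cokernel[OF infa] by blast
qed

end

section \<open>Categories of functors\<close>

lemma functor_dom_cat: "is_functor C D F \<Longrightarrow> category C" and functor_cod_cat: "is_functor C D F \<Longrightarrow> category D"
  and functor_ob: "\<lbrakk>is_functor C D F; X \<in> Ob C\<rbrakk> \<Longrightarrow> Fob F X \<in> Ob D"
  and functor_hom: "\<lbrakk>is_functor C D F; f \<in> Hom C X Y\<rbrakk> \<Longrightarrow> Far F f \<in> Hom D (Fob F X) (Fob F Y)"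
  and functor_idn: "\<lbrakk>is_functor C D F; X \<in> Ob C\<rbrakk> \<Longrightarrow> Far F (Idn C X) = Idn D (Fob F X)"
  and functor_cmp: "\<lbrakk>is_functor C D F; f \<in> Hom C X Y; g \<in> Hom C Y Z\<rbrakk> \<Longrightarrow>
      Far F (g \<cdot>[C] f) = Far F g \<cdot>[D] Far F f"
  and functor_extensional: "is_functor C D F \<Longrightarrow> Fob F \<in> extensional (Ob C)"
    "is_functor C D F \<Longrightarrow> Far F \<in> extensional (Ar C)" unfolding is_functor_def by (auto simp: hom_iff PiE_def)

lemma functorI: assumes "category C" "category D" "Fob F \<in> extensional (Ob C)" "Far F \<in> extensional (Ar C)"
    "\<And>X. X \<in> Ob C \<Longrightarrow> Fob F X \<in> Ob D" "\<And>f X Y. f \<in> Hom C X Y \<Longrightarrow> Far F f \<in> Hom D (Fob F X) (Fob F Y)"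
    "\<And>X. X \<in> Ob C \<Longrightarrow> Far F (Idn C X) = Idn D (Fob F X)"
    "\<And>f g X Y Z. \<lbrakk>f \<in> Hom C X Y; g \<in> Hom C Y Z\<rbrakk> \<Longrightarrow> Far F (g \<cdot>[C] f) = Far F g \<cdot>[D] Far F f"
  shows "is_functor C D F"
proof -
  have "Far F f \<in> Hom D (Fob F (Dom C f)) (Fob F (Cod C f))" if "f \<in> Ar C" for f
    using assms(6)[of f "Dom C f" "Cod C f"] that by (simp add: hom_iff)
  moreover have "Far F (g \<cdot>[C] f) = Far F g \<cdot>[D] Far F f" if "f \<in> Ar C" "g \<in> Ar C" "Cod C f = Dom C g" for f g
    using assms(8)[of f "Dom C f" "Cod C f" g "Cod C g"] that by (simp add: hom_iff)
  ultimately show ?thesis unfolding is_functor_def using assms(1-5,7) by (auto simp: hom_iff PiE_def)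
qed

lemma ftr_eqI: "\<lbrakk>Fob F = Fob G; Far F = Far G\<rbrakk> \<Longrightarrow> F = (G :: ('o, 'm, 'p, 'n) ftr)" by (cases F; cases G) simp

lemma functor_eqI: assumes "is_functor C D F" "is_functor C D G" "\<And>X. X \<in> Ob C \<Longrightarrow> Fob F X = Fob G X"
    "\<And>f. f \<in> Ar C \<Longrightarrow> Far F f = Far G f" shows "F = G" by (rule ftr_eqI; rule extensionalityI)
    (use assms functor_extensional[OF assms(1)] functor_extensional[OF assms(2)] in auto)

lemma nt_src: "is_nt C D \<eta> \<Longrightarrow> is_functor C D (src \<eta>)" and nt_tgt: "is_nt C D \<eta> \<Longrightarrow> is_functor C D (tgt \<eta>)"
  and nt_hom: "\<lbrakk>is_nt C D \<eta>; X \<in> Ob C\<rbrakk> \<Longrightarrow> at \<eta> X \<in> Hom D (Fob (src \<eta>) X) (Fob (tgt \<eta>) X)"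
  and nt_natural: "\<lbrakk>is_nt C D \<eta>; f \<in> Hom C X Y\<rbrakk> \<Longrightarrow>
    at \<eta> Y \<cdot>[D] Far (src \<eta>) f = Far (tgt \<eta>) f \<cdot>[D] at \<eta> X"
  and nt_extensional: "is_nt C D \<eta> \<Longrightarrow> at \<eta> \<in> extensional (Ob C)"
  unfolding is_nt_def by (auto simp: hom_iff PiE_def)

lemma ntI: assumes "is_functor C D (src \<eta>)" "is_functor C D (tgt \<eta>)" "at \<eta> \<in> extensional (Ob C)"
    "\<And>X. X \<in> Ob C \<Longrightarrow> at \<eta> X \<in> Hom D (Fob (src \<eta>) X) (Fob (tgt \<eta>) X)"
    "\<And>f X Y. f \<in> Hom C X Y \<Longrightarrow> at \<eta> Y \<cdot>[D] Far (src \<eta>) f = Far (tgt \<eta>) f \<cdot>[D] at \<eta> X" shows "is_nt C D \<eta>"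
  using assms(1-4) assms(5)[of _ "Dom C _" "Cod C _"] unfolding is_nt_def by (auto simp: hom_iff PiE_def)

lemma nt_eqI: assumes "src \<eta> = src \<nu>" "tgt \<eta> = tgt \<nu>" "at \<eta> \<in> extensional S" "at \<nu> \<in> extensional S"
    "\<And>X. X \<in> S \<Longrightarrow> at \<eta> X = at \<nu> X" shows "\<eta> = (\<nu> :: ('o, 'm, 'p, 'n) nt)"
  using assms(1,2) extensionalityI[OF assms(3,4)] assms(5) by (cases \<eta>; cases \<nu>) auto

lemma Fun_simps: "Ob (Fun C D) = {F. is_functor C D F}" "Ar (Fun C D) = {\<eta>. is_nt C D \<eta>}"
  "Dom (Fun C D) = src" "Cod (Fun C D) = tgt"
  "Idn (Fun C D) F = \<lparr>src = F, tgt = F, at = (\<lambda>X\<in>Ob C. Idn D (Fob F X))\<rparr>"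
  "\<nu> \<cdot>[Fun C D] \<eta> = \<lparr>src = src \<eta>, tgt = tgt \<nu>, at = (\<lambda>X\<in>Ob C. at \<nu> X \<cdot>[D] at \<eta> X)\<rparr>" by (simp_all add: Fun_def)

lemma Hom_Fun: "\<eta> \<in> Hom (Fun C D) F G \<longleftrightarrow> is_nt C D \<eta> \<and> src \<eta> = F \<and> tgt \<eta> = G" by (simp add: hom_iff Fun_simps)

lemma category_Fun: assumes "category C" "category D" shows "category (Fun C D)"
proof -
  interpret C: category C by fact interpret D: category D by fact
  show ?thesis
  proof
    fix F assume "F \<in> Ob (Fun C D)"
    hence F: "is_functor C D F" by (simp add: Fun_simps)
    show "Idn (Fun C D) F \<in> Hom (Fun C D) F F" unfolding Hom_Fun
    proof (intro conjI ntI)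
      fix f X Y assume f: "f \<in> Hom C X Y"
      from functor_hom[OF F f] C.hom_ob[OF f] functor_ob[OF F]
      show "at (Idn (Fun C D) F) Y \<cdot>[D] Far (src (Idn (Fun C D) F)) f =
          Far (tgt (Idn (Fun C D) F)) f \<cdot>[D] at (Idn (Fun C D) F) X"
        by (simp add: Fun_simps D.cmp_id_left D.cmp_id_right)
    qed (use F functor_ob[OF F] in \<open>simp_all add: Fun_simps D.id_hom\<close>)
  next
    fix \<eta> \<nu> F G H assume "\<eta> \<in> Hom (Fun C D) F G" "\<nu> \<in> Hom (Fun C D) G H"
    hence n: "is_nt C D \<eta>" "is_nt C D \<nu>" and [simp]: "src \<eta> = F" "tgt \<eta> = G" "src \<nu> = G" "tgt \<nu> = H"
      by (auto simp: Hom_Fun)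
    note hs = nt_hom[OF n(1), simplified] nt_hom[OF n(2), simplified]
    show "\<nu> \<cdot>[Fun C D] \<eta> \<in> Hom (Fun C D) F H" unfolding Hom_Fun
    proof (intro conjI ntI)
      fix f X Y assume f: "f \<in> Hom C X Y"
      note fs = functor_hom[OF nt_src[OF n(1)] f] functor_hom[OF nt_src[OF n(2)] f]
        functor_hom[OF nt_tgt[OF n(2)] f]
      have ob: "X \<in> Ob C" "Y \<in> Ob C" using C.hom_ob[OF f] .
      have "at \<nu> Y \<cdot>[D] at \<eta> Y \<cdot>[D] Far F f = at \<nu> Y \<cdot>[D] (at \<eta> Y \<cdot>[D] Far F f)"
        using fs hs ob by (simp add: hom_iff D.assoc)
      also have "\<dots> = (at \<nu> Y \<cdot>[D] Far G f) \<cdot>[D] at \<eta> X"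
        using nt_natural[OF n(1) f] fs hs ob by (simp add: hom_iff D.assoc)
      also have "\<dots> = Far H f \<cdot>[D] (at \<nu> X \<cdot>[D] at \<eta> X)"
        unfolding nt_natural[OF n(2) f, simplified] using fs hs ob by (simp add: hom_iff D.assoc)
      finally show "at (\<nu> \<cdot>[Fun C D] \<eta>) Y \<cdot>[D] Far (src (\<nu> \<cdot>[Fun C D] \<eta>)) f =
          Far (tgt (\<nu> \<cdot>[Fun C D] \<eta>)) f \<cdot>[D] at (\<nu> \<cdot>[Fun C D] \<eta>) X" using ob by (simp add: Fun_simps)
    qed (use n hs nt_src[OF n(1)] nt_tgt[OF n(2)] in \<open>auto simp add: Fun_simps intro: D.cmp_hom\<close>)
  next
    fix \<eta> F G assume "\<eta> \<in> Hom (Fun C D) F G"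
    hence n: "is_nt C D \<eta>" and [simp]: "src \<eta> = F" "tgt \<eta> = G" by (auto simp: Hom_Fun)
    note hs = nt_hom[OF n(1), simplified]
    show "Idn (Fun C D) G \<cdot>[Fun C D] \<eta> = \<eta>" "\<eta> \<cdot>[Fun C D] Idn (Fun C D) F = \<eta>"
      by (rule nt_eqI[of _ _ "Ob C"]; use hs nt_extensional[OF n] in
          \<open>auto simp: Fun_simps intro: D.cmp_id_left D.cmp_id_right\<close>)+
  next
    fix \<eta> \<nu> \<mu> F G H K
    assume "\<eta> \<in> Hom (Fun C D) F G" "\<nu> \<in> Hom (Fun C D) G H" "\<mu> \<in> Hom (Fun C D) H K"
    hence n: "is_nt C D \<eta>" "is_nt C D \<nu>" "is_nt C D \<mu>"
      and [simp]: "src \<eta> = F" "tgt \<eta> = G" "src \<nu> = G" "tgt \<nu> = H" "src \<mu> = H" "tgt \<mu> = K"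
      by (auto simp: Hom_Fun)
    note hs = nt_hom[OF n(1), simplified] nt_hom[OF n(2), simplified] nt_hom[OF n(3), simplified]
    show "\<mu> \<cdot>[Fun C D] \<nu> \<cdot>[Fun C D] \<eta> = \<mu> \<cdot>[Fun C D] (\<nu> \<cdot>[Fun C D] \<eta>)"
      by (rule nt_eqI[of _ _ "Ob C"]; use hs in \<open>auto simp: Fun_simps intro: D.cmp_assoc\<close>)
  qed (auto simp: Fun_simps nt_src nt_tgt)
qed

text \<open>The two records may belong to different schemes: besides full subcategories this covers
  \<open>AFun\<close> inside \<open>Fun\<close> and, through \<open>preadditive_full\<close>,
  \<open>mod_adm\<close> inside \<open>Mod_cat\<close>, where the smaller category carries more
  fields.\<close>

lemma category_full:
  fixes C :: "('o, 'm, 'y) cat_scheme" and D :: "('o, 'm, 'z) cat_scheme"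
  assumes "category C" "Ob D \<subseteq> Ob C" "Ar D = {f \<in> Ar C. Dom C f \<in> Ob D \<and> Cod C f \<in> Ob D}"
    "Dom D = Dom C" "Cod D = Cod C" "Idn D = Idn C" "Cmp D = Cmp C" shows "category D"
proof -
  interpret C: category C by fact
  have H: "f \<in> Hom D X Y \<longleftrightarrow> f \<in> Hom C X Y \<and> X \<in> Ob D \<and> Y \<in> Ob D" for f X Y by (auto simp: hom_iff assms(3-5))
  show ?thesis
  proof
    fix f assume "f \<in> Ar D"
    thus "Dom D f \<in> Ob D" "Cod D f \<in> Ob D" using assms(3-5) by auto
  qed (use assms(2,6,7) C.id_hom C.cmp_hom C.cmp_id_left C.cmp_id_right C.cmp_assoc in \<open>auto simp: H\<close>)
qed

lemma category_full_subcat: "category C \<Longrightarrow> category (full_subcat C S)"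
  by (rule category_full[of C]) (auto simp: full_subcat_def category.dom_ob category.cod_ob)

lemma preadditive_full:
  fixes C :: "('o, 'm, 'y) acat_scheme" and D :: "('o, 'm, 'z) acat_scheme"
  assumes "preadditive_category C" "Ob D \<subseteq> Ob C" "Ar D = {f \<in> Ar C. Dom C f \<in> Ob D \<and> Cod C f \<in> Ob D}"
    "Dom D = Dom C" "Cod D = Cod C" "Idn D = Idn C" "Cmp D = Cmp C" "Add D = Add C" "Zer D = Zer C"
  shows "preadditive_category D"
proof -
  interpret C: preadditive_category C by fact
  have H: "f \<in> Hom D X Y \<longleftrightarrow> f \<in> Hom C X Y \<and> X \<in> Ob D \<and> Y \<in> Ob D" for f X Y by (auto simp: hom_iff assms(3-5))
  interpret category D by (rule category_full[OF C.category_axioms]) (use assms in auto)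
  show ?thesis
  proof (intro preadditive_category.intro preadditive_category_axioms.intro, rule category_axioms)
    fix X Y assume "X \<in> Ob D" "Y \<in> Ob D"
    moreover from this have "hom_grp D X Y = hom_grp C X Y" using H assms(8,9) by (auto simp: hom_grp_def)
    ultimately show "comm_group (hom_grp D X Y)" using C.hom_comm_group assms(2) by auto
  qed (use assms(7,8) C.add_cmp C.cmp_add in \<open>auto simp: H\<close>)
qed

section \<open>The category of abelian groups\<close>

lemma Hom_Ab: "\<phi> \<in> Hom Ab G H \<longleftrightarrow>
    (\<exists>h. \<phi> = (G, H, h) \<and> comm_group G \<and> comm_group H \<and> h \<in> hom G H \<and> h \<in> extensional (carrier G))"
  by (auto simp: hom_iff Ab_def)

lemma Ab_simps: "Ob Ab = {G. comm_group G}" "Idn Ab G = (G, G, \<lambda>x\<in>carrier G. x)"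
  "(H', K, k) \<cdot>[Ab] (G, H, h) = (G, K, compose (carrier G) k h)"
  "(G, H, h) \<boxplus>[Ab] (G', H', k) = (G, H, \<lambda>x\<in>carrier G. h x \<otimes>[H] k x)" "Zer Ab G H = (G, H, \<lambda>x\<in>carrier G. \<one>[H])"
  by (simp_all add: Ab_def)

lemma category_Ab: "category (Ab :: ('g monoid, 'g ab_hom) acat)"
proof
  fix f :: "'g ab_hom" assume "f \<in> Ar Ab"
  thus "Dom Ab f \<in> Ob Ab" "Cod Ab f \<in> Ob Ab" by (auto simp: Ab_def)
next
  fix G :: "'g monoid" assume "G \<in> Ob Ab"
  thus "Idn Ab G \<in> Hom Ab G G" by (auto simp: Hom_Ab Ab_simps hom_def
        monoid.m_closed[OF group.is_monoid[OF comm_group.axioms(2)]])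
next
  fix f g and X Y Z :: "'g monoid" assume "f \<in> Hom Ab X Y" "g \<in> Hom Ab Y Z"
  thus "g \<cdot>[Ab] f \<in> Hom Ab X Z" by (auto simp: Hom_Ab Ab_simps compose_def hom_def Pi_def
        monoid.m_closed[OF group.is_monoid[OF comm_group.axioms(2)]])
next
  fix f and X Y :: "'g monoid" assume "f \<in> Hom Ab X Y"
  thus "Idn Ab Y \<cdot>[Ab] f = f" "f \<cdot>[Ab] Idn Ab X = f"
    by (auto simp: Hom_Ab Ab_simps compose_def hom_def extensional_def fun_eq_iff)
next
  fix f g h and W X Y Z :: "'g monoid"
  assume "f \<in> Hom Ab W X" "g \<in> Hom Ab X Y" "h \<in> Hom Ab Y Z"
  thus "h \<cdot>[Ab] g \<cdot>[Ab] f = h \<cdot>[Ab] (g \<cdot>[Ab] f)"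
    by (auto simp: Hom_Ab Ab_simps compose_def hom_def fun_eq_iff)
qed

text \<open>Commutativity of \<open>H\<close> makes pointwise products and inverses of homomorphisms
  homomorphisms again.\<close>

lemma comm_group_homs:
  fixes G H :: "'g monoid" assumes "comm_group G" "comm_group H" shows "comm_group (hom_grp Ab G H)"
proof -
  interpret G: comm_group G by fact interpret H: comm_group H by fact
  show ?thesis
  proof (rule comm_groupI)
    fix x y assume "x \<in> carrier (hom_grp Ab G H)" "y \<in> carrier (hom_grp Ab G H)"
    then obtain h k where hk: "x = (G, H, h)" "y = (G, H, k)" "h \<in> hom G H" "k \<in> hom G H"
      by (auto simp: hom_grp_def Hom_Ab)
    show "x \<otimes>[hom_grp Ab G H] y \<in> carrier (hom_grp Ab G H)"
      using hk assms by (auto simp: hom_grp_def Hom_Ab Ab_simps hom_def Pi_def H.m_ac)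
    show "x \<otimes>[hom_grp Ab G H] y = y \<otimes>[hom_grp Ab G H] x"
      using hk by (auto simp: hom_grp_def Ab_simps hom_def Pi_def H.m_comm)
  next
    fix x y z assume "x \<in> carrier (hom_grp Ab G H)" "y \<in> carrier (hom_grp Ab G H)"
      "z \<in> carrier (hom_grp Ab G H)"
    thus "x \<otimes>[hom_grp Ab G H] y \<otimes>[hom_grp Ab G H] z = x \<otimes>[hom_grp Ab G H] (y \<otimes>[hom_grp Ab G H] z)"
      by (auto simp: hom_grp_def Hom_Ab Ab_simps hom_def Pi_def H.m_assoc fun_eq_iff)
  next
    show "\<one>[hom_grp Ab G H] \<in> carrier (hom_grp Ab G H)"
      using assms by (auto simp: hom_grp_def Hom_Ab Ab_simps hom_def)
  next
    fix x assume "x \<in> carrier (hom_grp Ab G H)"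
    then obtain h where h: "x = (G, H, h)" "h \<in> hom G H" "h \<in> extensional (carrier G)"
      by (auto simp: hom_grp_def Hom_Ab)
    show "\<one>[hom_grp Ab G H] \<otimes>[hom_grp Ab G H] x = x"
      using h by (auto simp: hom_grp_def Ab_simps hom_def Pi_def extensional_def)
    have "(G, H, \<lambda>x\<in>carrier G. inv[H] h x) \<in> carrier (hom_grp Ab G H)"
      using h assms by (auto simp: hom_grp_def Hom_Ab hom_def Pi_def H.inv_mult)
    moreover have "(G, H, \<lambda>x\<in>carrier G. inv[H] h x) \<otimes>[hom_grp Ab G H] x = \<one>[hom_grp Ab G H]"
      using h by (auto simp: hom_grp_def Ab_simps hom_def Pi_def)
    ultimately show "\<exists>y\<in>carrier (hom_grp Ab G H). y \<otimes>[hom_grp Ab G H] x = \<one>[hom_grp Ab G H]" by blast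
  qed
qed

lemma preadditive_Ab: "preadditive_category (Ab :: ('g monoid, 'g ab_hom) acat)"
proof -
  interpret category "Ab :: ('g monoid, 'g ab_hom) acat" by (rule category_Ab)
  show ?thesis
  proof (intro preadditive_category.intro preadditive_category_axioms.intro, rule category_axioms)
    fix X Y :: "'g monoid" assume "X \<in> Ob Ab" "Y \<in> Ob Ab"
    thus "comm_group (hom_grp Ab X Y)" by (auto simp: Ab_simps intro: comm_group_homs)
  next
    fix f g g' and X Y Z :: "'g monoid" assume "f \<in> Hom Ab X Y" "g \<in> Hom Ab Y Z" "g' \<in> Hom Ab Y Z"
    thus "(g \<boxplus>[Ab] g') \<cdot>[Ab] f = g \<cdot>[Ab] f \<boxplus>[Ab] g' \<cdot>[Ab] f"
      by (auto simp: Hom_Ab Ab_simps compose_def hom_def fun_eq_iff)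
  next
    fix f f' g and X Y Z :: "'g monoid" assume "f \<in> Hom Ab X Y" "f' \<in> Hom Ab X Y" "g \<in> Hom Ab Y Z"
    thus "g \<cdot>[Ab] (f \<boxplus>[Ab] f') = g \<cdot>[Ab] f \<boxplus>[Ab] g \<cdot>[Ab] f'"
      by (auto simp: Hom_Ab Ab_simps compose_def hom_def Pi_def fun_eq_iff)
  qed
qed

section \<open>Categories of additive functors\<close>

lemma AFun_simps: "Ob (AFun A B) = {F. additive_functor A B F}"
  "Ar (AFun A B) = {\<eta>. is_nt A B \<eta> \<and> additive_functor A B (src \<eta>) \<and> additive_functor A B (tgt \<eta>)}"
  "Dom (AFun A B) = src" "Cod (AFun A B) = tgt" "Idn (AFun A B) = Idn (Fun A B)"
  "Cmp (AFun A B) = Cmp (Fun A B)"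
  "\<eta> \<boxplus>[AFun A B] \<nu> = \<lparr>src = src \<eta>, tgt = tgt \<eta>, at = (\<lambda>X\<in>Ob A. at \<eta> X \<boxplus>[B] at \<nu> X)\<rparr>"
  "Zer (AFun A B) F G = \<lparr>src = F, tgt = G, at = (\<lambda>X\<in>Ob A. Zer B (Fob F X) (Fob G X))\<rparr>"
  by (simp_all add: AFun_def)

text \<open>All laws hold objectwise in \<open>B\<close>; what remains is that sums, zeros and
  negatives of natural families are natural, by bilinearity of composition in
  \<open>B\<close>.\<close>

lemma preadditive_AFun: assumes "category A" "preadditive_category B" shows "preadditive_category (AFun A B)"
proof -
  interpret A: category A by fact interpret B: preadditive_category B by fact
  interpret Fun: category "Fun A B" by (rule category_Fun) unfold_locales interpret category "AFun A B"
    by (rule category_full[OF Fun.category_axioms]) (auto simp: AFun_simps Fun_simps additive_functor_def)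
  have H: "\<eta> \<in> Hom (AFun A B) F G \<longleftrightarrow>
      is_nt A B \<eta> \<and> src \<eta> = F \<and> tgt \<eta> = G \<and> additive_functor A B F \<and> additive_functor A B G" for \<eta> F G
    by (auto simp: hom_iff AFun_simps)
  have at: "at \<eta> X \<in> Hom B (Fob F X) (Fob G X)" if "\<eta> \<in> Hom (AFun A B) F G" "X \<in> Ob A" for \<eta> F G X
    using that nt_hom[of A B \<eta> X] by (auto simp: H)
  have at_ext: "at \<eta> \<in> extensional (Ob A)" "src \<eta> = F" "tgt \<eta> = G" if "\<eta> \<in> Hom (AFun A B) F G" for \<eta> F G
    using that nt_extensional[of A B \<eta>] by (auto simp: H)
  show ?thesis
  proof (intro preadditive_category.intro preadditive_category_axioms.intro, rule category_axioms)
    fix F G assume "F \<in> Ob (AFun A B)" "G \<in> Ob (AFun A B)"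
    hence FG: "is_functor A B F" "is_functor A B G" "additive_functor A B F" "additive_functor A B G"
      by (auto simp: AFun_simps additive_functor_def)
    show "comm_group (hom_grp (AFun A B) F G)"
    proof (rule comm_groupI, unfold hom_grp_def, simp_all)
      fix \<eta> \<nu> assume en: "\<eta> \<in> Hom (AFun A B) F G" "\<nu> \<in> Hom (AFun A B) F G"
      hence n: "is_nt A B \<eta>" "is_nt A B \<nu>" and [simp]: "src \<eta> = F" "src \<nu> = F" "tgt \<eta> = G" "tgt \<nu> = G"
        by (auto simp: H)
      show "\<eta> \<boxplus>[AFun A B] \<nu> \<in> Hom (AFun A B) F G" unfolding H
      proof (intro conjI ntI)
        fix f X Y assume f: "f \<in> Hom A X Y"
        have ob: "X \<in> Ob A" "Y \<in> Ob A" using A.hom_ob[OF f] .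
        show "at (\<eta> \<boxplus>[AFun A B] \<nu>) Y \<cdot>[B] Far (src (\<eta> \<boxplus>[AFun A B] \<nu>)) f =
          Far (tgt (\<eta> \<boxplus>[AFun A B] \<nu>)) f \<cdot>[B] at (\<eta> \<boxplus>[AFun A B] \<nu>) X"
          using ob nt_natural[OF n(1) f] nt_natural[OF n(2) f]
            B.add_cmp[OF functor_hom[OF FG(1) f] at[OF en(1) ob(2)] at[OF en(2) ob(2)]]
            B.cmp_add[OF at[OF en(1) ob(1)] at[OF en(2) ob(1)] functor_hom[OF FG(2) f]]
          by (simp add: AFun_simps)
      qed (use FG at[OF en(1)] at[OF en(2)] in \<open>auto simp: AFun_simps intro: B.add_hom\<close>)
      show "\<eta> \<boxplus>[AFun A B] \<nu> = \<nu> \<boxplus>[AFun A B] \<eta>" by (rule nt_eqI[of _ _ "Ob A"])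
          (use at[OF en(1)] at[OF en(2)] in \<open>auto simp: AFun_simps intro: B.hom_add_comm\<close>)
    next
      fix \<eta> \<nu> \<mu>
      assume en: "\<eta> \<in> Hom (AFun A B) F G" "\<nu> \<in> Hom (AFun A B) F G" "\<mu> \<in> Hom (AFun A B) F G"
      show "\<eta> \<boxplus>[AFun A B] \<nu> \<boxplus>[AFun A B] \<mu> = \<eta> \<boxplus>[AFun A B] (\<nu> \<boxplus>[AFun A B] \<mu>)" by (rule nt_eqI[of _ _ "Ob A"])
          (use at[OF en(1)] at[OF en(2)] at[OF en(3)] in \<open>auto simp: AFun_simps intro: B.hom_add_assoc\<close>)
    next
      show "Zer (AFun A B) F G \<in> Hom (AFun A B) F G" unfolding H
      proof (intro conjI ntI)
        fix f X Y assume f: "f \<in> Hom A X Y"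
        have ob: "X \<in> Ob A" "Y \<in> Ob A" using A.hom_ob[OF f] .
        thus "at (Zer (AFun A B) F G) Y \<cdot>[B] Far (src (Zer (AFun A B) F G)) f =
          Far (tgt (Zer (AFun A B) F G)) f \<cdot>[B] at (Zer (AFun A B) F G) X"
          using functor_hom[OF FG(1) f] functor_hom[OF FG(2) f] functor_ob[OF FG(1)] functor_ob[OF FG(2)]
          by (simp add: AFun_simps hom_iff)
      qed (use FG functor_ob[OF FG(1)] functor_ob[OF FG(2)] in \<open>auto simp: AFun_simps intro: B.zer_hom\<close>)
    next
      fix \<eta> assume en: "\<eta> \<in> Hom (AFun A B) F G"
      hence n: "is_nt A B \<eta>" and [simp]: "src \<eta> = F" "tgt \<eta> = G" by (auto simp: H)
      show "Zer (AFun A B) F G \<boxplus>[AFun A B] \<eta> = \<eta>" by (rule nt_eqI[of _ _ "Ob A"])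
          (use at[OF en(1)] at_ext[OF en] in \<open>auto simp: AFun_simps intro: B.hom_add_zer\<close>)
      define \<nu> where "\<nu> = \<lparr>src = F, tgt = G, at = (\<lambda>X\<in>Ob A. Neg B (at \<eta> X))\<rparr>"
      have "\<nu> \<in> Hom (AFun A B) F G" unfolding H
      proof (intro conjI ntI)
        fix f X Y assume f: "f \<in> Hom A X Y"
        have ob: "X \<in> Ob A" "Y \<in> Ob A" using A.hom_ob[OF f] .
        show "at \<nu> Y \<cdot>[B] Far (src \<nu>) f = Far (tgt \<nu>) f \<cdot>[B] at \<nu> X"
          using ob nt_natural[OF n f] B.neg_cmp[OF functor_hom[OF FG(1) f] at[OF en ob(2)]]
            B.cmp_neg[OF at[OF en ob(1)] functor_hom[OF FG(2) f]] by (simp add: \<nu>_def)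
      qed (use FG at[OF en] in \<open>auto simp: \<nu>_def intro: B.neg_hom\<close>)
      moreover have "\<nu> \<boxplus>[AFun A B] \<eta> = Zer (AFun A B) F G" by (rule nt_eqI[of _ _ "Ob A"])
          (use at[OF en(1)] in \<open>auto simp: AFun_simps \<nu>_def intro: B.hom_add_neg\<close>)
      ultimately show "\<exists>\<nu>\<in>Hom (AFun A B) F G. \<nu> \<boxplus>[AFun A B] \<eta> = Zer (AFun A B) F G" by blast
    qed
  next
    fix F G K \<eta> \<nu> \<mu>
    assume en: "\<eta> \<in> Hom (AFun A B) F G" "\<nu> \<in> Hom (AFun A B) G K" "\<mu> \<in> Hom (AFun A B) G K"
    show "(\<nu> \<boxplus>[AFun A B] \<mu>) \<cdot>[AFun A B] \<eta> = \<nu> \<cdot>[AFun A B] \<eta> \<boxplus>[AFun A B] \<mu> \<cdot>[AFun A B] \<eta>"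
      by (rule nt_eqI[of _ _ "Ob A"])
        (use at[OF en(1)] at[OF en(2)] at[OF en(3)] in
          \<open>auto simp: AFun_simps Fun_simps intro: B.add_cmp\<close>)
  next
    fix F G K \<eta> \<nu> \<mu>
    assume en: "\<eta> \<in> Hom (AFun A B) F G" "\<nu> \<in> Hom (AFun A B) F G" "\<mu> \<in> Hom (AFun A B) G K"
    show "\<mu> \<cdot>[AFun A B] (\<eta> \<boxplus>[AFun A B] \<nu>) = \<mu> \<cdot>[AFun A B] \<eta> \<boxplus>[AFun A B] \<mu> \<cdot>[AFun A B] \<nu>"
      by (rule nt_eqI[of _ _ "Ob A"])
        (use at[OF en(1)] at[OF en(2)] at[OF en(3)] in
          \<open>auto simp: AFun_simps Fun_simps intro: B.cmp_add\<close>)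
  qed
qed

section \<open>Modules over a preadditive category\<close>

abbreviation el :: "('o, 'm) md \<Rightarrow> 'o \<Rightarrow> 'm set" where "el M W \<equiv> carrier (Fob M W)"

text \<open>Arrows of \<open>Ab\<close> are triples carrying source and target; \<open>act\<close>
  and \<open>app\<close> extract the underlying map. As modules are contravariant, for
  \<open>f : X \<rightarrow> Y\<close> the map \<open>act M f\<close> goes from
  \<open>el M Y\<close> to \<open>el M X\<close>, like a right action on elements.\<close>

definition act :: "('o, 'm) md \<Rightarrow> 'm \<Rightarrow> 'm \<Rightarrow> 'm" where "act M f = snd (snd (Far M f))"

definition app :: "('o, 'm) md_hom \<Rightarrow> 'o \<Rightarrow> 'm \<Rightarrow> 'm" where "app \<alpha> W = snd (snd (at \<alpha> W))"

definition mk_mod :: "('o, 'm, 'z) acat_scheme \<Rightarrow> ('o \<Rightarrow> 'm monoid) \<Rightarrow> ('m \<Rightarrow> 'm \<Rightarrow> 'm) \<Rightarrow> ('o, 'm) md" where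
  "mk_mod A G r = \<lparr>Fob = (\<lambda>W\<in>Ob A. G W),
     Far = (\<lambda>f\<in>Ar A. (G (Cod A f), G (Dom A f), \<lambda>x\<in>carrier (G (Cod A f)). r f x))\<rparr>"

definition mk_hom :: "('o, 'm, 'z) acat_scheme \<Rightarrow> ('o, 'm) md \<Rightarrow> ('o, 'm) md \<Rightarrow> ('o \<Rightarrow> 'm \<Rightarrow> 'm) \<Rightarrow> ('o, 'm) md_hom" where
  "mk_hom A M N h = \<lparr>src = M, tgt = N, at = (\<lambda>W\<in>Ob A. (Fob M W, Fob N W, \<lambda>x\<in>el M W. h W x))\<rparr>"

lemma comm_group_m_closed: "\<lbrakk>comm_group G; x \<in> carrier G; y \<in> carrier G\<rbrakk> \<Longrightarrow> x \<otimes>[G] y \<in> carrier G"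
  by (rule monoid.m_closed[OF group.is_monoid[OF comm_group.axioms(2)]])

context preadditive_category
begin

lemma preadditive_Mod: "preadditive_category (\<M> A)"
  unfolding Mod_cat_def by (rule preadditive_AFun[OF category_opp preadditive_Ab]) (rule category_axioms)

lemma mod_additive: "M \<in> Ob (\<M> A) \<Longrightarrow> additive_functor (opp A) Ab M" by (simp add: Mod_cat_def AFun_simps)

lemma mod_functor: "M \<in> Ob (\<M> A) \<Longrightarrow> is_functor (opp A) Ab M" using mod_additive additive_functor_def by blast

lemma mod_group: "\<lbrakk>M \<in> Ob (\<M> A); W \<in> Ob A\<rbrakk> \<Longrightarrow> comm_group (Fob M W)"
  using functor_ob[OF mod_functor, of M W] by (simp add: opp_simps Ab_simps)

lemma Far_act: assumes "M \<in> Ob (\<M> A)" "f \<in> Hom A X Y"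
  shows "Far M f = (Fob M Y, Fob M X, act M f)" "act M f \<in> hom (Fob M Y) (Fob M X)"
    "act M f \<in> extensional (el M Y)" using functor_hom[OF mod_functor[OF assms(1)], of f Y X] assms(2)
  by (auto simp: Hom_opp Hom_Ab act_def)

lemma act_closed: "\<lbrakk>M \<in> Ob (\<M> A); f \<in> Hom A X Y; x \<in> el M Y\<rbrakk> \<Longrightarrow> act M f x \<in> el M X"
  using Far_act(2) by (fastforce simp: hom_def)

lemma act_mult: "\<lbrakk>M \<in> Ob (\<M> A); f \<in> Hom A X Y; x \<in> el M Y; y \<in> el M Y\<rbrakk> \<Longrightarrow>
    act M f (x \<otimes>[Fob M Y] y) = act M f x \<otimes>[Fob M X] act M f y" using Far_act(2) by (fastforce simp: hom_def)

lemma act_one: assumes "M \<in> Ob (\<M> A)" "f \<in> Hom A X Y" shows "act M f \<one>[Fob M Y] = \<one>[Fob M X]"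
  using hom_one[OF Far_act(2)[OF assms]] mod_group[OF assms(1)] hom_ob[OF assms(2)] comm_group.axioms(2)
  by blast

lemma act_inv: assumes "M \<in> Ob (\<M> A)" "f \<in> Hom A X Y" "x \<in> el M Y"
  shows "act M f (inv[Fob M Y] x) = inv[Fob M X] act M f x"
  using group_hom.hom_inv[of "Fob M Y" "Fob M X" "act M f" x] Far_act(2)[OF assms(1,2)]
    mod_group[OF assms(1)] hom_ob[OF assms(2)] assms(3)
  by (simp add: group_hom_def group_hom_axioms_def comm_group.axioms(2))

lemma act_idn: "\<lbrakk>M \<in> Ob (\<M> A); X \<in> Ob A; x \<in> el M X\<rbrakk> \<Longrightarrow> act M (Idn A X) x = x"
  using functor_idn[OF mod_functor, of M X] by (simp add: opp_simps Ab_simps act_def)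

lemma act_cmp: assumes "M \<in> Ob (\<M> A)" "f \<in> Hom A X Y" "g \<in> Hom A Y Z" "x \<in> el M Z"
  shows "act M (g \<cdot> f) x = act M f (act M g x)"
  using functor_cmp[OF mod_functor[OF assms(1)], of g Z Y f X] assms(2-4)
    Far_act(1)[OF assms(1) assms(2)] Far_act(1)[OF assms(1) assms(3)]
    Far_act(1)[OF assms(1) cmp_hom[OF assms(2,3)]] by (simp add: Hom_opp opp_simps Ab_simps compose_def)

lemma act_add: assumes "M \<in> Ob (\<M> A)" "f \<in> Hom A X Y" "g \<in> Hom A X Y" "x \<in> el M Y"
  shows "act M (f \<boxplus> g) x = act M f x \<otimes>[Fob M X] act M g x"
proof -
  have "Far M (f \<boxplus> g) = Far M f \<boxplus>[Ab] Far M g" using mod_additive[OF assms(1)] assms(2,3) hom_ob[OF assms(2)]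
    unfolding additive_functor_def by (simp add: Hom_opp opp_simps)
  thus ?thesis using Far_act(1)[OF assms(1) assms(2)] Far_act(1)[OF assms(1) assms(3)]
      Far_act(1)[OF assms(1) add_hom[OF assms(2,3)]] assms(4) by (simp add: Ab_simps)
qed

lemma act_zer: assumes "M \<in> Ob (\<M> A)" "X \<in> Ob A" "Y \<in> Ob A" "x \<in> el M Y"
  shows "act M (Zer A X Y) x = \<one>[Fob M X]"
proof -
  interpret G: comm_group "Fob M X" using mod_group assms by blast
  have z: "Zer A X Y \<in> Hom A X Y" using assms zer_hom by blast
  have "act M (Zer A X Y) x \<otimes>[Fob M X] act M (Zer A X Y) x = act M (Zer A X Y) x"
    using act_add[OF assms(1) z z assms(4)] hom_add_zer[OF z] by simp
  thus ?thesis using G.l_cancel_one act_closed[OF assms(1) z assms(4)] by blast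
qed

lemma act_neg: assumes "M \<in> Ob (\<M> A)" "f \<in> Hom A X Y" "x \<in> el M Y"
  shows "act M (Neg A f) x = inv[Fob M X] act M f x"
proof -
  have ob: "X \<in> Ob A" "Y \<in> Ob A" using hom_ob[OF assms(2)] .
  interpret G: comm_group "Fob M X" using mod_group assms ob by blast
  have n: "Neg A f \<in> Hom A X Y" using assms neg_hom by blast
  have "act M (Neg A f) x \<otimes>[Fob M X] act M f x = \<one>[Fob M X]"
    using act_add[OF assms(1) n assms(2,3)] hom_add_neg[OF assms(2)] act_zer[OF assms(1) ob assms(3)] by simp
  thus ?thesis using G.inv_equality act_closed[OF assms(1)] n assms(2,3) by simp
qed

lemma mk_mod: assumes G: "\<And>W. W \<in> Ob A \<Longrightarrow> comm_group (G W)"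
    and cl: "\<And>f X Y x. \<lbrakk>f \<in> Hom A X Y; x \<in> carrier (G Y)\<rbrakk> \<Longrightarrow> r f x \<in> carrier (G X)"
    and mu: "\<And>f X Y x y. \<lbrakk>f \<in> Hom A X Y; x \<in> carrier (G Y); y \<in> carrier (G Y)\<rbrakk> \<Longrightarrow>
       r f (x \<otimes>[G Y] y) = r f x \<otimes>[G X] r f y"
    and idn: "\<And>X x. \<lbrakk>X \<in> Ob A; x \<in> carrier (G X)\<rbrakk> \<Longrightarrow> r (Idn A X) x = x"
    and cmp: "\<And>f g X Y Z x. \<lbrakk>f \<in> Hom A X Y; g \<in> Hom A Y Z; x \<in> carrier (G Z)\<rbrakk> \<Longrightarrow>
       r (g \<cdot> f) x = r f (r g x)" and add: "\<And>f g X Y x. \<lbrakk>f \<in> Hom A X Y; g \<in> Hom A X Y; x \<in> carrier (G Y)\<rbrakk> \<Longrightarrow>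
       r (f \<boxplus> g) x = r f x \<otimes>[G X] r g x"
  shows "mk_mod A G r \<in> Ob (\<M> A)" "\<And>W. W \<in> Ob A \<Longrightarrow> Fob (mk_mod A G r) W = G W"
    "\<And>f X Y x. \<lbrakk>f \<in> Hom A X Y; x \<in> carrier (G Y)\<rbrakk> \<Longrightarrow> act (mk_mod A G r) f x = r f x"
proof -
  let ?M = "mk_mod A G r"
  have Far: "Far ?M f = (G Y, G X, \<lambda>x\<in>carrier (G Y). r f x)" if "f \<in> Hom A X Y" for f X Y
    using that by (auto simp: mk_mod_def hom_iff)
  show Fob: "Fob ?M W = G W" if "W \<in> Ob A" for W using that by (simp add: mk_mod_def)
  show "act ?M f x = r f x" if "f \<in> Hom A X Y" "x \<in> carrier (G Y)" for f X Y x
    using that by (simp add: act_def Far)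
  have "is_functor (opp A) Ab ?M"
  proof (rule functorI)
    show "category (opp A)" by (rule category_opp) (rule category_axioms)
    show "category Ab" by (rule category_Ab)
    show "Fob ?M \<in> extensional (Ob (opp A))" "Far ?M \<in> extensional (Ar (opp A))"
      by (simp_all add: mk_mod_def opp_simps)
    show "Fob ?M X \<in> Ob Ab" if "X \<in> Ob (opp A)" for X using that G Fob by (simp add: opp_simps Ab_simps)
    show "Far ?M f \<in> Hom Ab (Fob ?M X) (Fob ?M Y)" if "f \<in> Hom (opp A) X Y" for f X Y
      using that cl mu G Far[of f Y X] hom_ob[of f Y X] Fob by (auto simp: Hom_opp Hom_Ab hom_def comm_group_m_closed)
    show "Far ?M (Idn (opp A) X) = Idn Ab (Fob ?M X)" if "X \<in> Ob (opp A)" for X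
      using that idn Far[OF id_hom, of X] Fob by (auto simp: opp_simps Ab_simps)
    show "Far ?M (g \<cdot>[opp A] f) = Far ?M g \<cdot>[Ab] Far ?M f"
      if "f \<in> Hom (opp A) X Y" "g \<in> Hom (opp A) Y Z" for f g X Y Z
      using that cmp[of g Z Y f X] cl[of f Y X] Far[of f Y X] Far[of g Z Y] Far[OF cmp_hom, of g Z Y f X]
      by (auto simp: Hom_opp opp_simps Ab_simps compose_def)
  qed
  moreover have "Far ?M (f \<boxplus> g) = Far ?M f \<boxplus>[Ab] Far ?M g" if "f \<in> Hom A X Y" "g \<in> Hom A X Y" for f g X Y
    using that add[of f X Y g] Far[of f X Y] Far[of g X Y] Far[OF add_hom, of f X Y g]
    by (auto simp: Ab_simps)
  ultimately show "?M \<in> Ob (\<M> A)" by (simp add: Mod_cat_def AFun_simps additive_functor_def Hom_opp opp_simps)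
qed

section \<open>Homomorphisms of modules and exactness on elements\<close>

lemma Hom_Mod: "\<alpha> \<in> Hom (\<M> A) M N \<longleftrightarrow>
    is_nt (opp A) Ab \<alpha> \<and> src \<alpha> = M \<and> tgt \<alpha> = N \<and> M \<in> Ob (\<M> A) \<and> N \<in> Ob (\<M> A)"
  by (auto simp: hom_iff Mod_cat_def AFun_simps)

lemma Mod_ob: assumes "\<alpha> \<in> Hom (\<M> A) M N" shows "M \<in> Ob (\<M> A)" "N \<in> Ob (\<M> A)" using assms Hom_Mod by blast+

lemma at_app: assumes "\<alpha> \<in> Hom (\<M> A) M N" "W \<in> Ob A"
  shows "at \<alpha> W = (Fob M W, Fob N W, app \<alpha> W)" "app \<alpha> W \<in> hom (Fob M W) (Fob N W)"
    "app \<alpha> W \<in> extensional (el M W)"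
  using nt_hom[of "opp A" Ab \<alpha> W] assms by (auto simp: Hom_Mod Hom_Ab opp_simps app_def)

lemma app_closed: "\<lbrakk>\<alpha> \<in> Hom (\<M> A) M N; W \<in> Ob A; x \<in> el M W\<rbrakk> \<Longrightarrow> app \<alpha> W x \<in> el N W"
  using at_app(2) by (fastforce simp: hom_def)

lemma app_mult: "\<lbrakk>\<alpha> \<in> Hom (\<M> A) M N; W \<in> Ob A; x \<in> el M W; y \<in> el M W\<rbrakk> \<Longrightarrow>
    app \<alpha> W (x \<otimes>[Fob M W] y) = app \<alpha> W x \<otimes>[Fob N W] app \<alpha> W y" using at_app(2) by (fastforce simp: hom_def)

lemma app_one: assumes "\<alpha> \<in> Hom (\<M> A) M N" "W \<in> Ob A" shows "app \<alpha> W \<one>[Fob M W] = \<one>[Fob N W]"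
  using hom_one[OF at_app(2)[OF assms]] mod_group Mod_ob[OF assms(1)] assms(2) comm_group.axioms(2) by blast

lemma app_inv: assumes "\<alpha> \<in> Hom (\<M> A) M N" "W \<in> Ob A" "x \<in> el M W"
  shows "app \<alpha> W (inv[Fob M W] x) = inv[Fob N W] app \<alpha> W x"
  using group_hom.hom_inv[of "Fob M W" "Fob N W" "app \<alpha> W" x] at_app(2)[OF assms(1,2)]
    mod_group[OF _ assms(2)] Mod_ob[OF assms(1)] assms(3)
  by (simp add: group_hom_def group_hom_axioms_def comm_group.axioms(2))

lemma app_natural: assumes "\<alpha> \<in> Hom (\<M> A) M N" "f \<in> Hom A X Y" "x \<in> el M Y"
  shows "app \<alpha> X (act M f x) = act N f (app \<alpha> Y x)"
  using nt_natural[of "opp A" Ab \<alpha> f Y X] assms Far_act(1)[OF Mod_ob(1)[OF assms(1)] assms(2)]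
    Far_act(1)[OF Mod_ob(2)[OF assms(1)] assms(2)] at_app(1)[OF assms(1)] hom_ob[OF assms(2)]
  by (auto simp: Hom_Mod Hom_opp Ab_simps compose_def dest: fun_cong[of _ _ x])

lemma mk_hom: assumes M: "M \<in> Ob (\<M> A)" and N: "N \<in> Ob (\<M> A)"
    and cl: "\<And>W x. \<lbrakk>W \<in> Ob A; x \<in> el M W\<rbrakk> \<Longrightarrow> h W x \<in> el N W"
    and mu: "\<And>W x y. \<lbrakk>W \<in> Ob A; x \<in> el M W; y \<in> el M W\<rbrakk> \<Longrightarrow>
      h W (x \<otimes>[Fob M W] y) = h W x \<otimes>[Fob N W] h W y"
    and nat: "\<And>f X Y x. \<lbrakk>f \<in> Hom A X Y; x \<in> el M Y\<rbrakk> \<Longrightarrow> h X (act M f x) = act N f (h Y x)"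
  shows "mk_hom A M N h \<in> Hom (\<M> A) M N" "\<And>W x. \<lbrakk>W \<in> Ob A; x \<in> el M W\<rbrakk> \<Longrightarrow> app (mk_hom A M N h) W x = h W x"
proof -
  let ?\<alpha> = "mk_hom A M N h"
  have at: "at ?\<alpha> W = (Fob M W, Fob N W, \<lambda>x\<in>el M W. h W x)" if "W \<in> Ob A" for W
    using that by (simp add: mk_hom_def)
  have st: "src ?\<alpha> = M" "tgt ?\<alpha> = N" by (simp_all add: mk_hom_def)
  show "app ?\<alpha> W x = h W x" if "W \<in> Ob A" "x \<in> el M W" for W x using that by (simp add: app_def at)
  have "is_nt (opp A) Ab ?\<alpha>"
  proof (rule ntI, unfold st)
    show "at ?\<alpha> X \<in> Hom Ab (Fob M X) (Fob N X)" if "X \<in> Ob (opp A)" for X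
      using that at[of X] mod_group[OF M] mod_group[OF N] cl mu by (auto simp: Hom_Ab opp_simps hom_def comm_group_m_closed)
    show "at ?\<alpha> Y \<cdot>[Ab] Far M f = Far N f \<cdot>[Ab] at ?\<alpha> X" if "f \<in> Hom (opp A) X Y" for f X Y
      using that at[of X] at[of Y] Far_act(1)[OF M, of f Y X] Far_act(1)[OF N, of f Y X] hom_ob[of f Y X]
        nat[of f Y X] act_closed[OF M, of f Y X] by (auto simp: Hom_opp Ab_simps compose_def)
  qed (use mod_functor M N in \<open>auto simp: mk_hom_def opp_simps\<close>)
  thus "?\<alpha> \<in> Hom (\<M> A) M N" using M N st by (simp add: Hom_Mod)
qed

lemma Mod_hom_eqI: assumes "\<alpha> \<in> Hom (\<M> A) M N" "\<beta> \<in> Hom (\<M> A) M N"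
    "\<And>W x. \<lbrakk>W \<in> Ob A; x \<in> el M W\<rbrakk> \<Longrightarrow> app \<alpha> W x = app \<beta> W x" shows "\<alpha> = \<beta>"
proof (rule nt_eqI[of _ _ "Ob A"])
  show "at \<alpha> \<in> extensional (Ob A)" "at \<beta> \<in> extensional (Ob A)" "src \<alpha> = src \<beta>" "tgt \<alpha> = tgt \<beta>"
    using assms nt_extensional[of "opp A" Ab] by (auto simp: Hom_Mod opp_simps)
  fix W assume W: "W \<in> Ob A"
  have "app \<alpha> W = app \<beta> W"
    by (rule extensionalityI[OF at_app(3)[OF assms(1) W] at_app(3)[OF assms(2) W]]) (use assms(3) W in blast)
  thus "at \<alpha> W = at \<beta> W" using at_app(1)[OF assms(1) W] at_app(1)[OF assms(2) W] by simp
qed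

lemma Mod_simps: "Dom (\<M> A) = src" "Cod (\<M> A) = tgt"
    "Idn (\<M> A) = Idn (Fun (opp A) Ab)" "Cmp (\<M> A) = Cmp (Fun (opp A) Ab)"
  by (simp_all add: Mod_cat_def AFun_simps)

lemma app_cmp: assumes "\<alpha> \<in> Hom (\<M> A) L M" "\<beta> \<in> Hom (\<M> A) M N" "W \<in> Ob A" "x \<in> el L W"
  shows "app (\<beta> \<cdot>[\<M> A] \<alpha>) W x = app \<beta> W (app \<alpha> W x)"
  using at_app(1)[OF assms(1,3)] at_app(1)[OF assms(2,3)] assms(3,4)
  by (subst app_def) (simp add: Mod_simps Fun_simps opp_simps Ab_simps compose_def)

lemma app_idn: "\<lbrakk>W \<in> Ob A; x \<in> el M W\<rbrakk> \<Longrightarrow> app (Idn (\<M> A) M) W x = x"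
  by (simp add: app_def Mod_simps Fun_simps opp_simps Ab_simps)

lemma app_add: assumes "\<alpha> \<in> Hom (\<M> A) M N" "\<beta> \<in> Hom (\<M> A) M N" "W \<in> Ob A" "x \<in> el M W"
  shows "app (\<alpha> \<boxplus>[\<M> A] \<beta>) W x = app \<alpha> W x \<otimes>[Fob N W] app \<beta> W x"
  using at_app(1)[OF assms(1,3)] at_app(1)[OF assms(2,3)] assms(3,4)
  by (subst app_def) (simp add: Mod_cat_def AFun_simps opp_simps Ab_simps)

lemma app_zer: "\<lbrakk>W \<in> Ob A; x \<in> el M W\<rbrakk> \<Longrightarrow> app (Zer (\<M> A) M N) W x = \<one>[Fob N W]"
  by (simp add: app_def Mod_cat_def AFun_simps opp_simps Ab_simps)

text \<open>This and the next two lemmas replace kernels and images of triples by statements about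
  elements, the form in which exactness is used later.\<close>

lemma mod_mono_iff: assumes "\<alpha> \<in> Hom (\<M> A) M N"
  shows "mod_mono A \<alpha> \<longleftrightarrow> (\<forall>W\<in>Ob A. \<forall>x\<in>el M W. app \<alpha> W x = \<one>[Fob N W] \<longrightarrow> x = \<one>[Fob M W])"
proof -
  have "ab_kernel (at \<alpha> W) = {\<one>[Fob (src \<alpha>) W]} \<longleftrightarrow>
      (\<forall>x\<in>el M W. app \<alpha> W x = \<one>[Fob N W] \<longrightarrow> x = \<one>[Fob M W])" if "W \<in> Ob A" for W
  proof -
    have "\<one>[Fob M W] \<in> el M W" using mod_group[OF Mod_ob(1)[OF assms] that]
      by (simp add: group.is_monoid comm_group.axioms(2))
    thus ?thesis using assms at_app(1)[OF assms that] app_one[OF assms that]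
      by (auto simp: Hom_Mod ab_kernel_def kernel_def)
  qed
  thus ?thesis unfolding mod_mono_def by blast
qed

lemma mod_epi_iff: assumes "\<beta> \<in> Hom (\<M> A) M N"
  shows "mod_epi A \<beta> \<longleftrightarrow> (\<forall>W\<in>Ob A. \<forall>z\<in>el N W. \<exists>x\<in>el M W. app \<beta> W x = z)"
proof -
  have "ab_image (at \<beta> W) = carrier (Fob (tgt \<beta>) W) \<longleftrightarrow> (\<forall>z\<in>el N W. \<exists>x\<in>el M W. app \<beta> W x = z)"
    if "W \<in> Ob A" for W using assms at_app(1)[OF assms that] app_closed[OF assms that]
    by (auto simp: Hom_Mod ab_image_def set_eq_iff image_iff; metis)
  thus ?thesis unfolding mod_epi_def by blast
qed

lemma mod_exact_iff: assumes "\<alpha> \<in> Hom (\<M> A) L M" "\<beta> \<in> Hom (\<M> A) M N" shows "mod_exact_at A \<alpha> \<beta> \<longleftrightarrow>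
    (\<forall>W\<in>Ob A. \<forall>x\<in>el M W. app \<beta> W x = \<one>[Fob N W] \<longleftrightarrow> (\<exists>y\<in>el L W. app \<alpha> W y = x))"
proof -
  have "ab_image (at \<alpha> W) = ab_kernel (at \<beta> W) \<longleftrightarrow>
      (\<forall>x\<in>el M W. app \<beta> W x = \<one>[Fob N W] \<longleftrightarrow> (\<exists>y\<in>el L W. app \<alpha> W y = x))" if "W \<in> Ob A" for W
    using at_app(1)[OF assms(1) that] at_app(1)[OF assms(2) that] app_closed[OF assms(1) that]
    by (auto simp: ab_kernel_def ab_image_def kernel_def set_eq_iff image_iff; metis)
  thus ?thesis unfolding mod_exact_at_def using assms by (auto simp: hom_iff Mod_simps)
qed

section \<open>Representable modules and the Yoneda lemma\<close>

lemma yoneda_ob_mk: "\<Y> A X = mk_mod A (\<lambda>W. hom_grp A W X) (\<lambda>f g. g \<cdot> f)"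
  by (simp add: yoneda_ob_def mk_mod_def)

lemma yoneda_ob: assumes "X \<in> Ob A" shows "\<Y> A X \<in> Ob (\<M> A)" "\<And>W. W \<in> Ob A \<Longrightarrow> Fob (\<Y> A X) W = hom_grp A W X"
    "\<And>f W V g. \<lbrakk>f \<in> Hom A W V; g \<in> Hom A V X\<rbrakk> \<Longrightarrow> act (\<Y> A X) f g = g \<cdot> f" unfolding yoneda_ob_mk
  by ((rule mk_mod; use assms in \<open>auto simp: hom_simps intro: hom_comm_group\<close>)+)

lemma yoneda_ar: assumes "f \<in> Hom A X Y" shows "\<y> A f \<in> Hom (\<M> A) (\<Y> A X) (\<Y> A Y)"
    "\<And>W g. \<lbrakk>W \<in> Ob A; g \<in> Hom A W X\<rbrakk> \<Longrightarrow> app (\<y> A f) W g = f \<cdot> g"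
proof -
  have ob: "X \<in> Ob A" "Y \<in> Ob A" using hom_ob[OF assms] .
  have e: "\<y> A f = mk_hom A (\<Y> A X) (\<Y> A Y) (\<lambda>W g. f \<cdot> g)"
    using assms ob by (auto simp: yoneda_ar_def mk_hom_def hom_iff yoneda_ob(2) fun_eq_iff)
    have cl: "f \<cdot> x \<in> el (\<Y> A Y) W" if "W \<in> Ob A" "x \<in> el (\<Y> A X) W" for W x
      using that assms ob by (simp add: yoneda_ob cmp_hom)
    have mu: "f \<cdot> (x \<otimes>[Fob (\<Y> A X) W] y) = (f \<cdot> x) \<otimes>[Fob (\<Y> A Y) W] (f \<cdot> y)"
      if "W \<in> Ob A" "x \<in> el (\<Y> A X) W" "y \<in> el (\<Y> A X) W" for W x y
      using that assms ob cmp_add by (simp add: yoneda_ob)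
    have na: "f \<cdot> act (\<Y> A X) h x = act (\<Y> A Y) h (f \<cdot> x)" if "h \<in> Hom A V W" "x \<in> el (\<Y> A X) W" for h x V W
    proof -
      have W: "W \<in> Ob A" using hom_ob that by blast
      have x: "x \<in> Hom A W X" using that W ob by (simp add: yoneda_ob)
      show ?thesis using yoneda_ob(3)[OF ob(1) that(1) x] yoneda_ob(3)[OF ob(2) that(1) cmp_hom[OF x assms]]
          cmp_assoc[OF that(1) x assms] by simp
    qed
    have mk: "mk_hom A (\<Y> A X) (\<Y> A Y) (\<lambda>W g. f \<cdot> g) \<in> Hom (\<M> A) (\<Y> A X) (\<Y> A Y)"
    "\<And>W x. \<lbrakk>W \<in> Ob A; x \<in> el (\<Y> A X) W\<rbrakk> \<Longrightarrow>
       app (mk_hom A (\<Y> A X) (\<Y> A Y) (\<lambda>W g. f \<cdot> g)) W x = f \<cdot> x"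
    by (rule mk_hom; (assumption | rule yoneda_ob(1)[OF ob(1)] yoneda_ob(1)[OF ob(2)] | (rule cl mu na; assumption+)))+
  show "\<y> A f \<in> Hom (\<M> A) (\<Y> A X) (\<Y> A Y)" "\<And>W g. \<lbrakk>W \<in> Ob A; g \<in> Hom A W X\<rbrakk> \<Longrightarrow> app (\<y> A f) W g = f \<cdot> g"
    unfolding e using mk ob by (simp_all add: yoneda_ob)
qed

end

text \<open>The homomorphism \<open>\<Upsilon> X \<rightarrow> M\<close> corresponding to an element of \<open>M X\<close> under the Yoneda lemma.\<close>

definition yel :: "('o, 'm, 'z) acat_scheme \<Rightarrow> ('o, 'm) md \<Rightarrow> 'o \<Rightarrow> 'm \<Rightarrow> ('o, 'm) md_hom" where
  "yel A M X x = mk_hom A (\<Y> A X) M (\<lambda>W g. act M g x)"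

context preadditive_category
begin

lemma yel: assumes "M \<in> Ob (\<M> A)" "X \<in> Ob A" "x \<in> el M X" shows "yel A M X x \<in> Hom (\<M> A) (\<Y> A X) M"
    "\<And>W g. \<lbrakk>W \<in> Ob A; g \<in> Hom A W X\<rbrakk> \<Longrightarrow> app (yel A M X x) W g = act M g x"
proof -
  have na: "act M (act (\<Y> A X) h g) x = act M h (act M g x)" if "h \<in> Hom A V W" "g \<in> el (\<Y> A X) W" for h g V W
  proof -
    have W: "W \<in> Ob A" using hom_ob that by blast
    have g: "g \<in> Hom A W X" using that W assms by (simp add: yoneda_ob)
    show ?thesis using yoneda_ob(3)[OF assms(2) that(1) g] act_cmp[OF assms(1) that(1) g assms(3)] by simp
  qed
  have cl: "act M g x \<in> el M W" if "W \<in> Ob A" "g \<in> el (\<Y> A X) W" for g W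
    using that assms by (simp add: yoneda_ob) (rule act_closed)
  have mu: "act M (g \<otimes>[Fob (\<Y> A X) W] h) x = act M g x \<otimes>[Fob M W] act M h x"
    if "W \<in> Ob A" "g \<in> el (\<Y> A X) W" "h \<in> el (\<Y> A X) W" for g h W
    using that assms by (simp add: yoneda_ob act_add)
  have mk: "mk_hom A (\<Y> A X) M (\<lambda>W g. act M g x) \<in> Hom (\<M> A) (\<Y> A X) M" "\<And>W g. \<lbrakk>W \<in> Ob A; g \<in> el (\<Y> A X) W\<rbrakk> \<Longrightarrow>
       app (mk_hom A (\<Y> A X) M (\<lambda>W g. act M g x)) W g = act M g x"
    by (rule mk_hom; (assumption | rule yoneda_ob(1)[OF assms(2)] assms(1) | (rule cl mu na; assumption+)))+
  show "yel A M X x \<in> Hom (\<M> A) (\<Y> A X) M" unfolding yel_def by (rule mk(1))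
  show "\<And>W g. \<lbrakk>W \<in> Ob A; g \<in> Hom A W X\<rbrakk> \<Longrightarrow> app (yel A M X x) W g = act M g x"
    unfolding yel_def using mk(2) assms by (simp add: yoneda_ob)
qed

text \<open>Every \<open>g\<close> is the identity acted on by \<open>g\<close>, so naturality
  determines a homomorphism out of a representable by its value at the identity.\<close>

lemma yoneda_hom: assumes "\<pi> \<in> Hom (\<M> A) (\<Y> A X) M" "X \<in> Ob A" shows "app \<pi> X (Idn A X) \<in> el M X"
    "\<And>W g. \<lbrakk>W \<in> Ob A; g \<in> Hom A W X\<rbrakk> \<Longrightarrow> app \<pi> W g = act M g (app \<pi> X (Idn A X))"
proof -
  show "app \<pi> X (Idn A X) \<in> el M X" using app_closed[OF assms] assms(2) id_hom by (simp add: yoneda_ob)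
  fix W g assume "W \<in> Ob A" and g: "g \<in> Hom A W X"
  have i: "Idn A X \<in> el (\<Y> A X) X" using assms(2) id_hom by (simp add: yoneda_ob)
  have "app \<pi> W (act (\<Y> A X) g (Idn A X)) = act M g (app \<pi> X (Idn A X))" using app_natural[OF assms(1) g i] .
  moreover have "act (\<Y> A X) g (Idn A X) = g"
    using yoneda_ob(3)[OF assms(2) g id_hom[OF assms(2)]] cmp_id_left[OF g] by simp
  ultimately show "app \<pi> W g = act M g (app \<pi> X (Idn A X))" by simp
qed

text \<open>Preimages under \<pi> are chosen arbitrarily; two choices differ by an element of the
  kernel of \<pi>, on which \<phi> vanishes. So the resulting map is additive and natural even if
  the choice \<open>s\<close> is neither.\<close>

lemma factor_epi: assumes p: "\<pi> \<in> Hom (\<M> A) P M" and q: "\<phi> \<in> Hom (\<M> A) P N"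
    and surj: "\<And>W x. \<lbrakk>W \<in> Ob A; x \<in> el M W\<rbrakk> \<Longrightarrow> \<exists>p\<in>el P W. app \<pi> W p = x"
    and ker: "\<And>W p. \<lbrakk>W \<in> Ob A; p \<in> el P W; app \<pi> W p = \<one>[Fob M W]\<rbrakk> \<Longrightarrow> app \<phi> W p = \<one>[Fob N W]"
  obtains \<psi> where "\<psi> \<in> Hom (\<M> A) M N" "\<And>W p. \<lbrakk>W \<in> Ob A; p \<in> el P W\<rbrakk> \<Longrightarrow> app \<psi> W (app \<pi> W p) = app \<phi> W p"
proof -
  define s where "s W x = (SOME p. p \<in> el P W \<and> app \<pi> W p = x)" for W x
  have s: "s W x \<in> el P W \<and> app \<pi> W (s W x) = x" if "W \<in> Ob A" "x \<in> el M W" for W x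
    unfolding s_def by (rule someI_ex) (use surj[OF that] in blast)
  have ob: "P \<in> Ob (\<M> A)" "M \<in> Ob (\<M> A)" "N \<in> Ob (\<M> A)" using Mod_ob p q by auto
  have eq: "app \<phi> W x = app \<phi> W y" if "W \<in> Ob A" "x \<in> el P W" "y \<in> el P W" "app \<pi> W x = app \<pi> W y" for W x y
  proof -
    interpret P: comm_group "Fob P W" using mod_group ob that by blast
    interpret M: comm_group "Fob M W" using mod_group ob that by blast
    interpret N: comm_group "Fob N W" using mod_group ob that by blast
    have "app \<pi> W (x \<otimes>[Fob P W] inv[Fob P W] y) = \<one>[Fob M W]"
      using that app_mult[OF p] app_inv[OF p] app_closed[OF p] by simp
    hence "app \<phi> W x \<otimes>[Fob N W] inv[Fob N W] app \<phi> W y = \<one>[Fob N W]"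
      using ker[of W "x \<otimes>[Fob P W] inv[Fob P W] y"] that app_mult[OF q] app_inv[OF q] by simp
    thus ?thesis using N.inv_equality[of "app \<phi> W x" "inv[Fob N W] app \<phi> W y"] app_closed[OF q] that by simp
  qed
  have cl: "app \<phi> W (s W x) \<in> el N W" if "W \<in> Ob A" "x \<in> el M W" for W x
    using app_closed[OF q] s that by blast
  have mu: "app \<phi> W (s W (x \<otimes>[Fob M W] y)) = app \<phi> W (s W x) \<otimes>[Fob N W] app \<phi> W (s W y)"
    if "W \<in> Ob A" "x \<in> el M W" "y \<in> el M W" for W x y
  proof -
    interpret P: comm_group "Fob P W" using mod_group ob that by blast
    interpret M: comm_group "Fob M W" using mod_group ob that by blast
    have "app \<phi> W (s W (x \<otimes>[Fob M W] y)) = app \<phi> W (s W x \<otimes>[Fob P W] s W y)"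
      by (rule eq) (use that s app_mult[OF p] in auto)
    thus ?thesis using app_mult[OF q] s that by simp
  qed
  have na: "app \<phi> X (s X (act M f x)) = act N f (app \<phi> Y (s Y x))" if "f \<in> Hom A X Y" "x \<in> el M Y" for f X Y x
  proof -
    have XY: "X \<in> Ob A" "Y \<in> Ob A" using hom_ob that by blast+
    have "app \<phi> X (s X (act M f x)) = app \<phi> X (act P f (s Y x))"
      by (rule eq) (use that s XY act_closed[OF ob(1)] act_closed[OF ob(2)] app_natural[OF p] in auto)
    thus ?thesis using app_natural[OF q that(1)] s XY that by simp
  qed
  have mk: "mk_hom A M N (\<lambda>W x. app \<phi> W (s W x)) \<in> Hom (\<M> A) M N"
    "\<And>W x. \<lbrakk>W \<in> Ob A; x \<in> el M W\<rbrakk> \<Longrightarrow> app (mk_hom A M N (\<lambda>W x. app \<phi> W (s W x))) W x = app \<phi> W (s W x)"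
    by (rule mk_hom; (assumption | rule ob(2,3) | (rule cl mu na; assumption+)))+
  show thesis
  proof (rule that[OF mk(1)])
    fix W x assume "W \<in> Ob A" "x \<in> el P W"
    thus "app (mk_hom A M N (\<lambda>W x. app \<phi> W (s W x))) W (app \<pi> W x) = app \<phi> W x"
      using mk(2)[of W "app \<pi> W x"] app_closed[OF p, of W x] s[of W "app \<pi> W x"]
        eq[of W "s W (app \<pi> W x)" x] by simp
  qed
qed

text \<open>Here the chosen preimage is unique by injectivity, and uniqueness makes the choice
  itself additive and natural.\<close>

lemma factor_mono: assumes i: "\<iota> \<in> Hom (\<M> A) K M" and q: "\<phi> \<in> Hom (\<M> A) N M"
    and inj: "\<And>W x. \<lbrakk>W \<in> Ob A; x \<in> el K W; app \<iota> W x = \<one>[Fob M W]\<rbrakk> \<Longrightarrow> x = \<one>[Fob K W]"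
    and im: "\<And>W x. \<lbrakk>W \<in> Ob A; x \<in> el N W\<rbrakk> \<Longrightarrow> \<exists>k\<in>el K W. app \<iota> W k = app \<phi> W x"
  obtains \<psi> where "\<psi> \<in> Hom (\<M> A) N K" "\<And>W x. \<lbrakk>W \<in> Ob A; x \<in> el N W\<rbrakk> \<Longrightarrow> app \<iota> W (app \<psi> W x) = app \<phi> W x"
proof -
  define s where "s W x = (SOME k. k \<in> el K W \<and> app \<iota> W k = app \<phi> W x)" for W x
  have s: "s W x \<in> el K W" "app \<iota> W (s W x) = app \<phi> W x" if "W \<in> Ob A" "x \<in> el N W" for W x
    using someI_ex[of "\<lambda>k. k \<in> el K W \<and> app \<iota> W k = app \<phi> W x"] im[OF that] unfolding s_def by blast+
  have ob: "K \<in> Ob (\<M> A)" "M \<in> Ob (\<M> A)" "N \<in> Ob (\<M> A)" using Mod_ob i q by auto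
  have eq: "x = y" if "W \<in> Ob A" "x \<in> el K W" "y \<in> el K W" "app \<iota> W x = app \<iota> W y" for W x y
  proof -
    interpret K: comm_group "Fob K W" using mod_group ob that by blast
    interpret M: comm_group "Fob M W" using mod_group ob that by blast
    have "app \<iota> W (x \<otimes>[Fob K W] inv[Fob K W] y) = \<one>[Fob M W]"
      using that app_mult[OF i] app_inv[OF i] app_closed[OF i] by simp
    hence "x \<otimes>[Fob K W] inv[Fob K W] y = \<one>[Fob K W]"
      using inj[of W "x \<otimes>[Fob K W] inv[Fob K W] y"] that by simp
    thus ?thesis using K.inv_equality[of x "inv[Fob K W] y"] that by simp
  qed
  have mu: "s W (x \<otimes>[Fob N W] y) = s W x \<otimes>[Fob K W] s W y" if "W \<in> Ob A" "x \<in> el N W" "y \<in> el N W" for W x y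
  proof -
    interpret K: comm_group "Fob K W" using mod_group ob that by blast
    interpret N: comm_group "Fob N W" using mod_group ob that by blast
    show ?thesis by (rule eq) (use that s app_mult[OF i] app_mult[OF q] in auto)
  qed
  have na: "s X (act N f x) = act K f (s Y x)" if "f \<in> Hom A X Y" "x \<in> el N Y" for f X Y x
  proof -
    have XY: "X \<in> Ob A" "Y \<in> Ob A" using hom_ob that by blast+
    show ?thesis
      by (rule eq) (use that s XY act_closed[OF ob(1)] act_closed[OF ob(3)] app_natural[OF i that(1)]
          app_natural[OF q that(1)] in auto)
  qed
  have mk: "mk_hom A N K s \<in> Hom (\<M> A) N K" "\<And>W x. \<lbrakk>W \<in> Ob A; x \<in> el N W\<rbrakk> \<Longrightarrow> app (mk_hom A N K s) W x = s W x"
    by (rule mk_hom; (assumption | rule ob(3,1) | (rule s(1) mu na; assumption+)))+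
  show thesis
  proof (rule that[OF mk(1)])
    fix W x assume "W \<in> Ob A" "x \<in> el N W"
    thus "app \<iota> W (app (mk_hom A N K s) W x) = app \<phi> W x" using mk(2)[of W x] s by simp
  qed
qed

section \<open>Quotient modules and submodules\<close>

lemma comm_group_image:
  assumes "comm_group G" "\<And>x y. \<lbrakk>x \<in> carrier G; y \<in> carrier G\<rbrakk> \<Longrightarrow> h (x \<otimes>[G] y) = h x \<otimes>[H] h y"
    "carrier H = h ` carrier G" "\<one>[H] = h \<one>[G]" shows "comm_group H"
proof -
  interpret G: comm_group G by fact
  show ?thesis
  proof (rule comm_groupI)
    fix x assume "x \<in> carrier H"
    then obtain a where "x = h a" "a \<in> carrier G" using assms(3) by blast
    thus "\<exists>y\<in>carrier H. y \<otimes>[H] x = \<one>[H]" using assms(2)[of "inv[G] a" a, symmetric] assms(3,4) by auto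
  next
    fix x y assume "x \<in> carrier H" "y \<in> carrier H"
    then obtain a b where ab: "x = h a" "a \<in> carrier G" "y = h b" "b \<in> carrier G" using assms(3) by blast
    show "x \<otimes>[H] y \<in> carrier H" unfolding ab(1,3) assms(2)[OF ab(2,4), symmetric] assms(3) using ab by blast
    show "x \<otimes>[H] y = y \<otimes>[H] x"
      unfolding ab(1,3) assms(2)[OF ab(2,4), symmetric] assms(2)[OF ab(4,2), symmetric]
      using ab G.m_comm by simp
    fix z assume "z \<in> carrier H"
    then obtain c where c: "z = h c" "c \<in> carrier G" using assms(3) by blast
    show "x \<otimes>[H] y \<otimes>[H] z = x \<otimes>[H] (y \<otimes>[H] z)"
      using ab c assms(2)[of "a \<otimes>[G] b" c] assms(2)[of a "b \<otimes>[G] c"] assms(2)[OF ab(2,4)]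
        assms(2)[OF ab(4) c(2)] by (simp add: G.m_assoc)
  next
    show "\<one>[H] \<in> carrier H" using assms(3,4) by simp
    fix x assume "x \<in> carrier H"
    then obtain a where "x = h a" "a \<in> carrier G" using assms(3) by blast
    thus "\<one>[H] \<otimes>[H] x = x" using assms(2)[of "\<one>[G]" a] assms(4) by simp
  qed
qed

text \<open>Module values must consist of elements of the arrow type, so cosets cannot serve as
  elements. The quotient is carried by one chosen representative of each coset, and every operation
  is followed by the map \<open>r\<close> to the chosen representative.\<close>

lemma quotient_module: assumes M: "M \<in> Ob (\<M> A)" and sub: "\<And>W. W \<in> Ob A \<Longrightarrow> subgroup (K W) (Fob M W)"
    and st: "\<And>f X Y x. \<lbrakk>f \<in> Hom A X Y; x \<in> K Y\<rbrakk> \<Longrightarrow> act M f x \<in> K X" obtains N \<pi> where "\<pi> \<in> Hom (\<M> A) M N"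
    "\<And>W x. \<lbrakk>W \<in> Ob A; x \<in> el N W\<rbrakk> \<Longrightarrow> \<exists>y\<in>el M W. app \<pi> W y = x"
    "\<And>W x. \<lbrakk>W \<in> Ob A; x \<in> el M W\<rbrakk> \<Longrightarrow> app \<pi> W x = \<one>[Fob N W] \<longleftrightarrow> x \<in> K W"
proof -
  define r where "r W x = (SOME z. z \<in> K W #>[Fob M W] x)" for W x
  have r_in: "r W x \<in> K W #>[Fob M W] x" if "W \<in> Ob A" "x \<in> el M W" for W x
  proof -
    interpret G: comm_group "Fob M W" using mod_group M that by blast
    have "x \<in> K W #>[Fob M W] x" using G.rcos_self[OF that(2) sub[OF that(1)]] .
    thus ?thesis unfolding r_def by (rule someI)
  qed
  have r_el: "r W x \<in> el M W" and r_coset: "K W #>[Fob M W] r W x = K W #>[Fob M W] x"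
    if "W \<in> Ob A" "x \<in> el M W" for W x
  proof -
    interpret G: comm_group "Fob M W" using mod_group M that by blast
    have K: "K W \<subseteq> el M W" using sub[OF that(1)] subgroup.subset by blast
    show "r W x \<in> el M W" using G.r_coset_subset_G[OF K that(2)] r_in[OF that] by blast
    show "K W #>[Fob M W] r W x = K W #>[Fob M W] x"
      by (rule G.repr_independence[OF r_in[OF that] that(2) sub[OF that(1)], symmetric])
  qed
  have coset_iff: "K W #>[Fob M W] x = K W #>[Fob M W] y \<longleftrightarrow> x \<otimes>[Fob M W] inv[Fob M W] y \<in> K W"
    if "W \<in> Ob A" "x \<in> el M W" "y \<in> el M W" for W x y
  proof -
    interpret G: comm_group "Fob M W" using mod_group M that by blast
    interpret K: subgroup "K W" "Fob M W" using sub that by blast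
    show ?thesis
    proof
      assume "K W #>[Fob M W] x = K W #>[Fob M W] y"
      hence "x \<in> K W #>[Fob M W] y" using G.rcos_self[OF that(2) sub[OF that(1)]] by simp
      thus "x \<otimes>[Fob M W] inv[Fob M W] y \<in> K W" using K.rcos_module_imp[OF G.is_group that(3)] by simp
    next
      assume "x \<otimes>[Fob M W] inv[Fob M W] y \<in> K W"
      hence "x \<in> K W #>[Fob M W] y" using K.rcos_module_rev[OF G.is_group that(3,2)] by simp
      thus "K W #>[Fob M W] x = K W #>[Fob M W] y"
        using G.repr_independence[OF _ that(3) sub[OF that(1)]] by simp
    qed
  qed
  \<comment> \<open>\<open>r\<close> depends on \<open>x\<close> only through its coset, and the
    representative lies in that coset, so equal representatives mean equal cosets.\<close>
  have r_eq: "r W x = r W y \<longleftrightarrow> x \<otimes>[Fob M W] inv[Fob M W] y \<in> K W"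
    if "W \<in> Ob A" "x \<in> el M W" "y \<in> el M W" for W x y
    using coset_iff[OF that] r_coset[OF that(1,2)] r_coset[OF that(1,3)] unfolding r_def by metis
  have r_r: "r W x \<otimes>[Fob M W] inv[Fob M W] x \<in> K W" if "W \<in> Ob A" "x \<in> el M W" for W x
    using coset_iff[OF that(1) r_el[OF that] that(2)] r_coset[OF that] by blast
  have r_mult: "r W (r W x \<otimes>[Fob M W] r W y) = r W (x \<otimes>[Fob M W] y)"
    if "W \<in> Ob A" "x \<in> el M W" "y \<in> el M W" for W x y
  proof -
    interpret G: comm_group "Fob M W" using mod_group M that by blast
    note rx = r_el[OF that(1,2)] and ry = r_el[OF that(1,3)]
    have "(r W x \<otimes>[Fob M W] inv[Fob M W] x) \<otimes>[Fob M W] (r W y \<otimes>[Fob M W] inv[Fob M W] y) \<in> K W"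
      using subgroup.m_closed[OF sub[OF that(1)] r_r[OF that(1,2)] r_r[OF that(1,3)]] .
    moreover have "(r W x \<otimes>[Fob M W] inv[Fob M W] x) \<otimes>[Fob M W] (r W y \<otimes>[Fob M W] inv[Fob M W] y)
      = (r W x \<otimes>[Fob M W] r W y) \<otimes>[Fob M W] inv[Fob M W] (x \<otimes>[Fob M W] y)"
      using rx ry that by (simp add: G.inv_mult G.m_ac)
    ultimately show ?thesis using r_eq[OF that(1)] rx ry that by simp
  qed
  have r_act: "r X (act M f (r Y x)) = r X (act M f x)" if "f \<in> Hom A X Y" "x \<in> el M Y" for f X Y x
  proof -
    have XY: "X \<in> Ob A" "Y \<in> Ob A" using hom_ob that by blast+
    interpret G: comm_group "Fob M X" using mod_group M XY by blast
    interpret H: comm_group "Fob M Y" using mod_group M XY by blast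
    have "act M f (r Y x \<otimes>[Fob M Y] inv[Fob M Y] x) \<in> K X" using st that r_r XY by blast
    thus ?thesis using r_eq[OF XY(1)] r_el[OF XY(2) that(2)] that(2) act_closed[OF M that(1)]
        act_mult[OF M that(1)] act_inv[OF M that(1)] by simp
  qed
  define G where "G W = \<lparr>carrier = r W ` el M W, monoid.mult = (\<lambda>x y. r W (x \<otimes>[Fob M W] y)),
    one = r W \<one>[Fob M W]\<rparr>" for W
  have Gs: "carrier (G W) = r W ` el M W" "x \<otimes>[G W] y = r W (x \<otimes>[Fob M W] y)" "\<one>[G W] = r W \<one>[Fob M W]"
    for W x y by (simp_all add: G_def)
  \<comment> \<open>\<open>r W\<close> respects products by \<open>r_mult\<close> and is onto the
    carrier of \<open>G W\<close>, so the group laws are inherited as those of an image.\<close>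
  have grp: "comm_group (G W)" if "W \<in> Ob A" for W
    by (rule comm_group_image[OF mod_group[OF M that], of "r W"]) (use r_mult that in \<open>simp_all add: Gs\<close>)
  have rr: "r W (r W x) = r W x" if "W \<in> Ob A" "x \<in> el M W" for W x
    using r_eq[OF that(1) r_el[OF that] that(2)] r_r[OF that] by blast
  \<comment> \<open>\<open>r\<close> needs the object at which to normalize; for the action of
    \<open>f\<close> this is the domain of \<open>f\<close>.\<close>
  let ?N = "mk_mod A G (\<lambda>f x. r (Dom A f) (act M f x))"
  have N1: "r (Dom A f) (act M f x) \<in> carrier (G X)" if "f \<in> Hom A X Y" "x \<in> carrier (G Y)" for f X Y x
    using that act_closed[OF M that(1)] r_el[of Y] by (auto simp: Gs hom_iff)
  have N2: "r (Dom A f) (act M f (x \<otimes>[G Y] y)) = r (Dom A f) (act M f x) \<otimes>[G X] r (Dom A f) (act M f y)"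
    if "f \<in> Hom A X Y" "x \<in> carrier (G Y)" "y \<in> carrier (G Y)" for f X Y x y
  proof -
    have XY: "X \<in> Ob A" "Y \<in> Ob A" using hom_ob that by blast+
    have [simp]: "Dom A f = X" using that by (simp add: hom_iff)
    interpret H: comm_group "Fob M Y" using mod_group M XY by blast
    have xy: "x \<in> el M Y" "y \<in> el M Y" using that r_el XY by (auto simp: Gs)
    show ?thesis
      using xy r_act[OF that(1)] r_mult[OF XY(1)] act_mult[OF M that(1)] act_closed[OF M that(1)]
      by (simp add: Gs)
  qed
  have N3: "r (Dom A (Idn A X)) (act M (Idn A X) x) = x" if "X \<in> Ob A" "x \<in> carrier (G X)" for X x
    using that rr act_idn[OF M] r_el by (auto simp: Gs)
  have N4: "r (Dom A (g \<cdot> f)) (act M (g \<cdot> f) x) = r (Dom A f) (act M f (r (Dom A g) (act M g x)))"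
    if "f \<in> Hom A X Y" "g \<in> Hom A Y Z" "x \<in> carrier (G Z)" for f g X Y Z x
  proof -
    have [simp]: "Dom A f = X" "Dom A g = Y" "Dom A (g \<cdot> f) = X" using that by (auto simp: hom_iff)
    have "x \<in> el M Z" using that r_el hom_ob[OF that(2)] by (auto simp: Gs)
    thus ?thesis using r_act[OF that(1)] act_closed[OF M that(2)] act_cmp[OF M that(1,2)] by simp
  qed
  have N5: "r (Dom A (f \<boxplus> g)) (act M (f \<boxplus> g) x) = r (Dom A f) (act M f x) \<otimes>[G X] r (Dom A g) (act M g x)"
    if "f \<in> Hom A X Y" "g \<in> Hom A X Y" "x \<in> carrier (G Y)" for f g X Y x
  proof -
    have XY: "X \<in> Ob A" "Y \<in> Ob A" using hom_ob that by blast+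
    have [simp]: "Dom A f = X" "Dom A g = X" "Dom A (f \<boxplus> g) = X" using that by (auto simp: hom_iff)
    have "x \<in> el M Y" using that r_el XY by (auto simp: Gs)
    thus ?thesis
      using act_add[OF M that(1,2)] r_mult[OF XY(1)] act_closed[OF M that(1)] act_closed[OF M that(2)]
      by (simp add: Gs)
  qed
  have N: "?N \<in> Ob (\<M> A)" "\<And>W. W \<in> Ob A \<Longrightarrow> Fob ?N W = G W"
    "\<And>f X Y x. \<lbrakk>f \<in> Hom A X Y; x \<in> carrier (G Y)\<rbrakk> \<Longrightarrow> act ?N f x = r (Dom A f) (act M f x)"
    by (rule mk_mod; (assumption | (rule grp N1 N2 N3 N4 N5; assumption+)))+
  have h1: "r W x \<in> el ?N W" if "W \<in> Ob A" "x \<in> el M W" for W x using that N(2) by (simp add: Gs)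
  have h2: "r W (x \<otimes>[Fob M W] y) = r W x \<otimes>[Fob ?N W] r W y" if "W \<in> Ob A" "x \<in> el M W" "y \<in> el M W" for W x y
    using that N(2) r_mult by (simp add: Gs)
  have h3: "r X (act M f x) = act ?N f (r Y x)" if "f \<in> Hom A X Y" "x \<in> el M Y" for f X Y x
    using N(3)[OF that(1), of "r Y x"] that r_act[OF that] by (simp add: Gs hom_iff)
  have h: "mk_hom A M ?N r \<in> Hom (\<M> A) M ?N"
    "\<And>W x. \<lbrakk>W \<in> Ob A; x \<in> el M W\<rbrakk> \<Longrightarrow> app (mk_hom A M ?N r) W x = r W x"
    by (rule mk_hom; (assumption | rule M N(1) | (rule h1 h2 h3; assumption+)))+
  show thesis
  proof (rule that[OF h(1)])
    fix W x assume W: "W \<in> Ob A"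
    { assume "x \<in> el ?N W"
      thus "\<exists>y\<in>el M W. app (mk_hom A M ?N r) W y = x" using W N(2) h(2) by (auto simp: Gs) }
    interpret G: comm_group "Fob M W" using mod_group M W by blast
    assume x: "x \<in> el M W"
    thus "app (mk_hom A M ?N r) W x = \<one>[Fob ?N W] \<longleftrightarrow> x \<in> K W"
      using h(2)[OF W x] N(2)[OF W] r_eq[OF W x G.one_closed] by (simp add: Gs)
  qed
qed

lemma sub_module: assumes M: "M \<in> Ob (\<M> A)" and sub: "\<And>W. W \<in> Ob A \<Longrightarrow> subgroup (K W) (Fob M W)"
    and st: "\<And>f X Y x. \<lbrakk>f \<in> Hom A X Y; x \<in> K Y\<rbrakk> \<Longrightarrow> act M f x \<in> K X" obtains N \<iota> where "\<iota> \<in> Hom (\<M> A) N M"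
    "\<And>W. W \<in> Ob A \<Longrightarrow> el N W = K W" "\<And>W x. \<lbrakk>W \<in> Ob A; x \<in> K W\<rbrakk> \<Longrightarrow> app \<iota> W x = x"
    "\<And>W. W \<in> Ob A \<Longrightarrow> \<one>[Fob N W] = \<one>[Fob M W]"
proof -
  define G where "G W = (Fob M W)\<lparr>carrier := K W\<rparr>" for W
  have Gs: "carrier (G W) = K W" "x \<otimes>[G W] y = x \<otimes>[Fob M W] y" "\<one>[G W] = \<one>[Fob M W]" for W x y
    by (simp_all add: G_def)
  have K: "x \<in> el M W" if "W \<in> Ob A" "x \<in> K W" for W x using subgroup.subset[OF sub] that by blast
  have grp: "comm_group (G W)" if "W \<in> Ob A" for W
  proof -
    interpret H: comm_group "Fob M W" using mod_group M that by blast
    have "group (G W)" unfolding G_def by (rule subgroup.subgroup_is_group[OF sub[OF that]]) unfold_locales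
    thus ?thesis by (rule group.group_comm_groupI) (use K[OF that] in \<open>simp add: Gs H.m_comm\<close>)
  qed
  let ?N = "mk_mod A G (\<lambda>f x. act M f x)"
  have ob: "X \<in> Ob A" "Y \<in> Ob A" if "f \<in> Hom A X Y" for f X Y using hom_ob that by blast+
  have "?N \<in> Ob (\<M> A) \<and> (\<forall>W\<in>Ob A. Fob ?N W = G W) \<and>
    (\<forall>f X Y x. f \<in> Hom A X Y \<longrightarrow> x \<in> K Y \<longrightarrow> act ?N f x = act M f x)"
    by (intro conjI ballI allI impI; rule mk_mod)
      (use grp st K ob act_mult[OF M] act_idn[OF M] act_cmp[OF M] act_add[OF M] in \<open>auto simp: Gs\<close>)
  hence N: "?N \<in> Ob (\<M> A)" "\<And>W. W \<in> Ob A \<Longrightarrow> Fob ?N W = G W"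
    "\<And>f X Y x. \<lbrakk>f \<in> Hom A X Y; x \<in> K Y\<rbrakk> \<Longrightarrow> act ?N f x = act M f x" by blast+
  have h1: "x \<in> el M W" if "W \<in> Ob A" "x \<in> el ?N W" for W x using that N(2) K by (simp add: Gs)
  have h2: "x \<otimes>[Fob ?N W] y = x \<otimes>[Fob M W] y" if "W \<in> Ob A" for W x y using that N(2) by (simp add: Gs)
  have h3: "act ?N f x = act M f x" if "f \<in> Hom A X Y" "x \<in> el ?N Y" for f X Y x
    using N(3)[OF that(1), of x] that(2) N(2) ob[OF that(1)] by (simp add: Gs)
  have h: "mk_hom A ?N M (\<lambda>W x. x) \<in> Hom (\<M> A) ?N M"
    "\<And>W x. \<lbrakk>W \<in> Ob A; x \<in> el ?N W\<rbrakk> \<Longrightarrow> app (mk_hom A ?N M (\<lambda>W x. x)) W x = x"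
    by (rule mk_hom; (assumption | rule M N(1) | (rule h1 h2 h3; assumption+)))+
  show thesis by (rule that[OF h(1)]) (use h(2) N(2) in \<open>simp_all add: Gs\<close>)
qed

end

section \<open>Admissible presentations\<close>

text \<open>Universal elements are used instead of homomorphisms \<open>\<Upsilon> Y \<rightarrow> M\<close>: \<open>y\<close> generates \<open>M\<close>, and
  \<open>f\<close> generates the relations.\<close>

definition pres :: "('o, 'm, 'z) ecat_scheme \<Rightarrow> ('o, 'm) md \<Rightarrow> 'm \<Rightarrow> 'm \<Rightarrow> bool" where
  "pres E M f y \<longleftrightarrow> admissible E f \<and> f \<in> Ar E \<and> y \<in> el M (Cod E f) \<and> act M f y = \<one>[Fob M (Dom E f)] \<and>
     (\<forall>W\<in>Ob E. \<forall>x\<in>el M W. \<exists>g\<in>Hom E W (Cod E f). act M g y = x) \<and>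
     (\<forall>W. \<forall>g\<in>Hom E W (Cod E f). act M g y = \<one>[Fob M W] \<longrightarrow> (\<exists>s\<in>Hom E W (Dom E f). f \<cdot>[E] s = g))"

text \<open>Formulated for arbitrary modules, since such a sequence is often used to prove that one
  of its terms is admissibly presented.\<close>

definition short_exact :: "('o, 'm, 'z) acat_scheme \<Rightarrow> ('o, 'm) md \<Rightarrow> ('o, 'm) md \<Rightarrow> ('o, 'm) md \<Rightarrow>
    ('o, 'm) md_hom \<Rightarrow> ('o, 'm) md_hom \<Rightarrow> bool" where
  "short_exact A L M N \<alpha> \<beta> \<longleftrightarrow> \<alpha> \<in> Hom (\<M> A) L M \<and> \<beta> \<in> Hom (\<M> A) M N \<and>
     (\<forall>W\<in>Ob A. \<forall>x\<in>el L W. app \<alpha> W x = \<one>[Fob M W] \<longrightarrow> x = \<one>[Fob L W]) \<and>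
     (\<forall>W\<in>Ob A. \<forall>x\<in>el M W. app \<beta> W x = \<one>[Fob N W] \<longleftrightarrow> (\<exists>l\<in>el L W. app \<alpha> W l = x)) \<and>
     (\<forall>W\<in>Ob A. \<forall>z\<in>el N W. \<exists>x\<in>el M W. app \<beta> W x = z)"

lemma short_exactD: assumes "short_exact A L M N \<alpha> \<beta>" shows "\<alpha> \<in> Hom (\<M> A) L M" "\<beta> \<in> Hom (\<M> A) M N"
    "\<And>W x. \<lbrakk>W \<in> Ob A; x \<in> el L W; app \<alpha> W x = \<one>[Fob M W]\<rbrakk> \<Longrightarrow> x = \<one>[Fob L W]"
    "\<And>W x. \<lbrakk>W \<in> Ob A; x \<in> el M W\<rbrakk> \<Longrightarrow> app \<beta> W x = \<one>[Fob N W] \<longleftrightarrow> (\<exists>l\<in>el L W. app \<alpha> W l = x)"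
    "\<And>W z. \<lbrakk>W \<in> Ob A; z \<in> el N W\<rbrakk> \<Longrightarrow> \<exists>x\<in>el M W. app \<beta> W x = z" using assms unfolding short_exact_def by blast+

context preadditive_category
begin

lemma app_inj: assumes "\<alpha> \<in> Hom (\<M> A) M N" "W \<in> Ob A" "x \<in> el M W" "y \<in> el M W" "app \<alpha> W x = app \<alpha> W y"
    and inj: "\<And>z. \<lbrakk>z \<in> el M W; app \<alpha> W z = \<one>[Fob N W]\<rbrakk> \<Longrightarrow> z = \<one>[Fob M W]" shows "x = y"
proof -
  interpret M: comm_group "Fob M W" using mod_group Mod_ob assms by blast
  interpret N: comm_group "Fob N W" using mod_group Mod_ob assms by blast
  have "x \<otimes>[Fob M W] inv[Fob M W] y = \<one>[Fob M W]"
    using assms(1-5) by (intro inj) (simp_all add: app_mult app_inv app_closed)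
  thus ?thesis using M.inv_equality[of x "inv[Fob M W] y"] assms by simp
qed

lemma app_neg: assumes "\<alpha> \<in> Hom (\<M> A) M N" "W \<in> Ob A" "x \<in> el M W"
  shows "app (Neg (\<M> A) \<alpha>) W x = inv[Fob N W] app \<alpha> W x"
proof -
  interpret Mod: preadditive_category "\<M> A" by (rule preadditive_Mod)
  interpret N: comm_group "Fob N W" using mod_group Mod_ob assms by blast
  note n = Mod.neg_hom[OF assms(1)]
  have "app (Neg (\<M> A) \<alpha>) W x \<otimes>[Fob N W] app \<alpha> W x = \<one>[Fob N W]"
    using app_add[OF n assms] app_zer[OF assms(2,3)] Mod.hom_add_neg(2)[OF assms(1)] by simp
  thus ?thesis using N.inv_equality app_closed[OF n assms(2,3)] app_closed[OF assms] by simp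
qed

lemma image_subgroup: assumes "\<alpha> \<in> Hom (\<M> A) L M" "W \<in> Ob A" shows "subgroup (app \<alpha> W ` el L W) (Fob M W)"
  using group_hom.img_is_subgroup[of "Fob L W" "Fob M W" "app \<alpha> W"] at_app(2)[OF assms]
    mod_group Mod_ob[OF assms(1)] assms(2)
  by (simp add: group_hom_def group_hom_axioms_def comm_group.axioms(2))

lemma kernel_subgroup: assumes "\<alpha> \<in> Hom (\<M> A) L M" "W \<in> Ob A"
  shows "subgroup {x \<in> el L W. app \<alpha> W x = \<one>[Fob M W]} (Fob L W)"
  using group_hom.subgroup_kernel[of "Fob L W" "Fob M W" "app \<alpha> W"] at_app(2)[OF assms]
    mod_group Mod_ob[OF assms(1)] assms(2)
  by (simp add: group_hom_def group_hom_axioms_def comm_group.axioms(2) kernel_def)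

text \<open>Cokernels, and below kernels, are formed among all modules; whether they are admissibly
  presented is decided afterwards, mostly by closure under extensions.\<close>

lemma cokernel_module: assumes "\<alpha> \<in> Hom (\<M> A) L M" obtains N \<beta> where "\<beta> \<in> Hom (\<M> A) M N"
    "\<And>W z. \<lbrakk>W \<in> Ob A; z \<in> el N W\<rbrakk> \<Longrightarrow> \<exists>x\<in>el M W. app \<beta> W x = z"
    "\<And>W x. \<lbrakk>W \<in> Ob A; x \<in> el M W\<rbrakk> \<Longrightarrow> app \<beta> W x = \<one>[Fob N W] \<longleftrightarrow> (\<exists>l\<in>el L W. app \<alpha> W l = x)"
proof -
  have st: "act M f x \<in> app \<alpha> X ` el L X" if "f \<in> Hom A X Y" "x \<in> app \<alpha> Y ` el L Y" for f X Y x
    using that app_natural[OF assms that(1)] act_closed[OF Mod_ob(1)[OF assms] that(1)] by force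
  show thesis
  proof (rule quotient_module[OF Mod_ob(2)[OF assms], where K = "\<lambda>W. app \<alpha> W ` el L W"])
    fix N \<beta> assume N: "\<beta> \<in> Hom (\<M> A) M N" "\<And>W x. \<lbrakk>W \<in> Ob A; x \<in> el N W\<rbrakk> \<Longrightarrow> \<exists>y\<in>el M W. app \<beta> W y = x"
      "\<And>W x. \<lbrakk>W \<in> Ob A; x \<in> el M W\<rbrakk> \<Longrightarrow> app \<beta> W x = \<one>[Fob N W] \<longleftrightarrow> x \<in> app \<alpha> W ` el L W"
    show thesis by (rule that[OF N(1,2)]) (use N(3) in auto)
  qed (use image_subgroup[OF assms] st in auto)
qed

lemma kernel_module: assumes "\<beta> \<in> Hom (\<M> A) M N" obtains L \<alpha> where "\<alpha> \<in> Hom (\<M> A) L M"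
    "\<And>W x. \<lbrakk>W \<in> Ob A; x \<in> el L W; app \<alpha> W x = \<one>[Fob M W]\<rbrakk> \<Longrightarrow> x = \<one>[Fob L W]"
    "\<And>W x. \<lbrakk>W \<in> Ob A; x \<in> el M W\<rbrakk> \<Longrightarrow> app \<beta> W x = \<one>[Fob N W] \<longleftrightarrow> (\<exists>l\<in>el L W. app \<alpha> W l = x)"
proof -
  have st: "act M f x \<in> {x \<in> el M X. app \<beta> X x = \<one>[Fob N X]}"
    if "f \<in> Hom A X Y" "x \<in> {x \<in> el M Y. app \<beta> Y x = \<one>[Fob N Y]}" for f X Y x
    using that app_natural[OF assms that(1)] act_closed[OF Mod_ob(1)[OF assms] that(1)]
      act_one[OF Mod_ob(2)[OF assms] that(1)] by auto
  show thesis
  proof (rule sub_module[OF Mod_ob(1)[OF assms], where K = "\<lambda>W. {x \<in> el M W. app \<beta> W x = \<one>[Fob N W]}"])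
    fix L \<iota> assume L: "\<iota> \<in> Hom (\<M> A) L M" "\<And>W. W \<in> Ob A \<Longrightarrow> el L W = {x \<in> el M W. app \<beta> W x = \<one>[Fob N W]}"
      "\<And>W x. \<lbrakk>W \<in> Ob A; x \<in> {x \<in> el M W. app \<beta> W x = \<one>[Fob N W]}\<rbrakk> \<Longrightarrow> app \<iota> W x = x"
      "\<And>W. W \<in> Ob A \<Longrightarrow> \<one>[Fob L W] = \<one>[Fob M W]"
    show thesis by (rule that[OF L(1)]) (use L(2-4) in auto)
  qed (rule kernel_subgroup[OF assms] st; assumption)+
qed

end

section \<open>Cokernels of admissible arrows and presentations by elements\<close>

context exact_category
begin

lemma deflation_cmp_cokernel: assumes "is_cokernel E c m" "deflation E p" "p \<in> Hom E X I" "m \<in> Hom E I Y"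
  shows "is_cokernel E c (m \<cdot> p)"
  using cokernel_cmp_epi[OF assms(3,4)] deflation_epi[OF assms(2)] assms(1,3) by (auto simp: hom_iff)

text \<open>The deflation in a factorization can be cancelled, so the cokernel of its inflation,
  which comes from a conflation, is a cokernel of \<open>f\<close>.\<close>

lemma admissible_cokernel: assumes "admissible E f" "f \<in> Hom E X Y" obtains c where "is_cokernel E c f"
proof -
  obtain I m p where f: "inflation E m" "deflation E p" "p \<in> Hom E X I" "m \<in> Hom E I Y" "f = m \<cdot> p"
    using admissibleE[OF assms] by blast
  then obtain c where "(m, c) \<in> Conf E" unfolding inflation_def by blast
  from deflation_cmp_cokernel[OF conf_cokernel[OF this] f(2-4)] show ?thesis using that f(5) by blast
qed

lemma inflation_cmp_kernel: assumes "inflation E m" "m \<in> Hom E I Y" "p \<in> Hom E X I"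
  shows "is_kernel E k (m \<cdot> p) \<longleftrightarrow> is_kernel E k p"
  using kernel_cmp_mono[OF assms(2,3)] inflation_mono[OF assms(1)] assms(2) by (auto simp: hom_iff)

lemma admissible_ar: "admissible E f \<Longrightarrow> f \<in> Ar E"
  unfolding admissible_def using inflation_ar deflation_ar by auto

lemma presD: assumes "pres E M f y" "f \<in> Hom E X Y"
  shows "admissible E f" "y \<in> el M Y" "act M f y = \<one>[Fob M X]"
    "\<And>W x. \<lbrakk>W \<in> Ob E; x \<in> el M W\<rbrakk> \<Longrightarrow> \<exists>g\<in>Hom E W Y. act M g y = x"
    "\<And>W g. \<lbrakk>g \<in> Hom E W Y; act M g y = \<one>[Fob M W]\<rbrakk> \<Longrightarrow> \<exists>s\<in>Hom E W X. f \<cdot> s = g"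
  using assms unfolding pres_def by (auto simp: hom_iff)

lemma presI: assumes "admissible E f" "f \<in> Hom E X Y" "y \<in> el M Y" "act M f y = \<one>[Fob M X]"
    "\<And>W x. \<lbrakk>W \<in> Ob E; x \<in> el M W\<rbrakk> \<Longrightarrow> \<exists>g\<in>Hom E W Y. act M g y = x"
    "\<And>W g. \<lbrakk>g \<in> Hom E W Y; act M g y = \<one>[Fob M W]\<rbrakk> \<Longrightarrow> \<exists>s\<in>Hom E W X. f \<cdot> s = g" shows "pres E M f y"
  unfolding pres_def using assms by (auto simp: hom_iff)

lemma yoneda_simps: "X \<in> Ob E \<Longrightarrow> Fob (\<Upsilon> E) X = \<Y> E X" "f \<in> Ar E \<Longrightarrow> Far (\<Upsilon> E) f = \<y> E f"
  by (simp_all add: yoneda_def)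

text \<open>By the Yoneda lemma an epimorphism from the representable of \<open>Y\<close> is the
  same as a generator \<open>y\<close>, the image of the identity, and exactness says that
  \<open>f\<close> generates its relations.\<close>

lemma adm_presented_iff: "M \<in> adm E \<longleftrightarrow> M \<in> Ob (\<M> E) \<and> (\<exists>f y. pres E M f y)"
proof (intro iffI conjI; (elim conjE exE)?)
  assume "M \<in> adm E"
  then obtain f \<pi> where f: "M \<in> Ob (\<M> E)" "admissible E f"
    "\<pi> \<in> Hom (\<M> E) (Fob (\<Upsilon> E) (Cod E f)) M" "mod_exact_at E (Far (\<Upsilon> E) f) \<pi>" "mod_epi E \<pi>"
    unfolding adm_presented_def by blast
  show "M \<in> Ob (\<M> E)" by fact
  define X Y where "X = Dom E f" and "Y = Cod E f"
  have fh: "f \<in> Hom E X Y" using admissible_ar[OF f(2)] by (simp add: X_def Y_def hom_iff)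
  have ob: "X \<in> Ob E" "Y \<in> Ob E" using hom_ob[OF fh] .
  have p: "\<pi> \<in> Hom (\<M> E) (\<Y> E Y) M" using f(3) ob yoneda_simps by (simp add: Y_def)
  note y = yoneda_hom[OF p ob(2)]
  note ex = f(4)[unfolded yoneda_simps(2)[OF admissible_ar[OF f(2)]] mod_exact_iff[OF yoneda_ar(1)[OF fh] p]]
  note ep = f(5)[unfolded mod_epi_iff[OF p]]
  have "pres E M f (app \<pi> Y (Idn E Y))"
  proof (rule presI[OF f(2) fh y(1)])
    have "app \<pi> X f = \<one>[Fob M X]"
    proof -
      have "app (\<y> E f) X (Idn E X) = f" using yoneda_ar(2)[OF fh ob(1) id_hom] ob cmp_id_right[OF fh] by simp
      moreover have "Idn E X \<in> el (\<Y> E X) X" "f \<in> el (\<Y> E Y) X"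
        using ob fh id_hom by (simp_all add: yoneda_ob)
      ultimately show ?thesis using ex ob(1) by blast
    qed
    thus "act M f (app \<pi> Y (Idn E Y)) = \<one>[Fob M X]" using y(2)[OF ob(1) fh] by simp
    fix W
    { fix x assume "W \<in> Ob E" "x \<in> el M W"
      thus "\<exists>g\<in>Hom E W Y. act M g (app \<pi> Y (Idn E Y)) = x" using ep y(2) ob by (fastforce simp: yoneda_ob) }
    fix g assume g: "g \<in> Hom E W Y" "act M g (app \<pi> Y (Idn E Y)) = \<one>[Fob M W]"
    have W: "W \<in> Ob E" using hom_ob[OF g(1)] by blast
    have "g \<in> el (\<Y> E Y) W" "app \<pi> W g = \<one>[Fob M W]" using g y(2) W ob by (simp_all add: yoneda_ob)
    then obtain s where "s \<in> el (\<Y> E X) W" "app (\<y> E f) W s = g" using ex W by blast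
    thus "\<exists>s\<in>Hom E W X. f \<cdot> s = g" using yoneda_ar(2)[OF fh W] W ob by (auto simp: yoneda_ob)
  qed
  thus "\<exists>f y. pres E M f y" by blast
next
  fix f y assume M: "M \<in> Ob (\<M> E)" and P: "pres E M f y"
  define X Y where "X = Dom E f" and "Y = Cod E f"
  have fh: "f \<in> Hom E X Y" using P by (simp add: X_def Y_def hom_iff pres_def)
  have ob: "X \<in> Ob E" "Y \<in> Ob E" using hom_ob[OF fh] .
  note P = presD[OF P fh]
  note p = yel[OF M ob(2) P(2)]
  have fa: "f \<in> Ar E" "Cod E f = Y" using fh by (simp_all add: hom_iff)
  have "mod_epi E (yel E M Y y)" unfolding mod_epi_iff[OF p(1)] using P(4) p(2) ob by (fastforce simp: yoneda_ob)
  moreover have "mod_exact_at E (\<y> E f) (yel E M Y y)" unfolding mod_exact_iff[OF yoneda_ar(1)[OF fh] p(1)]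
  proof (intro ballI iffI)
    fix W g assume W: "W \<in> Ob E" and "g \<in> el (\<Y> E Y) W"
    hence g: "g \<in> Hom E W Y" using ob by (simp add: yoneda_ob)
    { assume "app (yel E M Y y) W g = \<one>[Fob M W]"
      then obtain s where "s \<in> Hom E W X" "f \<cdot> s = g" using P(5)[OF g] p(2)[OF W g] by auto
      thus "\<exists>s\<in>el (\<Y> E X) W. app (\<y> E f) W s = g" using W ob yoneda_ar(2)[OF fh W] by (auto simp: yoneda_ob) }
    assume "\<exists>s\<in>el (\<Y> E X) W. app (\<y> E f) W s = g"
    then obtain s where s: "s \<in> Hom E W X" "f \<cdot> s = g"
      using W ob yoneda_ar(2)[OF fh W] by (auto simp: yoneda_ob)
    have "act M g y = act M s (act M f y)" using act_cmp[OF M s(1) fh P(2)] s(2) by simp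
    also have "\<dots> = \<one>[Fob M W]" unfolding P(3) by (rule act_one[OF M s(1)])
    finally show "app (yel E M Y y) W g = \<one>[Fob M W]" using p(2)[OF W g] by simp
  qed
  ultimately show "M \<in> adm E"
    unfolding adm_presented_def using M P(1) p(1) yoneda_simps(1)[OF ob(2)] yoneda_simps(2)[OF fa(1)] fa(2)
    by force
qed

lemma adm_Mod: "M \<in> adm E \<Longrightarrow> M \<in> Ob (\<M> E)" using adm_presented_iff by blast

lemma presE: assumes "M \<in> adm E" obtains f y X Y where "pres E M f y" "f \<in> Hom E X Y" "X \<in> Ob E" "Y \<in> Ob E"
  using assms adm_presented_iff[of M] unfolding pres_def by (auto simp: hom_iff)

text \<open>A generator of the middle term combines the image of \<open>y'\<close> with a lift
  \<open>z\<close> of \<open>y''\<close>; the corner \<open>h\<close> of the new relation matrix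
  records how far \<open>z\<close> is from satisfying the relation \<open>f''\<close>. The data
  \<open>h\<close>, \<open>t\<close> and the behaviour of the generator belong to the conclusion
  because the horseshoe lemma is applied to them once more after a left exact functor.\<close>

lemma extension_pres: assumes ex: "short_exact E L M N \<alpha> \<beta>"
    and P': "pres E L f' y'" "f' \<in> Hom E X' Y'" and P'': "pres E N f'' y''" "f'' \<in> Hom E X'' Y''"
    and bX: "is_biproduct E X' X'' SX i1 i2 p1 p2" and bY: "is_biproduct E Y' Y'' SY j1 j2 q1 q2"
    and k: "is_kernel E k f''"
  obtains h t f y where "h \<in> Hom E X'' Y'" "t \<in> Hom E (Dom E k) X'" "h \<cdot> k = f' \<cdot> t"
    "f \<in> Hom E SX SY" "f \<cdot> i1 = j1 \<cdot> f'" "f \<cdot> i2 = j1 \<cdot> h \<boxplus> j2 \<cdot> f''"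
    "pres E M f y" "act M j1 y = app \<alpha> Y' y'" "app \<beta> SY y = act N q2 y''"
proof -
  note SE = short_exactD[OF ex]
  note a = SE(1) and b = SE(2)
  have M: "L \<in> Ob (\<M> E)" "M \<in> Ob (\<M> E)" "N \<in> Ob (\<M> E)" using Mod_ob a b by auto
  have ob: "X' \<in> Ob E" "X'' \<in> Ob E" "Y' \<in> Ob E" "Y'' \<in> Ob E" using hom_ob P'(2) P''(2) by auto
  note D' = presD[OF P'] note D'' = presD[OF P'']
  note BX = bX[unfolded is_biproduct_def] note BY = bY[unfolded is_biproduct_def]
  have SY: "SY \<in> Ob E" "SX \<in> Ob E" using BY BX by auto
  have gr: "comm_group (Fob L W)" "comm_group (Fob M W)" "comm_group (Fob N W)" if "W \<in> Ob E" for W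
    using mod_group M that by auto
  have jq: "j1 \<in> Hom E Y' SY" "j2 \<in> Hom E Y'' SY" "q1 \<in> Hom E SY Y'" "q2 \<in> Hom E SY Y''"
    "p1 \<in> Hom E SX X'" "p2 \<in> Hom E SX X''" "i1 \<in> Hom E X' SX" "i2 \<in> Hom E X'' SX" using BY BX by auto
  obtain z where z: "z \<in> el M Y''" "app \<beta> Y'' z = y''" using SE(5)[OF ob(4) D''(2)] by blast
  have "app \<beta> X'' (act M f'' z) = \<one>[Fob N X'']" using app_natural[OF b P''(2) z(1)] z(2) D''(3) by simp
  then obtain w where w: "w \<in> el L X''" "app \<alpha> X'' w = act M f'' z"
    using SE(4)[OF ob(2)] act_closed[OF M(2) P''(2) z(1)] by blast
  obtain h0 where h0: "h0 \<in> Hom E X'' Y'" "act L h0 y' = w" using D'(4)[OF ob(2) w(1)] by blast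
  \<comment> \<open>The sign makes \<open>act M h\<close> of the image of \<open>y'\<close> cancel
    \<open>act M f'' z\<close>, so that the second column of \<open>f\<close> kills
    \<open>y\<close>.\<close>
  define h where "h = Neg E h0"
  have h: "h \<in> Hom E X'' Y'" "act L h y' = inv[Fob L X''] w"
    unfolding h_def using neg_hom[OF h0(1)] act_neg[OF M(1) h0(1) D'(2)] h0(2) by auto
  have ah: "act M h (app \<alpha> Y' y') = inv[Fob M X''] act M f'' z"
    using app_natural[OF a h(1) D'(2)] h(2) app_inv[OF a ob(2) w(1)] w(2) by simp
  have ay: "app \<alpha> Y' y' \<in> el M Y'" using app_closed[OF a ob(3) D'(2)] .
  note KD = kernelD[OF k]
  have kh: "k \<in> Hom E (Dom E k) X''" using KD P''(2) by (simp add: hom_iff)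
  have Kob: "Dom E k \<in> Ob E" using hom_ob[OF kh] by blast
  \<comment> \<open>\<open>f'' \<cdot> k\<close> is zero, so the image of this element in
    \<open>M\<close> vanishes, and \<alpha> is injective. Hence \<open>h \<cdot> k\<close> is a
    relation of \<open>y'\<close> and factors through \<open>f'\<close>.\<close>
  have "act L (h \<cdot> k) y' = \<one>[Fob L (Dom E k)]"
  proof (rule SE(3)[OF Kob])
    interpret G: comm_group "Fob M (Dom E k)" using gr Kob by blast
    have hk: "h \<cdot> k \<in> Hom E (Dom E k) Y'" using cmp_hom[OF kh h(1)] .
    show "act L (h \<cdot> k) y' \<in> el L (Dom E k)" using act_closed[OF M(1) hk D'(2)] .
    have "app \<alpha> (Dom E k) (act L (h \<cdot> k) y') = act M (h \<cdot> k) (app \<alpha> Y' y')" using app_natural[OF a hk D'(2)] .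
    also have "\<dots> = act M k (inv[Fob M X''] act M f'' z)" using act_cmp[OF M(2) kh h(1) ay] ah by simp
    also have "\<dots> = inv[Fob M (Dom E k)] act M k (act M f'' z)"
      using act_inv[OF M(2) kh act_closed[OF M(2) P''(2) z(1)]] .
    also have "act M k (act M f'' z) = act M (f'' \<cdot> k) z" using act_cmp[OF M(2) kh P''(2) z(1)] by simp
    also have "f'' \<cdot> k = Zer E (Dom E k) Y''" using KD(4) P''(2) by (simp add: hom_iff)
    finally show "app \<alpha> (Dom E k) (act L (h \<cdot> k) y') = \<one>[Fob M (Dom E k)]"
      using act_zer[OF M(2) Kob ob(4) z(1)] by simp
  qed
  then obtain t where t: "t \<in> Hom E (Dom E k) X'" "h \<cdot> k = f' \<cdot> t"
    using D'(5)[OF cmp_hom[OF kh h(1)]] by metis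
  have jf: "j1 \<cdot> f' \<in> Hom E X' SY" "j1 \<cdot> h \<boxplus> j2 \<cdot> f'' \<in> Hom E X'' SY"
    using cmp_hom jq P'(2) P''(2) h(1) add_hom by blast+
  define f where "f = (j1 \<cdot> f') \<cdot> p1 \<boxplus> (j1 \<cdot> h \<boxplus> j2 \<cdot> f'') \<cdot> p2"
  have f: "f \<in> Hom E SX SY" "f \<cdot> i1 = j1 \<cdot> f'" "f \<cdot> i2 = j1 \<cdot> h \<boxplus> j2 \<cdot> f''"
    unfolding f_def using biproduct_out[OF bX jf] by blast+
  define y where "y = act M q1 (app \<alpha> Y' y') \<otimes>[Fob M SY] act M q2 z"
  have q_el: "act M q1 (app \<alpha> Y' y') \<in> el M SY" "act M q2 z \<in> el M SY"
    using act_closed[OF M(2)] jq ay z(1) by blast+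
  have y_el: "y \<in> el M SY" unfolding y_def using comm_group_m_closed[OF gr(2)[OF SY(1)] q_el] .
  have act_y: "act M g y = act M (q1 \<cdot> g) (app \<alpha> Y' y') \<otimes>[Fob M W] act M (q2 \<cdot> g) z" if "g \<in> Hom E W SY" for g W
    unfolding y_def using act_mult[OF M(2) that q_el] act_cmp[OF M(2) that jq(3) ay] act_cmp[OF M(2) that jq(4) z(1)]
    by simp
  \<comment> \<open>On the two summands the generator \<open>y\<close> restricts to the image of
    \<open>y'\<close> and, by \<open>act_j2\<close>, to \<open>z\<close>.\<close>
  have act_j: "act M (j1 \<cdot> g) y = act M g (app \<alpha> Y' y')" if g: "g \<in> Hom E W Y'" for g W
  proof -
    have W: "W \<in> Ob E" using hom_ob[OF g] by blast interpret G: comm_group "Fob M W" using gr W by blast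
    have "q1 \<cdot> (j1 \<cdot> g) = (q1 \<cdot> j1) \<cdot> g" "q2 \<cdot> (j1 \<cdot> g) = (q2 \<cdot> j1) \<cdot> g"
      using g jq by (simp_all add: hom_iff flip: assoc)
    hence "q1 \<cdot> (j1 \<cdot> g) = g" "q2 \<cdot> (j1 \<cdot> g) = Zer E W Y''" using BY g ob by (simp_all add: hom_iff)
    thus ?thesis using act_y[OF cmp_hom[OF g jq(1)]] act_zer[OF M(2) W ob(4) z(1)] act_closed[OF M(2) g ay] by simp
  qed
  have act_j2: "act M (j2 \<cdot> g) y = act M g z" if g: "g \<in> Hom E W Y''" for g W
  proof -
    have W: "W \<in> Ob E" using hom_ob[OF g] by blast interpret G: comm_group "Fob M W" using gr W by blast
    have "q1 \<cdot> (j2 \<cdot> g) = (q1 \<cdot> j2) \<cdot> g" "q2 \<cdot> (j2 \<cdot> g) = (q2 \<cdot> j2) \<cdot> g"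
      using g jq by (simp_all add: hom_iff flip: assoc)
    hence "q2 \<cdot> (j2 \<cdot> g) = g" "q1 \<cdot> (j2 \<cdot> g) = Zer E W Y'" using BY g ob by (simp_all add: hom_iff)
    thus ?thesis using act_y[OF cmp_hom[OF g jq(2)]] act_zer[OF M(2) W ob(3) ay] act_closed[OF M(2) g z(1)] by simp
  qed
  have y1: "act M j1 y = app \<alpha> Y' y'"
    using act_j[OF id_hom[OF ob(3)]] cmp_id_right[OF jq(1)] act_idn[OF M(2) ob(3) ay] by simp
  have ba: "app \<beta> Y' (app \<alpha> Y' y') = \<one>[Fob N Y']" using SE(4)[OF ob(3) ay] D'(2) by blast
  have by': "app \<beta> SY y = act N q2 y''"
  proof -
    interpret G: comm_group "Fob N SY" using gr SY by blast
    have "app \<beta> SY y = act N q1 (app \<beta> Y' (app \<alpha> Y' y')) \<otimes>[Fob N SY] act N q2 (app \<beta> Y'' z)"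
      unfolding y_def using app_mult[OF b SY(1) q_el] app_natural[OF b jq(3) ay] app_natural[OF b jq(4) z(1)] by simp
    thus ?thesis using ba z(2) act_one[OF M(3) jq(3)] act_closed[OF M(3) jq(4) D''(2)] by simp
  qed
  obtain c' where c': "is_cokernel E c' f'" using admissible_cokernel[OF D'(1) P'(2)] by blast
  obtain c'' where c'': "is_cokernel E c'' f''" using admissible_cokernel[OF D''(1) P''(2)] by blast
  have admf: "admissible E f"
    using horseshoe_admissible(1)[OF D'(1) D''(1) P'(2) P''(2) h(1) bX bY k t f c' c''] .
  have "pres E M f y"
  proof (rule presI[OF admf f(1) y_el])
    have 1: "act M (f \<cdot> i1) y = \<one>[Fob M X']"
      unfolding f(2) using act_j[OF P'(2)] app_natural[OF a P'(2) D'(2)] D'(3) app_one[OF a ob(1)] by simp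
    have 2: "act M (f \<cdot> i2) y = \<one>[Fob M X'']"
    proof -
      interpret G: comm_group "Fob M X''" using gr ob by blast
      show ?thesis unfolding f(3) using act_add[OF M(2) cmp_hom[OF h(1) jq(1)] cmp_hom[OF P''(2) jq(2)] y_el]
          act_j[OF h(1)] act_j2[OF P''(2)] ah act_closed[OF M(2) P''(2) z(1)] by simp
    qed
    have h12: "f \<cdot> i1 \<in> Hom E X' SY" "f \<cdot> i2 \<in> Hom E X'' SY" using cmp_hom jq f(1) by blast+
    have "act M f y = act M ((f \<cdot> i1) \<cdot> p1 \<boxplus> (f \<cdot> i2) \<cdot> p2) y" using biproduct_out_decomp[OF bX f(1)] by simp
    also have "\<dots> = act M p1 (act M (f \<cdot> i1) y) \<otimes>[Fob M SX] act M p2 (act M (f \<cdot> i2) y)"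
      using act_add[OF M(2) cmp_hom[OF jq(5) h12(1)] cmp_hom[OF jq(6) h12(2)] y_el]
        act_cmp[OF M(2) jq(5) h12(1) y_el] act_cmp[OF M(2) jq(6) h12(2) y_el] by simp
    finally show "act M f y = \<one>[Fob M SX]"
      unfolding 1 2 using act_one[OF M(2) jq(5)] act_one[OF M(2) jq(6)] gr(2)[OF SY(2)]
      by (simp add: group.is_monoid comm_group.axioms(2))
  next
    \<comment> \<open>Generation: the image of \<open>x\<close> in \<open>N\<close> is reached by
      \<open>g''\<close>; what is left over comes from \<open>L\<close>, where \<open>g'\<close>
      reaches it.\<close>
    fix W x assume W: "W \<in> Ob E" and x: "x \<in> el M W" interpret G: comm_group "Fob M W" using gr W by blast
    interpret N: comm_group "Fob N W" using gr W by blast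
    obtain g'' where g'': "g'' \<in> Hom E W Y''" "act N g'' y'' = app \<beta> W x" using D''(4)[OF W app_closed[OF b W x]] by blast
    have az: "act M g'' z \<in> el M W" using act_closed[OF M(2) g''(1) z(1)] .
    have "app \<beta> W (x \<otimes>[Fob M W] inv[Fob M W] act M g'' z) = \<one>[Fob N W]"
      using app_mult[OF b W x] app_inv[OF b W az] app_natural[OF b g''(1) z(1)] z(2) g''(2) az
        app_closed[OF b W x] by simp
    then obtain l where l: "l \<in> el L W" "app \<alpha> W l = x \<otimes>[Fob M W] inv[Fob M W] act M g'' z"
      using SE(4)[OF W] az x by blast
    obtain g' where g': "g' \<in> Hom E W Y'" "act L g' y' = l" using D'(4)[OF W l(1)] by blast
    have "act M (j1 \<cdot> g' \<boxplus> j2 \<cdot> g'') y = act M g' (app \<alpha> Y' y') \<otimes>[Fob M W] act M g'' z"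
      using act_add[OF M(2) cmp_hom[OF g'(1) jq(1)] cmp_hom[OF g''(1) jq(2)] y_el] act_j[OF g'(1)] act_j2[OF g''(1)] by simp
    also have "act M g' (app \<alpha> Y' y') = app \<alpha> W l" using app_natural[OF a g'(1) D'(2)] g'(2) by simp
    finally have "act M (j1 \<cdot> g' \<boxplus> j2 \<cdot> g'') y = x" unfolding l(2) using x az by (simp add: G.m_assoc)
    moreover have "j1 \<cdot> g' \<boxplus> j2 \<cdot> g'' \<in> Hom E W SY" using biproduct_in(1)[OF bY g'(1) g''(1)] .
    ultimately show "\<exists>g\<in>Hom E W SY. act M g y = x" by blast
  next
    \<comment> \<open>Relations: the second component \<open>q2 \<cdot> g\<close> is a relation of
      \<open>y''\<close>, hence equals \<open>f'' \<cdot> s\<close>; the first component minus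
      \<open>h \<cdot> s\<close> is then a relation of \<open>y'\<close>, hence equals
      \<open>f' \<cdot> r\<close>.\<close>
    fix W g assume g: "g \<in> Hom E W SY" "act M g y = \<one>[Fob M W]"
    have W: "W \<in> Ob E" using hom_ob[OF g(1)] by blast interpret L: comm_group "Fob L W" using gr W by blast
    interpret G: comm_group "Fob M W" using gr W by blast
    have qg: "q1 \<cdot> g \<in> Hom E W Y'" "q2 \<cdot> g \<in> Hom E W Y''" using cmp_hom g(1) jq by blast+
    have "act N (q2 \<cdot> g) y'' = app \<beta> W (act M g y)"
      using act_cmp[OF M(3) g(1) jq(4) D''(2)] app_natural[OF b g(1) y_el] by' by simp
    hence "act N (q2 \<cdot> g) y'' = \<one>[Fob N W]" using g(2) app_one[OF b W] by simp
    then obtain s where s: "s \<in> Hom E W X''" "f'' \<cdot> s = q2 \<cdot> g" using D''(5)[OF qg(2)] by blast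
    have hs: "h \<cdot> s \<in> Hom E W Y'" using cmp_hom[OF s(1) h(1)] .
    have e1: "act M (q2 \<cdot> g) z = inv[Fob M W] app \<alpha> W (act L (h \<cdot> s) y')"
    proof -
      have "app \<alpha> W (act L (h \<cdot> s) y') = act M s (act M h (app \<alpha> Y' y'))"
        using app_natural[OF a hs D'(2)] act_cmp[OF M(2) s(1) h(1) ay] by simp
      also have "\<dots> = inv[Fob M W] act M s (act M f'' z)"
        unfolding ah using act_inv[OF M(2) s(1) act_closed[OF M(2) P''(2) z(1)]] .
      also have "act M s (act M f'' z) = act M (q2 \<cdot> g) z" using act_cmp[OF M(2) s(1) P''(2) z(1)] s(2) by simp
      finally show ?thesis using act_closed[OF M(2) qg(2) z(1)] by simp
    qed
    let ?u = "act L (q1 \<cdot> g) y'" and ?v = "act L (h \<cdot> s) y'"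
    have uv: "?u \<in> el L W" "?v \<in> el L W" using act_closed[OF M(1)] qg(1) hs D'(2) by blast+
    have "\<one>[Fob M W] = app \<alpha> W ?u \<otimes>[Fob M W] inv[Fob M W] app \<alpha> W ?v"
      using act_y[OF g(1)] g(2) e1 app_natural[OF a qg(1) D'(2)] by simp
    hence "app \<alpha> W (?u \<otimes>[Fob L W] inv[Fob L W] ?v) = \<one>[Fob M W]"
      using app_mult[OF a W uv(1)] app_inv[OF a W uv(2)] uv by simp
    hence "?u \<otimes>[Fob L W] inv[Fob L W] ?v = \<one>[Fob L W]" using SE(3)[OF W] uv by simp
    moreover have "act L (q1 \<cdot> g \<boxplus> Neg E (h \<cdot> s)) y' = ?u \<otimes>[Fob L W] inv[Fob L W] ?v"
      using act_add[OF M(1) qg(1) neg_hom[OF hs] D'(2)] act_neg[OF M(1) hs D'(2)] by simp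
    ultimately obtain r where r: "r \<in> Hom E W X'" "f' \<cdot> r = q1 \<cdot> g \<boxplus> Neg E (h \<cdot> s)"
      using D'(5)[OF add_hom[OF qg(1) neg_hom[OF hs]]] by metis
    let ?x = "i1 \<cdot> r \<boxplus> i2 \<cdot> s"
    have xh: "?x \<in> Hom E W SX" using biproduct_in(1)[OF bX r(1) s(1)] .
    have "f \<cdot> ?x = f \<cdot> (i1 \<cdot> r) \<boxplus> f \<cdot> (i2 \<cdot> s)"
      using cmp_add[OF cmp_hom[OF r(1) jq(7)] cmp_hom[OF s(1) jq(8)] f(1)] .
    also have "\<dots> = (f \<cdot> i1) \<cdot> r \<boxplus> (f \<cdot> i2) \<cdot> s"
      using cmp_assoc[OF r(1) jq(7) f(1)] cmp_assoc[OF s(1) jq(8) f(1)] by simp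
    also have "\<dots> = j1 \<cdot> (f' \<cdot> r) \<boxplus> (j1 \<cdot> (h \<cdot> s) \<boxplus> j2 \<cdot> (f'' \<cdot> s))"
      unfolding f(2,3) using r(1) s(1) jq P'(2) P''(2) h(1) by (simp add: hom_simps)
    also have "\<dots> = (j1 \<cdot> (f' \<cdot> r) \<boxplus> j1 \<cdot> (h \<cdot> s)) \<boxplus> j2 \<cdot> (f'' \<cdot> s)"
      by (rule hom_add_assoc[symmetric, of _ W SY]) (use r(1) s(1) jq P'(2) P''(2) h(1) in \<open>simp_all add: hom_iff\<close>)
    also have "j1 \<cdot> (f' \<cdot> r) \<boxplus> j1 \<cdot> (h \<cdot> s) = j1 \<cdot> (f' \<cdot> r \<boxplus> h \<cdot> s)"
      using cmp_add[OF cmp_hom[OF r(1) P'(2)] hs jq(1)] by simp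
    also have "f' \<cdot> r \<boxplus> h \<cdot> s = q1 \<cdot> g" unfolding r(2) by (rule hom_diff_add[OF qg(1) hs])
    finally have "f \<cdot> ?x = g" unfolding s(2) using biproduct_in_decomp[OF bY g(1)] by simp
    thus "\<exists>x\<in>Hom E W SX. f \<cdot> x = g" using xh by blast
  qed
  thus thesis using that[OF h(1) t f _ y1 by'] by blast
qed

lemma admissible_has_kernel: assumes "admissible E f" "f \<in> Hom E X Y" obtains k where "is_kernel E k f"
proof -
  obtain I m p where f: "inflation E m" "deflation E p" "p \<in> Hom E X I" "m \<in> Hom E I Y" "f = m \<cdot> p"
    using admissibleE[OF assms] by blast
  thus ?thesis using that conf_kernel inflation_cmp_kernel[OF f(1,4,3)] unfolding deflation_def by blast
qed

lemma adm_extension: assumes "short_exact E L M N \<alpha> \<beta>" "L \<in> adm E" "N \<in> adm E" shows "M \<in> adm E"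
proof -
  obtain f' y' X' Y' where 1: "pres E L f' y'" "f' \<in> Hom E X' Y'" "X' \<in> Ob E" "Y' \<in> Ob E" using presE assms(2) by metis
  obtain f'' y'' X'' Y'' where 2: "pres E N f'' y''" "f'' \<in> Hom E X'' Y''" "X'' \<in> Ob E" "Y'' \<in> Ob E" using presE assms(3) by metis
  obtain SX i1 i2 p1 p2 where bX: "is_biproduct E X' X'' SX i1 i2 p1 p2" using has_biproducts 1 2 by metis
  obtain SY j1 j2 q1 q2 where bY: "is_biproduct E Y' Y'' SY j1 j2 q1 q2" using has_biproducts 1 2 by metis
  obtain k where k: "is_kernel E k f''" using admissible_has_kernel[OF presD(1)[OF 2(1,2)] 2(2)] by blast
  obtain f y where "pres E M f y" using extension_pres[OF assms(1) 1(1,2) 2(1,2) bX bY k] by metis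
  thus ?thesis using adm_presented_iff Mod_ob(2)[OF short_exactD(1)[OF assms(1)]] by blast
qed

section \<open>Representables are admissibly presented\<close>

lemma zero_inflation: assumes "X \<in> Ob E"
  obtains z where "(z, Idn E X) \<in> Conf E" "z \<in> Hom E (Dom E z) X" "z = Zer E (Dom E z) X" "admissible E z"
proof -
  \<comment> \<open>The identity is a deflation; the inflation paired with it is its kernel, hence a
    zero arrow.\<close>
  obtain z where z: "(z, Idn E X) \<in> Conf E" using id_deflation[OF assms] unfolding deflation_def by blast
  note D = kernelD[OF conf_kernel[OF z]]
  have zh: "z \<in> Hom E (Dom E z) X" using D assms by (simp add: hom_iff)
  have "inflation E z" using z unfolding inflation_def by blast
  hence "admissible E (z \<cdot> Idn E (Dom E z))" using D by (intro admissibleI id_deflation) simp_all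
  moreover have "z \<cdot> Idn E (Dom E z) = z" using D by simp
  moreover have "z = Zer E (Dom E z) X" using D assms by simp
  ultimately show ?thesis using that z zh by simp
qed

text \<open>A representable is generated by its identity without relations; a presentation still
  requires an admissible arrow, and the zero inflation into \<open>X\<close> is one.\<close>

lemma yoneda_pres: assumes "X \<in> Ob E" "z \<in> Hom E Z X" "z = Zer E Z X" "admissible E z"
  shows "pres E (\<Y> E X) z (Idn E X)"
proof (rule presI[OF assms(4,2)])
  have Z: "Z \<in> Ob E" using hom_ob[OF assms(2)] by blast
  have act: "act (\<Y> E X) g (Idn E X) = g" if "g \<in> Hom E W X" for g W
    using yoneda_ob(3)[OF assms(1) that id_hom[OF assms(1)]] cmp_id_left[OF that] by simp
  show "Idn E X \<in> el (\<Y> E X) X" using assms(1) id_hom by (simp add: yoneda_ob)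
  show "act (\<Y> E X) z (Idn E X) = \<one>[Fob (\<Y> E X) Z]"
    using act[OF assms(2)] assms(1,3) Z by (simp add: yoneda_ob)
  fix W
  show "\<exists>g\<in>Hom E W X. act (\<Y> E X) g (Idn E X) = x" if "W \<in> Ob E" "x \<in> el (\<Y> E X) W" for x
    using that act assms(1) by (auto simp: yoneda_ob)
  fix g assume g: "g \<in> Hom E W X" "act (\<Y> E X) g (Idn E X) = \<one>[Fob (\<Y> E X) W]"
  have W: "W \<in> Ob E" using hom_ob[OF g(1)] by blast
  have "g = Zer E W X" using g act[OF g(1)] W assms(1) by (simp add: yoneda_ob)
  moreover have "z \<cdot> Zer E W Z = Zer E W X" using assms(2) W by (simp add: hom_iff)
  ultimately show "\<exists>s\<in>Hom E W Z. z \<cdot> s = g" using zer_hom[OF W Z] by blast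
qed

lemma yoneda_adm: "X \<in> Ob E \<Longrightarrow> \<Y> E X \<in> adm E"
  using zero_inflation[of X] yoneda_pres adm_presented_iff yoneda_ob(1) by metis

end

section \<open>The exact structure on admissibly presented modules\<close>

lemma short_exactI: assumes "\<alpha> \<in> Hom (\<M> A) L M" "\<beta> \<in> Hom (\<M> A) M N"
    "\<And>W x. \<lbrakk>W \<in> Ob A; x \<in> el L W; app \<alpha> W x = \<one>[Fob M W]\<rbrakk> \<Longrightarrow> x = \<one>[Fob L W]"
    "\<And>W x. \<lbrakk>W \<in> Ob A; x \<in> el M W; app \<beta> W x = \<one>[Fob N W]\<rbrakk> \<Longrightarrow> \<exists>l\<in>el L W. app \<alpha> W l = x"
    "\<And>W x. \<lbrakk>W \<in> Ob A; x \<in> el L W\<rbrakk> \<Longrightarrow> app \<beta> W (app \<alpha> W x) = \<one>[Fob N W]"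
    "\<And>W z. \<lbrakk>W \<in> Ob A; z \<in> el N W\<rbrakk> \<Longrightarrow> \<exists>x\<in>el M W. app \<beta> W x = z" shows "short_exact A L M N \<alpha> \<beta>"
  unfolding short_exact_def using assms by blast

context exact_category
begin

lemma mod_adm_simps: "Ob (\<A> E) = adm E" "Dom (\<A> E) = src" "Cod (\<A> E) = tgt"
  "Idn (\<A> E) = Idn (\<M> E)" "Cmp (\<A> E) = Cmp (\<M> E)" "Add (\<A> E) = Add (\<M> E)" "Zer (\<A> E) = Zer (\<M> E)"
  by (simp_all add: mod_adm_def)

lemma Hom_mod_adm: "\<alpha> \<in> Hom (\<A> E) M N \<longleftrightarrow>
    \<alpha> \<in> Hom (\<M> E) M N \<and> M \<in> adm E \<and> N \<in> adm E" by (auto simp: hom_iff mod_adm_def Mod_simps)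

lemma preadditive_mod_adm: "preadditive_category (\<A> E)"
  by (rule preadditive_full[OF preadditive_Mod]) (auto simp: mod_adm_def Mod_simps adm_Mod)

interpretation Mod: preadditive_category "\<M> E" by (rule preadditive_Mod)
interpretation MA: preadditive_category "\<A> E" by (rule preadditive_mod_adm)

text \<open>Brings the conflations into the form \<open>short_exact\<close>, with named terms and
  elementwise conditions, in which the axioms are verified.\<close>

lemma Conf_mod_adm: "(\<alpha>, \<beta>) \<in> Conf (\<A> E) \<longleftrightarrow> (\<exists>L M N. L \<in> adm E \<and>
    M \<in> adm E \<and> N \<in> adm E \<and> short_exact E L M N \<alpha> \<beta>)"
proof
  assume "(\<alpha>, \<beta>) \<in> Conf (\<A> E)"
  hence a: "src \<alpha> \<in> adm E" "tgt \<alpha> \<in> adm E" "tgt \<beta> \<in> adm E"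
    "mod_mono E \<alpha>" "mod_exact_at E \<alpha> \<beta>" "mod_epi E \<beta>" by (auto simp: mod_adm_def)
  have h: "\<alpha> \<in> Hom (\<M> E) (src \<alpha>) (tgt \<alpha>)" "\<beta> \<in> Hom (\<M> E) (tgt \<alpha>) (tgt \<beta>)"
    using a(5) unfolding mod_exact_at_def by (auto simp: hom_iff Mod_simps)
  have "short_exact E (src \<alpha>) (tgt \<alpha>) (tgt \<beta>) \<alpha> \<beta>"
    using a(4-6) h unfolding short_exact_def mod_mono_iff[OF h(1)] mod_epi_iff[OF h(2)] mod_exact_iff[OF h]
    by blast
  thus "\<exists>L M N. L \<in> adm E \<and> M \<in> adm E \<and> N \<in> adm E \<and> short_exact E L M N \<alpha> \<beta>" using a by blast
next
  assume "\<exists>L M N. L \<in> adm E \<and> M \<in> adm E \<and> N \<in> adm E \<and> short_exact E L M N \<alpha> \<beta>"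
  then obtain L M N where a: "L \<in> adm E" "M \<in> adm E" "N \<in> adm E" "short_exact E L M N \<alpha> \<beta>" by blast
  note h = short_exactD(1,2)[OF a(4)]
  have "mod_mono E \<alpha> \<and> mod_exact_at E \<alpha> \<beta> \<and> mod_epi E \<beta>"
    using a(4) unfolding short_exact_def mod_mono_iff[OF h(1)] mod_epi_iff[OF h(2)] mod_exact_iff[OF h]
    by blast
  thus "(\<alpha>, \<beta>) \<in> Conf (\<A> E)" using a h by (simp add: mod_adm_def Hom_Mod)
qed

lemma mod_adm_inflationI: assumes "short_exact E L M N \<alpha> \<beta>" "L \<in> adm E" "M \<in> adm E" "N \<in> adm E"
  shows "inflation (\<A> E) \<alpha>" "deflation (\<A> E) \<beta>"
  using assms Conf_mod_adm unfolding inflation_def deflation_def by blast+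

lemma mod_adm_inflationE: assumes "inflation (\<A> E) \<alpha>"
  obtains L M N \<beta> where "short_exact E L M N \<alpha> \<beta>" "L \<in> adm E" "M \<in> adm E" "N \<in> adm E"
  using assms Conf_mod_adm unfolding inflation_def by blast

lemma mod_adm_deflationE: assumes "deflation (\<A> E) \<beta>"
  obtains L M N \<alpha> where "short_exact E L M N \<alpha> \<beta>" "L \<in> adm E" "M \<in> adm E" "N \<in> adm E"
  using assms Conf_mod_adm unfolding deflation_def by blast

text \<open>Both claims share exactness in the middle, but injectivity is assumed only for the
  kernel and surjectivity only for the cokernel: for the sequences that define pushouts and
  pullbacks just one of the two is at hand.\<close>

lemma mod_adm_ker_coker: assumes adm: "L \<in> adm E" "M \<in> adm E" "N \<in> adm E"
    and SE: "\<alpha> \<in> Hom (\<M> E) L M" "\<beta> \<in> Hom (\<M> E) M N"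
    and ex: "\<And>W x. \<lbrakk>W \<in> Ob E; x \<in> el M W\<rbrakk> \<Longrightarrow> app \<beta> W x = \<one>[Fob N W] \<longleftrightarrow> (\<exists>l\<in>el L W. app \<alpha> W l = x)"
  shows "(\<And>W x. \<lbrakk>W \<in> Ob E; x \<in> el L W; app \<alpha> W x = \<one>[Fob M W]\<rbrakk> \<Longrightarrow> x = \<one>[Fob L W]) \<Longrightarrow> is_kernel (\<A> E) \<alpha> \<beta>"
    and "(\<And>W z. \<lbrakk>W \<in> Ob E; z \<in> el N W\<rbrakk> \<Longrightarrow> \<exists>x\<in>el M W. app \<beta> W x = z) \<Longrightarrow> is_cokernel (\<A> E) \<beta> \<alpha>"
proof -
  note ob = adm[THEN adm_Mod]
  have H: "\<alpha> \<in> Hom (\<A> E) L M" "\<beta> \<in> Hom (\<A> E) M N" using SE(1,2) adm by (simp_all add: Hom_mod_adm)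
  have z: "\<beta> \<cdot>[\<M> E] \<alpha> = Zer (\<M> E) L N"
  proof (rule Mod_hom_eqI[OF Mod.cmp_hom[OF SE(1,2)] Mod.zer_hom[OF ob(1,3)]])
    fix W x assume "W \<in> Ob E" "x \<in> el L W"
    thus "app (\<beta> \<cdot>[\<M> E] \<alpha>) W x = app (Zer (\<M> E) L N) W x"
      using app_cmp[OF SE(1,2)] app_zer ex[of W "app \<alpha> W x"] app_closed[OF SE(1)] by auto
  qed
  show "is_kernel (\<A> E) \<alpha> \<beta>" if inj: "\<And>W x. \<lbrakk>W \<in> Ob E; x \<in> el L W; app \<alpha> W x = \<one>[Fob M W]\<rbrakk> \<Longrightarrow> x = \<one>[Fob L W]"
  proof (rule MA.kernelI[OF H])
    show "\<beta> \<cdot>[\<A> E] \<alpha> = Zer (\<A> E) L N" using z by (simp add: mod_adm_simps)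
    fix K h assume hh: "h \<in> Hom (\<A> E) K M" "\<beta> \<cdot>[\<A> E] h = Zer (\<A> E) K N"
    have h: "h \<in> Hom (\<M> E) K M" "K \<in> adm E" using hh by (auto simp: Hom_mod_adm)
    have e: "\<beta> \<cdot>[\<M> E] h = Zer (\<M> E) K N" using hh(2) by (simp add: mod_adm_simps)
    have im: "\<exists>l\<in>el L W. app \<alpha> W l = app h W x" if "W \<in> Ob E" "x \<in> el K W" for W x
      using ex[OF that(1) app_closed[OF h(1) that]] app_cmp[OF h(1) SE(2) that] app_zer[OF that, of N] e by simp
    obtain \<psi> where \<psi>: "\<psi> \<in> Hom (\<M> E) K L" "\<And>W x. \<lbrakk>W \<in> Ob E; x \<in> el K W\<rbrakk> \<Longrightarrow> app \<alpha> W (app \<psi> W x) = app h W x"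
      using factor_mono[OF SE(1) h(1) inj im] by blast
    have "\<alpha> \<cdot>[\<M> E] \<psi> = h"
      by (rule Mod_hom_eqI[OF Mod.cmp_hom[OF \<psi>(1) SE(1)] h(1)]) (use \<psi> app_cmp[OF \<psi>(1) SE(1)] in simp)
    thus "\<exists>u. u \<in> Hom (\<A> E) K L \<and> \<alpha> \<cdot>[\<A> E] u = h"
      using \<psi>(1) h(2) adm by (auto simp: Hom_mod_adm mod_adm_simps)
  next
    fix K u v assume uv: "u \<in> Hom (\<A> E) K L" "v \<in> Hom (\<A> E) K L" "\<alpha> \<cdot>[\<A> E] u = \<alpha> \<cdot>[\<A> E] v"
    hence h: "u \<in> Hom (\<M> E) K L" "v \<in> Hom (\<M> E) K L" "\<alpha> \<cdot>[\<M> E] u = \<alpha> \<cdot>[\<M> E] v"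
      by (auto simp: Hom_mod_adm mod_adm_simps)
    show "u = v"
    proof (rule Mod_hom_eqI[OF h(1,2)])
      fix W x assume W: "W \<in> Ob E" "x \<in> el K W"
      have "app \<alpha> W (app u W x) = app \<alpha> W (app v W x)"
        using app_cmp[OF h(1) SE(1) W] app_cmp[OF h(2) SE(1) W] h(3) by simp
      thus "app u W x = app v W x"
        using app_inj[OF SE(1) W(1) app_closed[OF h(1) W] app_closed[OF h(2) W]] inj[OF W(1)] by blast
    qed
  qed
  show "is_cokernel (\<A> E) \<beta> \<alpha>" if surj: "\<And>W z. \<lbrakk>W \<in> Ob E; z \<in> el N W\<rbrakk> \<Longrightarrow> \<exists>x\<in>el M W. app \<beta> W x = z"
  proof (rule MA.cokernelI[OF H])
    show "\<beta> \<cdot>[\<A> E] \<alpha> = Zer (\<A> E) L N" using z by (simp add: mod_adm_simps)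
    fix K h assume hh: "h \<in> Hom (\<A> E) M K" "h \<cdot>[\<A> E] \<alpha> = Zer (\<A> E) L K"
    have h: "h \<in> Hom (\<M> E) M K" "K \<in> adm E" using hh by (auto simp: Hom_mod_adm)
    have e: "h \<cdot>[\<M> E] \<alpha> = Zer (\<M> E) L K" using hh(2) by (simp add: mod_adm_simps)
    have ker: "app h W x = \<one>[Fob K W]" if "W \<in> Ob E" "x \<in> el M W" "app \<beta> W x = \<one>[Fob N W]" for W x
      using ex[OF that(1,2)] that(3) app_cmp[OF SE(1) h(1) that(1)] app_zer[OF that(1), of _ L K] e by auto
    obtain \<psi> where \<psi>: "\<psi> \<in> Hom (\<M> E) N K" "\<And>W x. \<lbrakk>W \<in> Ob E; x \<in> el M W\<rbrakk> \<Longrightarrow> app \<psi> W (app \<beta> W x) = app h W x"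
      using factor_epi[OF SE(2) h(1) surj ker] by blast
    have "\<psi> \<cdot>[\<M> E] \<beta> = h"
      by (rule Mod_hom_eqI[OF Mod.cmp_hom[OF SE(2) \<psi>(1)] h(1)]) (use \<psi> app_cmp[OF SE(2) \<psi>(1)] in simp)
    thus "\<exists>u. u \<in> Hom (\<A> E) N K \<and> u \<cdot>[\<A> E] \<beta> = h"
      using \<psi>(1) h(2) adm by (auto simp: Hom_mod_adm mod_adm_simps)
  next
    fix K u v assume uv: "u \<in> Hom (\<A> E) N K" "v \<in> Hom (\<A> E) N K" "u \<cdot>[\<A> E] \<beta> = v \<cdot>[\<A> E] \<beta>"
    hence h: "u \<in> Hom (\<M> E) N K" "v \<in> Hom (\<M> E) N K" "u \<cdot>[\<M> E] \<beta> = v \<cdot>[\<M> E] \<beta>"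
      by (auto simp: Hom_mod_adm mod_adm_simps)
    show "u = v"
    proof (rule Mod_hom_eqI[OF h(1,2)])
      fix W z assume W: "W \<in> Ob E" "z \<in> el N W"
      then obtain x where x: "x \<in> el M W" "app \<beta> W x = z" using surj by blast
      thus "app u W z = app v W z" using app_cmp[OF SE(2) h(1) W(1)] app_cmp[OF SE(2) h(2) W(1)] h(3) by metis
    qed
  qed
qed

lemma short_exact_ker_coker: assumes "short_exact E L M N \<alpha> \<beta>" "L \<in> adm E" "M \<in> adm E" "N \<in> adm E"
  shows "is_kernel (\<A> E) \<alpha> \<beta>" "is_cokernel (\<A> E) \<beta> \<alpha>"
  using short_exactD[OF assms(1)] mod_adm_ker_coker[OF assms(2-4)] by blast+

section \<open>Zero module, modules with a given presentation, biproducts\<close>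

lemma zero_module:
  obtains Q where "is_zero_ob (\<A> E) Q" "Q \<in> adm E" "\<And>W x. \<lbrakk>W \<in> Ob E; x \<in> el Q W\<rbrakk> \<Longrightarrow> x = \<one>[Fob Q W]"
proof -
  obtain Z where Z: "is_zero_ob E Z" using has_zero_ob by blast
  hence ZO: "Z \<in> Ob E" unfolding is_zero_ob_def by blast
  define O' where "O' = \<Y> E Z"
  have adm: "O' \<in> adm E" unfolding O'_def by (rule yoneda_adm[OF ZO])
  have el: "x = \<one>[Fob O' W]" if "W \<in> Ob E" "x \<in> el O' W" for W x
  proof -
    have "\<exists>!f. f \<in> Hom E W Z" using Z that(1) unfolding is_zero_ob_def by blast
    thus ?thesis using that ZO zer_hom[OF that(1) ZO] by (auto simp: O'_def yoneda_ob)
  qed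
  have "is_zero_ob (\<A> E) O'" unfolding is_zero_ob_def mod_adm_simps(1)
  proof (intro conjI ballI ex1I)
    fix M assume M: "M \<in> adm E"
    note ob = M[THEN adm_Mod] adm[THEN adm_Mod]
    show "Zer (\<M> E) M O' \<in> Hom (\<A> E) M O'" "Zer (\<M> E) O' M \<in> Hom (\<A> E) O' M"
      using Mod.zer_hom ob M adm by (auto simp: Hom_mod_adm)
    fix f
    { assume "f \<in> Hom (\<A> E) M O'"
      hence f: "f \<in> Hom (\<M> E) M O'" by (simp add: Hom_mod_adm)
      show "f = Zer (\<M> E) M O'"
        by (rule Mod_hom_eqI[OF f Mod.zer_hom[OF ob]]) (use el app_closed[OF f] app_zer in auto) }
    { assume "f \<in> Hom (\<A> E) O' M"
      hence f: "f \<in> Hom (\<M> E) O' M" by (simp add: Hom_mod_adm)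
      show "f = Zer (\<M> E) O' M"
        by (rule Mod_hom_eqI[OF f Mod.zer_hom[OF ob(2,1)]]) (use el app_one[OF f] app_zer in auto) }
  qed (rule adm)
  thus thesis using that adm el by blast
qed

text \<open>The cokernel of the homomorphism between representables is formed among all modules; the
  class of the identity generates it with \<open>f\<close> as relations.\<close>

lemma pres_exists: assumes "admissible E f" "f \<in> Hom E X Y" obtains M y where "M \<in> adm E" "pres E M f y"
proof -
  have ob: "X \<in> Ob E" "Y \<in> Ob E" using hom_ob assms(2) by auto
  obtain C \<kappa> where C: "\<kappa> \<in> Hom (\<M> E) (\<Y> E Y) C"
    "\<And>W z. \<lbrakk>W \<in> Ob E; z \<in> el C W\<rbrakk> \<Longrightarrow> \<exists>x\<in>el (\<Y> E Y) W. app \<kappa> W x = z" "\<And>W x. \<lbrakk>W \<in> Ob E; x \<in> el (\<Y> E Y) W\<rbrakk> \<Longrightarrow>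
       app \<kappa> W x = \<one>[Fob C W] \<longleftrightarrow> (\<exists>l\<in>el (\<Y> E X) W. app (\<y> E f) W l = x)"
    by (rule cokernel_module[OF yoneda_ar(1)[OF assms(2)]]) (rule that)
  have C2: "\<exists>x\<in>Hom E W Y. app \<kappa> W x = z" if "W \<in> Ob E" "z \<in> el C W" for W z
    using C(2)[OF that] that ob by (simp add: yoneda_ob)
  have C3: "app \<kappa> W x = \<one>[Fob C W] \<longleftrightarrow> (\<exists>l\<in>Hom E W X. f \<cdot> l = x)" if "W \<in> Ob E" "x \<in> Hom E W Y" for W x
    using C(3)[of W x] that ob yoneda_ar(2)[OF assms(2)] by (simp add: yoneda_ob)
  have CO: "C \<in> Ob (\<M> E)" using Mod_ob C(1) by blast
  note y = yoneda_hom[OF C(1) ob(2)]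
  have P: "pres E C f (app \<kappa> Y (Idn E Y))"
  proof (rule presI[OF assms y(1)])
    show "act C f (app \<kappa> Y (Idn E Y)) = \<one>[Fob C X]"
      using y(2)[OF ob(1) assms(2)] C3[OF ob(1) assms(2)] id_hom[OF ob(1)] cmp_id_right[OF assms(2)] by auto
    fix W
    show "\<exists>g\<in>Hom E W Y. act C g (app \<kappa> Y (Idn E Y)) = x" if "W \<in> Ob E" "x \<in> el C W" for x
      using C2[OF that] y(2)[OF that(1)] by auto
    show "\<exists>s\<in>Hom E W X. f \<cdot> s = g" if "g \<in> Hom E W Y" "act C g (app \<kappa> Y (Idn E Y)) = \<one>[Fob C W]" for g
      using C3[OF hom_ob(1)[OF that(1)] that(1)] y(2)[OF hom_ob(1)[OF that(1)] that(1)] that(2) by simp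
  qed
  thus thesis using that[OF _ P] adm_presented_iff CO by blast
qed

text \<open>The homomorphism from the representable of \<open>Y\<close> that corresponds to
  \<open>n\<close> vanishes on everything factoring through \<open>f\<close>, that is on all
  relations of \<open>y\<close>, and so factors through the epimorphism given by
  \<open>y\<close>.\<close>

lemma pres_hom: assumes P: "pres E M f y" "f \<in> Hom E X Y" and M: "M \<in> Ob (\<M> E)" and N: "N \<in> Ob (\<M> E)"
    and n: "n \<in> el N Y" "act N f n = \<one>[Fob N X]" obtains \<phi> where "\<phi> \<in> Hom (\<M> E) M N" "app \<phi> Y y = n"
proof -
  have Y: "Y \<in> Ob E" using hom_ob[OF P(2)] by blast
  note D = presD[OF P] note u = yel[OF M Y D(2)] and v = yel[OF N Y n(1)]
  have el: "el (\<Y> E Y) W = Hom E W Y" if "W \<in> Ob E" for W using that Y by (simp add: yoneda_ob)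
  have surj: "\<exists>p\<in>el (\<Y> E Y) W. app (yel E M Y y) W p = x" if "W \<in> Ob E" "x \<in> el M W" for W x
    using D(4)[OF that] u(2)[OF that(1)] el[OF that(1)] by auto
  have ker: "app (yel E N Y n) W g = \<one>[Fob N W]"
    if W: "W \<in> Ob E" "g \<in> el (\<Y> E Y) W" "app (yel E M Y y) W g = \<one>[Fob M W]" for W g
  proof -
    have g: "g \<in> Hom E W Y" using W el by simp
    obtain s where s: "s \<in> Hom E W X" "f \<cdot> s = g" using D(5)[OF g] u(2)[OF W(1) g] W(3) by auto
    show ?thesis using v(2)[OF W(1) g] act_cmp[OF N s(1) P(2) n(1)] n(2) act_one[OF N s(1)] s(2) by simp
  qed
  obtain \<phi> where \<phi>: "\<phi> \<in> Hom (\<M> E) M N"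
    "\<And>W p. \<lbrakk>W \<in> Ob E; p \<in> el (\<Y> E Y) W\<rbrakk> \<Longrightarrow> app \<phi> W (app (yel E M Y y) W p) = app (yel E N Y n) W p"
    using factor_epi[OF u(1) v(1) surj ker] by blast
  have "app \<phi> Y y = n"
    using \<phi>(2)[OF Y, of "Idn E Y"] el[OF Y] id_hom[OF Y] u(2)[OF Y id_hom[OF Y]] v(2)[OF Y id_hom[OF Y]]
      act_idn[OF M Y D(2)] act_idn[OF N Y n(1)] by simp
  thus thesis using that \<phi>(1) by blast
qed

lemma pres_hom_eqI: assumes P: "pres E M f y" "f \<in> Hom E X Y"
    and h: "\<alpha> \<in> Hom (\<M> E) M N" "\<beta> \<in> Hom (\<M> E) M N" "app \<alpha> Y y = app \<beta> Y y" shows "\<alpha> = \<beta>"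
proof (rule Mod_hom_eqI[OF h(1,2)])
  fix W x assume W: "W \<in> Ob E" "x \<in> el M W"
  obtain g where g: "g \<in> Hom E W Y" "act M g y = x" using presD(4)[OF P W] by blast
  thus "app \<alpha> W x = app \<beta> W x"
    using app_natural[OF h(1) g(1) presD(2)[OF P]] app_natural[OF h(2) g(1) presD(2)[OF P]] h(3) by simp
qed

text \<open>The biproduct is presented by the direct sum of two presentations, so its values fit in the arrow type.\<close>

lemma module_biproduct: assumes M: "M \<in> adm E" and N: "N \<in> adm E"
  obtains S i j p q where "S \<in> adm E" "is_biproduct (\<A> E) M N S i j p q"
    "i \<in> Hom (\<M> E) M S" "j \<in> Hom (\<M> E) N S" "p \<in> Hom (\<M> E) S M" "q \<in> Hom (\<M> E) S N"
    "\<And>W x. \<lbrakk>W \<in> Ob E; x \<in> el M W\<rbrakk> \<Longrightarrow> app p W (app i W x) = x \<and> app q W (app i W x) = \<one>[Fob N W]"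
    "\<And>W x. \<lbrakk>W \<in> Ob E; x \<in> el N W\<rbrakk> \<Longrightarrow> app q W (app j W x) = x \<and> app p W (app j W x) = \<one>[Fob M W]"
    "\<And>W s. \<lbrakk>W \<in> Ob E; s \<in> el S W\<rbrakk> \<Longrightarrow> app i W (app p W s) \<otimes>[Fob S W] app j W (app q W s) = s"
proof -
  obtain f y X Y where f: "pres E M f y" "f \<in> Hom E X Y" "X \<in> Ob E" "Y \<in> Ob E" using presE[OF M] by metis
  obtain g z X' Y' where g: "pres E N g z" "g \<in> Hom E X' Y'" "X' \<in> Ob E" "Y' \<in> Ob E" using presE[OF N] by metis
  obtain R i1 i2 p1 p2 where bR: "is_biproduct E X X' R i1 i2 p1 p2" using has_biproducts f g by metis
  obtain T a b c d where bT: "is_biproduct E Y Y' T a b c d" using has_biproducts f g by metis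
  note BR = bR[unfolded is_biproduct_def] and BT = bT[unfolded is_biproduct_def]
  have R: "p1 \<in> Hom E R X" "p2 \<in> Hom E R X'" "i1 \<in> Hom E X R" "i2 \<in> Hom E X' R" using BR by auto
  have T: "T \<in> Ob E" "a \<in> Hom E Y T" "b \<in> Hom E Y' T" "c \<in> Hom E T Y" "d \<in> Hom E T Y'" using BT by auto
  note Fp = presD[OF f(1,2)] and Gp = presD[OF g(1,2)] and MO = adm_Mod[OF M] and NO = adm_Mod[OF N]
  note af = cmp_hom[OF f(2) T(2)] and bg = cmp_hom[OF g(2) T(3)]
  define F where "F = (a \<cdot> f) \<cdot> p1 \<boxplus> (b \<cdot> g) \<cdot> p2"
  note F = biproduct_out[OF bR af bg, folded F_def]
  obtain k where k: "is_kernel E k g" using admissible_has_kernel[OF Gp(1) g(2)] .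
  have kh: "k \<in> Hom E (Dom E k) X'" "Dom E k \<in> Ob E"
    using kernelD[OF k] g(2) by (simp_all add: hom_iff)
  obtain c1 where c1: "is_cokernel E c1 f" using admissible_cokernel[OF Fp(1) f(2)] .
  obtain c2 where c2: "is_cokernel E c2 g" using admissible_cokernel[OF Gp(1) g(2)] .
  \<comment> \<open>The horseshoe lemma with zero corner: the sum of two admissible arrows is
    admissible.\<close>
  have "admissible E F"
    by (rule horseshoe_admissible(1)[OF Fp(1) Gp(1) f(2) g(2) zer_hom[OF g(3) f(4)] bR bT k
          zer_hom[OF kh(2) f(3)] _ F(1,2) _ c1 c2]) (use kh f g T F(3) in \<open>simp_all add: hom_iff\<close>)
  then obtain S s where S: "S \<in> adm E" "pres E S F s" using pres_exists F(1) by metis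
  note SO = adm_Mod[OF S(1)] and Sp = presD[OF S(2) F(1)]
  \<comment> \<open>The four structure homomorphisms are prescribed on generators: \<open>i\<close>
    and \<open>j\<close> send \<open>y\<close> and \<open>z\<close> to the restrictions of
    \<open>s\<close> along \<open>a\<close> and \<open>b\<close>, while \<open>p\<close> and
    \<open>q\<close> send \<open>s\<close> to \<open>y\<close> and \<open>z\<close> pulled back
    along the projections.\<close>
  have "act S f (act S a s) = act S i1 (act S F s)"
    using act_cmp[OF SO f(2) T(2) Sp(2)] act_cmp[OF SO R(3) F(1) Sp(2)] F(2) by simp
  also have "\<dots> = \<one>[Fob S X]" unfolding Sp(3) by (rule act_one[OF SO R(3)])
  finally obtain i where i: "i \<in> Hom (\<M> E) M S" "app i Y y = act S a s"
    using pres_hom[OF f(1,2) MO SO act_closed[OF SO T(2) Sp(2)]] by blast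
  have "act S g (act S b s) = act S i2 (act S F s)"
    using act_cmp[OF SO g(2) T(3) Sp(2)] act_cmp[OF SO R(4) F(1) Sp(2)] F(3) by simp
  also have "\<dots> = \<one>[Fob S X']" unfolding Sp(3) by (rule act_one[OF SO R(4)])
  finally obtain j where j: "j \<in> Hom (\<M> E) N S" "app j Y' z = act S b s"
    using pres_hom[OF g(1,2) NO SO act_closed[OF SO T(3) Sp(2)]] by blast
  \<comment> \<open>\<open>F\<close> acts through \<open>f\<close> on the component along
    \<open>a\<close> and through \<open>g\<close> on that along \<open>b\<close>. For the elements
    used below one component is a generator, killed by its relation, and the other is zero.\<close>
  have actF: "act L F m = act L p1 (act L f (act L a m)) \<otimes>[Fob L R] act L p2 (act L g (act L b m))"
    if L: "L \<in> Ob (\<M> E)" and m: "m \<in> el L T" for L m unfolding F_def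
    using act_add[OF L cmp_hom[OF R(1) af] cmp_hom[OF R(2) bg] m] act_cmp[OF L R(1) af m] act_cmp[OF L R(2) bg m]
      act_cmp[OF L f(2) T(2) m] act_cmp[OF L g(2) T(3) m] by simp
  have one: "\<one>[Fob L R] \<otimes>[Fob L R] \<one>[Fob L R] = \<one>[Fob L R]" if "L \<in> Ob (\<M> E)" for L
    using mod_group[OF that hom_ob(1)[OF R(1)]] by (simp add: comm_group.axioms(2) group.is_monoid)
  note my = act_closed[OF MO T(4) Fp(2)] and nz = act_closed[OF NO T(5) Gp(2)]
  have M1: "act M a (act M c y) = y" "act M b (act M c y) = \<one>[Fob M Y']"
    using act_cmp[OF MO T(2,4) Fp(2)] act_cmp[OF MO T(3,4) Fp(2)] BT act_idn[OF MO f(4) Fp(2)]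
      act_zer[OF MO g(4) f(4) Fp(2)] by simp_all
  have N1: "act N b (act N d z) = z" "act N a (act N d z) = \<one>[Fob N Y]"
    using act_cmp[OF NO T(3,5) Gp(2)] act_cmp[OF NO T(2,5) Gp(2)] BT act_idn[OF NO g(4) Gp(2)]
      act_zer[OF NO f(4) g(4) Gp(2)] by simp_all
  have "act M F (act M c y) = \<one>[Fob M R]"
    unfolding actF[OF MO my] M1 Fp(3) act_one[OF MO g(2)] act_one[OF MO R(1)] act_one[OF MO R(2)] by (rule one[OF MO])
  then obtain p where p: "p \<in> Hom (\<M> E) S M" "app p T s = act M c y" using pres_hom[OF S(2) F(1) SO MO my] by blast
  have "act N F (act N d z) = \<one>[Fob N R]"
    unfolding actF[OF NO nz] N1 Gp(3) act_one[OF NO f(2)] act_one[OF NO R(1)] act_one[OF NO R(2)] by (rule one[OF NO])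
  then obtain q where q: "q \<in> Hom (\<M> E) S N" "app q T s = act N d z" using pres_hom[OF S(2) F(1) SO NO nz] by blast
  note ip = Mod.cmp_hom[OF p(1) i(1)] and jq = Mod.cmp_hom[OF q(1) j(1)]
  \<comment> \<open>The biproduct identities compare homomorphisms out of presented modules, so they
    are checked on generators.\<close>
  have pi: "p \<cdot>[\<M> E] i = Idn (\<M> E) M"
    by (rule pres_hom_eqI[OF f(1,2) Mod.cmp_hom[OF i(1) p(1)] Mod.id_hom[OF MO]])
      (use app_cmp[OF i(1) p(1) f(4) Fp(2)] app_natural[OF p(1) T(2) Sp(2)] i p M1 app_idn[OF f(4) Fp(2)] in simp)
  have qi: "q \<cdot>[\<M> E] i = Zer (\<M> E) M N"
    by (rule pres_hom_eqI[OF f(1,2) Mod.cmp_hom[OF i(1) q(1)] Mod.zer_hom[OF MO NO]])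
      (use app_cmp[OF i(1) q(1) f(4) Fp(2)] app_natural[OF q(1) T(2) Sp(2)] i q N1 app_zer[OF f(4) Fp(2)] in simp)
  have qj: "q \<cdot>[\<M> E] j = Idn (\<M> E) N"
    by (rule pres_hom_eqI[OF g(1,2) Mod.cmp_hom[OF j(1) q(1)] Mod.id_hom[OF NO]])
      (use app_cmp[OF j(1) q(1) g(4) Gp(2)] app_natural[OF q(1) T(3) Sp(2)] j q N1 app_idn[OF g(4) Gp(2)] in simp)
  have pj: "p \<cdot>[\<M> E] j = Zer (\<M> E) N M"
    by (rule pres_hom_eqI[OF g(1,2) Mod.cmp_hom[OF j(1) p(1)] Mod.zer_hom[OF NO MO]])
      (use app_cmp[OF j(1) p(1) g(4) Gp(2)] app_natural[OF p(1) T(3) Sp(2)] j p M1 app_zer[OF g(4) Gp(2)] in simp)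
  have ij: "i \<cdot>[\<M> E] p \<boxplus>[\<M> E] j \<cdot>[\<M> E] q = Idn (\<M> E) S"
  proof (rule pres_hom_eqI[OF S(2) F(1) Mod.add_hom[OF ip jq] Mod.id_hom[OF SO]])
    have "app i T (act M c y) = act S (a \<cdot> c) s" "app j T (act N d z) = act S (b \<cdot> d) s"
      using app_natural[OF i(1) T(4) Fp(2)] app_natural[OF j(1) T(5) Gp(2)] i(2) j(2) act_cmp[OF SO T(4,2) Sp(2)]
        act_cmp[OF SO T(5,3) Sp(2)] by simp_all
    thus "app (i \<cdot>[\<M> E] p \<boxplus>[\<M> E] j \<cdot>[\<M> E] q) T s = app (Idn (\<M> E) S) T s"
      using app_add[OF ip jq T(1) Sp(2)] app_cmp[OF p(1) i(1) T(1) Sp(2)] app_cmp[OF q(1) j(1) T(1) Sp(2)] p(2) q(2)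
        act_add[OF SO cmp_hom[OF T(4,2)] cmp_hom[OF T(5,3)] Sp(2)] BT act_idn[OF SO T(1) Sp(2)] app_idn[OF T(1) Sp(2)]
      by simp
  qed
  have "is_biproduct (\<A> E) M N S i j p q"
    unfolding is_biproduct_def using S(1) M N i(1) j(1) p(1) q(1) pi qi qj pj ij by (simp add: mod_adm_simps Hom_mod_adm)
  moreover have "app p W (app i W x) = x \<and> app q W (app i W x) = \<one>[Fob N W]" if "W \<in> Ob E" "x \<in> el M W" for W x
    using app_cmp[OF i(1) p(1) that] app_cmp[OF i(1) q(1) that] pi qi app_idn[OF that] app_zer[OF that] by simp
  moreover have "app q W (app j W x) = x \<and> app p W (app j W x) = \<one>[Fob M W]" if "W \<in> Ob E" "x \<in> el N W" for W x
    using app_cmp[OF j(1) q(1) that] app_cmp[OF j(1) p(1) that] qj pj app_idn[OF that] app_zer[OF that] by simp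
  moreover have "app i W (app p W t) \<otimes>[Fob S W] app j W (app q W t) = t" if "W \<in> Ob E" "t \<in> el S W" for W t
    using app_add[OF ip jq that] app_cmp[OF p(1) i(1) that] app_cmp[OF q(1) j(1) that] ij app_idn[OF that] by simp
  ultimately show thesis using that[OF S(1) _ i(1) j(1) p(1) q(1)] by blast
qed

section \<open>Conflations of modules under isomorphism and composition\<close>

lemma mod_adm_iso_bij: assumes "is_iso (\<A> E) a" "a \<in> Hom (\<A> E) M N" and W: "W \<in> Ob E"
  shows "x \<in> el M W \<Longrightarrow> app a W x = \<one>[Fob N W] \<longleftrightarrow> x = \<one>[Fob M W]" "y \<in> el N W \<Longrightarrow> \<exists>x\<in>el M W. app a W x = y"
proof -
  obtain b where b: "b \<in> Hom (\<A> E) N M" "b \<cdot>[\<A> E] a = Idn (\<A> E) M" "a \<cdot>[\<A> E] b = Idn (\<A> E) N"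
    using MA.isoE[OF assms(1,2)] by metis
  have h: "a \<in> Hom (\<M> E) M N" "b \<in> Hom (\<M> E) N M" using assms b by (auto simp: Hom_mod_adm)
  { assume x: "x \<in> el M W"
    have "app b W (app a W x) = x" using app_cmp[OF h W x] b(2) app_idn[OF W x] by (simp add: mod_adm_simps)
    thus "app a W x = \<one>[Fob N W] \<longleftrightarrow> x = \<one>[Fob M W]" using app_one[OF h(1) W] app_one[OF h(2) W] by auto }
  assume y: "y \<in> el N W"
  have "app a W (app b W y) = y" using app_cmp[OF h(2,1) W y] b(3) app_idn[OF W y] by (simp add: mod_adm_simps)
  thus "\<exists>x\<in>el M W. app a W x = y" using app_closed[OF h(2) W y] by blast
qed

lemma mod_adm_conf_iso_closed:
  assumes fg: "(f, g) \<in> Conf (\<A> E)" and f': "f' \<in> Ar (\<A> E)" and g': "g' \<in> Ar (\<A> E)"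
    and cd: "Cod (\<A> E) f' = Dom (\<A> E) g'" and a: "a \<in> Hom (\<A> E) (Dom (\<A> E) f) (Dom (\<A> E) f')"
    and b: "b \<in> Hom (\<A> E) (Cod (\<A> E) f) (Cod (\<A> E) f')" and c: "c \<in> Hom (\<A> E) (Cod (\<A> E) g) (Cod (\<A> E) g')"
    and iso: "is_iso (\<A> E) a" "is_iso (\<A> E) b" "is_iso (\<A> E) c"
    and eq: "b \<cdot>[\<A> E] f = f' \<cdot>[\<A> E] a" "c \<cdot>[\<A> E] g = g' \<cdot>[\<A> E] b" shows "(f', g') \<in> Conf (\<A> E)"
proof -
  obtain L M N where ex: "short_exact E L M N f g" and adm: "L \<in> adm E" "M \<in> adm E" "N \<in> adm E"
    using fg Conf_mod_adm by blast
  note SE = short_exactD[OF ex]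
  define L' M' N' where "L' = src f'" and "M' = tgt f'" and "N' = tgt g'"
  have st: "src f = L" "tgt f = M" "tgt g = N" using SE(1,2) by (auto simp: Hom_Mod)
  have H: "a \<in> Hom (\<A> E) L L'" "b \<in> Hom (\<A> E) M M'" "c \<in> Hom (\<A> E) N N'"
    "f' \<in> Hom (\<A> E) L' M'" "g' \<in> Hom (\<A> E) M' N'"
    using a b c f' g' cd st by (simp_all add: mod_adm_simps L'_def M'_def N'_def hom_iff)
  have h: "a \<in> Hom (\<M> E) L L'" "b \<in> Hom (\<M> E) M M'" "c \<in> Hom (\<M> E) N N'"
    "f' \<in> Hom (\<M> E) L' M'" "g' \<in> Hom (\<M> E) M' N'" and adm': "L' \<in> adm E" "M' \<in> adm E" "N' \<in> adm E"
    using H by (auto simp: Hom_mod_adm)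
  note A = mod_adm_iso_bij[OF iso(1) H(1)] and B = mod_adm_iso_bij[OF iso(2) H(2)] and C = mod_adm_iso_bij[OF iso(3) H(3)]
  have e1: "app b W (app f W x) = app f' W (app a W x)" if "W \<in> Ob E" "x \<in> el L W" for W x
    using app_cmp[OF SE(1) h(2) that] app_cmp[OF h(1,4) that] eq(1) by (simp add: mod_adm_simps)
  have e2: "app c W (app g W x) = app g' W (app b W x)" if "W \<in> Ob E" "x \<in> el M W" for W x
    using app_cmp[OF SE(2) h(3) that] app_cmp[OF h(2,5) that] eq(2) by (simp add: mod_adm_simps)
  have "short_exact E L' M' N' f' g'"
  proof (rule short_exactI[OF h(4,5)])
    fix W assume W: "W \<in> Ob E"
    note cl = app_closed[OF SE(1) W] app_closed[OF SE(2) W] app_closed[OF h(1) W] app_closed[OF h(2) W]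
    { fix x assume x: "x \<in> el L' W" "app f' W x = \<one>[Fob M' W]"
      obtain u where u: "u \<in> el L W" "app a W u = x" using A(2)[OF W x(1)] by blast
      have "app b W (app f W u) = \<one>[Fob M' W]" using e1[OF W u(1)] u(2) x(2) by simp
      hence "u = \<one>[Fob L W]" using B(1)[OF W cl(1)[OF u(1)]] SE(3)[OF W u(1)] by blast
      thus "x = \<one>[Fob L' W]" using u(2) app_one[OF h(1) W] by simp }
    { fix x assume x: "x \<in> el M' W" "app g' W x = \<one>[Fob N' W]"
      obtain u where u: "u \<in> el M W" "app b W u = x" using B(2)[OF W x(1)] by blast
      have "app c W (app g W u) = \<one>[Fob N' W]" using e2[OF W u(1)] u(2) x(2) by simp
      then obtain l where l: "l \<in> el L W" "app f W l = u" using C(1)[OF W cl(2)[OF u(1)]] SE(4)[OF W u(1)] by blast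
      thus "\<exists>l\<in>el L' W. app f' W l = x" using e1[OF W l(1)] u(2) cl(3)[OF l(1)] by auto }
    { fix x assume "x \<in> el L' W"
      then obtain u where u: "u \<in> el L W" "app a W u = x" using A(2)[OF W] by blast
      have "app g W (app f W u) = \<one>[Fob N W]" using SE(4)[OF W cl(1)[OF u(1)]] u(1) by blast
      thus "app g' W (app f' W x) = \<one>[Fob N' W]"
        using e1[OF W u(1)] e2[OF W cl(1)[OF u(1)]] u(2) app_one[OF h(3) W] by simp }
    { fix z assume "z \<in> el N' W"
      then obtain v where v: "v \<in> el N W" "app c W v = z" using C(2)[OF W] by blast
      obtain x where x: "x \<in> el M W" "app g W x = v" using SE(5)[OF W v(1)] by blast
      thus "\<exists>x\<in>el M' W. app g' W x = z" using e2[OF W x(1)] v(2) cl(4)[OF x(1)] by auto }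
  qed
  thus ?thesis using adm' Conf_mod_adm by blast
qed

text \<open>The zero module completes the identity to a conflation on either side.\<close>

lemma mod_adm_id: assumes M: "M \<in> adm E" shows "inflation (\<A> E) (Idn (\<A> E) M)" "deflation (\<A> E) (Idn (\<A> E) M)"
proof -
  obtain O' where O': "O' \<in> adm E" "\<And>W x. \<lbrakk>W \<in> Ob E; x \<in> el O' W\<rbrakk> \<Longrightarrow> x = \<one>[Fob O' W]"
    using zero_module by metis
  note MO = adm_Mod[OF M] and OO = adm_Mod[OF O'(1)]
  have one: "\<one>[Fob M W] \<in> el M W" "\<one>[Fob O' W] \<in> el O' W" if "W \<in> Ob E" for W
    using mod_group[OF MO that] mod_group[OF OO that]
    by (simp_all add: group.is_monoid comm_group.axioms(2))
  have "short_exact E M M O' (Idn (\<M> E) M) (Zer (\<M> E) M O')"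
    by (rule short_exactI[OF Mod.id_hom[OF MO] Mod.zer_hom[OF MO OO]]) (use O'(2) one in \<open>auto simp: app_idn app_zer\<close>)
  thus "inflation (\<A> E) (Idn (\<A> E) M)" using mod_adm_inflationI(1) M O'(1) by (simp add: mod_adm_simps)
  have "short_exact E O' M M (Zer (\<M> E) O' M) (Idn (\<M> E) M)"
  proof (rule short_exactI[OF Mod.zer_hom[OF OO MO] Mod.id_hom[OF MO]])
    fix W x assume W: "W \<in> Ob E" "x \<in> el M W" "app (Idn (\<M> E) M) W x = \<one>[Fob M W]"
    show "\<exists>l\<in>el O' W. app (Zer (\<M> E) O' M) W l = x"
      by (rule bexI[OF _ one(2)[OF W(1)]]) (use W one in \<open>simp add: app_idn app_zer\<close>)
  qed (use O'(2) one in \<open>auto simp: app_idn app_zer\<close>)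
  thus "deflation (\<A> E) (Idn (\<A> E) M)" using mod_adm_inflationI(2) M O'(1) by (simp add: mod_adm_simps)
qed

text \<open>The cokernel \<open>H\<close> of the composite is an extension of the cokernel of
  \<open>g\<close> by that of \<open>f\<close>, as in the third isomorphism theorem; closure under
  extensions makes it admissibly presented.\<close>

lemma mod_adm_inflation_cmp: assumes "inflation (\<A> E) f" "inflation (\<A> E) g" "Cod (\<A> E) f = Dom (\<A> E) g"
  shows "inflation (\<A> E) (g \<cdot>[\<A> E] f)"
proof -
  obtain L M P \<pi> where f: "short_exact E L M P f \<pi>" "L \<in> adm E" "M \<in> adm E" "P \<in> adm E"
    using mod_adm_inflationE[OF assms(1)] .
  obtain M' N Q \<rho> where g: "short_exact E M' N Q g \<rho>" "M' \<in> adm E" "N \<in> adm E" "Q \<in> adm E"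
    using mod_adm_inflationE[OF assms(2)] .
  note F = short_exactD[OF f(1)]
  have M': "M' = M" using assms(3) F(1) short_exactD(1)[OF g(1)] by (auto simp: Hom_Mod mod_adm_simps)
  note G = short_exactD[OF g(1)[unfolded M']]
  note gf = Mod.cmp_hom[OF F(1) G(1)]
  obtain H \<kappa> where H: "\<kappa> \<in> Hom (\<M> E) N H" "\<And>W z. \<lbrakk>W \<in> Ob E; z \<in> el H W\<rbrakk> \<Longrightarrow> \<exists>x\<in>el N W. app \<kappa> W x = z"
    "\<And>W x. \<lbrakk>W \<in> Ob E; x \<in> el N W\<rbrakk> \<Longrightarrow> app \<kappa> W x = \<one>[Fob H W] \<longleftrightarrow> (\<exists>l\<in>el L W. app (g \<cdot>[\<M> E] f) W l = x)"
    by (rule cokernel_module[OF gf]) (rule that)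
  have gfa: "app (g \<cdot>[\<M> E] f) W l = app g W (app f W l)" if "W \<in> Ob E" "l \<in> el L W" for W l
    using app_cmp[OF F(1) G(1) that] .
  have kg: "app (\<kappa> \<cdot>[\<M> E] g) W m = app \<kappa> W (app g W m)" if "W \<in> Ob E" "m \<in> el M W" for W m
    using app_cmp[OF G(1) H(1) that] .
  \<comment> \<open>As \<open>g\<close> is injective, an element of \<open>M\<close> dies in
    \<open>H\<close> exactly if it dies in the cokernel \<open>P\<close> of \<open>f\<close>. This
    gives both the homomorphism from \<open>P\<close> to \<open>H\<close> and its
    injectivity.\<close>
  have Hz: "app \<kappa> W (app g W m) = \<one>[Fob H W] \<longleftrightarrow> app \<pi> W m = \<one>[Fob P W]" if W: "W \<in> Ob E" "m \<in> el M W" for W m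
  proof
    assume "app \<kappa> W (app g W m) = \<one>[Fob H W]"
    then obtain l where l: "l \<in> el L W" "app g W (app f W l) = app g W m"
      using H(3)[OF W(1) app_closed[OF G(1) W]] gfa[OF W(1)] by auto
    have "app f W l = m" using app_inj[OF G(1) W(1) app_closed[OF F(1) W(1) l(1)] W(2) l(2)] G(3)[OF W(1)] by blast
    thus "app \<pi> W m = \<one>[Fob P W]" using F(4)[OF W] l(1) by blast
  next
    assume "app \<pi> W m = \<one>[Fob P W]"
    then obtain l where "l \<in> el L W" "app f W l = m" using F(4)[OF W] by blast
    thus "app \<kappa> W (app g W m) = \<one>[Fob H W]" using H(3)[OF W(1) app_closed[OF G(1) W]] gfa[OF W(1)] by auto
  qed
  obtain \<phi> where \<phi>: "\<phi> \<in> Hom (\<M> E) P H"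
    "\<And>W m. \<lbrakk>W \<in> Ob E; m \<in> el M W\<rbrakk> \<Longrightarrow> app \<phi> W (app \<pi> W m) = app (\<kappa> \<cdot>[\<M> E] g) W m"
    using factor_epi[OF F(2) Mod.cmp_hom[OF G(1) H(1)] F(5)] kg Hz by (metis (no_types, lifting))
  have ker: "app \<rho> W n = \<one>[Fob Q W]" if W: "W \<in> Ob E" "n \<in> el N W" "app \<kappa> W n = \<one>[Fob H W]" for W n
    using H(3)[OF W(1,2)] W(3) gfa[OF W(1)] G(4)[OF W(1,2)] app_closed[OF F(1) W(1)] by auto
  obtain \<psi> where \<psi>: "\<psi> \<in> Hom (\<M> E) H Q" "\<And>W n. \<lbrakk>W \<in> Ob E; n \<in> el N W\<rbrakk> \<Longrightarrow> app \<psi> W (app \<kappa> W n) = app \<rho> W n"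
    using factor_epi[OF H(1) G(2) H(2) ker] by blast
  have "short_exact E P H Q \<phi> \<psi>"
  proof (rule short_exactI[OF \<phi>(1) \<psi>(1)])
    fix W assume W: "W \<in> Ob E"
    { fix x assume x: "x \<in> el P W" "app \<phi> W x = \<one>[Fob H W]"
      obtain m where "m \<in> el M W" "app \<pi> W m = x" using F(5)[OF W x(1)] by blast
      thus "x = \<one>[Fob P W]" using x(2) \<phi>(2)[OF W] kg[OF W] Hz[OF W] by auto }
    { fix x assume x: "x \<in> el H W" "app \<psi> W x = \<one>[Fob Q W]"
      obtain n where n: "n \<in> el N W" "app \<kappa> W n = x" using H(2)[OF W x(1)] by blast
      hence "app \<rho> W n = \<one>[Fob Q W]" using x(2) \<psi>(2)[OF W] by auto
      then obtain m where m: "m \<in> el M W" "app g W m = n" using G(4)[OF W n(1)] by blast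
      hence "app \<phi> W (app \<pi> W m) = x" using \<phi>(2)[OF W] kg[OF W] n by simp
      thus "\<exists>l\<in>el P W. app \<phi> W l = x" using app_closed[OF F(2) W m(1)] by blast }
    { fix x assume x: "x \<in> el P W"
      obtain m where m: "m \<in> el M W" "app \<pi> W m = x" using F(5)[OF W x(1)] by blast
      have "app \<rho> W (app g W m) = \<one>[Fob Q W]" using G(4)[OF W app_closed[OF G(1) W m(1)]] m(1) by blast
      thus "app \<psi> W (app \<phi> W x) = \<one>[Fob Q W]"
        using \<phi>(2)[OF W m(1)] kg[OF W m(1)] \<psi>(2)[OF W app_closed[OF G(1) W m(1)]] m(2) by simp }
    { fix z assume "z \<in> el Q W"
      then obtain n where "n \<in> el N W" "app \<rho> W n = z" using G(5)[OF W] by blast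
      thus "\<exists>x\<in>el H W. app \<psi> W x = z" using \<psi>(2)[OF W] app_closed[OF H(1) W] by metis }
  qed
  hence Hadm: "H \<in> adm E" using adm_extension f g by blast
  have "short_exact E L N H (g \<cdot>[\<M> E] f) \<kappa>"
  proof (rule short_exactI[OF gf H(1)])
    show "x = \<one>[Fob L W]" if "W \<in> Ob E" "x \<in> el L W" "app (g \<cdot>[\<M> E] f) W x = \<one>[Fob N W]" for W x
      using that gfa[OF that(1,2)] F(3)[OF that(1,2)] G(3)[OF that(1) app_closed[OF F(1) that(1,2)]] by simp
    show "app \<kappa> W (app (g \<cdot>[\<M> E] f) W x) = \<one>[Fob H W]" if "W \<in> Ob E" "x \<in> el L W" for W x
      using H(3)[OF that(1) app_closed[OF gf that]] that by blast
  qed (use H(2,3) in blast)+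
  thus ?thesis using mod_adm_inflationI(1) f(2) g(3) Hadm by (simp add: mod_adm_simps)
qed

text \<open>Dually, the kernel of the composite is an extension of the kernel of \<open>g\<close> by
  that of \<open>f\<close>.\<close>

lemma mod_adm_deflation_cmp: assumes "deflation (\<A> E) f" "deflation (\<A> E) g" "Cod (\<A> E) f = Dom (\<A> E) g"
  shows "deflation (\<A> E) (g \<cdot>[\<A> E] f)"
proof -
  obtain K1 L M \<iota> where f: "short_exact E K1 L M \<iota> f" "K1 \<in> adm E" "L \<in> adm E" "M \<in> adm E"
    using mod_adm_deflationE[OF assms(1)] .
  obtain K2 M' N \<kappa> where g: "short_exact E K2 M' N \<kappa> g" "K2 \<in> adm E" "M' \<in> adm E" "N \<in> adm E"
    using mod_adm_deflationE[OF assms(2)] .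
  note F = short_exactD[OF f(1)]
  have M': "M' = M" using assms(3) F(2) short_exactD(2)[OF g(1)] by (auto simp: Hom_Mod mod_adm_simps)
  note G = short_exactD[OF g(1)[unfolded M']]
  note gf = Mod.cmp_hom[OF F(2) G(2)]
  obtain K \<nu> where K: "\<nu> \<in> Hom (\<M> E) K L"
    "\<And>W x. \<lbrakk>W \<in> Ob E; x \<in> el K W; app \<nu> W x = \<one>[Fob L W]\<rbrakk> \<Longrightarrow> x = \<one>[Fob K W]"
    "\<And>W x. \<lbrakk>W \<in> Ob E; x \<in> el L W\<rbrakk> \<Longrightarrow> app (g \<cdot>[\<M> E] f) W x = \<one>[Fob N W] \<longleftrightarrow> (\<exists>l\<in>el K W. app \<nu> W l = x)"
    by (rule kernel_module[OF gf]) (rule that)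
  have gfa: "app (g \<cdot>[\<M> E] f) W l = app g W (app f W l)" if "W \<in> Ob E" "l \<in> el L W" for W l
    using app_cmp[OF F(2) G(2) that] .
  have fn: "app (f \<cdot>[\<M> E] \<nu>) W k = app f W (app \<nu> W k)" if "W \<in> Ob E" "k \<in> el K W" for W k
    using app_cmp[OF K(1) F(2) that] .
  have im1: "\<exists>k\<in>el K W. app \<nu> W k = app \<iota> W x" if W: "W \<in> Ob E" "x \<in> el K1 W" for W x
  proof -
    note c = app_closed[OF F(1) W]
    have "app f W (app \<iota> W x) = \<one>[Fob M W]" using F(4)[OF W(1) c] W(2) by blast
    thus ?thesis using K(3)[OF W(1) c] gfa[OF W(1) c] app_one[OF G(2) W(1)] by simp
  qed
  obtain \<phi> where \<phi>: "\<phi> \<in> Hom (\<M> E) K1 K" "\<And>W x. \<lbrakk>W \<in> Ob E; x \<in> el K1 W\<rbrakk> \<Longrightarrow> app \<nu> W (app \<phi> W x) = app \<iota> W x"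
    using factor_mono[OF K(1) F(1) K(2) im1] by blast
  have im2: "\<exists>k\<in>el K2 W. app \<kappa> W k = app (f \<cdot>[\<M> E] \<nu>) W x" if W: "W \<in> Ob E" "x \<in> el K W" for W x
  proof -
    note c = app_closed[OF K(1) W]
    have "app g W (app f W (app \<nu> W x)) = \<one>[Fob N W]" using K(3)[OF W(1) c] gfa[OF W(1) c] W(2) by auto
    thus ?thesis using G(4)[OF W(1) app_closed[OF F(2) W(1) c]] fn[OF W] by simp
  qed
  obtain \<psi> where \<psi>: "\<psi> \<in> Hom (\<M> E) K K2"
    "\<And>W x. \<lbrakk>W \<in> Ob E; x \<in> el K W\<rbrakk> \<Longrightarrow> app \<kappa> W (app \<psi> W x) = app (f \<cdot>[\<M> E] \<nu>) W x"
    using factor_mono[OF G(1) Mod.cmp_hom[OF K(1) F(2)] G(3) im2] by blast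
  have "short_exact E K1 K K2 \<phi> \<psi>"
  proof (rule short_exactI[OF \<phi>(1) \<psi>(1)])
    fix W assume W: "W \<in> Ob E"
    { fix x assume x: "x \<in> el K1 W" "app \<phi> W x = \<one>[Fob K W]"
      thus "x = \<one>[Fob K1 W]" using F(3)[OF W x(1)] \<phi>(2)[OF W x(1)] app_one[OF K(1) W] by simp }
    { fix x assume x: "x \<in> el K W" "app \<psi> W x = \<one>[Fob K2 W]"
      have "app f W (app \<nu> W x) = \<one>[Fob M W]" using \<psi>(2)[OF W x(1)] fn[OF W x(1)] x(2) app_one[OF G(1) W] by simp
      then obtain k where k: "k \<in> el K1 W" "app \<iota> W k = app \<nu> W x" using F(4)[OF W app_closed[OF K(1) W x(1)]] by blast
      have "app \<phi> W k = x"
        using app_inj[OF K(1) W app_closed[OF \<phi>(1) W k(1)] x(1)] \<phi>(2)[OF W k(1)] k(2) K(2)[OF W] by simp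
      thus "\<exists>l\<in>el K1 W. app \<phi> W l = x" using k(1) by blast }
    { fix x assume x: "x \<in> el K1 W"
      have "app f W (app \<iota> W x) = \<one>[Fob M W]" using F(4)[OF W app_closed[OF F(1) W x]] x by blast
      hence "app \<kappa> W (app \<psi> W (app \<phi> W x)) = \<one>[Fob M W]"
        using \<psi>(2)[OF W app_closed[OF \<phi>(1) W x]] fn[OF W app_closed[OF \<phi>(1) W x]] \<phi>(2)[OF W x] by simp
      thus "app \<psi> W (app \<phi> W x) = \<one>[Fob K2 W]"
        using G(3)[OF W app_closed[OF \<psi>(1) W app_closed[OF \<phi>(1) W x]]] by blast }
    { fix z assume z: "z \<in> el K2 W"
      obtain l where l: "l \<in> el L W" "app f W l = app \<kappa> W z" using F(5)[OF W app_closed[OF G(1) W z]] by blast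
      have "app g W (app f W l) = \<one>[Fob N W]" using G(4)[OF W app_closed[OF G(1) W z]] z l(2) by auto
      then obtain k where k: "k \<in> el K W" "app \<nu> W k = l" using K(3)[OF W l(1)] gfa[OF W l(1)] by auto
      have "app \<psi> W k = z"
        using app_inj[OF G(1) W app_closed[OF \<psi>(1) W k(1)] z] \<psi>(2)[OF W k(1)] fn[OF W k(1)] k(2) l(2) G(3)[OF W] by simp
      thus "\<exists>x\<in>el K W. app \<psi> W x = z" using k(1) by blast }
  qed
  hence Kadm: "K \<in> adm E" using adm_extension f g by blast
  have "short_exact E K L N \<nu> (g \<cdot>[\<M> E] f)"
  proof (rule short_exactI[OF K(1) gf])
    fix W assume W: "W \<in> Ob E"
    show "app (g \<cdot>[\<M> E] f) W (app \<nu> W x) = \<one>[Fob N W]" if "x \<in> el K W" for x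
      using K(3)[OF W app_closed[OF K(1) W that]] that by blast
    fix z assume z: "z \<in> el N W"
    obtain m where m: "m \<in> el M W" "app g W m = z" using G(5)[OF W z] by blast
    obtain l where l: "l \<in> el L W" "app f W l = m" using F(5)[OF W m(1)] by blast
    show "\<exists>x\<in>el L W. app (g \<cdot>[\<M> E] f) W x = z" using gfa[OF W l(1)] l m by auto
  qed (use K(2,3) in blast)+
  thus ?thesis using mod_adm_inflationI(2) f(3) g(4) Kadm by (simp add: mod_adm_simps)
qed

end

lemma comm_group_diff_eq: assumes "comm_group G" "x \<in> carrier G" "y \<in> carrier G"
  shows "x \<otimes>[G] inv[G] y = \<one>[G] \<longleftrightarrow> x = y"
proof -
  interpret comm_group G by fact
  show ?thesis using inv_equality[of x "inv[G] y"] assms by auto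
qed

section \<open>Pushouts of inflations and pullbacks of deflations of modules\<close>

context exact_category
begin

interpretation Mod: preadditive_category "\<M> E" by (rule preadditive_Mod)
interpretation MA: preadditive_category "\<A> E" by (rule preadditive_mod_adm)

text \<open>The pushout \<open>P\<close> is the cokernel of \<open>f\<close> and minus
  \<open>g\<close> into a biproduct. The leg \<open>N \<rightarrow> P\<close> is injective with the
  same cokernel \<open>Q\<close> as \<open>f\<close>, so \<open>P\<close> is an extension of
  \<open>Q\<close> by \<open>N\<close> and admissibly presented.\<close>

lemma mod_adm_inflation_pushout: assumes "inflation (\<A> E) f" "g \<in> Ar (\<A> E)" "Dom (\<A> E) g = Dom (\<A> E) f"
  shows "\<exists>f' g'. is_pushout (\<A> E) f g f' g' \<and> inflation (\<A> E) g'"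
proof -
  obtain L M Q \<pi> where f: "short_exact E L M Q f \<pi>" "L \<in> adm E" "M \<in> adm E" "Q \<in> adm E"
    using mod_adm_inflationE[OF assms(1)] .
  note F = short_exactD[OF f(1)]
  define N where "N = tgt g"
  have gM: "g \<in> Hom (\<A> E) L N" using assms(2,3) F(1) by (auto simp: hom_iff mod_adm_simps N_def Mod_simps)
  hence g: "g \<in> Hom (\<M> E) L N" "N \<in> adm E" by (auto simp: Hom_mod_adm)
  obtain S i j p q where S: "S \<in> adm E" and bS: "is_biproduct (\<A> E) M N S i j p q" and S':
    "i \<in> Hom (\<M> E) M S" "j \<in> Hom (\<M> E) N S" "p \<in> Hom (\<M> E) S M" "q \<in> Hom (\<M> E) S N"
    and pi: "\<And>W x. \<lbrakk>W \<in> Ob E; x \<in> el M W\<rbrakk> \<Longrightarrow> app p W (app i W x) = x \<and> app q W (app i W x) = \<one>[Fob N W]"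
    and qj: "\<And>W x. \<lbrakk>W \<in> Ob E; x \<in> el N W\<rbrakk> \<Longrightarrow> app q W (app j W x) = x \<and> app p W (app j W x) = \<one>[Fob M W]"
    and ij: "\<And>W s. \<lbrakk>W \<in> Ob E; s \<in> el S W\<rbrakk> \<Longrightarrow> app i W (app p W s) \<otimes>[Fob S W] app j W (app q W s) = s"
    by (rule module_biproduct[OF f(3) g(2)]) (rule that)
  note S = S S'
  note ob = f(2)[THEN adm_Mod] f(3)[THEN adm_Mod] g(2)[THEN adm_Mod] S(1)[THEN adm_Mod] f(4)[THEN adm_Mod]
  have gr: "comm_group (Fob L W)" "comm_group (Fob M W)" "comm_group (Fob N W)" "comm_group (Fob S W)"
    "comm_group (Fob Q W)" if "W \<in> Ob E" for W using ob mod_group that by auto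
  note ng = Mod.neg_hom[OF g(1)]
  define \<delta> where "\<delta> = i \<cdot>[\<M> E] f \<boxplus>[\<M> E] j \<cdot>[\<M> E] Neg (\<M> E) g"
  note h1 = Mod.cmp_hom[OF F(1) S(2)] and h2 = Mod.cmp_hom[OF ng S(3)]
  have \<delta>: "\<delta> \<in> Hom (\<M> E) L S" unfolding \<delta>_def using Mod.add_hom[OF h1 h2] .
  have d: "app \<delta> W l = app i W (app f W l) \<otimes>[Fob S W] inv[Fob S W] app j W (app g W l)"
    if "W \<in> Ob E" "l \<in> el L W" for W l
    unfolding \<delta>_def using app_add[OF h1 h2 that] app_neg[OF g(1) that] app_inv[OF S(3) that(1) app_closed[OF g(1) that]]
      app_cmp[OF F(1) S(2) that] app_cmp[OF ng S(3) that] by simp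
  \<comment> \<open>Projecting \<delta> to \<open>M\<close> gives back \<open>f\<close>; this is how
    injectivity of \<open>f\<close> and its cokernel enter below.\<close>
  have pd: "app p W (app \<delta> W l) = app f W l" if W: "W \<in> Ob E" and l: "l \<in> el L W" for W l
  proof -
    interpret MG: comm_group "Fob M W" using gr W by blast
    interpret SG: comm_group "Fob S W" using gr W by blast
    note c = app_closed[OF F(1) W l] app_closed[OF g(1) W l]
    note c2 = app_closed[OF S(2) W c(1)] app_closed[OF S(3) W c(2)]
    show ?thesis unfolding d[OF W l]
      using app_mult[OF S(4) W c2(1) SG.inv_closed[OF c2(2)]] app_inv[OF S(4) W c2(2)] pi[OF W c(1)] qj[OF W c(2)] c by simp
  qed
  obtain P \<kappa> where P: "\<kappa> \<in> Hom (\<M> E) S P" "\<And>W z. \<lbrakk>W \<in> Ob E; z \<in> el P W\<rbrakk> \<Longrightarrow> \<exists>x\<in>el S W. app \<kappa> W x = z"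
    "\<And>W x. \<lbrakk>W \<in> Ob E; x \<in> el S W\<rbrakk> \<Longrightarrow> app \<kappa> W x = \<one>[Fob P W] \<longleftrightarrow> (\<exists>l\<in>el L W. app \<delta> W l = x)"
    by (rule cokernel_module[OF \<delta>]) (rule that)
  have PO: "P \<in> Ob (\<M> E)" using Mod_ob P(1) by blast
  have grP: "comm_group (Fob P W)" if "W \<in> Ob E" for W using PO mod_group that by auto
  define f' where "f' = \<kappa> \<cdot>[\<M> E] i"
  define g' where "g' = \<kappa> \<cdot>[\<M> E] j"
  have f': "f' \<in> Hom (\<M> E) M P" "\<And>W x. \<lbrakk>W \<in> Ob E; x \<in> el M W\<rbrakk> \<Longrightarrow> app f' W x = app \<kappa> W (app i W x)"
    and g': "g' \<in> Hom (\<M> E) N P" "\<And>W x. \<lbrakk>W \<in> Ob E; x \<in> el N W\<rbrakk> \<Longrightarrow> app g' W x = app \<kappa> W (app j W x)"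
    unfolding f'_def g'_def using Mod.cmp_hom[OF S(2) P(1)] Mod.cmp_hom[OF S(3) P(1)] app_cmp[OF S(2) P(1)] app_cmp[OF S(3) P(1)]
    by auto
  have kd: "app \<kappa> W (app \<delta> W l) = \<one>[Fob P W]" if "W \<in> Ob E" "l \<in> el L W" for W l
    using P(3)[OF that(1) app_closed[OF \<delta> that]] that(2) by blast
  have comm: "app f' W (app f W l) = app g' W (app g W l)" if W: "W \<in> Ob E" and l: "l \<in> el L W" for W l
  proof -
    interpret SG: comm_group "Fob S W" using gr W by blast
    note c = app_closed[OF F(1) W l] app_closed[OF g(1) W l]
    note c2 = app_closed[OF S(2) W c(1)] app_closed[OF S(3) W c(2)]
    have "app \<kappa> W (app i W (app f W l)) \<otimes>[Fob P W] inv[Fob P W] app \<kappa> W (app j W (app g W l)) = \<one>[Fob P W]"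
      using kd[OF W l] unfolding d[OF W l]
      using app_mult[OF P(1) W c2(1) SG.inv_closed[OF c2(2)]] app_inv[OF P(1) W c2(2)] by simp
    thus ?thesis
      using comm_group_diff_eq[OF grP[OF W] app_closed[OF P(1) W c2(1)] app_closed[OF P(1) W c2(2)]] f'(2) g'(2) W c
      by simp
  qed
  note pp = Mod.cmp_hom[OF S(4) F(2)]
  have ppa: "app (\<pi> \<cdot>[\<M> E] p) W s = app \<pi> W (app p W s)" if "W \<in> Ob E" "s \<in> el S W" for W s
    using app_cmp[OF S(4) F(2) that] .
  have ker: "app (\<pi> \<cdot>[\<M> E] p) W s = \<one>[Fob Q W]" if W: "W \<in> Ob E" "s \<in> el S W" "app \<kappa> W s = \<one>[Fob P W]" for W s
  proof -
    obtain l where l: "l \<in> el L W" "app \<delta> W l = s" using P(3)[OF W(1,2)] W(3) by blast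
    have "app \<pi> W (app f W l) = \<one>[Fob Q W]" using F(4)[OF W(1) app_closed[OF F(1) W(1) l(1)]] l(1) by blast
    thus ?thesis using ppa[OF W(1,2)] pd[OF W(1) l(1)] l(2) by simp
  qed
  obtain \<psi> where \<psi>: "\<psi> \<in> Hom (\<M> E) P Q"
    "\<And>W s. \<lbrakk>W \<in> Ob E; s \<in> el S W\<rbrakk> \<Longrightarrow> app \<psi> W (app \<kappa> W s) = app (\<pi> \<cdot>[\<M> E] p) W s"
    using factor_epi[OF P(1) pp P(2) ker] by blast
  have ex: "short_exact E N P Q g' \<psi>"
  proof (rule short_exactI[OF g'(1) \<psi>(1)])
    fix W assume W: "W \<in> Ob E" interpret SG: comm_group "Fob S W" using gr W by blast
    { fix n assume n: "n \<in> el N W" "app g' W n = \<one>[Fob P W]"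
      note c = app_closed[OF S(3) W n(1)]
      obtain l where l: "l \<in> el L W" "app \<delta> W l = app j W n" using P(3)[OF W c] n(2) g'(2)[OF W n(1)] by auto
      have "app f W l = \<one>[Fob M W]" using pd[OF W l(1)] l(2) qj[OF W n(1)] by simp
      hence "l = \<one>[Fob L W]" using F(3)[OF W l(1)] by blast
      hence "app j W n = \<one>[Fob S W]" using l(2) app_one[OF \<delta> W] by simp
      thus "n = \<one>[Fob N W]" using qj[OF W n(1)] app_one[OF S(5) W] by simp }
    { fix x assume x: "x \<in> el P W" "app \<psi> W x = \<one>[Fob Q W]"
      obtain s where s: "s \<in> el S W" "app \<kappa> W s = x" using P(2)[OF W x(1)] by blast
      have "app \<pi> W (app p W s) = \<one>[Fob Q W]" using x(2) \<psi>(2)[OF W s(1)] ppa[OF W s(1)] s(2) by simp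
      then obtain l where l: "l \<in> el L W" "app f W l = app p W s" using F(4)[OF W app_closed[OF S(4) W s(1)]] by blast
      note cf = app_closed[OF F(1) W l(1)] and cg = app_closed[OF g(1) W l(1)] and cq = app_closed[OF S(5) W s(1)]
      \<comment> \<open>Splitting \<open>s\<close> into its components, the part in \<open>M\<close>
        lies in the image of \<open>f\<close> and can be moved to \<open>N\<close> across the
        square.\<close>
      have "x = app \<kappa> W (app i W (app p W s) \<otimes>[Fob S W] app j W (app q W s))" using ij[OF W s(1)] s(2) by simp
      also have "\<dots> = app f' W (app f W l) \<otimes>[Fob P W] app g' W (app q W s)"
        using app_mult[OF P(1) W app_closed[OF S(2) W cf] app_closed[OF S(3) W cq]] f'(2)[OF W cf] g'(2)[OF W cq] l(2) by simp
      also have "\<dots> = app g' W (app g W l \<otimes>[Fob N W] app q W s)"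
        using comm[OF W l(1)] app_mult[OF g'(1) W cg cq] by simp
      finally show "\<exists>n\<in>el N W. app g' W n = x" using comm_group_m_closed[OF gr(3)[OF W] cg cq] by blast }
    { fix n assume n: "n \<in> el N W"
      show "app \<psi> W (app g' W n) = \<one>[Fob Q W]"
        using g'(2)[OF W n] \<psi>(2)[OF W app_closed[OF S(3) W n]] ppa[OF W app_closed[OF S(3) W n]] qj[OF W n]
          app_one[OF F(2) W] by simp }
    { fix z assume z: "z \<in> el Q W"
      obtain m where m: "m \<in> el M W" "app \<pi> W m = z" using F(5)[OF W z] by blast
      note c = app_closed[OF S(2) W m(1)]
      have "app \<psi> W (app \<kappa> W (app i W m)) = z" using \<psi>(2)[OF W c] ppa[OF W c] pi[OF W m(1)] m(2) by simp
      thus "\<exists>x\<in>el P W. app \<psi> W x = z" using app_closed[OF P(1) W c] by blast }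
  qed
  have Padm: "P \<in> adm E" using adm_extension[OF ex g(2) f(4)] .
  have inf: "inflation (\<A> E) g'" using mod_adm_inflationI(1)[OF ex g(2) Padm f(4)] .
  have "is_cokernel (\<A> E) \<kappa> \<delta>" by (rule mod_adm_ker_coker(2)[OF f(2) S(1) Padm \<delta> P(1,3,2)])
  hence "is_pushout (\<A> E) f g f' g'" unfolding f'_def g'_def \<delta>_def
    using MA.pushout_of_cokernel[OF bS, of f L g "Neg (\<M> E) g" \<kappa>] F(1) g f(2,3) Mod.neg_hom[OF g(1)] Mod.hom_add_neg[OF g(1)]
    by (simp add: Hom_mod_adm mod_adm_simps)
  thus ?thesis using inf by blast
qed

text \<open>The pullback \<open>P\<close> is the kernel of the difference on a biproduct; the kernel
  \<open>K\<close> of \<open>f\<close> is also that of \<open>P \<rightarrow> N\<close>, so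
  \<open>P\<close> is an extension of \<open>N\<close> by \<open>K\<close>.\<close>

lemma mod_adm_deflation_pullback: assumes "deflation (\<A> E) f" "g \<in> Ar (\<A> E)" "Cod (\<A> E) g = Cod (\<A> E) f"
  shows "\<exists>f' g'. is_pullback (\<A> E) f g f' g' \<and> deflation (\<A> E) g'"
proof -
  obtain K M L \<iota> where f: "short_exact E K M L \<iota> f" "K \<in> adm E" "M \<in> adm E" "L \<in> adm E"
    using mod_adm_deflationE[OF assms(1)] .
  note F = short_exactD[OF f(1)]
  define N where "N = src g"
  have gM: "g \<in> Hom (\<A> E) N L" using assms(2,3) F(2) by (auto simp: hom_iff mod_adm_simps N_def Mod_simps)
  hence g: "g \<in> Hom (\<M> E) N L" "N \<in> adm E" by (auto simp: Hom_mod_adm)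
  obtain S i j p q where S: "S \<in> adm E" and bS: "is_biproduct (\<A> E) M N S i j p q" and S':
    "i \<in> Hom (\<M> E) M S" "j \<in> Hom (\<M> E) N S" "p \<in> Hom (\<M> E) S M" "q \<in> Hom (\<M> E) S N"
    and pi: "\<And>W x. \<lbrakk>W \<in> Ob E; x \<in> el M W\<rbrakk> \<Longrightarrow> app p W (app i W x) = x \<and> app q W (app i W x) = \<one>[Fob N W]"
    and qj: "\<And>W x. \<lbrakk>W \<in> Ob E; x \<in> el N W\<rbrakk> \<Longrightarrow> app q W (app j W x) = x \<and> app p W (app j W x) = \<one>[Fob M W]"
    and ij: "\<And>W s. \<lbrakk>W \<in> Ob E; s \<in> el S W\<rbrakk> \<Longrightarrow> app i W (app p W s) \<otimes>[Fob S W] app j W (app q W s) = s"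
    by (rule module_biproduct[OF f(3) g(2)]) (rule that)
  note S = S S'
  note ob = f(4)[THEN adm_Mod] f(3)[THEN adm_Mod] g(2)[THEN adm_Mod] S(1)[THEN adm_Mod]
  have gr: "comm_group (Fob L W)" "comm_group (Fob M W)" "comm_group (Fob N W)" "comm_group (Fob S W)"
    if "W \<in> Ob E" for W using ob mod_group that by auto
  have pm: "app p W (app i W m \<otimes>[Fob S W] app j W n) = m" and qm: "app q W (app i W m \<otimes>[Fob S W] app j W n) = n"
    and ijc: "app i W m \<otimes>[Fob S W] app j W n \<in> el S W"
    if W: "W \<in> Ob E" and m: "m \<in> el M W" and n: "n \<in> el N W" for W m n
  proof -
    interpret MG: comm_group "Fob M W" using gr W by blast
    interpret NG: comm_group "Fob N W" using gr W by blast
    note c = app_closed[OF S(2) W m] app_closed[OF S(3) W n]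
    show "app p W (app i W m \<otimes>[Fob S W] app j W n) = m" "app q W (app i W m \<otimes>[Fob S W] app j W n) = n"
      using app_mult[OF S(4) W c] app_mult[OF S(5) W c] pi[OF W m] qj[OF W n] m n by simp_all
    show "app i W m \<otimes>[Fob S W] app j W n \<in> el S W" using comm_group_m_closed[OF gr(4)[OF W] c] .
  qed
  note ng = Mod.neg_hom[OF g(1)]
  define \<delta> where "\<delta> = f \<cdot>[\<M> E] p \<boxplus>[\<M> E] Neg (\<M> E) g \<cdot>[\<M> E] q"
  note h1 = Mod.cmp_hom[OF S(4) F(2)] and h2 = Mod.cmp_hom[OF S(5) ng]
  have \<delta>: "\<delta> \<in> Hom (\<M> E) S L" unfolding \<delta>_def using Mod.add_hom[OF h1 h2] .
  have d: "app \<delta> W s = \<one>[Fob L W] \<longleftrightarrow> app f W (app p W s) = app g W (app q W s)"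
    if W: "W \<in> Ob E" "s \<in> el S W" for W s
  proof -
    have "app \<delta> W s = app f W (app p W s) \<otimes>[Fob L W] inv[Fob L W] app g W (app q W s)"
      unfolding \<delta>_def using app_add[OF h1 h2 W] app_neg[OF g(1) W(1) app_closed[OF S(5) W]]
        app_cmp[OF S(4) F(2) W] app_cmp[OF S(5) ng W] by simp
    thus ?thesis using comm_group_diff_eq[OF gr(1)[OF W(1)] app_closed[OF F(2) W(1) app_closed[OF S(4) W]]
          app_closed[OF g(1) W(1) app_closed[OF S(5) W]]] by simp
  qed
  obtain P \<nu> where P: "\<nu> \<in> Hom (\<M> E) P S"
    "\<And>W x. \<lbrakk>W \<in> Ob E; x \<in> el P W; app \<nu> W x = \<one>[Fob S W]\<rbrakk> \<Longrightarrow> x = \<one>[Fob P W]"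
    "\<And>W x. \<lbrakk>W \<in> Ob E; x \<in> el S W\<rbrakk> \<Longrightarrow> app \<delta> W x = \<one>[Fob L W] \<longleftrightarrow> (\<exists>l\<in>el P W. app \<nu> W l = x)"
    by (rule kernel_module[OF \<delta>]) (rule that)
  define f' where "f' = p \<cdot>[\<M> E] \<nu>"
  define g' where "g' = q \<cdot>[\<M> E] \<nu>"
  have f': "f' \<in> Hom (\<M> E) P M" "\<And>W x. \<lbrakk>W \<in> Ob E; x \<in> el P W\<rbrakk> \<Longrightarrow> app f' W x = app p W (app \<nu> W x)"
    and g': "g' \<in> Hom (\<M> E) P N" "\<And>W x. \<lbrakk>W \<in> Ob E; x \<in> el P W\<rbrakk> \<Longrightarrow> app g' W x = app q W (app \<nu> W x)"
    unfolding f'_def g'_def using Mod.cmp_hom[OF P(1) S(4)] Mod.cmp_hom[OF P(1) S(5)] app_cmp[OF P(1) S(4)] app_cmp[OF P(1) S(5)]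
    by auto
  have comm: "app f W (app f' W x) = app g W (app g' W x)" if W: "W \<in> Ob E" and x: "x \<in> el P W" for W x
    using d[OF W app_closed[OF P(1) W x]] P(3)[OF W app_closed[OF P(1) W x]] x f'(2)[OF W x] g'(2)[OF W x] by auto
  \<comment> \<open>This and the next fact say that elements of \<open>P\<close> are the pairs of
    elements of \<open>M\<close> and \<open>N\<close> with the same image in
    \<open>L\<close>.\<close>
  have nu_eq: "x = y" if W: "W \<in> Ob E" and xy: "x \<in> el P W" "y \<in> el P W" "app f' W x = app f' W y" "app g' W x = app g' W y" for W x y
  proof -
    have "app \<nu> W x = app \<nu> W y"
      using ij[OF W app_closed[OF P(1) W xy(1)]] ij[OF W app_closed[OF P(1) W xy(2)]]
        f'(2)[OF W xy(1)] f'(2)[OF W xy(2)] g'(2)[OF W xy(1)] g'(2)[OF W xy(2)] xy(3,4) by simp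
    thus ?thesis using app_inj[OF P(1) W xy(1,2)] P(2)[OF W] by blast
  qed
  have sP: "\<exists>x\<in>el P W. app f' W x = m \<and> app g' W x = n"
    if W: "W \<in> Ob E" and m: "m \<in> el M W" and n: "n \<in> el N W" and e: "app f W m = app g W n" for W m n
  proof -
    have "app \<delta> W (app i W m \<otimes>[Fob S W] app j W n) = \<one>[Fob L W]"
      using d[OF W ijc[OF W m n]] pm[OF W m n] qm[OF W m n] e by simp
    then obtain x where "x \<in> el P W" "app \<nu> W x = app i W m \<otimes>[Fob S W] app j W n"
      using P(3)[OF W ijc[OF W m n]] by blast
    thus ?thesis using f'(2)[OF W] g'(2)[OF W] pm[OF W m n] qm[OF W m n] by (intro bexI[of _ x]) simp_all
  qed
  note ii = Mod.cmp_hom[OF F(1) S(2)]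
  have im: "\<exists>x\<in>el P W. app \<nu> W x = app (i \<cdot>[\<M> E] \<iota>) W k" if W: "W \<in> Ob E" and k: "k \<in> el K W" for W k
  proof -
    note c = app_closed[OF F(1) W k]
    have "app f W (app \<iota> W k) = \<one>[Fob L W]" using F(4)[OF W c] k by blast
    hence "app \<delta> W (app i W (app \<iota> W k)) = \<one>[Fob L W]"
      using d[OF W app_closed[OF S(2) W c]] pi[OF W c] app_one[OF g(1) W] by simp
    thus ?thesis using P(3)[OF W app_closed[OF S(2) W c]] app_cmp[OF F(1) S(2) W k] by simp
  qed
  obtain \<phi> where \<phi>: "\<phi> \<in> Hom (\<M> E) K P"
    "\<And>W k. \<lbrakk>W \<in> Ob E; k \<in> el K W\<rbrakk> \<Longrightarrow> app \<nu> W (app \<phi> W k) = app (i \<cdot>[\<M> E] \<iota>) W k"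
    using factor_mono[OF P(1) ii P(2) im] by blast
  have fphi: "app f' W (app \<phi> W k) = app \<iota> W k" "app g' W (app \<phi> W k) = \<one>[Fob N W]"
    if W: "W \<in> Ob E" and k: "k \<in> el K W" for W k
    using \<phi>(2)[OF W k] app_cmp[OF F(1) S(2) W k] f'(2)[OF W app_closed[OF \<phi>(1) W k]]
      g'(2)[OF W app_closed[OF \<phi>(1) W k]] pi[OF W app_closed[OF F(1) W k]] by simp_all
  have ex: "short_exact E K P N \<phi> g'"
  proof (rule short_exactI[OF \<phi>(1) g'(1)])
    fix W assume W: "W \<in> Ob E"
    { fix k assume k: "k \<in> el K W" "app \<phi> W k = \<one>[Fob P W]"
      hence "app \<iota> W k = \<one>[Fob M W]" using fphi(1)[OF W k(1)] app_one[OF f'(1) W] by simp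
      thus "k = \<one>[Fob K W]" using F(3)[OF W k(1)] by blast }
    { fix x assume x: "x \<in> el P W" "app g' W x = \<one>[Fob N W]"
      note c = app_closed[OF f'(1) W x(1)]
      have "app f W (app f' W x) = \<one>[Fob L W]" using comm[OF W x(1)] x(2) app_one[OF g(1) W] by simp
      then obtain k where k: "k \<in> el K W" "app \<iota> W k = app f' W x" using F(4)[OF W c] by blast
      have "app \<phi> W k = x"
        by (rule nu_eq[OF W app_closed[OF \<phi>(1) W k(1)] x(1)]) (use fphi[OF W k(1)] k x in simp_all)
      thus "\<exists>k\<in>el K W. app \<phi> W k = x" using k(1) by blast }
    show "app g' W (app \<phi> W k) = \<one>[Fob N W]" if "k \<in> el K W" for k using fphi(2)[OF W that] .
    fix n assume n: "n \<in> el N W"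
    obtain m where "m \<in> el M W" "app f W m = app g W n" using F(5)[OF W app_closed[OF g(1) W n]] by blast
    thus "\<exists>x\<in>el P W. app g' W x = n" using sP[OF W _ n] by blast
  qed
  have Padm: "P \<in> adm E" using adm_extension[OF ex f(2) g(2)] .
  have def: "deflation (\<A> E) g'" using mod_adm_inflationI(2)[OF ex f(2) Padm g(2)] .
  have "is_kernel (\<A> E) \<nu> \<delta>" by (rule mod_adm_ker_coker(1)[OF Padm S(1) f(4) P(1) \<delta> P(3,2)])
  hence "is_pullback (\<A> E) f g f' g'" unfolding f'_def g'_def \<delta>_def
    using MA.pullback_of_kernel[OF bS, of f L g "Neg (\<M> E) g" \<nu>] F(2) g f(3,4) Mod.neg_hom[OF g(1)] Mod.hom_add_neg[OF g(1)]
    by (simp add: Hom_mod_adm mod_adm_simps)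
  thus ?thesis using def by blast
qed

section \<open>The exact structure and left exactness of the Yoneda functor\<close>

theorem exact_mod_adm: "exact_category (\<A> E)"
proof (intro exact_category.intro additive_category.intro exact_category_axioms.intro
    additive_category_axioms.intro, goal_cases)
  case 1 show ?case by (rule preadditive_mod_adm)
next
  case 2 show ?case using zero_module by metis
next
  case (3 X Y) thus ?case using module_biproduct[of X Y] by (simp add: mod_adm_simps) metis
next
  case (4 f g) thus ?case using Conf_mod_adm short_exact_ker_coker(1) by blast
next
  case (5 f g) thus ?case using Conf_mod_adm short_exact_ker_coker(2) by blast
next
  case 6 thus ?case by (rule mod_adm_conf_iso_closed)
next
  case 7 thus ?case using mod_adm_id(1) by (simp add: mod_adm_simps)
next
  case 8 thus ?case using mod_adm_id(2) by (simp add: mod_adm_simps)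
next
  case 9 thus ?case by (rule mod_adm_inflation_cmp)
next
  case 10 thus ?case by (rule mod_adm_deflation_cmp)
next
  case 11 thus ?case by (rule mod_adm_inflation_pushout)
next
  case 12 thus ?case by (rule mod_adm_deflation_pullback)
qed

lemma yoneda_Ob: "X \<in> Ob E \<Longrightarrow> Fob (\<Upsilon> E) X \<in> adm E" using yoneda_adm yoneda_simps(1) by simp

lemma yoneda_functor: "is_functor E (\<A> E) (\<Upsilon> E)"
proof -
  show ?thesis
  proof (rule functorI[OF category_axioms MA.category_axioms])
    show "Fob (\<Upsilon> E) \<in> extensional (Ob E)" "Far (\<Upsilon> E) \<in> extensional (Ar E)" by (simp_all add: yoneda_def)
    show "Fob (\<Upsilon> E) X \<in> Ob (\<A> E)" if "X \<in> Ob E" for X using that yoneda_Ob by (simp add: mod_adm_simps)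
    show "Far (\<Upsilon> E) f \<in> Hom (\<A> E) (Fob (\<Upsilon> E) X) (Fob (\<Upsilon> E) Y)" if "f \<in> Hom E X Y" for f X Y
      using that yoneda_ar(1)[OF that] hom_ob[OF that] yoneda_adm yoneda_simps by (simp add: Hom_mod_adm hom_iff[of f])
    show "Far (\<Upsilon> E) (Idn E X) = Idn (\<A> E) (Fob (\<Upsilon> E) X)" if X: "X \<in> Ob E" for X
    proof -
      have "\<y> E (Idn E X) = Idn (\<M> E) (\<Y> E X)"
      proof (rule Mod_hom_eqI[OF yoneda_ar(1)[OF id_hom[OF X]] Mod.id_hom[OF yoneda_ob(1)[OF X]]])
        fix W g assume W: "W \<in> Ob E" "g \<in> el (\<Y> E X) W"
        thus "app (\<y> E (Idn E X)) W g = app (Idn (\<M> E) (\<Y> E X)) W g"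
          using yoneda_ar(2)[OF id_hom[OF X] W(1)] app_idn[OF W] X cmp_id_left by (simp add: yoneda_ob)
      qed
      thus ?thesis using X by (simp add: yoneda_simps mod_adm_simps)
    qed
    show "Far (\<Upsilon> E) (g \<cdot> f) = Far (\<Upsilon> E) g \<cdot>[\<A> E] Far (\<Upsilon> E) f" if fg: "f \<in> Hom E X Y" "g \<in> Hom E Y Z" for f g X Y Z
    proof -
      note y = yoneda_ar(1)[OF fg(1)] yoneda_ar(1)[OF fg(2)] yoneda_ar(1)[OF cmp_hom[OF fg]]
      have X: "X \<in> Ob E" using hom_ob[OF fg(1)] by blast
      have "\<y> E (g \<cdot> f) = \<y> E g \<cdot>[\<M> E] \<y> E f"
      proof (rule Mod_hom_eqI[OF y(3) Mod.cmp_hom[OF y(1,2)]])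
        fix W h assume W: "W \<in> Ob E" "h \<in> el (\<Y> E X) W"
        hence h: "h \<in> Hom E W X" using X by (simp add: yoneda_ob)
        show "app (\<y> E (g \<cdot> f)) W h = app (\<y> E g \<cdot>[\<M> E] \<y> E f) W h"
          using yoneda_ar(2)[OF fg(1) W(1) h] yoneda_ar(2)[OF fg(2) W(1) cmp_hom[OF h fg(1)]]
            yoneda_ar(2)[OF cmp_hom[OF fg] W(1) h] app_cmp[OF y(1,2) W] cmp_assoc[OF h fg] by simp
      qed
      thus ?thesis using fg by (simp add: yoneda_simps mod_adm_simps hom_iff)
    qed
  qed
qed

lemma yoneda_additive: "additive_functor E (\<A> E) (\<Upsilon> E)" unfolding additive_functor_def
proof (intro conjI yoneda_functor ballI)
  fix X Y f g assume fg: "f \<in> Hom E X Y" "g \<in> Hom E X Y" and X: "X \<in> Ob E" "Y \<in> Ob E"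
  note y = yoneda_ar(1)[OF fg(1)] yoneda_ar(1)[OF fg(2)] yoneda_ar(1)[OF add_hom[OF fg]]
  have "\<y> E (f \<boxplus> g) = \<y> E f \<boxplus>[\<M> E] \<y> E g"
  proof (rule Mod_hom_eqI[OF y(3) Mod.add_hom[OF y(1,2)]])
    fix W h assume W: "W \<in> Ob E" "h \<in> el (\<Y> E X) W"
    hence h: "h \<in> Hom E W X" using X by (simp add: yoneda_ob)
    show "app (\<y> E (f \<boxplus> g)) W h = app (\<y> E f \<boxplus>[\<M> E] \<y> E g) W h"
      using yoneda_ar(2)[OF fg(1) W(1) h] yoneda_ar(2)[OF fg(2) W(1) h] yoneda_ar(2)[OF add_hom[OF fg] W(1) h]
        app_add[OF y(1,2) W] add_cmp[OF h fg] W X by (simp add: yoneda_ob)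
  qed
  thus "Far (\<Upsilon> E) (f \<boxplus> g) = Far (\<Upsilon> E) f \<boxplus>[\<A> E] Far (\<Upsilon> E) g"
    using fg by (simp add: yoneda_simps mod_adm_simps hom_iff)
qed

lemma inflation_admissible: assumes "inflation E f" shows "admissible E f"
proof -
  have f: "f \<in> Ar E" using inflation_ar[OF assms] .
  have "admissible E (f \<cdot> Idn E (Dom E f))" using f assms id_deflation by (intro admissibleI) simp_all
  thus ?thesis using f by simp
qed

lemma deflation_admissible: assumes "deflation E f" shows "admissible E f"
proof -
  have f: "f \<in> Ar E" using deflation_ar[OF assms] .
  have "admissible E (Idn E (Cod E f) \<cdot> f)" using f assms id_inflation by (intro admissibleI) simp_all
  thus ?thesis using f by simp
qed

text \<open>\<open>K\<close> is the image of \<open>\<Upsilon> f\<close>, that is the kernel of the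
  epimorphism onto \<open>M\<close> given by \<open>y\<close>. Its own relations are generated by
  \<open>k\<close>, the kernel of the deflation part of \<open>f\<close>, which is an inflation and
  thus admissible. So \<open>K\<close> is admissibly presented, and \<open>\<Upsilon> f\<close> is a
  deflation followed by an inflation of modules.\<close>

lemma pres_factorization: assumes M: "M \<in> adm E" and P: "pres E M f y" and f: "f \<in> Hom E X Y"
    and k: "(k, p) \<in> Conf E" and m: "inflation E m" "p \<in> Hom E X I" "m \<in> Hom E I Y" "f = m \<cdot> p"
  obtains K \<nu> \<rho> where "(\<nu>, yel E M Y y) \<in> Conf (\<A> E)" "(\<y> E k, \<rho>) \<in> Conf (\<A> E)"
    "\<rho> \<in> Hom (\<A> E) (\<Y> E X) K" "\<nu> \<in> Hom (\<A> E) K (\<Y> E Y)" "\<y> E f = \<nu> \<cdot>[\<A> E] \<rho>"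
proof -
  have ob: "X \<in> Ob E" "Y \<in> Ob E" using hom_ob[OF f] .
  note MO = adm_Mod[OF M] and P = presD[OF P f]
  note ad = yoneda_adm[OF ob(1)] yoneda_adm[OF ob(2)]
  note y = yel[OF MO ob(2) P(2)] and yf = yoneda_ar[OF f]
  obtain K \<nu> where K: "\<nu> \<in> Hom (\<M> E) K (\<Y> E Y)"
    "\<And>W x. \<lbrakk>W \<in> Ob E; x \<in> el K W; app \<nu> W x = \<one>[Fob (\<Y> E Y) W]\<rbrakk> \<Longrightarrow> x = \<one>[Fob K W]"
    "\<And>W x. \<lbrakk>W \<in> Ob E; x \<in> el (\<Y> E Y) W\<rbrakk> \<Longrightarrow>
      app (yel E M Y y) W x = \<one>[Fob M W] \<longleftrightarrow> (\<exists>l\<in>el K W. app \<nu> W l = x)"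
    by (rule kernel_module[OF y(1)]) (rule that)
  note KO = Mod_ob(1)[OF K(1)]
  have el: "el (\<Y> E V) W = Hom E W V" "\<one>[Fob (\<Y> E V) W] = Zer E W V" if "W \<in> Ob E" "V \<in> Ob E" for V W
    using that by (simp_all add: yoneda_ob)
  have Kim: "(\<exists>l\<in>el K W. app \<nu> W l = g) \<longleftrightarrow> (\<exists>s\<in>Hom E W X. f \<cdot> s = g)" if g: "g \<in> Hom E W Y" for g W
  proof -
    have W: "W \<in> Ob E" using hom_ob[OF g] by blast
    have "act M g y = \<one>[Fob M W] \<longleftrightarrow> (\<exists>s\<in>Hom E W X. f \<cdot> s = g)"
    proof
      assume "\<exists>s\<in>Hom E W X. f \<cdot> s = g"
      then obtain s where s: "s \<in> Hom E W X" "f \<cdot> s = g" by blast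
      show "act M g y = \<one>[Fob M W]" using act_cmp[OF MO s(1) f P(2)] P(3) act_one[OF MO s(1)] s(2) by simp
    qed (use P(5)[OF g] in blast)
    thus ?thesis using K(3)[OF W, of g] el[OF W ob(2)] y(2)[OF W g] g by simp
  qed
  have ex1: "short_exact E K (\<Y> E Y) M \<nu> (yel E M Y y)"
  proof (rule short_exactI[OF K(1) y(1) K(2)])
    show "\<exists>l\<in>el K W. app \<nu> W l = x" if "W \<in> Ob E" "x \<in> el (\<Y> E Y) W" "app (yel E M Y y) W x = \<one>[Fob M W]" for W x
      using K(3) that by blast
    show "app (yel E M Y y) W (app \<nu> W x) = \<one>[Fob M W]" if "W \<in> Ob E" "x \<in> el K W" for W x
      using K(3)[OF that(1) app_closed[OF K(1) that]] that by blast
    fix W z assume W: "W \<in> Ob E" "z \<in> el M W"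
    obtain g where "g \<in> Hom E W Y" "act M g y = z" using P(4)[OF W] by blast
    thus "\<exists>x\<in>el (\<Y> E Y) W. app (yel E M Y y) W x = z" using y(2)[OF W(1)] el[OF W(1) ob(2)] by auto
  qed
  have im: "\<exists>l\<in>el K W. app \<nu> W l = app (\<y> E f) W s" if W: "W \<in> Ob E" and "s \<in> el (\<Y> E X) W" for W s
  proof -
    have s: "s \<in> Hom E W X" using that el ob by simp
    show ?thesis using Kim[OF cmp_hom[OF s f]] yf(2)[OF W s] s by auto
  qed
  obtain \<rho> where \<rho>: "\<rho> \<in> Hom (\<M> E) (\<Y> E X) K"
    "\<And>W s. \<lbrakk>W \<in> Ob E; s \<in> el (\<Y> E X) W\<rbrakk> \<Longrightarrow> app \<nu> W (app \<rho> W s) = app (\<y> E f) W s"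
    using factor_mono[OF K(1) yf(1) K(2) im] by blast
  have fac: "\<y> E f = \<nu> \<cdot>[\<M> E] \<rho>"
    by (rule Mod_hom_eqI[OF yf(1) Mod.cmp_hom[OF \<rho>(1) K(1)]]) (use \<rho>(2) app_cmp[OF \<rho>(1) K(1)] in simp)
  have rs: "app \<nu> W (app \<rho> W s) = f \<cdot> s" if "s \<in> Hom E W X" for W s
    using \<rho>(2)[of W s] that el yf(2) hom_ob[OF that] by simp
  \<comment> \<open>\<nu> sends an element of \<open>K\<close> to an arrow that factors through
    \<open>f\<close>; injectivity of \<nu> makes the factor a preimage under \<rho>.\<close>
  have surj: "\<exists>s\<in>Hom E W X. app \<rho> W s = l" if W: "W \<in> Ob E" and l: "l \<in> el K W" for W l
  proof -
    have "app \<nu> W l \<in> Hom E W Y" using app_closed[OF K(1) W l] el[OF W ob(2)] by simp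
    then obtain s where s: "s \<in> Hom E W X" "f \<cdot> s = app \<nu> W l" using Kim l by blast
    have "app \<rho> W s \<in> el K W" using app_closed[OF \<rho>(1) W] s(1) el[OF W ob(1)] by simp
    hence "app \<rho> W s = l" using app_inj[OF K(1) W _ l] rs[OF s(1)] s(2) K(2)[OF W] by simp
    thus ?thesis using s(1) by blast
  qed
  have kk: "is_kernel E k f" unfolding m(4) using inflation_cmp_kernel[OF m(1,3,2)] conf_kernel[OF k] by blast
  define A where "A = Dom E k"
  have kh: "k \<in> Hom E A X" using conf_hom[OF k] m(2) by (simp add: hom_iff A_def)
  have AO: "A \<in> Ob E" using hom_ob[OF kh] by blast
  have admk: "admissible E k" using inflation_admissible k unfolding inflation_def by blast
  have fk: "f \<cdot> k = Zer E A Y" using kernelD(4)[OF kk] f by (simp add: hom_iff A_def)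
  have rker: "app \<rho> W s = \<one>[Fob K W] \<longleftrightarrow> (\<exists>a\<in>Hom E W A. k \<cdot> a = s)" if s: "s \<in> Hom E W X" for s W
  proof -
    have W: "W \<in> Ob E" using hom_ob[OF s] by blast
    have rc: "app \<rho> W s \<in> el K W" using app_closed[OF \<rho>(1) W] s el[OF W ob(1)] by simp
    have "app \<rho> W s = \<one>[Fob K W] \<longleftrightarrow> f \<cdot> s = Zer E W Y"
      using K(2)[OF W rc] rs[OF s] el[OF W ob(2)] app_one[OF K(1) W] by auto
    also have "\<dots> \<longleftrightarrow> (\<exists>a\<in>Hom E W A. k \<cdot> a = s)"
    proof
      assume "f \<cdot> s = Zer E W Y"
      then obtain u where "u \<in> Hom E W (Dom E k)" "k \<cdot> u = s"
        using kernelE[OF kk, of s W] s f by (auto simp: hom_iff)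
      thus "\<exists>a\<in>Hom E W A. k \<cdot> a = s" unfolding A_def by blast
    next
      assume "\<exists>a\<in>Hom E W A. k \<cdot> a = s"
      then obtain a where a: "a \<in> Hom E W A" "k \<cdot> a = s" by blast
      have "f \<cdot> s = (f \<cdot> k) \<cdot> a" using cmp_assoc[OF a(1) kh f] a(2) by simp
      thus "f \<cdot> s = Zer E W Y" unfolding fk using zer_cmp[OF a(1) ob(2)] by simp
    qed
    finally show ?thesis .
  qed
  have ri: "app \<rho> W g = act K g (app \<rho> X (Idn E X))" if "g \<in> Hom E W X" for g W
    using yoneda_hom(2)[OF \<rho>(1) ob(1) hom_ob(1)[OF that] that] .
  \<comment> \<open>The generator of \<open>K\<close> is the image of the identity of
    \<open>X\<close>; an arrow \<open>s\<close> is a relation exactly if \<open>f \<cdot> s\<close>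
    is zero, that is if it factors through \<open>k\<close>.\<close>
  have "pres E K k (app \<rho> X (Idn E X))"
  proof (rule presI[OF admk kh])
    show "app \<rho> X (Idn E X) \<in> el K X" using yoneda_hom(1)[OF \<rho>(1) ob(1)] .
    show "act K k (app \<rho> X (Idn E X)) = \<one>[Fob K A]"
      using rker[OF kh] ri[OF kh] id_hom[OF AO] cmp_id_right[OF kh] by auto
    fix W
    show "\<exists>g\<in>Hom E W X. act K g (app \<rho> X (Idn E X)) = x" if "W \<in> Ob E" "x \<in> el K W" for x
      using surj[OF that] ri by auto
    show "\<exists>s\<in>Hom E W A. k \<cdot> s = g" if "g \<in> Hom E W X" "act K g (app \<rho> X (Idn E X)) = \<one>[Fob K W]" for g
      using rker[OF that(1)] ri[OF that(1)] that(2) by simp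
  qed
  hence Kadm: "K \<in> adm E" using adm_presented_iff KO by blast
  note yk = yoneda_ar[OF kh]
  have ex2: "short_exact E (\<Y> E A) (\<Y> E X) K (\<y> E k) \<rho>"
  proof (rule short_exactI[OF yk(1) \<rho>(1)])
    fix W assume W: "W \<in> Ob E"
    { fix a assume "a \<in> el (\<Y> E A) W" and e: "app (\<y> E k) W a = \<one>[Fob (\<Y> E X) W]"
      hence a: "a \<in> Hom E W A" using el W AO by simp
      have e: "k \<cdot> a = k \<cdot> Zer E W A" using e yk(2)[OF W a] el[OF W ob(1)] cmp_zer[OF kh W] by simp
      have "a = Zer E W A" by (rule kernel_mono[OF kk _ _ e]) (use a zer_hom[OF W AO] in \<open>auto simp: A_def\<close>)
      thus "a = \<one>[Fob (\<Y> E A) W]" using el[OF W AO] by simp }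
    { fix s assume "s \<in> el (\<Y> E X) W" "app \<rho> W s = \<one>[Fob K W]"
      thus "\<exists>l\<in>el (\<Y> E A) W. app (\<y> E k) W l = s" using rker el W ob AO yk(2)[OF W] by auto }
    { fix a assume "a \<in> el (\<Y> E A) W"
      hence a: "a \<in> Hom E W A" using el W AO by simp
      show "app \<rho> W (app (\<y> E k) W a) = \<one>[Fob K W]" using yk(2)[OF W a] rker[OF cmp_hom[OF a kh]] a by auto }
    show "\<exists>x\<in>el (\<Y> E X) W. app \<rho> W x = z" if "z \<in> el K W" for z using surj[OF W that] el[OF W ob(1)] by simp
  qed
  show thesis
  proof (rule that)
    show "(\<nu>, yel E M Y y) \<in> Conf (\<A> E)" using Conf_mod_adm ex1 Kadm ad M by blast
    show "(\<y> E k, \<rho>) \<in> Conf (\<A> E)" using Conf_mod_adm ex2 Kadm ad yoneda_adm[OF AO] by blast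
    show "\<rho> \<in> Hom (\<A> E) (\<Y> E X) K" "\<nu> \<in> Hom (\<A> E) K (\<Y> E Y)"
      using \<rho>(1) K(1) ad Kadm by (simp_all add: Hom_mod_adm)
    show "\<y> E f = \<nu> \<cdot>[\<A> E] \<rho>" using fac by (simp add: mod_adm_simps)
  qed
qed

text \<open>A deflation \<open>g\<close> is admissible with an identity as inflation part, so it
  presents some module \<open>M\<close>, and the deflation part of \<open>\<Upsilon> g\<close> has
  kernel \<open>\<Upsilon> f\<close>. The inflation part of \<open>\<Upsilon> g\<close> has cokernel
  \<open>M\<close>, in general not zero, which is why the Yoneda functor is left exact but not
  exact.\<close>

lemma yoneda_conf: assumes fg: "(f, g) \<in> Conf E"
  shows "admissible (\<A> E) (Far (\<Upsilon> E) g) \<and> inflation (\<A> E) (Far (\<Upsilon> E) f) \<and>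
      is_kernel (\<A> E) (Far (\<Upsilon> E) f) (Far (\<Upsilon> E) g)"
proof -
  interpret MA: exact_category "\<A> E" by (rule exact_mod_adm)
  define X Y where "X = Dom E g" and "Y = Cod E g"
  note H = conf_hom[OF fg]
  have g: "g \<in> Hom E X Y" using H by (simp add: hom_iff X_def Y_def)
  have Y: "Y \<in> Ob E" using hom_ob[OF g] by blast
  have adm: "admissible E g" using deflation_admissible fg unfolding deflation_def by blast
  obtain M y where M: "M \<in> adm E" "pres E M g y" using pres_exists[OF adm g] .
  obtain K \<nu> \<rho> where K: "(\<nu>, yel E M Y y) \<in> Conf (\<A> E)" "(\<y> E f, \<rho>) \<in> Conf (\<A> E)"
    "\<rho> \<in> Hom (\<A> E) (\<Y> E X) K" "\<nu> \<in> Hom (\<A> E) K (\<Y> E Y)" "\<y> E g = \<nu> \<cdot>[\<A> E] \<rho>"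
    by (rule pres_factorization[OF M g fg id_inflation[OF Y] g id_hom[OF Y]]) (use cmp_id_left[OF g] in auto)
  have inf: "inflation (\<A> E) \<nu>" "deflation (\<A> E) \<rho>" "inflation (\<A> E) (\<y> E f)"
    using K(1,2) unfolding inflation_def deflation_def by blast+
  show ?thesis
    using MA.admissibleI[OF inf(1,2)] inf(3) MA.inflation_cmp_kernel[OF inf(1) K(4,3)] MA.conf_kernel[OF K(2)] K(3-5) H
    by (simp add: yoneda_simps hom_iff)
qed

end

theorem yoneda_left_exact: assumes "exact_category (E :: ('o, 'm) ecat)"
  shows "left_exact_functor E (\<A> E) (\<Upsilon> E)"
  using exact_category.yoneda_conf[OF assms] exact_category.yoneda_additive[OF assms]
  unfolding left_exact_functor_def by auto

section \<open>Extension along the Yoneda functor\<close>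

lemma fcomp_simps: "X \<in> Ob C \<Longrightarrow> Fob (fcomp C G F) X = Fob G (Fob F X)"
  "f \<in> Ar C \<Longrightarrow> Far (fcomp C G F) f = Far G (Far F f)" by (simp_all add: fcomp_def compose_def)

lemma fcomp_functor: assumes F: "is_functor C D F" and G: "is_functor D K G"
  shows "is_functor C K (fcomp C G F)"
proof (rule functorI)
  interpret C: category C using functor_dom_cat[OF F] .
  show "category C" "category K" using functor_dom_cat[OF F] functor_cod_cat[OF G] .
  show "Fob (fcomp C G F) \<in> extensional (Ob C)" "Far (fcomp C G F) \<in> extensional (Ar C)"
    by (simp_all add: fcomp_def)
  show "Fob (fcomp C G F) X \<in> Ob K" if "X \<in> Ob C" for X
    using that functor_ob[OF F] functor_ob[OF G] by (simp add: fcomp_simps)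
  show "Far (fcomp C G F) f \<in> Hom K (Fob (fcomp C G F) X) (Fob (fcomp C G F) Y)" if "f \<in> Hom C X Y" for f X Y
    using functor_hom[OF G functor_hom[OF F that]] that C.hom_ob[OF that] by (simp add: fcomp_simps hom_iff[of f])
  show "Far (fcomp C G F) (Idn C X) = Idn K (Fob (fcomp C G F) X)" if "X \<in> Ob C" for X
    using that functor_idn[OF F] functor_idn[OF G] functor_ob[OF F] by (simp add: fcomp_simps)
  show "Far (fcomp C G F) (g \<cdot>[C] f) = Far (fcomp C G F) g \<cdot>[K] Far (fcomp C G F) f"
    if "f \<in> Hom C X Y" "g \<in> Hom C Y Z" for f g X Y Z
    using that functor_cmp[OF F that] functor_cmp[OF G functor_hom[OF F that(1)] functor_hom[OF F that(2)]]
      by (simp add: fcomp_simps hom_iff)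
qed

lemma additive_functorD: assumes "additive_functor A B F" shows "is_functor A B F"
    "\<And>f g X Y. \<lbrakk>f \<in> Hom A X Y; g \<in> Hom A X Y\<rbrakk> \<Longrightarrow> Far F (f \<boxplus>[A] g) = Far F f \<boxplus>[B] Far F g"
proof -
  show f: "is_functor A B F" using assms additive_functor_def by blast
  fix f g X Y assume "f \<in> Hom A X Y" "g \<in> Hom A X Y"
  thus "Far F (f \<boxplus>[A] g) = Far F f \<boxplus>[B] Far F g"
    using assms category.hom_ob[OF functor_dom_cat[OF f]] unfolding additive_functor_def by blast
qed

lemma fcomp_additive:
  assumes F: "additive_functor C D F" and G: "additive_functor D K G" and C: "preadditive_category C"
  shows "additive_functor C K (fcomp C G F)"
proof -
  note f = additive_functorD[OF F] and g = additive_functorD[OF G] interpret C: preadditive_category C by fact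
  show ?thesis unfolding additive_functor_def
  proof (intro conjI ballI fcomp_functor[OF f(1) g(1)])
    fix X Y a b assume ab: "a \<in> Hom C X Y" "b \<in> Hom C X Y"
    show "Far (fcomp C G F) (a \<boxplus>[C] b) = Far (fcomp C G F) a \<boxplus>[K] Far (fcomp C G F) b"
      using ab f(2)[OF ab] g(2)[OF functor_hom[OF f(1) ab(1)] functor_hom[OF f(1) ab(2)]]
      by (simp add: fcomp_simps hom_iff)
  qed
qed

lemma additive_zer:
  assumes F: "additive_functor A B F" and "preadditive_category A" "preadditive_category B" "X \<in> Ob A" "Y \<in> Ob A"
  shows "Far F (Zer A X Y) = Zer B (Fob F X) (Fob F Y)"
proof -
  interpret A: preadditive_category A by fact interpret B: preadditive_category B by fact
  note f = additive_functorD[OF F]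
  have z: "Zer A X Y \<in> Hom A X Y" using A.zer_hom assms by blast
  note h = functor_hom[OF f(1) z]
  have "Far F (Zer A X Y) \<boxplus>[B] Far F (Zer A X Y) = Far F (Zer A X Y) \<boxplus>[B] Zer B (Fob F X) (Fob F Y)"
    using f(2)[OF z z] A.hom_add_zer[OF z] B.hom_add_zer[OF h] by simp
  thus ?thesis using B.hom_add_cancel(1)[OF h h B.zer_hom] B.hom_ob[OF h] by blast
qed

lemma additive_biproduct:
  assumes F: "additive_functor A B F" and "preadditive_category A" "preadditive_category B"
    and b: "is_biproduct A X Y S i j p q"
  shows "is_biproduct B (Fob F X) (Fob F Y) (Fob F S) (Far F i) (Far F j) (Far F p) (Far F q)"
proof -
  interpret A: preadditive_category A by fact interpret B: preadditive_category B by fact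
  note f = additive_functorD[OF F]
  note b = b[unfolded is_biproduct_def]
  have h: "i \<in> Hom A X S" "j \<in> Hom A Y S" "p \<in> Hom A S X" "q \<in> Hom A S Y" using b by auto
  have ob: "X \<in> Ob A" "Y \<in> Ob A" "S \<in> Ob A" using A.hom_ob h by auto
  note F = functor_hom[OF f(1)] and c = functor_cmp[OF f(1), symmetric]
  have "Far F i \<cdot>[B] Far F p \<boxplus>[B] Far F j \<cdot>[B] Far F q = Idn B (Fob F S)"
    using c[OF h(3,1)] c[OF h(4,2)] f(2)[OF A.cmp_hom[OF h(3,1)] A.cmp_hom[OF h(4,2)]] b functor_idn[OF f(1) ob(3)]
    by simp
  thus ?thesis unfolding is_biproduct_def
    using F[OF h(1)] F[OF h(2)] F[OF h(3)] F[OF h(4)] c[OF h(1,3)] c[OF h(2,4)] c[OF h(1,4)] c[OF h(2,3)]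
      b functor_idn[OF f(1)] ob additive_zer[OF assms(1-3)] functor_ob[OF f(1)] by simp
qed

text \<open>Natural families \<open>M W \<rightarrow> Hom (F W) T\<close>. A universal one exhibits \<open>T\<close> as the value at \<open>M\<close> of the
  left Kan extension of \<open>F\<close> along the Yoneda functor.\<close>

definition cocone :: "('o, 'm, 'y) ecat_scheme \<Rightarrow> ('p, 'n, 'z) ecat_scheme \<Rightarrow> ('o, 'm, 'p, 'n) ftr \<Rightarrow>
    ('o, 'm) md \<Rightarrow> 'p \<Rightarrow> ('o \<Rightarrow> 'm \<Rightarrow> 'n) \<Rightarrow> bool" where "cocone E D F M T e \<longleftrightarrow> T \<in> Ob D \<and>
     (\<forall>W\<in>Ob E. \<forall>x\<in>el M W. e W x \<in> Hom D (Fob F W) T) \<and>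
     (\<forall>W\<in>Ob E. \<forall>x\<in>el M W. \<forall>y\<in>el M W. e W (x \<otimes>[Fob M W] y) = e W x \<boxplus>[D] e W y) \<and>
     (\<forall>f\<in>Ar E. \<forall>x\<in>el M (Cod E f). e (Dom E f) (act M f x) = e (Cod E f) x \<cdot>[D] Far F f)"

definition universal :: "('o, 'm, 'y) ecat_scheme \<Rightarrow> ('p, 'n, 'z) ecat_scheme \<Rightarrow> ('o, 'm, 'p, 'n) ftr \<Rightarrow>
    ('o, 'm) md \<Rightarrow> 'p \<Rightarrow> ('o \<Rightarrow> 'm \<Rightarrow> 'n) \<Rightarrow> bool" where "universal E D F M T e \<longleftrightarrow> cocone E D F M T e \<and>
     (\<forall>T' e'. cocone E D F M T' e' \<longrightarrow> (\<exists>!u. u \<in> Hom D T T' \<and> (\<forall>W\<in>Ob E. \<forall>x\<in>el M W. u \<cdot>[D] e W x = e' W x)))"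

lemma coconeD: assumes "cocone E D F M T e"
  shows "T \<in> Ob D" "\<And>W x. \<lbrakk>W \<in> Ob E; x \<in> el M W\<rbrakk> \<Longrightarrow> e W x \<in> Hom D (Fob F W) T"
    "\<And>W x y. \<lbrakk>W \<in> Ob E; x \<in> el M W; y \<in> el M W\<rbrakk> \<Longrightarrow> e W (x \<otimes>[Fob M W] y) = e W x \<boxplus>[D] e W y"
    "\<And>f X Y x. \<lbrakk>f \<in> Hom E X Y; x \<in> el M Y\<rbrakk> \<Longrightarrow> e X (act M f x) = e Y x \<cdot>[D] Far F f"
  using assms unfolding cocone_def by (auto simp: hom_iff)

lemma coconeI: assumes "T \<in> Ob D" "\<And>W x. \<lbrakk>W \<in> Ob E; x \<in> el M W\<rbrakk> \<Longrightarrow> e W x \<in> Hom D (Fob F W) T"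
    "\<And>W x y. \<lbrakk>W \<in> Ob E; x \<in> el M W; y \<in> el M W\<rbrakk> \<Longrightarrow> e W (x \<otimes>[Fob M W] y) = e W x \<boxplus>[D] e W y"
    "\<And>f X Y x. \<lbrakk>f \<in> Hom E X Y; x \<in> el M Y\<rbrakk> \<Longrightarrow> e X (act M f x) = e Y x \<cdot>[D] Far F f" shows "cocone E D F M T e"
  using assms(1-3) assms(4)[of _ "Dom E _" "Cod E _"] unfolding cocone_def by (auto simp: hom_iff)

lemma universal_cocone: "universal E D F M T e \<Longrightarrow> cocone E D F M T e" by (simp add: universal_def)

lemma universal_ex: assumes "universal E D F M T e" "cocone E D F M T' e'"
  obtains u where "u \<in> Hom D T T'" "\<And>W x. \<lbrakk>W \<in> Ob E; x \<in> el M W\<rbrakk> \<Longrightarrow> u \<cdot>[D] e W x = e' W x"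
  using assms unfolding universal_def by blast

text \<open>Common ground of both sides of the correspondence: left exact functors that are to be
  extended, and restrictions of exact functors on modules.\<close>

locale two_exact = E: exact_category E + D: exact_category D
  for E :: "('o, 'm) ecat" and D :: "('p, 'n) ecat" +
  fixes F :: "('o, 'm, 'p, 'n) ftr" assumes F_additive: "additive_functor E D F"
begin

lemmas F_functor = additive_functorD(1)[OF F_additive]
lemmas F_add = additive_functorD(2)[OF F_additive]
lemmas F_hom = functor_hom[OF F_functor]
lemmas F_cmp = functor_cmp[OF F_functor]

lemma cocone_one: assumes M: "M \<in> Ob (\<M> E)" and c: "cocone E D F M T e" and W: "W \<in> Ob E"
  shows "e W \<one>[Fob M W] = Zer D (Fob F W) T"
proof -
  interpret G: comm_group "Fob M W" using E.mod_group[OF M W] .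
  note h = coconeD(2)[OF c W G.one_closed]
  have "e W \<one>[Fob M W] \<boxplus>[D] e W \<one>[Fob M W] = e W \<one>[Fob M W] \<boxplus>[D] Zer D (Fob F W) T"
    using coconeD(3)[OF c W G.one_closed G.one_closed] D.hom_add_zer[OF h] by simp
  thus ?thesis using D.hom_add_cancel(1)[OF h h D.zer_hom] D.hom_ob[OF h] by blast
qed

lemma cocone_cmp: assumes c: "cocone E D F M T e" and u: "u \<in> Hom D T T'"
  shows "cocone E D F M T' (\<lambda>W x. u \<cdot>[D] e W x)"
proof (rule coconeI)
  note C = coconeD[OF c]
  show "T' \<in> Ob D" using D.hom_ob[OF u] by blast
  show "u \<cdot>[D] e W x \<in> Hom D (Fob F W) T'" if "W \<in> Ob E" "x \<in> el M W" for W x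
    using D.cmp_hom[OF C(2)[OF that] u] .
  show "u \<cdot>[D] e W (x \<otimes>[Fob M W] y) = u \<cdot>[D] e W x \<boxplus>[D] u \<cdot>[D] e W y"
    if "W \<in> Ob E" "x \<in> el M W" "y \<in> el M W" for W x y
    using C(3)[OF that] D.cmp_add[OF C(2)[OF that(1,2)] C(2)[OF that(1,3)] u] by simp
  show "u \<cdot>[D] e X (act M f x) = u \<cdot>[D] e Y x \<cdot>[D] Far F f" if "f \<in> Hom E X Y" "x \<in> el M Y" for f X Y x
    using C(4)[OF that] D.cmp_assoc[OF F_hom[OF that(1)] C(2)[OF E.hom_ob(2)[OF that(1)] that(2)] u] by simp
qed

lemma universal_unique: assumes U: "universal E D F M T e" and uv: "u \<in> Hom D T T'" "v \<in> Hom D T T'"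
    and eq: "\<And>W x. \<lbrakk>W \<in> Ob E; x \<in> el M W\<rbrakk> \<Longrightarrow> u \<cdot>[D] e W x = v \<cdot>[D] e W x" shows "u = v"
proof -
  have c: "cocone E D F M T e" using universal_cocone[OF U] .
  have "\<exists>!w. w \<in> Hom D T T' \<and> (\<forall>W\<in>Ob E. \<forall>x\<in>el M W. w \<cdot>[D] e W x = v \<cdot>[D] e W x)"
    using U cocone_cmp[OF c uv(2)] unfolding universal_def by blast
  thus ?thesis using uv eq by blast
qed

text \<open>Every element is \<open>act M g y\<close> for some \<open>g\<close> and has to be sent
  to \<open>h\<close> after \<open>F g\<close>. Two such \<open>g\<close> differ by a relation,
  which factors through \<open>f\<close>, and \<open>h\<close> kills \<open>F f\<close>; so the
  value does not depend on the choice.\<close>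

lemma cocone_of_pres: assumes M: "M \<in> Ob (\<M> E)" and P: "pres E M f y" and f: "f \<in> Hom E X Y"
    and h: "h \<in> Hom D (Fob F Y) T" "h \<cdot>[D] Far F f = Zer D (Fob F X) T"
  shows "\<exists>e. cocone E D F M T e \<and> e Y y = h"
proof -
  note P = E.presD[OF P f]
  have Y: "Y \<in> Ob E" using E.hom_ob[OF f] by blast
  have key: "h \<cdot>[D] Far F a = h \<cdot>[D] Far F b" if ab: "a \<in> Hom E W Y" "b \<in> Hom E W Y" "act M a y = act M b y" for a b W
  proof -
    have W: "W \<in> Ob E" using E.hom_ob[OF ab(1)] by blast
    interpret G: comm_group "Fob M W" using E.mod_group[OF M W] .
    let ?d = "a \<boxplus>[E] Neg E b"
    have d: "?d \<in> Hom E W Y" using E.add_hom[OF ab(1) E.neg_hom[OF ab(2)]] .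
    have "act M ?d y = \<one>[Fob M W]"
      using E.act_add[OF M ab(1) E.neg_hom[OF ab(2)] P(2)] E.act_neg[OF M ab(2) P(2)] ab(3) E.act_closed[OF M ab(2) P(2)]
      by simp
    then obtain s where s: "s \<in> Hom E W X" "f \<cdot>[E] s = ?d" using P(5)[OF d] by blast
    have hF: "h \<cdot>[D] Far F b \<in> Hom D (Fob F W) T" using D.cmp_hom[OF F_hom[OF ab(2)] h(1)] .
    have "h \<cdot>[D] Far F ?d = (h \<cdot>[D] Far F f) \<cdot>[D] Far F s"
      using F_cmp[OF s(1) f] s(2) D.cmp_assoc[OF F_hom[OF s(1)] F_hom[OF f] h(1)] by simp
    also have "\<dots> = Zer D (Fob F W) T" unfolding h(2) using F_hom[OF s(1)] D.hom_ob[OF h(1)] by (simp add: hom_iff)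
    finally have z: "h \<cdot>[D] Far F ?d = Zer D (Fob F W) T" .
    have "Far F a = Far F ?d \<boxplus>[D] Far F b" using E.hom_diff_add[OF ab(1,2)] F_add[OF d ab(2)] by simp
    hence "h \<cdot>[D] Far F a = h \<cdot>[D] Far F ?d \<boxplus>[D] h \<cdot>[D] Far F b"
      using D.cmp_add[OF F_hom[OF d] F_hom[OF ab(2)] h(1)] by simp
    thus ?thesis using z D.hom_add_zer[OF hF] by simp
  qed
  define r where "r W x = (SOME g. g \<in> Hom E W Y \<and> act M g y = x)" for W x
  have r: "r W x \<in> Hom E W Y" "act M (r W x) y = x" if "W \<in> Ob E" "x \<in> el M W" for W x
    using someI_ex[of "\<lambda>g. g \<in> Hom E W Y \<and> act M g y = x"] P(4)[OF that] unfolding r_def by blast+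
  define e where "e W x = h \<cdot>[D] Far F (r W x)" for W x
  have e: "e W (act M g y) = h \<cdot>[D] Far F g" if g: "g \<in> Hom E W Y" for W g
    unfolding e_def by (rule key) (use r[OF E.hom_ob(1)[OF g] E.act_closed[OF M g P(2)]] g in auto)
  have "cocone E D F M T e"
  proof (rule coconeI)
    show "T \<in> Ob D" using D.hom_ob[OF h(1)] by blast
    show "e W x \<in> Hom D (Fob F W) T" if "W \<in> Ob E" "x \<in> el M W" for W x
      unfolding e_def using D.cmp_hom[OF F_hom[OF r(1)[OF that]] h(1)] .
    show "e W (x \<otimes>[Fob M W] x') = e W x \<boxplus>[D] e W x'" if W: "W \<in> Ob E" and x: "x \<in> el M W" "x' \<in> el M W" for W x x'
    proof -
      note r1 = r[OF W x(1)] and r2 = r[OF W x(2)]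
      have "e W (x \<otimes>[Fob M W] x') = h \<cdot>[D] Far F (r W x \<boxplus>[E] r W x')"
        using e[OF E.add_hom[OF r1(1) r2(1)]] E.act_add[OF M r1(1) r2(1) P(2)] r1(2) r2(2) by simp
      thus ?thesis
        unfolding e_def using F_add[OF r1(1) r2(1)] D.cmp_add[OF F_hom[OF r1(1)] F_hom[OF r2(1)] h(1)] by simp
    qed
    show "e V (act M g x) = e W x \<cdot>[D] Far F g" if g: "g \<in> Hom E V W" and x: "x \<in> el M W" for g V W x
    proof -
      note r1 = r[OF E.hom_ob(2)[OF g] x]
      have "act M g x = act M (r W x \<cdot>[E] g) y" using E.act_cmp[OF M g r1(1) P(2)] r1(2) by simp
      hence "e V (act M g x) = h \<cdot>[D] Far F (r W x \<cdot>[E] g)" using e[OF E.cmp_hom[OF g r1(1)]] by simp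
      thus ?thesis
        unfolding e_def using F_cmp[OF g r1(1)] D.cmp_assoc[OF F_hom[OF g] F_hom[OF r1(1)] h(1)] by simp
    qed
  qed
  moreover have "e Y y = h"
    using e[OF E.id_hom[OF Y]] E.act_idn[OF M Y P(2)] functor_idn[OF F_functor Y] D.cmp_id_right[OF h(1)] by simp
  ultimately show ?thesis by blast
qed

lemma cocone_pres_zero:
  assumes M: "M \<in> Ob (\<M> E)" and P: "pres E M f y" and f: "f \<in> Hom E X Y" and c: "cocone E D F M T e"
  shows "e Y y \<cdot>[D] Far F f = Zer D (Fob F X) T"
  using coconeD(4)[OF c f E.presD(2)[OF P f]] E.presD(3)[OF P f] cocone_one[OF M c E.hom_ob(1)[OF f]] by simp

lemma cocone_pres_eq: assumes M: "M \<in> Ob (\<M> E)" and P: "pres E M f y" and f: "f \<in> Hom E X Y"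
    and c: "cocone E D F M T e" "cocone E D F M T e'" and eq: "e Y y = e' Y y" and W: "W \<in> Ob E" "x \<in> el M W"
  shows "e W x = e' W x"
proof -
  obtain g where g: "g \<in> Hom E W Y" "act M g y = x" using E.presD(4)[OF P f W] by blast
  show ?thesis
    using coconeD(4)[OF c(1) g(1) E.presD(2)[OF P f]] coconeD(4)[OF c(2) g(1) E.presD(2)[OF P f]] eq g(2) by simp
qed

text \<open>Evaluation at the generator identifies cocones on \<open>M\<close> with arrows that kill
  \<open>F f\<close>, so a cokernel of \<open>F f\<close> is the same as a universal cocone.\<close>

lemma universal_of_cokernel: assumes M: "M \<in> Ob (\<M> E)" and P: "pres E M f y" and f: "f \<in> Hom E X Y"
    and c: "cocone E D F M T e" and ck: "is_cokernel D (e Y y) (Far F f)" shows "universal E D F M T e"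
  unfolding universal_def
proof (intro conjI c allI impI)
  note Ff = F_hom[OF f]
  have Y: "Y \<in> Ob E" using E.hom_ob[OF f] by blast
  have ey: "e Y y \<in> Hom D (Fob F Y) T" using coconeD(2)[OF c Y E.presD(2)[OF P f]] .
  fix T' e' assume c': "cocone E D F M T' e'"
  have e'y: "e' Y y \<in> Hom D (Fob F Y) T'" using coconeD(2)[OF c' Y E.presD(2)[OF P f]] .
  have "e' Y y \<cdot>[D] Far F f = Zer D (Fob F X) T'" using cocone_pres_zero[OF M P f c'] .
  then obtain u where u: "u \<in> Hom D T T'" "u \<cdot>[D] e Y y = e' Y y"
    using D.cokernelE[OF ck, of "e' Y y" T'] e'y ey Ff by (auto simp: hom_iff)
  show "\<exists>!u. u \<in> Hom D T T' \<and> (\<forall>W\<in>Ob E. \<forall>x\<in>el M W. u \<cdot>[D] e W x = e' W x)"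
  proof (rule ex1I[of _ u], intro conjI ballI u(1))
    fix W x assume "W \<in> Ob E" "x \<in> el M W"
    thus "u \<cdot>[D] e W x = e' W x" using cocone_pres_eq[OF M P f cocone_cmp[OF c u(1)] c' u(2)] by blast
  next
    fix v assume v: "v \<in> Hom D T T' \<and> (\<forall>W\<in>Ob E. \<forall>x\<in>el M W. v \<cdot>[D] e W x = e' W x)"
    hence e: "v \<cdot>[D] e Y y = u \<cdot>[D] e Y y" using Y E.presD(2)[OF P f] u(2) by auto
    show "v = u" by (rule D.cokernel_epi[OF ck _ _ e]) (use v u(1) ey in \<open>auto simp: hom_iff\<close>)
  qed
qed

text \<open>Valid for every presentation of \<open>M\<close>: a single chosen universal cocone
  provides cokernels for all presentations, in particular for those built by the horseshoe
  construction.\<close>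

lemma cokernel_of_universal: assumes M: "M \<in> Ob (\<M> E)" and P: "pres E M f y" and f: "f \<in> Hom E X Y"
    and U: "universal E D F M T e" shows "is_cokernel D (e Y y) (Far F f)"
proof -
  have c: "cocone E D F M T e" using universal_cocone[OF U] .
  have Y: "Y \<in> Ob E" using E.hom_ob[OF f] by blast
  note yel = E.presD(2)[OF P f]
  have ey: "e Y y \<in> Hom D (Fob F Y) T" using coconeD(2)[OF c Y yel] .
  show ?thesis
  proof (rule D.cokernelI[OF F_hom[OF f] ey cocone_pres_zero[OF M P f c]])
    fix T' h assume h: "h \<in> Hom D (Fob F Y) T'" "h \<cdot>[D] Far F f = Zer D (Fob F X) T'"
    obtain e' where e': "cocone E D F M T' e'" "e' Y y = h" using cocone_of_pres[OF M P f h] by blast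
    obtain u where "u \<in> Hom D T T'" "\<And>W x. \<lbrakk>W \<in> Ob E; x \<in> el M W\<rbrakk> \<Longrightarrow> u \<cdot>[D] e W x = e' W x"
      by (rule universal_ex[OF U e'(1)]) (rule that)
    thus "\<exists>u. u \<in> Hom D T T' \<and> u \<cdot>[D] e Y y = h" using e'(2) Y yel by blast
  next
    fix T' u v assume uv: "u \<in> Hom D T T'" "v \<in> Hom D T T'" "u \<cdot>[D] e Y y = v \<cdot>[D] e Y y"
    show "u = v" by (rule universal_unique[OF U uv(1,2)])
        (use cocone_pres_eq[OF M P f cocone_cmp[OF c uv(1)] cocone_cmp[OF c uv(2)] uv(3)] in blast)
  qed
qed

end

section \<open>The extension of a left exact functor\<close>

locale left_exact_pair = two_exact E D F for E :: "('o, 'm) ecat" and D :: "('p, 'n) ecat" and F +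
  assumes F_left_exact: "left_exact_functor E D F"
begin

lemma F_inflation: assumes "inflation E m" shows "inflation D (Far F m)"
  using assms F_left_exact unfolding left_exact_functor_def inflation_def[of E] by blast

lemma F_conf: assumes "(k, p) \<in> Conf E" shows "admissible D (Far F p)" "is_kernel D (Far F k) (Far F p)"
  using assms F_left_exact unfolding left_exact_functor_def by blast+

text \<open>For a deflation \<open>p\<close> the arrow \<open>F p\<close> is admissible by left
  exactness, an inflation \<open>n\<close> after a deflation \<open>q\<close>; the inflation
  \<open>F m\<close> is absorbed into \<open>n\<close>.\<close>

lemma F_admissible: assumes "admissible E f" "f \<in> Hom E X Y" shows "admissible D (Far F f)"
proof -
  obtain I m p where f: "inflation E m" "deflation E p" "p \<in> Hom E X I" "m \<in> Hom E I Y" "f = m \<cdot>[E] p"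
    using E.admissibleE[OF assms] by blast
  have "admissible D (Far F p)" using f(2) F_conf unfolding deflation_def by blast
  then obtain J n q where p: "inflation D n" "deflation D q" "q \<in> Hom D (Fob F X) J" "n \<in> Hom D J (Fob F I)"
    "Far F p = n \<cdot>[D] q" using D.admissibleE[OF _ F_hom[OF f(3)]] by metis
  note Fm = F_hom[OF f(4)]
  have "inflation D (Far F m \<cdot>[D] n)"
    by (rule D.inflation_cmp[OF p(1) F_inflation[OF f(1)]]) (use p(4) Fm in \<open>simp add: hom_iff\<close>)
  hence "admissible D ((Far F m \<cdot>[D] n) \<cdot>[D] q)"
    using p(2-4) Fm by (intro D.admissibleI) (simp_all add: hom_iff)
  moreover have "Far F f = (Far F m \<cdot>[D] n) \<cdot>[D] q"
    using F_cmp[OF f(3,4)] f(5) p(5) D.cmp_assoc[OF p(3,4) Fm] by simp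
  ultimately show ?thesis by simp
qed

lemma universal_exists: assumes "M \<in> adm E" shows "\<exists>T e. universal E D F M T e"
proof -
  have M: "M \<in> Ob (\<M> E)" using E.adm_Mod assms by blast
  obtain f y X Y where P: "pres E M f y" "f \<in> Hom E X Y" "X \<in> Ob E" "Y \<in> Ob E" using E.presE[OF assms] by metis
  note Ff = F_hom[OF P(2)]
  obtain c where c: "is_cokernel D c (Far F f)"
    using D.admissible_cokernel[OF F_admissible[OF E.presD(1)[OF P(1,2)] P(2)] Ff] by blast
  note C = D.cokernelD[OF c]
  have ch: "c \<in> Hom D (Fob F Y) (Cod D c)" "c \<cdot>[D] Far F f = Zer D (Fob F X) (Cod D c)"
    using C Ff by (simp_all add: hom_iff)
  obtain e where "cocone E D F M (Cod D c) e" "e Y y = c" using cocone_of_pres[OF M P(1,2) ch] by blast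
  thus ?thesis using universal_of_cokernel[OF M P(1,2)] c by metis
qed

text \<open>An arbitrary choice; what is used afterwards is universality of the chosen
  cocone.\<close>

definition kan :: "('o, 'm) md \<Rightarrow> 'p \<times> ('o \<Rightarrow> 'm \<Rightarrow> 'n)" where
  "kan M = (SOME Te. universal E D F M (fst Te) (snd Te))"

abbreviation "T M \<equiv> fst (kan M)"
abbreviation "e M \<equiv> snd (kan M)"

lemma kan: assumes "M \<in> adm E" shows "universal E D F M (T M) (e M)"
proof -
  have "\<exists>Te. universal E D F M (fst Te) (snd Te)" using universal_exists[OF assms] by auto
  thus ?thesis unfolding kan_def by (rule someI_ex)
qed

lemma kan_cocone: "M \<in> adm E \<Longrightarrow> cocone E D F M (T M) (e M)" using universal_cocone[OF kan] .

definition extn :: "(('o, 'm) md, ('o, 'm) md_hom, 'p, 'n) ftr" where "extn = \<lparr>Fob = (\<lambda>M\<in>Ob (\<A> E). T M),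
     Far = (\<lambda>\<phi>\<in>Ar (\<A> E). THE u. u \<in> Hom D (T (src \<phi>)) (T (tgt \<phi>)) \<and>
       (\<forall>W\<in>Ob E. \<forall>x\<in>el (src \<phi>) W. u \<cdot>[D] e (src \<phi>) W x = e (tgt \<phi>) W (app \<phi> W x)))\<rparr>"

lemma cocone_pull: assumes "\<phi> \<in> Hom (\<M> E) M N" "cocone E D F N S d"
  shows "cocone E D F M S (\<lambda>W x. d W (app \<phi> W x))"
proof -
  note C = coconeD[OF assms(2)]
  show ?thesis
    by (rule coconeI) (use C E.app_closed[OF assms(1)] E.app_mult[OF assms(1)] E.app_natural[OF assms(1)]
        E.hom_ob in simp_all)
qed

lemma extn_ob: "M \<in> adm E \<Longrightarrow> Fob extn M = T M" by (simp add: extn_def E.mod_adm_simps)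

lemma extn_ar: assumes "\<phi> \<in> Hom (\<A> E) M N" shows "Far extn \<phi> \<in> Hom D (T M) (T N)"
    "\<And>W x. \<lbrakk>W \<in> Ob E; x \<in> el M W\<rbrakk> \<Longrightarrow> Far extn \<phi> \<cdot>[D] e M W x = e N W (app \<phi> W x)"
proof -
  have h: "\<phi> \<in> Hom (\<M> E) M N" "M \<in> adm E" "N \<in> adm E" using assms by (auto simp: E.Hom_mod_adm)
  have st: "src \<phi> = M" "tgt \<phi> = N" "\<phi> \<in> Ar (\<A> E)" using assms by (auto simp: hom_iff E.mod_adm_simps)
  have "\<exists>!u. u \<in> Hom D (T M) (T N) \<and> (\<forall>W\<in>Ob E. \<forall>x\<in>el M W. u \<cdot>[D] e M W x = e N W (app \<phi> W x))"
    using kan[OF h(2)] cocone_pull[OF h(1) kan_cocone[OF h(3)]] unfolding universal_def by blast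
  from theI'[OF this] show "Far extn \<phi> \<in> Hom D (T M) (T N)"
    "\<And>W x. \<lbrakk>W \<in> Ob E; x \<in> el M W\<rbrakk> \<Longrightarrow> Far extn \<phi> \<cdot>[D] e M W x = e N W (app \<phi> W x)"
    using st by (simp_all add: extn_def)
qed

text \<open>Functoriality and additivity of the extension follow from uniqueness: both sides of each
  law are compared on the universal family.\<close>

lemma extn_ar_eqI: assumes "\<phi> \<in> Hom (\<A> E) M N" "u \<in> Hom D (T M) (T N)"
    "\<And>W x. \<lbrakk>W \<in> Ob E; x \<in> el M W\<rbrakk> \<Longrightarrow> u \<cdot>[D] e M W x = e N W (app \<phi> W x)" shows "Far extn \<phi> = u"
proof -
  have M: "M \<in> adm E" using assms(1) by (simp add: E.Hom_mod_adm)
  show ?thesis by (rule universal_unique[OF kan[OF M] extn_ar(1)[OF assms(1)] assms(2)])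
    (use extn_ar(2)[OF assms(1)] assms(3) in simp)
qed

lemma extn_additive: "additive_functor (\<A> E) D extn"
proof -
  interpret MA: exact_category "\<A> E" by (rule E.exact_mod_adm)
  have ob: "M \<in> adm E" "N \<in> adm E" if "\<phi> \<in> Hom (\<A> E) M N" for \<phi> M N using that by (auto simp: E.Hom_mod_adm)
  have eh: "e M W x \<in> Hom D (Fob F W) (T M)" if "M \<in> adm E" "W \<in> Ob E" "x \<in> el M W" for M W x
    using coconeD(2)[OF kan_cocone[OF that(1)] that(2,3)] .
  have "is_functor (\<A> E) D extn"
  proof (rule functorI[OF MA.category_axioms D.category_axioms])
    show "Fob extn \<in> extensional (Ob (\<A> E))" "Far extn \<in> extensional (Ar (\<A> E))" by (simp_all add: extn_def)
    show "Fob extn M \<in> Ob D" if "M \<in> Ob (\<A> E)" for M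
      using that extn_ob coconeD(1)[OF kan_cocone] by (simp add: E.mod_adm_simps)
    show "Far extn f \<in> Hom D (Fob extn M) (Fob extn N)" if "f \<in> Hom (\<A> E) M N" for f M N
      using extn_ar(1)[OF that] ob[OF that] extn_ob by simp
    show "Far extn (Idn (\<A> E) M) = Idn D (Fob extn M)" if M: "M \<in> Ob (\<A> E)" for M
    proof -
      have Ma: "M \<in> adm E" using M by (simp add: E.mod_adm_simps)
      have TM: "T M \<in> Ob D" using coconeD(1)[OF kan_cocone[OF Ma]] .
      have "Far extn (Idn (\<A> E) M) = Idn D (T M)"
      proof (rule extn_ar_eqI[OF MA.id_hom[OF M] D.id_hom[OF TM]])
        fix W x assume W: "W \<in> Ob E" "x \<in> el M W"
        show "Idn D (T M) \<cdot>[D] e M W x = e M W (app (Idn (\<A> E) M) W x)"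
          using D.cmp_id_left[OF eh[OF Ma W]] E.app_idn[OF W] by (simp add: E.mod_adm_simps)
      qed
      thus ?thesis using extn_ob[OF Ma] by simp
    qed
    show "Far extn (g \<cdot>[\<A> E] f) = Far extn g \<cdot>[D] Far extn f"
      if fg: "f \<in> Hom (\<A> E) L M" "g \<in> Hom (\<A> E) M N" for f g L M N
    proof (rule extn_ar_eqI[OF MA.cmp_hom[OF fg] D.cmp_hom[OF extn_ar(1)[OF fg(1)] extn_ar(1)[OF fg(2)]]])
      have h: "f \<in> Hom (\<M> E) L M" "g \<in> Hom (\<M> E) M N" using fg by (auto simp: E.Hom_mod_adm)
      fix W x assume W: "W \<in> Ob E" "x \<in> el L W"
      have "Far extn g \<cdot>[D] Far extn f \<cdot>[D] e L W x = Far extn g \<cdot>[D] (Far extn f \<cdot>[D] e L W x)"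
        by (rule D.cmp_assoc[OF eh[OF ob(1)[OF fg(1)] W] extn_ar(1)[OF fg(1)] extn_ar(1)[OF fg(2)]])
      thus "Far extn g \<cdot>[D] Far extn f \<cdot>[D] e L W x = e N W (app (g \<cdot>[\<A> E] f) W x)"
        using extn_ar(2)[OF fg(1) W] extn_ar(2)[OF fg(2) W(1) E.app_closed[OF h(1) W]] E.app_cmp[OF h W]
        by (simp add: E.mod_adm_simps)
    qed
  qed
  moreover have "Far extn (f \<boxplus>[\<A> E] g) = Far extn f \<boxplus>[D] Far extn g"
    if fg: "f \<in> Hom (\<A> E) M N" "g \<in> Hom (\<A> E) M N" for f g M N
  proof (rule extn_ar_eqI[OF MA.add_hom[OF fg] D.add_hom[OF extn_ar(1)[OF fg(1)] extn_ar(1)[OF fg(2)]]])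
    have h: "f \<in> Hom (\<M> E) M N" "g \<in> Hom (\<M> E) M N" using fg by (auto simp: E.Hom_mod_adm)
    note MN = ob[OF fg(1)]
    fix W x assume W: "W \<in> Ob E" "x \<in> el M W"
    show "(Far extn f \<boxplus>[D] Far extn g) \<cdot>[D] e M W x = e N W (app (f \<boxplus>[\<A> E] g) W x)"
      using D.add_cmp[OF eh[OF MN(1) W] extn_ar(1)[OF fg(1)] extn_ar(1)[OF fg(2)]] extn_ar(2)[OF fg(1) W]
        extn_ar(2)[OF fg(2) W] E.app_add[OF h W]
        coconeD(3)[OF kan_cocone[OF MN(2)] W(1) E.app_closed[OF h(1) W] E.app_closed[OF h(2) W]]
      by (simp add: E.mod_adm_simps)
  qed
  ultimately show ?thesis unfolding additive_functor_def by blast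
qed

text \<open>Presentations of the ends are combined to one of the middle term, and the horseshoe
  lemma is applied in \<open>D\<close> to the image of this data under \<open>F\<close>: the values
  of the extension are cokernels of the three transformed presentations.\<close>

lemma extn_exact: "exact_functor (\<A> E) D extn" unfolding exact_functor_def
proof (intro conjI extn_additive ballI, clarify)
  fix \<alpha> \<beta> assume "(\<alpha>, \<beta>) \<in> Conf (\<A> E)"
  then obtain L M N where ex: "short_exact E L M N \<alpha> \<beta>"
    and adm: "L \<in> adm E" "M \<in> adm E" "N \<in> adm E" using E.Conf_mod_adm by blast
  note SE = short_exactD[OF ex] and ob = adm[THEN E.adm_Mod]
  obtain f' y' X' Y' where P': "pres E L f' y'" "f' \<in> Hom E X' Y'" "X' \<in> Ob E" "Y' \<in> Ob E" using E.presE[OF adm(1)] by metis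
  obtain f'' y'' X'' Y'' where P'': "pres E N f'' y''" "f'' \<in> Hom E X'' Y''" "X'' \<in> Ob E" "Y'' \<in> Ob E" using E.presE[OF adm(3)] by metis
  obtain SX i1 i2 p1 p2 where bX: "is_biproduct E X' X'' SX i1 i2 p1 p2" using E.has_biproducts P' P'' by metis
  obtain SY j1 j2 q1 q2 where bY: "is_biproduct E Y' Y'' SY j1 j2 q1 q2" using E.has_biproducts P' P'' by metis
  note BX = bX[unfolded is_biproduct_def] and BY = bY[unfolded is_biproduct_def]
  have ij: "i1 \<in> Hom E X' SX" "i2 \<in> Hom E X'' SX" "j1 \<in> Hom E Y' SY" "j2 \<in> Hom E Y'' SY" "q2 \<in> Hom E SY Y''"
    "SY \<in> Ob E" using BX BY by auto
  obtain I m p where mp: "inflation E m" "deflation E p" "p \<in> Hom E X'' I" "m \<in> Hom E I Y''" "f'' = m \<cdot>[E] p"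
    using E.admissibleE[OF E.presD(1)[OF P''(1,2)] P''(2)] by blast
  \<comment> \<open>A kernel that belongs to a conflation is chosen, because left exactness speaks
    about conflations.\<close>
  obtain k where k: "(k, p) \<in> Conf E" using mp(2) unfolding deflation_def by blast
  have kk: "is_kernel E k f''" unfolding mp(5) using E.inflation_cmp_kernel[OF mp(1,4,3)] E.conf_kernel[OF k] by blast
  have kh: "k \<in> Hom E (Dom E k) X''" using E.conf_hom[OF k] mp(3) by (simp add: hom_iff)
  obtain h t f y where H: "h \<in> Hom E X'' Y'" "t \<in> Hom E (Dom E k) X'" "h \<cdot>[E] k = f' \<cdot>[E] t"
    "f \<in> Hom E SX SY" "f \<cdot>[E] i1 = j1 \<cdot>[E] f'" "f \<cdot>[E] i2 = j1 \<cdot>[E] h \<boxplus>[E] j2 \<cdot>[E] f''"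
    "pres E M f y" "act M j1 y = app \<alpha> Y' y'" "app \<beta> SY y = act N q2 y''"
    by (rule E.extension_pres[OF ex P'(1,2) P''(1,2) bX bY kk]) (rule that)
  note pa = E.preadditive_category_axioms D.preadditive_category_axioms
  \<comment> \<open>Here left exactness preserves the crucial datum: \<open>F k\<close> is still a
    kernel of \<open>F f''\<close>. Together with the transported equation \<open>hk\<close> this is
    the hypothesis of the horseshoe lemma in \<open>D\<close>.\<close>
  have kF: "is_kernel D (Far F k) (Far F f'')"
    using F_conf(2)[OF k] D.inflation_cmp_kernel[OF F_inflation[OF mp(1)] F_hom[OF mp(4)] F_hom[OF mp(3)]]
      F_cmp[OF mp(3,4)] mp(5) by simp
  have dk: "Dom D (Far F k) = Fob F (Dom E k)" using F_hom[OF kh] by (simp add: hom_iff)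
  have tF: "Far F t \<in> Hom D (Dom D (Far F k)) (Fob F X')" unfolding dk using F_hom[OF H(2)] .
  have hk: "Far F h \<cdot>[D] Far F k = Far F f' \<cdot>[D] Far F t" using F_cmp[OF kh H(1)] F_cmp[OF H(2) P'(2)] H(3) by simp
  have f1: "Far F f \<cdot>[D] Far F i1 = Far F j1 \<cdot>[D] Far F f'" using F_cmp[OF ij(1) H(4)] F_cmp[OF P'(2) ij(3)] H(5) by simp
  have f2: "Far F f \<cdot>[D] Far F i2 = Far F j1 \<cdot>[D] Far F h \<boxplus>[D] Far F j2 \<cdot>[D] Far F f''"
    using F_cmp[OF ij(2) H(4)] H(6) F_add[OF E.cmp_hom[OF H(1) ij(3)] E.cmp_hom[OF P''(2) ij(4)]]
      F_cmp[OF H(1) ij(3)] F_cmp[OF P''(2) ij(4)] by simp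
  note ck' = cokernel_of_universal[OF ob(1) P'(1,2) kan[OF adm(1)]]
  note ck = cokernel_of_universal[OF ob(2) H(7,4) kan[OF adm(2)]]
  note ck'' = cokernel_of_universal[OF ob(3) P''(1,2) kan[OF adm(3)]]
  have y: "y' \<in> el L Y'" "y \<in> el M SY" "y'' \<in> el N Y''"
    using E.presD(2)[OF P'(1,2)] E.presD(2)[OF H(7,4)] E.presD(2)[OF P''(1,2)] .
  note eh = coconeD(2)[OF kan_cocone[OF adm(1)] P'(4) y(1)] coconeD(2)[OF kan_cocone[OF adm(2)] ij(6) y(2)]
    coconeD(2)[OF kan_cocone[OF adm(3)] P''(4) y(3)]
  have \<alpha>\<beta>: "\<alpha> \<in> Hom (\<A> E) L M" "\<beta> \<in> Hom (\<A> E) M N" using SE(1,2) adm by (simp_all add: E.Hom_mod_adm)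
  have cods: "Cod D (e L Y' y') = T L" "Cod D (e M SY y) = T M" "Cod D (e N Y'' y'') = T N" using eh by (simp_all add: hom_iff)
  \<comment> \<open>The values of the extension on \<alpha> and \<beta> are recognized by their
    effect on generators, which \<open>extension_pres\<close> supplies.\<close>
  have ea: "Far extn \<alpha> \<cdot>[D] e L Y' y' = e M SY y \<cdot>[D] Far F j1"
    using extn_ar(2)[OF \<alpha>\<beta>(1) P'(4) y(1)] coconeD(4)[OF kan_cocone[OF adm(2)] ij(3) y(2)] H(8) by simp
  have eb: "Far extn \<beta> \<cdot>[D] e M SY y = e N Y'' y'' \<cdot>[D] Far F q2"
    using extn_ar(2)[OF \<alpha>\<beta>(2) ij(6) y(2)] coconeD(4)[OF kan_cocone[OF adm(3)] ij(5) y(3)] H(9) by simp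
  show "(Far extn \<alpha>, Far extn \<beta>) \<in> Conf D"
    by (rule D.horseshoe_admissible(2)[OF F_admissible[OF E.presD(1)[OF P'(1,2)] P'(2)]
        F_admissible[OF E.presD(1)[OF P''(1,2)] P''(2)] F_hom[OF P'(2)] F_hom[OF P''(2)] F_hom[OF H(1)]
        additive_biproduct[OF F_additive pa bX] additive_biproduct[OF F_additive pa bY] kF tF hk F_hom[OF H(4)]
        f1 f2 ck' ck'' ck]) (use extn_ar(1)[OF \<alpha>\<beta>(1)] extn_ar(1)[OF \<alpha>\<beta>(2)] ea eb cods in simp_all)
qed

text \<open>A representable is presented by a zero arrow, so the value there is a cokernel of a zero
  arrow into \<open>F X\<close>, that is \<open>F X\<close> up to isomorphism.\<close>

lemma extn_yoneda: assumes X: "X \<in> Ob E"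
  defines "\<eta> \<equiv> e (\<Y> E X) X (Idn E X)" shows "\<eta> \<in> Hom D (Fob F X) (T (\<Y> E X))" "is_iso D \<eta>"
proof -
  note adm = E.yoneda_adm[OF X]
  obtain z where z: "(z, Idn E X) \<in> Conf E" "z \<in> Hom E (Dom E z) X" "z = Zer E (Dom E z) X" "admissible E z"
    using E.zero_inflation[OF X] .
  have Z: "Dom E z \<in> Ob E" using E.hom_ob[OF z(2)] by blast
  note ck = cokernel_of_universal[OF E.yoneda_ob(1)[OF X] E.yoneda_pres[OF X z(2-4)] z(2) kan[OF adm], folded \<eta>_def]
  have "Idn E X \<in> el (\<Y> E X) X" using X E.id_hom by (simp add: E.yoneda_ob)
  thus h: "\<eta> \<in> Hom D (Fob F X) (T (\<Y> E X))" unfolding \<eta>_def using coconeD(2)[OF kan_cocone[OF adm] X] by blast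
  have FX: "Fob F X \<in> Ob D" using functor_ob[OF F_functor X] .
  have Fz: "Far F z = Zer D (Fob F (Dom E z)) (Fob F X)"
    using additive_zer[OF F_additive E.preadditive_category_axioms D.preadditive_category_axioms Z X] z(3) by simp
  have FZ: "Fob F (Dom E z) \<in> Ob D" using functor_ob[OF F_functor Z] .
  \<comment> \<open>The identity of \<open>F X\<close> composed with the zero arrow is zero, so it
    factors through the cokernel \<eta>; the factor is the inverse.\<close>
  obtain u where u: "u \<in> Hom D (T (\<Y> E X)) (Fob F X)" "u \<cdot>[D] \<eta> = Idn D (Fob F X)"
    using D.cokernelE[OF ck, of "Idn D (Fob F X)" "Fob F X"] h FX FZ Fz by (auto simp: hom_iff)
  have e: "(\<eta> \<cdot>[D] u) \<cdot>[D] \<eta> = Idn D (T (\<Y> E X)) \<cdot>[D] \<eta>"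
    using D.cmp_assoc[OF h u(1) h] u(2) D.cmp_id_left[OF h] D.cmp_id_right[OF h] by simp
  have TO: "T (\<Y> E X) \<in> Ob D" using D.hom_ob[OF h] by blast
  have "\<eta> \<cdot>[D] u = Idn D (T (\<Y> E X))"
    by (rule D.cokernel_epi[OF ck _ _ e]) (use h u(1) TO in \<open>simp_all add: hom_iff\<close>)
  thus "is_iso D \<eta>" using D.isoI[OF h u(1)] u(2) by blast
qed

lemma extn_yoneda_natural: assumes f: "f \<in> Hom E X Y"
  shows "Far extn (\<y> E f) \<cdot>[D] e (\<Y> E X) X (Idn E X) = e (\<Y> E Y) Y (Idn E Y) \<cdot>[D] Far F f"
proof -
  have XY: "X \<in> Ob E" "Y \<in> Ob E" using E.hom_ob[OF f] .
  note adm = E.yoneda_adm[OF XY(1)] E.yoneda_adm[OF XY(2)]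
  have y: "\<y> E f \<in> Hom (\<A> E) (\<Y> E X) (\<Y> E Y)" using E.yoneda_ar(1)[OF f] adm by (simp add: E.Hom_mod_adm)
  have i: "Idn E X \<in> el (\<Y> E X) X" "Idn E Y \<in> el (\<Y> E Y) Y" using XY E.id_hom by (simp_all add: E.yoneda_ob)
  have "app (\<y> E f) X (Idn E X) = act (\<Y> E Y) f (Idn E Y)"
    using E.yoneda_ar(2)[OF f XY(1) E.id_hom[OF XY(1)]] E.yoneda_ob(3)[OF XY(2) f E.id_hom[OF XY(2)]]
      E.cmp_id_left[OF f] E.cmp_id_right[OF f] by simp
  thus ?thesis using extn_ar(2)[OF y XY(1) i(1)] coconeD(4)[OF kan_cocone[OF adm(2)] f i(2)] by simp
qed

end

section \<open>Restriction along the Yoneda functor\<close>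

context exact_category
begin

interpretation Mod: preadditive_category "\<M> E" by (rule preadditive_Mod)

lemma yel_adm: assumes "M \<in> adm E" "W \<in> Ob E" "x \<in> el M W" shows "yel E M W x \<in> Hom (\<A> E) (\<Y> E W) M"
  using yel(1)[OF adm_Mod[OF assms(1)] assms(2,3)] yoneda_adm[OF assms(2)] assms(1) by (simp add: Hom_mod_adm)

text \<open>Additivity in \<open>x\<close> and, in the next lemmas, compatibility with the action of
  arrows and with homomorphisms make \<open>yel\<close> a natural family, which an exact functor
  turns into a cocone.\<close>

lemma yel_mult: assumes "M \<in> Ob (\<M> E)" "W \<in> Ob E" "x \<in> el M W" "y \<in> el M W"
  shows "yel E M W (x \<otimes>[Fob M W] y) = yel E M W x \<boxplus>[\<M> E] yel E M W y"
proof -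
  have xy: "x \<otimes>[Fob M W] y \<in> el M W" using comm_group_m_closed[OF mod_group] assms by blast
  note Y = yel[OF assms(1,2,3)] yel[OF assms(1,2,4)] yel[OF assms(1,2) xy]
  show ?thesis
  proof (rule Mod_hom_eqI[OF Y(5) Mod.add_hom[OF Y(1,3)]])
    fix V g assume V: "V \<in> Ob E" "g \<in> el (\<Y> E W) V"
    hence g: "g \<in> Hom E V W" using assms by (simp add: yoneda_ob)
    show "app (yel E M W (x \<otimes>[Fob M W] y)) V g = app (yel E M W x \<boxplus>[\<M> E] yel E M W y) V g"
      using Y(2)[OF V(1) g] Y(4)[OF V(1) g] Y(6)[OF V(1) g] app_add[OF Y(1,3) V] act_mult[OF assms(1) g assms(3,4)] by simp
  qed
qed

lemma yel_act: assumes "M \<in> Ob (\<M> E)" "f \<in> Hom E X Y" "x \<in> el M Y"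
  shows "yel E M X (act M f x) = yel E M Y x \<cdot>[\<M> E] \<y> E f"
proof -
  have ob: "X \<in> Ob E" "Y \<in> Ob E" using hom_ob[OF assms(2)] .
  note Y = yel[OF assms(1) ob(2) assms(3)] yel[OF assms(1) ob(1) act_closed[OF assms]] yoneda_ar[OF assms(2)]
  show ?thesis
  proof (rule Mod_hom_eqI[OF Y(3) Mod.cmp_hom[OF Y(5,1)]])
    fix V g assume V: "V \<in> Ob E" "g \<in> el (\<Y> E X) V"
    hence g: "g \<in> Hom E V X" using ob by (simp add: yoneda_ob)
    show "app (yel E M X (act M f x)) V g = app (yel E M Y x \<cdot>[\<M> E] \<y> E f) V g"
      using Y(4)[OF V(1) g] app_cmp[OF Y(5,1) V] Y(6)[OF V(1) g] Y(2)[OF V(1) cmp_hom[OF g assms(2)]]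
        act_cmp[OF assms(1) g assms(2,3)] by simp
  qed
qed

lemma cmp_yel: assumes "\<phi> \<in> Hom (\<M> E) M N" "W \<in> Ob E" "x \<in> el M W"
  shows "\<phi> \<cdot>[\<M> E] yel E M W x = yel E N W (app \<phi> W x)"
proof -
  note ob = Mod_ob[OF assms(1)]
  note Y = yel[OF ob(1) assms(2,3)] yel[OF ob(2) assms(2) app_closed[OF assms]]
  show ?thesis
  proof (rule Mod_hom_eqI[OF Mod.cmp_hom[OF Y(1) assms(1)] Y(3)])
    fix V g assume V: "V \<in> Ob E" "g \<in> el (\<Y> E W) V"
    hence g: "g \<in> Hom E V W" using assms by (simp add: yoneda_ob)
    show "app (\<phi> \<cdot>[\<M> E] yel E M W x) V g = app (yel E N W (app \<phi> W x)) V g"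
      using app_cmp[OF Y(1) assms(1) V] Y(2)[OF V(1) g] Y(4)[OF V(1) g] app_natural[OF assms(1) g assms(3)] by simp
  qed
qed

lemma yel_idn: assumes "X \<in> Ob E"
  shows "Idn E X \<in> el (\<Y> E X) X" "yel E (\<Y> E X) X (Idn E X) = Idn (\<M> E) (\<Y> E X)"
proof -
  show i: "Idn E X \<in> el (\<Y> E X) X" using assms id_hom by (simp add: yoneda_ob)
  note Y = yel[OF yoneda_ob(1)[OF assms] assms i]
  show "yel E (\<Y> E X) X (Idn E X) = Idn (\<M> E) (\<Y> E X)"
  proof (rule Mod_hom_eqI[OF Y(1) Mod.id_hom[OF yoneda_ob(1)[OF assms]]])
    fix V g assume V: "V \<in> Ob E" "g \<in> el (\<Y> E X) V"
    hence g: "g \<in> Hom E V X" using assms by (simp add: yoneda_ob)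
    show "app (yel E (\<Y> E X) X (Idn E X)) V g = app (Idn (\<M> E) (\<Y> E X)) V g"
      using Y(2)[OF V(1) g] app_idn[OF V] yoneda_ob(3)[OF assms g id_hom[OF assms]] cmp_id_left[OF g] by simp
  qed
qed

end

section \<open>Exact functors on admissibly presented modules\<close>

lemma exact_functor_additive: "exact_functor E D G \<Longrightarrow> additive_functor E D G"
  and exact_functor_conf: "\<lbrakk>exact_functor E D G; (f, g) \<in> Conf E\<rbrakk> \<Longrightarrow> (Far G f, Far G g) \<in> Conf D"
  unfolding exact_functor_def by auto

locale exact_on_mod_adm = E: exact_category E + D: exact_category D
  for E :: "('o, 'm) ecat" and D :: "('p, 'n) ecat" +
  fixes G :: "(('o, 'm) md, ('o, 'm) md_hom, 'p, 'n) ftr" assumes G_exact: "exact_functor (\<A> E) D G"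
begin

lemmas G_additive = exact_functor_additive[OF G_exact]
lemmas G_functor = additive_functorD(1)[OF G_additive]
lemmas G_hom = functor_hom[OF G_functor]
lemmas G_cmp = functor_cmp[OF G_functor]

sublocale R: two_exact E D "fcomp E G (\<Upsilon> E)"
  by unfold_locales (rule fcomp_additive[OF E.yoneda_additive G_additive E.preadditive_category_axioms])

lemma restr_simps: "X \<in> Ob E \<Longrightarrow> Fob (fcomp E G (\<Upsilon> E)) X = Fob G (\<Y> E X)"
  "f \<in> Ar E \<Longrightarrow> Far (fcomp E G (\<Upsilon> E)) f = Far G (\<y> E f)" by (simp_all add: fcomp_simps E.yoneda_simps)

lemma yel_cocone: assumes M: "M \<in> adm E"
  shows "cocone E D (fcomp E G (\<Upsilon> E)) M (Fob G M) (\<lambda>W x. Far G (yel E M W x))"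
proof (rule coconeI)
  note MO = E.adm_Mod[OF M]
  show "Fob G M \<in> Ob D" using functor_ob[OF G_functor] M by (simp add: E.mod_adm_simps)
  show "Far G (yel E M W x) \<in> Hom D (Fob (fcomp E G (\<Upsilon> E)) W) (Fob G M)" if "W \<in> Ob E" "x \<in> el M W" for W x
    using G_hom[OF E.yel_adm[OF M that]] restr_simps(1)[OF that(1)] by simp
  show "Far G (yel E M W (x \<otimes>[Fob M W] y)) = Far G (yel E M W x) \<boxplus>[D] Far G (yel E M W y)"
    if "W \<in> Ob E" "x \<in> el M W" "y \<in> el M W" for W x y
    using E.yel_mult[OF MO that] additive_functorD(2)[OF G_additive E.yel_adm[OF M that(1,2)] E.yel_adm[OF M that(1,3)]]
    by (simp add: E.mod_adm_simps)
  show "Far G (yel E M X (act M f x)) = Far G (yel E M Y x) \<cdot>[D] Far (fcomp E G (\<Upsilon> E)) f"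
    if f: "f \<in> Hom E X Y" and x: "x \<in> el M Y" for f X Y x
  proof -
    have ob: "X \<in> Ob E" "Y \<in> Ob E" "f \<in> Ar E" using f by (auto simp: hom_iff)
    have "\<y> E f \<in> Hom (\<A> E) (\<Y> E X) (\<Y> E Y)"
      using E.yoneda_ar(1)[OF f] E.yoneda_adm ob by (simp add: E.Hom_mod_adm)
    from G_cmp[OF this E.yel_adm[OF M ob(2) x]] show ?thesis
      using E.yel_act[OF MO f x] restr_simps(2)[OF ob(3)] by (simp add: E.mod_adm_simps)
  qed
qed

text \<open>\<open>G\<close> sends the two conflations of \<open>pres_factorization\<close> to
  conflations. Hence \<open>G\<close> of the generating epimorphism is a cokernel of
  \<open>G \<nu>\<close>, and also of \<open>G \<nu>\<close> after the deflation
  \<open>G \<rho>\<close>, which is the restricted functor at \<open>f\<close>. So an exact functor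
  on modules is the left Kan extension of its restriction.\<close>

lemma yel_universal: assumes M: "M \<in> adm E"
  shows "universal E D (fcomp E G (\<Upsilon> E)) M (Fob G M) (\<lambda>W x. Far G (yel E M W x))"
proof -
  obtain f y X Y where P: "pres E M f y" "f \<in> Hom E X Y" "X \<in> Ob E" "Y \<in> Ob E" using E.presE[OF M] by metis
  obtain I m p where mp: "inflation E m" "deflation E p" "p \<in> Hom E X I" "m \<in> Hom E I Y" "f = m \<cdot>[E] p"
    using E.admissibleE[OF E.presD(1)[OF P(1,2)] P(2)] by blast
  obtain k where k: "(k, p) \<in> Conf E" using mp(2) unfolding deflation_def by blast
  obtain K \<nu> \<rho> where K: "(\<nu>, yel E M Y y) \<in> Conf (\<A> E)" "(\<y> E k, \<rho>) \<in> Conf (\<A> E)"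
    "\<rho> \<in> Hom (\<A> E) (\<Y> E X) K" "\<nu> \<in> Hom (\<A> E) K (\<Y> E Y)" "\<y> E f = \<nu> \<cdot>[\<A> E] \<rho>"
    by (rule E.pres_factorization[OF M P(1,2) k mp(1,3,4,5)]) (rule that)
  have 1: "is_cokernel D (Far G (yel E M Y y)) (Far G \<nu>)"
    using D.conf_cokernel[OF exact_functor_conf[OF G_exact K(1)]] .
  have 2: "deflation D (Far G \<rho>)" using exact_functor_conf[OF G_exact] K(2) unfolding deflation_def by blast
  have "is_cokernel D (Far G (yel E M Y y)) (Far (fcomp E G (\<Upsilon> E)) f)"
    using D.deflation_cmp_cokernel[OF 1 2 G_hom[OF K(3)] G_hom[OF K(4)]] G_cmp[OF K(3,4)] K(5) P(2)
      restr_simps(2)[of f] by (simp add: hom_iff)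
  thus ?thesis using R.universal_of_cokernel[OF E.adm_Mod[OF M] P(1,2) yel_cocone[OF M]] by blast
qed

lemma epi_family: assumes "M \<in> adm E" "u \<in> Hom D (Fob G M) S" "v \<in> Hom D (Fob G M) S"
    "\<And>W x. \<lbrakk>W \<in> Ob E; x \<in> el M W\<rbrakk> \<Longrightarrow> u \<cdot>[D] Far G (yel E M W x) = v \<cdot>[D] Far G (yel E M W x)" shows "u = v"
  using R.universal_unique[OF yel_universal[OF assms(1)] assms(2,3)] assms(4) by blast

end

locale exact_pair_on_mod_adm = G: exact_on_mod_adm E D G + H: exact_on_mod_adm E D H
  for E :: "('o, 'm) ecat" and D :: "('p, 'n) ecat" and G H
begin

text \<open>Naturality along the homomorphisms \<open>yel E M W x\<close> fixes the component at
  \<open>M\<close> on a jointly epic family that starts at representables.\<close>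

lemma restriction_faithful: assumes t: "\<tau> \<in> Hom (Fun (\<A> E) D) G H" "\<tau>' \<in> Hom (Fun (\<A> E) D) G H"
    and eq: "\<And>X. X \<in> Ob E \<Longrightarrow> at \<tau> (\<Y> E X) = at \<tau>' (\<Y> E X)" shows "\<tau> = \<tau>'"
proof -
  have n: "is_nt (\<A> E) D \<tau>" "src \<tau> = G" "tgt \<tau> = H" "is_nt (\<A> E) D \<tau>'" "src \<tau>' = G" "tgt \<tau>' = H"
    using t by (auto simp: Hom_Fun)
  show ?thesis
  proof (rule nt_eqI[of _ _ "adm E"])
    show "at \<tau> \<in> extensional (adm E)" "at \<tau>' \<in> extensional (adm E)"
      using nt_extensional n by (metis G.E.mod_adm_simps(1))+
    fix M assume M: "M \<in> adm E"
    have h: "at \<tau> M \<in> Hom D (Fob G M) (Fob H M)" "at \<tau>' M \<in> Hom D (Fob G M) (Fob H M)"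
      using nt_hom[OF n(1), of M] nt_hom[OF n(4), of M] n M by (simp_all add: G.E.mod_adm_simps)
    show "at \<tau> M = at \<tau>' M"
    proof (rule G.epi_family[OF M h])
      fix W x assume W: "W \<in> Ob E" "x \<in> el M W"
      show "at \<tau> M \<cdot>[D] Far G (yel E M W x) = at \<tau>' M \<cdot>[D] Far G (yel E M W x)"
        using nt_natural[OF n(1) G.E.yel_adm[OF M W]] nt_natural[OF n(4) G.E.yel_adm[OF M W]] n eq[OF W(1)] by simp
    qed
  qed (use n in simp_all)
qed

text \<open>Sending \<open>x\<close> to \<open>H\<close> of \<open>yel E M W x\<close> after
  \<open>s W\<close> is a cocone on \<open>M\<close>, because \<open>s\<close> is natural; the
  universal property of \<open>G M\<close> turns it into the component at \<open>M\<close>.\<close>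

lemma restriction_full: assumes s: "\<And>X. X \<in> Ob E \<Longrightarrow> s X \<in> Hom D (Fob G (\<Y> E X)) (Fob H (\<Y> E X))"
    and nat: "\<And>f X Y. f \<in> Hom E X Y \<Longrightarrow> s Y \<cdot>[D] Far G (\<y> E f) = Far H (\<y> E f) \<cdot>[D] s X"
  obtains \<tau> where "\<tau> \<in> Hom (Fun (\<A> E) D) G H" "\<And>X. X \<in> Ob E \<Longrightarrow> at \<tau> (\<Y> E X) = s X"
proof -
  have yar: "\<y> E f \<in> Hom (\<A> E) (\<Y> E X) (\<Y> E Y)" if "f \<in> Hom E X Y" for f X Y
    using G.E.yoneda_ar(1)[OF that] G.E.yoneda_adm G.E.hom_ob[OF that] by (simp add: G.E.Hom_mod_adm)
  let ?d = "\<lambda>M W x. Far H (yel E M W x) \<cdot>[D] s W"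
  have coc: "cocone E D (fcomp E G (\<Upsilon> E)) M (Fob H M) (?d M)" if M: "M \<in> adm E" for M
  proof (rule coconeI)
    note C = coconeD[OF H.yel_cocone[OF M]]
    show "Fob H M \<in> Ob D" using C(1) .
    have hh: "Far H (yel E M W x) \<in> Hom D (Fob H (\<Y> E W)) (Fob H M)" if "W \<in> Ob E" "x \<in> el M W" for W x
      using C(2)[OF that] H.restr_simps(1)[OF that(1)] by simp
    show "?d M W x \<in> Hom D (Fob (fcomp E G (\<Upsilon> E)) W) (Fob H M)" if "W \<in> Ob E" "x \<in> el M W" for W x
      using G.D.cmp_hom[OF s[OF that(1)] hh[OF that]] G.restr_simps(1)[OF that(1)] by simp
    show "?d M W (x \<otimes>[Fob M W] y) = ?d M W x \<boxplus>[D] ?d M W y" if "W \<in> Ob E" "x \<in> el M W" "y \<in> el M W" for W x y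
      using C(3)[OF that] G.D.add_cmp[OF s[OF that(1)] hh[OF that(1,2)] hh[OF that(1,3)]] by simp
    show "?d M X (act M f x) = ?d M Y x \<cdot>[D] Far (fcomp E G (\<Upsilon> E)) f" if f: "f \<in> Hom E X Y" and x: "x \<in> el M Y" for f X Y x
    proof -
      have ob: "X \<in> Ob E" "Y \<in> Ob E" "f \<in> Ar E" using f by (auto simp: hom_iff)
      note g = G.G_hom[OF yar[OF f]] H.G_hom[OF yar[OF f]]
      have "?d M X (act M f x) = (Far H (yel E M Y x) \<cdot>[D] Far H (\<y> E f)) \<cdot>[D] s X"
        using C(4)[OF f x] H.restr_simps(2)[OF ob(3)] by simp
      also have "\<dots> = Far H (yel E M Y x) \<cdot>[D] (s Y \<cdot>[D] Far G (\<y> E f))"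
        using G.D.cmp_assoc[OF s[OF ob(1)] g(2) hh[OF ob(2) x]] nat[OF f] by simp
      also have "\<dots> = ?d M Y x \<cdot>[D] Far (fcomp E G (\<Upsilon> E)) f"
        using G.D.cmp_assoc[OF g(1) s[OF ob(2)] hh[OF ob(2) x]] G.restr_simps(2)[OF ob(3)] by simp
      finally show ?thesis .
    qed
  qed
  define t where "t M = (SOME u. u \<in> Hom D (Fob G M) (Fob H M) \<and>
    (\<forall>W\<in>Ob E. \<forall>x\<in>el M W. u \<cdot>[D] Far G (yel E M W x) = ?d M W x))" for M
  have t: "t M \<in> Hom D (Fob G M) (Fob H M)" "\<And>W x. \<lbrakk>W \<in> Ob E; x \<in> el M W\<rbrakk> \<Longrightarrow> t M \<cdot>[D] Far G (yel E M W x) = ?d M W x"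
    if M: "M \<in> adm E" for M
  proof -
    have "\<exists>u. u \<in> Hom D (Fob G M) (Fob H M) \<and> (\<forall>W\<in>Ob E. \<forall>x\<in>el M W. u \<cdot>[D] Far G (yel E M W x) = ?d M W x)"
      using G.yel_universal[OF M] coc[OF M] unfolding universal_def by blast
    from someI_ex[OF this] show "t M \<in> Hom D (Fob G M) (Fob H M)"
      "\<And>W x. \<lbrakk>W \<in> Ob E; x \<in> el M W\<rbrakk> \<Longrightarrow> t M \<cdot>[D] Far G (yel E M W x) = ?d M W x" unfolding t_def by blast+
  qed
  define \<tau> where "\<tau> = \<lparr>src = G, tgt = H, at = (\<lambda>M\<in>adm E. t M)\<rparr>"
  have "is_nt (\<A> E) D \<tau>"
  proof (rule ntI)
    show "is_functor (\<A> E) D (src \<tau>)" "is_functor (\<A> E) D (tgt \<tau>)"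
      using G.G_functor H.G_functor by (simp_all add: \<tau>_def)
    show "at \<tau> \<in> extensional (Ob (\<A> E))" by (simp add: \<tau>_def G.E.mod_adm_simps)
    show "at \<tau> M \<in> Hom D (Fob (src \<tau>) M) (Fob (tgt \<tau>) M)" if "M \<in> Ob (\<A> E)" for M
      using that t(1) by (simp add: \<tau>_def G.E.mod_adm_simps)
    fix \<phi> M N assume phi: "\<phi> \<in> Hom (\<A> E) M N"
    hence h: "\<phi> \<in> Hom (\<M> E) M N" "M \<in> adm E" "N \<in> adm E" by (auto simp: G.E.Hom_mod_adm)
    note gp = G.G_hom[OF phi] and hp = H.G_hom[OF phi]
    \<comment> \<open>Naturality is tested on the jointly epic family; \<phi> carries
      \<open>yel E M W x\<close> to \<open>yel E N W (app \<phi> W x)\<close>.\<close>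
    have "t N \<cdot>[D] Far G \<phi> = Far H \<phi> \<cdot>[D] t M"
    proof (rule G.epi_family[OF h(2) G.D.cmp_hom[OF gp t(1)[OF h(3)]] G.D.cmp_hom[OF t(1)[OF h(2)] hp]])
      fix W x assume W: "W \<in> Ob E" "x \<in> el M W"
      note yx = G.E.yel_adm[OF h(2) W]
      have pc: "\<phi> \<cdot>[\<A> E] yel E M W x = yel E N W (app \<phi> W x)" using G.E.cmp_yel[OF h(1) W] by (simp add: G.E.mod_adm_simps)
      have "t N \<cdot>[D] Far G \<phi> \<cdot>[D] Far G (yel E M W x) = t N \<cdot>[D] Far G (yel E N W (app \<phi> W x))"
        using G.D.cmp_assoc[OF G.G_hom[OF yx] gp t(1)[OF h(3)]] G.G_cmp[OF yx phi] pc by simp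
      also have "\<dots> = Far H (yel E N W (app \<phi> W x)) \<cdot>[D] s W" using t(2)[OF h(3) W(1) G.E.app_closed[OF h(1) W]] .
      also have "\<dots> = Far H \<phi> \<cdot>[D] (Far H (yel E M W x) \<cdot>[D] s W)"
        using G.D.cmp_assoc[OF s[OF W(1)] H.G_hom[OF yx] hp] H.G_cmp[OF yx phi] pc by simp
      also have "\<dots> = Far H \<phi> \<cdot>[D] t M \<cdot>[D] Far G (yel E M W x)"
        using G.D.cmp_assoc[OF G.G_hom[OF yx] t(1)[OF h(2)] hp] t(2)[OF h(2) W] by simp
      finally show "t N \<cdot>[D] Far G \<phi> \<cdot>[D] Far G (yel E M W x) = Far H \<phi> \<cdot>[D] t M \<cdot>[D] Far G (yel E M W x)" .
    qed
    thus "at \<tau> N \<cdot>[D] Far (src \<tau>) \<phi> = Far (tgt \<tau>) \<phi> \<cdot>[D] at \<tau> M" using h by (simp add: \<tau>_def)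
  qed
  hence 1: "\<tau> \<in> Hom (Fun (\<A> E) D) G H" by (simp add: Hom_Fun \<tau>_def)
  \<comment> \<open>Evaluation at the identity of \<open>X\<close>, whose \<open>yel\<close> is the
    identity homomorphism.\<close>
  have "at \<tau> (\<Y> E X) = s X" if X: "X \<in> Ob E" for X
  proof -
    note ad = G.E.yoneda_adm[OF X] and i = G.E.yel_idn[OF X]
    have Y: "\<Y> E X \<in> Ob (\<A> E)" using ad by (simp add: G.E.mod_adm_simps)
    have "Far G (yel E (\<Y> E X) X (Idn E X)) = Idn D (Fob G (\<Y> E X))"
      "Far H (yel E (\<Y> E X) X (Idn E X)) = Idn D (Fob H (\<Y> E X))"
      unfolding i(2) using functor_idn[OF G.G_functor Y] functor_idn[OF H.G_functor Y] by (simp_all add: G.E.mod_adm_simps)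
    hence "t (\<Y> E X) = s X"
      using t(2)[OF ad X i(1)] G.D.cmp_id_right[OF t(1)[OF ad]] G.D.cmp_id_left[OF s[OF X]] by simp
    thus ?thesis using ad by (simp add: \<tau>_def)
  qed
  thus thesis using that 1 by blast
qed

end

section \<open>Natural isomorphisms and equivalences of categories\<close>

lemma nt_isoI: assumes n: "is_nt C D \<eta>" and iso: "\<And>X. X \<in> Ob C \<Longrightarrow> is_iso D (at \<eta> X)" shows "is_iso (Fun C D) \<eta>"
proof -
  interpret C: category C using functor_dom_cat[OF nt_src[OF n]] .
  interpret D: category D using functor_cod_cat[OF nt_src[OF n]] .
  interpret Fun: category "Fun C D" by (rule category_Fun) unfold_locales
  define i where "i X = (SOME g. g \<in> Hom D (Fob (tgt \<eta>) X) (Fob (src \<eta>) X) \<and>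
    g \<cdot>[D] at \<eta> X = Idn D (Fob (src \<eta>) X) \<and> at \<eta> X \<cdot>[D] g = Idn D (Fob (tgt \<eta>) X))" for X
  have i: "i X \<in> Hom D (Fob (tgt \<eta>) X) (Fob (src \<eta>) X)" "i X \<cdot>[D] at \<eta> X = Idn D (Fob (src \<eta>) X)"
    "at \<eta> X \<cdot>[D] i X = Idn D (Fob (tgt \<eta>) X)" if X: "X \<in> Ob C" for X
  proof -
    have "\<exists>g. g \<in> Hom D (Fob (tgt \<eta>) X) (Fob (src \<eta>) X) \<and>
    g \<cdot>[D] at \<eta> X = Idn D (Fob (src \<eta>) X) \<and> at \<eta> X \<cdot>[D] g = Idn D (Fob (tgt \<eta>) X)"
      using D.isoE[OF iso[OF X] nt_hom[OF n X]] by metis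
    from someI_ex[OF this] show "i X \<in> Hom D (Fob (tgt \<eta>) X) (Fob (src \<eta>) X)" "i X \<cdot>[D] at \<eta> X = Idn D (Fob (src \<eta>) X)"
      "at \<eta> X \<cdot>[D] i X = Idn D (Fob (tgt \<eta>) X)" unfolding i_def by blast+
  qed
  define \<iota> where "\<iota> = \<lparr>src = tgt \<eta>, tgt = src \<eta>, at = (\<lambda>X\<in>Ob C. i X)\<rparr>"
  have "is_nt C D \<iota>"
  proof (rule ntI)
    show "is_functor C D (src \<iota>)" "is_functor C D (tgt \<iota>)" "at \<iota> \<in> extensional (Ob C)"
      using nt_src[OF n] nt_tgt[OF n] by (simp_all add: \<iota>_def)
    show "at \<iota> X \<in> Hom D (Fob (src \<iota>) X) (Fob (tgt \<iota>) X)" if "X \<in> Ob C" for X using i(1)[OF that] that by (simp add: \<iota>_def)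
    fix f X Y assume f: "f \<in> Hom C X Y"
    have X: "X \<in> Ob C" "Y \<in> Ob C" using C.hom_ob[OF f] .
    note sf = functor_hom[OF nt_src[OF n] f] and tf = functor_hom[OF nt_tgt[OF n] f]
    note a = nt_hom[OF n X(1)] nt_hom[OF n X(2)]
    have "i Y \<cdot>[D] Far (tgt \<eta>) f = i Y \<cdot>[D] (Far (tgt \<eta>) f \<cdot>[D] (at \<eta> X \<cdot>[D] i X))"
      using i(3)[OF X(1)] D.cmp_id_right[OF tf] by simp
    also have "\<dots> = i Y \<cdot>[D] ((at \<eta> Y \<cdot>[D] Far (src \<eta>) f) \<cdot>[D] i X)"
      using D.cmp_assoc[OF i(1)[OF X(1)] a(1) tf] nt_natural[OF n f] by simp
    also have "\<dots> = (i Y \<cdot>[D] at \<eta> Y) \<cdot>[D] (Far (src \<eta>) f \<cdot>[D] i X)"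
      using a sf i(1)[OF X(1)] i(1)[OF X(2)] by (simp add: hom_iff D.assoc)
    also have "\<dots> = Far (src \<eta>) f \<cdot>[D] i X"
      unfolding i(2)[OF X(2)] by (rule D.cmp_id_left[OF D.cmp_hom[OF i(1)[OF X(1)] sf]])
    finally show "at \<iota> Y \<cdot>[D] Far (src \<iota>) f = Far (tgt \<iota>) f \<cdot>[D] at \<iota> X" using X by (simp add: \<iota>_def)
  qed
  hence h: "\<iota> \<in> Hom (Fun C D) (tgt \<eta>) (src \<eta>)" "\<eta> \<in> Hom (Fun C D) (src \<eta>) (tgt \<eta>)"
    using n by (auto simp: Hom_Fun \<iota>_def)
  have "\<iota> \<cdot>[Fun C D] \<eta> = Idn (Fun C D) (src \<eta>)"
    by (rule nt_eqI[of _ _ "Ob C"]) (use i(2) in \<open>auto simp: Fun_simps \<iota>_def\<close>)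
  moreover have "\<eta> \<cdot>[Fun C D] \<iota> = Idn (Fun C D) (tgt \<eta>)"
    by (rule nt_eqI[of _ _ "Ob C"]) (use i(3) in \<open>auto simp: Fun_simps \<iota>_def\<close>)
  ultimately show ?thesis using Fun.isoI[OF h(2,1)] by blast
qed

lemma nt_iso_at: assumes "is_iso (Fun C D) \<eta>" "X \<in> Ob C" "category C" "category D" shows "is_iso D (at \<eta> X)"
proof -
  interpret D: category D by fact interpret Fun: category "Fun C D" using category_Fun assms by blast
  have n: "is_nt C D \<eta>" using assms(1) by (simp add: is_iso_def Fun_simps)
  obtain \<iota> where i: "\<iota> \<in> Hom (Fun C D) (tgt \<eta>) (src \<eta>)" "\<iota> \<cdot>[Fun C D] \<eta> = Idn (Fun C D) (src \<eta>)"
    "\<eta> \<cdot>[Fun C D] \<iota> = Idn (Fun C D) (tgt \<eta>)"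
    using Fun.isoE[OF assms(1), of "src \<eta>" "tgt \<eta>"] n by (auto simp: Hom_Fun)
  have ni: "is_nt C D \<iota>" "src \<iota> = tgt \<eta>" "tgt \<iota> = src \<eta>" using i(1) by (auto simp: Hom_Fun)
  have "at (\<iota> \<cdot>[Fun C D] \<eta>) X = at (Idn (Fun C D) (src \<eta>)) X" "at (\<eta> \<cdot>[Fun C D] \<iota>) X = at (Idn (Fun C D) (tgt \<eta>)) X"
    using i by simp_all
  thus ?thesis
    using D.isoI[OF nt_hom[OF n assms(2)], of "at \<iota> X"] nt_hom[OF ni(1) assms(2)] ni(2,3) assms(2) by (simp add: Fun_simps)
qed

lemma fid_functor: assumes "category C" shows "is_functor C C (fid C)"
proof -
  interpret category C by fact
  show ?thesis by (rule functorI[OF assms assms]) (auto simp: fid_def hom_iff)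
qed

text \<open>Both natural isomorphisms are transported through \<open>ff\<close>: the inverse functor is built from
  chosen preimages under \<open>R\<close>.\<close>

lemma cat_equivalenceI: assumes R: "is_functor C D R"
    and ff: "\<And>A B g. \<lbrakk>A \<in> Ob C; B \<in> Ob C; g \<in> Hom D (Fob R A) (Fob R B)\<rbrakk> \<Longrightarrow> \<exists>!f. f \<in> Hom C A B \<and> Far R f = g"
    and es: "\<And>Y. Y \<in> Ob D \<Longrightarrow> \<exists>A\<in>Ob C. \<exists>h\<in>Hom D (Fob R A) Y. is_iso D h" shows "cat_equivalence C D R"
proof -
  interpret C: category C using functor_dom_cat[OF R] .
  interpret D: category D using functor_cod_cat[OF R] .
  note Rh = functor_hom[OF R] and Rc = functor_cmp[OF R] and Ri = functor_idn[OF R] and Ro = functor_ob[OF R]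
  define pre where "pre A B g = (THE f. f \<in> Hom C A B \<and> Far R f = g)" for A B g
  have pre: "pre A B g \<in> Hom C A B" "Far R (pre A B g) = g" if "A \<in> Ob C" "B \<in> Ob C" "g \<in> Hom D (Fob R A) (Fob R B)" for A B g
    using theI'[OF ff[OF that]] unfolding pre_def by blast+
  have inj: "f = f'" if "f \<in> Hom C A B" "f' \<in> Hom C A B" "Far R f = Far R f'" for f f' A B
    using ff[OF C.hom_ob[OF that(1)] Rh[OF that(1)]] that by metis
  define s where "s Y = (SOME Ah. fst Ah \<in> Ob C \<and> snd Ah \<in> Hom D (Fob R (fst Ah)) Y \<and> is_iso D (snd Ah))" for Y
  define S where "S Y = fst (s Y)" for Y
  define ep where "ep Y = snd (s Y)" for Y
  have s: "S Y \<in> Ob C" "ep Y \<in> Hom D (Fob R (S Y)) Y" "is_iso D (ep Y)" if Y: "Y \<in> Ob D" for Y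
  proof -
    have "\<exists>Ah. fst Ah \<in> Ob C \<and> snd Ah \<in> Hom D (Fob R (fst Ah)) Y \<and> is_iso D (snd Ah)" using es[OF Y] by auto
    from someI_ex[OF this] show "S Y \<in> Ob C" "ep Y \<in> Hom D (Fob R (S Y)) Y" "is_iso D (ep Y)"
      unfolding s_def S_def ep_def by blast+
  qed
  define epi where "epi Y = (SOME g. g \<in> Hom D Y (Fob R (S Y)) \<and> g \<cdot>[D] ep Y = Idn D (Fob R (S Y)) \<and> ep Y \<cdot>[D] g = Idn D Y)" for Y
  have epi: "epi Y \<in> Hom D Y (Fob R (S Y))" "epi Y \<cdot>[D] ep Y = Idn D (Fob R (S Y))" "ep Y \<cdot>[D] epi Y = Idn D Y" if Y: "Y \<in> Ob D" for Y
  proof -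
    have "\<exists>g. g \<in> Hom D Y (Fob R (S Y)) \<and> g \<cdot>[D] ep Y = Idn D (Fob R (S Y)) \<and> ep Y \<cdot>[D] g = Idn D Y"
      using D.isoE[OF s(3)[OF Y] s(2)[OF Y]] by metis
    from someI_ex[OF this] show "epi Y \<in> Hom D Y (Fob R (S Y))" "epi Y \<cdot>[D] ep Y = Idn D (Fob R (S Y))" "ep Y \<cdot>[D] epi Y = Idn D Y"
      unfolding epi_def by blast+
  qed
  define G where "G = \<lparr>Fob = (\<lambda>Y\<in>Ob D. S Y), Far = (\<lambda>g\<in>Ar D. pre (S (Dom D g)) (S (Cod D g))
      (epi (Cod D g) \<cdot>[D] (g \<cdot>[D] ep (Dom D g))))\<rparr>"
  have Gob: "Fob G Y = S Y" if "Y \<in> Ob D" for Y using that by (simp add: G_def)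
  have Ga: "Far G g \<in> Hom C (S Y) (S Z)" "ep Z \<cdot>[D] Far R (Far G g) = g \<cdot>[D] ep Y" if g: "g \<in> Hom D Y Z" for g Y Z
  proof -
    have YZ: "Y \<in> Ob D" "Z \<in> Ob D" using D.hom_ob[OF g] .
    have ge: "g \<cdot>[D] ep Y \<in> Hom D (Fob R (S Y)) Z" using D.cmp_hom[OF s(2)[OF YZ(1)] g] .
    have e: "Far G g = pre (S Y) (S Z) (epi Z \<cdot>[D] (g \<cdot>[D] ep Y))" using g by (simp add: G_def hom_iff)
    note p = pre[OF s(1)[OF YZ(1)] s(1)[OF YZ(2)] D.cmp_hom[OF ge epi(1)[OF YZ(2)]]]
    show "Far G g \<in> Hom C (S Y) (S Z)" using p(1) e by simp
    show "ep Z \<cdot>[D] Far R (Far G g) = g \<cdot>[D] ep Y"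
      using p(2) e D.cmp_assoc[OF ge epi(1)[OF YZ(2)] s(2)[OF YZ(2)]] epi(3)[OF YZ(2)] D.cmp_id_left[OF ge] by simp
  qed
  \<comment> \<open>\<open>Far G g\<close> is the only arrow that makes the square of
    \<open>ep\<close> with \<open>g\<close> commute, so both functor laws reduce to checking this
    square.\<close>
  have Geq: "Far G g = f" if g: "g \<in> Hom D Y Z" and f: "f \<in> Hom C (S Y) (S Z)" "ep Z \<cdot>[D] Far R f = g \<cdot>[D] ep Y" for g Y Z f
  proof -
    have Z: "Z \<in> Ob D" using D.hom_ob[OF g] by blast
    have "Far R (Far G g) = Far R f"
      using D.iso_cancel_left[OF s(3)[OF Z] s(2)[OF Z] Rh[OF Ga(1)[OF g]] Rh[OF f(1)]] Ga(2)[OF g] f(2) by simp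
    thus ?thesis using inj[OF Ga(1)[OF g] f(1)] by blast
  qed
  have G: "is_functor D C G"
  proof (rule functorI[OF D.category_axioms C.category_axioms])
    show "Fob G \<in> extensional (Ob D)" "Far G \<in> extensional (Ar D)" by (simp_all add: G_def)
    show "Fob G X \<in> Ob C" if "X \<in> Ob D" for X using that s(1) Gob by simp
    show "Far G f \<in> Hom C (Fob G X) (Fob G Y)" if "f \<in> Hom D X Y" for f X Y using Ga(1)[OF that] Gob D.hom_ob[OF that] by simp
    show "Far G (Idn D X) = Idn C (Fob G X)" if X: "X \<in> Ob D" for X unfolding Gob[OF X]
      by (rule Geq[OF D.id_hom[OF X] C.id_hom[OF s(1)[OF X]]])
        (use Ri[OF s(1)[OF X]] D.cmp_id_left[OF s(2)[OF X]] D.cmp_id_right[OF s(2)[OF X]] in simp)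
    show "Far G (g \<cdot>[D] f) = Far G g \<cdot>[C] Far G f" if fg: "f \<in> Hom D X Y" "g \<in> Hom D Y Z" for f g X Y Z
    proof (rule Geq[OF D.cmp_hom[OF fg] C.cmp_hom[OF Ga(1)[OF fg(1)] Ga(1)[OF fg(2)]]])
      have ob: "X \<in> Ob D" "Y \<in> Ob D" "Z \<in> Ob D" using D.hom_ob fg by auto
      note r = Rh[OF Ga(1)[OF fg(1)]] Rh[OF Ga(1)[OF fg(2)]]
      show "ep Z \<cdot>[D] Far R (Far G g \<cdot>[C] Far G f) = g \<cdot>[D] f \<cdot>[D] ep X"
        using Rc[OF Ga(1)[OF fg(1)] Ga(1)[OF fg(2)]] D.cmp_assoc[OF r s(2)[OF ob(3)]] Ga(2)[OF fg(1)] Ga(2)[OF fg(2)]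
          D.cmp_assoc[OF r(1) s(2)[OF ob(2)] fg(2)] D.cmp_assoc[OF s(2)[OF ob(1)] fg] by simp
    qed
  qed
  define \<epsilon> where "\<epsilon> = \<lparr>src = fcomp D R G, tgt = fid D, at = (\<lambda>Y\<in>Ob D. ep Y)\<rparr>"
  have ne: "is_nt D D \<epsilon>"
  proof (rule ntI)
    show "is_functor D D (src \<epsilon>)" "is_functor D D (tgt \<epsilon>)" "at \<epsilon> \<in> extensional (Ob D)"
      using fcomp_functor[OF G R] fid_functor[OF D.category_axioms] by (simp_all add: \<epsilon>_def)
    show "at \<epsilon> X \<in> Hom D (Fob (src \<epsilon>) X) (Fob (tgt \<epsilon>) X)" if "X \<in> Ob D" for X
      using that s(2) Gob by (simp add: \<epsilon>_def fcomp_simps fid_def)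
    show "at \<epsilon> Y \<cdot>[D] Far (src \<epsilon>) f = Far (tgt \<epsilon>) f \<cdot>[D] at \<epsilon> X" if f: "f \<in> Hom D X Y" for f X Y
      using D.hom_ob[OF f] f Ga(2)[OF f] by (simp add: \<epsilon>_def fcomp_simps fid_def hom_iff[of f])
  qed
  have "is_iso (Fun D D) \<epsilon>" by (rule nt_isoI[OF ne]) (use s(3) in \<open>simp add: \<epsilon>_def\<close>)
  moreover have "\<epsilon> \<in> Hom (Fun D D) (fcomp D R G) (fid D)" using ne by (simp add: Hom_Fun) (simp add: \<epsilon>_def)
  ultimately have i2: "isomorphic (Fun D D) (fcomp D R G) (fid D)" unfolding isomorphic_def by blast
  \<comment> \<open>The transformation from \<open>G\<close> after \<open>R\<close> to the identity
    is the preimage under \<open>R\<close> of \<open>ep\<close> at \<open>R A\<close>, so its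
    invertibility and naturality can be checked after applying \<open>R\<close>.\<close>
  define et where "et A = pre (S (Fob R A)) A (ep (Fob R A))" for A
  have et: "et A \<in> Hom C (S (Fob R A)) A" "Far R (et A) = ep (Fob R A)" if A: "A \<in> Ob C" for A
    unfolding et_def using pre[OF s(1)[OF Ro[OF A]] A s(2)[OF Ro[OF A]]] by blast+
  have iet: "is_iso C (et A)" if A: "A \<in> Ob C" for A
  proof -
    note RA = Ro[OF A]
    note p = pre[OF A s(1)[OF RA] epi(1)[OF RA]]
    have "pre A (S (Fob R A)) (epi (Fob R A)) \<cdot>[C] et A = Idn C (S (Fob R A))"
      by (rule inj[OF C.cmp_hom[OF et(1)[OF A] p(1)] C.id_hom[OF s(1)[OF RA]]])
        (use Rc[OF et(1)[OF A] p(1)] p(2) et(2)[OF A] epi(2)[OF RA] Ri[OF s(1)[OF RA]] in simp)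
    moreover have "et A \<cdot>[C] pre A (S (Fob R A)) (epi (Fob R A)) = Idn C A"
      by (rule inj[OF C.cmp_hom[OF p(1) et(1)[OF A]] C.id_hom[OF A]])
        (use Rc[OF p(1) et(1)[OF A]] p(2) et(2)[OF A] epi(3)[OF RA] Ri[OF A] in simp)
    ultimately show ?thesis using C.isoI[OF et(1)[OF A] p(1)] by blast
  qed
  define \<eta> where "\<eta> = \<lparr>src = fcomp C G R, tgt = fid C, at = (\<lambda>A\<in>Ob C. et A)\<rparr>"
  have nh: "is_nt C C \<eta>"
  proof (rule ntI)
    show "is_functor C C (src \<eta>)" "is_functor C C (tgt \<eta>)" "at \<eta> \<in> extensional (Ob C)"
      using fcomp_functor[OF R G] fid_functor[OF C.category_axioms] by (simp_all add: \<eta>_def)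
    show "at \<eta> X \<in> Hom C (Fob (src \<eta>) X) (Fob (tgt \<eta>) X)" if "X \<in> Ob C" for X
      using that et(1) Gob[OF Ro[OF that]] by (simp add: \<eta>_def fcomp_simps fid_def)
    fix f X Y assume f: "f \<in> Hom C X Y"
    have ob: "X \<in> Ob C" "Y \<in> Ob C" using C.hom_ob[OF f] .
    note g = Ga[OF Rh[OF f]]
    have "et Y \<cdot>[C] Far G (Far R f) = f \<cdot>[C] et X"
      by (rule inj[OF C.cmp_hom[OF g(1) et(1)[OF ob(2)]] C.cmp_hom[OF et(1)[OF ob(1)] f]])
        (use Rc[OF g(1) et(1)[OF ob(2)]] Rc[OF et(1)[OF ob(1)] f] et(2) ob g(2) in simp)
    thus "at \<eta> Y \<cdot>[C] Far (src \<eta>) f = Far (tgt \<eta>) f \<cdot>[C] at \<eta> X"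
      using ob f by (simp add: \<eta>_def fcomp_simps fid_def hom_iff[of f])
  qed
  have "is_iso (Fun C C) \<eta>" by (rule nt_isoI[OF nh]) (use iet in \<open>simp add: \<eta>_def\<close>)
  moreover have "\<eta> \<in> Hom (Fun C C) (fcomp C G R) (fid C)" using nh by (simp add: Hom_Fun) (simp add: \<eta>_def)
  ultimately have i1: "isomorphic (Fun C C) (fcomp C G R) (fid C)" unfolding isomorphic_def by blast
  show ?thesis unfolding cat_equivalence_def using R G i1 i2 by blast
qed

section \<open>Exact and left exact functors and their composites\<close>

lemma left_exact_additive: "left_exact_functor E D F \<Longrightarrow> additive_functor E D F"
  and left_exact_functor: "left_exact_functor E D F \<Longrightarrow> is_functor E D F"
  unfolding left_exact_functor_def additive_functor_def by auto

lemma left_exact_pairI: assumes "exact_category E" "exact_category D" "left_exact_functor E D F"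
  shows "left_exact_pair E D F"
  using assms left_exact_additive unfolding left_exact_pair_def two_exact_def two_exact_axioms_def left_exact_pair_axioms_def
  by blast

lemma exact_imp_left_exact: assumes "exact_category E" "exact_category D" "exact_functor E D F"
  shows "left_exact_functor E D F"
proof -
  interpret D: exact_category D by fact
  have "admissible D (Far F g) \<and> inflation D (Far F f) \<and> is_kernel D (Far F f) (Far F g)" if "(f, g) \<in> Conf E" for f g
    using exact_functor_conf[OF assms(3) that] D.deflation_admissible D.conf_kernel
    unfolding inflation_def deflation_def by blast
  thus ?thesis unfolding left_exact_functor_def using exact_functor_additive[OF assms(3)] by auto
qed

text \<open>\<open>F g\<close> is admissible but in general no deflation, so left exactness of
  \<open>G\<close> does not apply to the image of the conflation. With \<open>F g\<close> written as
  \<open>m\<close> after \<open>p\<close>, the pair of \<open>F f\<close> and \<open>p\<close> is a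
  conflation in \<open>D\<close>, to which it does apply; the inflation \<open>G m\<close> does not
  change kernels.\<close>

lemma left_exact_cmp: assumes C: "exact_category C" and D: "exact_category D" and K: "exact_category K"
    and F: "left_exact_functor C D F" and G: "left_exact_functor D K G"
  shows "left_exact_functor C K (fcomp C G F)"
proof -
  interpret F: left_exact_pair C D F by (rule left_exact_pairI[OF C D F])
  interpret G: left_exact_pair D K G by (rule left_exact_pairI[OF D K G])
  have "admissible K (Far (fcomp C G F) g) \<and> inflation K (Far (fcomp C G F) f) \<and>
      is_kernel K (Far (fcomp C G F) f) (Far (fcomp C G F) g)" if fg: "(f, g) \<in> Conf C" for f g
  proof -
    define X Y where "X = Dom C g" and "Y = Cod C g"
    have ar: "f \<in> Ar C" "g \<in> Ar C" using F.E.conf_hom[OF fg] by auto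
    have g: "g \<in> Hom C X Y" using ar by (simp add: hom_iff X_def Y_def)
    note Fg = F.F_hom[OF g] and cf = F.F_conf[OF fg]
    have "inflation C f" using fg unfolding inflation_def by blast
    hence Ff: "inflation D (Far F f)" using F.F_inflation by blast
    obtain I m p where mp: "inflation D m" "deflation D p" "p \<in> Hom D (Fob F X) I" "m \<in> Hom D I (Fob F Y)"
      "Far F g = m \<cdot>[D] p" using F.D.admissibleE[OF cf(1) Fg] by blast
    have "(Far F f, p) \<in> Conf D"
      using F.D.conf_if_kernel[OF mp(2)] F.D.inflation_cmp_kernel[OF mp(1,4,3)] cf(2) mp(5) by simp
    hence "is_kernel K (Far G (Far F f)) (Far G p)" using G.F_conf(2) by blast
    hence "is_kernel K (Far G (Far F f)) (Far G m \<cdot>[K] Far G p)"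
      using G.D.inflation_cmp_kernel[OF G.F_inflation[OF mp(1)] G.F_hom[OF mp(4)] G.F_hom[OF mp(3)]] by blast
    thus ?thesis
      using G.F_cmp[OF mp(3,4)] mp(5) G.F_admissible[OF cf(1) Fg] G.F_inflation[OF Ff] ar by (simp add: fcomp_simps)
  qed
  thus ?thesis unfolding left_exact_functor_def
    using fcomp_additive[OF F.F_additive G.F_additive F.E.preadditive_category_axioms] by auto
qed

lemma exact_cmp: assumes "exact_category C" and F: "exact_functor C D F" and G: "exact_functor D K G"
  shows "exact_functor C K (fcomp C G F)"
proof -
  interpret C: exact_category C by fact
  have "(Far (fcomp C G F) f, Far (fcomp C G F) g) \<in> Conf K" if fg: "(f, g) \<in> Conf C" for f g
    using exact_functor_conf[OF G exact_functor_conf[OF F fg]] C.conf_hom[OF fg] by (simp add: fcomp_simps)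
  thus ?thesis unfolding exact_functor_def
    using fcomp_additive[OF exact_functor_additive[OF F] exact_functor_additive[OF G] C.preadditive_category_axioms]
    by auto
qed

lemma fid_exact: assumes "exact_category C" shows "exact_functor C C (fid C)"
proof -
  interpret C: exact_category C by fact
  have "additive_functor C C (fid C)"
    unfolding additive_functor_def using fid_functor[OF C.category_axioms]
    by (auto simp: fid_def hom_iff)
  moreover have "(Far (fid C) f, Far (fid C) g) \<in> Conf C" if fg: "(f, g) \<in> Conf C" for f g
    using fg C.conf_hom[OF fg] by (simp add: fid_def)
  ultimately show ?thesis unfolding exact_functor_def by auto
qed

section \<open>Hom categories and the restriction functor\<close>

lemma fid_simps: "X \<in> Ob C \<Longrightarrow> Fob (fid C) X = X" "f \<in> Ar C \<Longrightarrow> Far (fid C) f = f" by (simp_all add: fid_def)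

lemma full_subcat_simps:
  "Ob (full_subcat C S) = Ob C \<inter> S" "Dom (full_subcat C S) = Dom C" "Cod (full_subcat C S) = Cod C"
  "Ar (full_subcat C S) = {f \<in> Ar C. Dom C f \<in> S \<and> Cod C f \<in> S}"
  "Idn (full_subcat C S) = Idn C" "Cmp (full_subcat C S) = Cmp C" by (simp_all add: full_subcat_def)

lemma Hom_full: "f \<in> Hom (full_subcat C S) X Y \<longleftrightarrow> f \<in> Hom C X Y \<and> X \<in> S \<and> Y \<in> S"
  by (auto simp: full_subcat_simps hom_iff)

lemma is_iso_full: assumes "category C" "is_iso C f" "f \<in> Hom C X Y" "X \<in> S" "Y \<in> S"
  shows "is_iso (full_subcat C S) f"
proof -
  interpret C: category C by fact
  obtain g where "g \<in> Hom C Y X" "g \<cdot>[C] f = Idn C X" "f \<cdot>[C] g = Idn C Y" using C.isoE[OF assms(2,3)] by metis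
  thus ?thesis using assms(3-5) unfolding is_iso_def full_subcat_simps by (auto simp: hom_iff full_subcat_simps)
qed

lemmas Hom_Ex_simps = full_subcat_simps[of "Fun E D" "{F. exact_functor E D F}" for E D, folded Hom_Ex_def]
lemmas Hom_ExL_simps = full_subcat_simps[of "Fun E D" "{F. left_exact_functor E D F}" for E D, folded Hom_ExL_def]

lemma Hom_Hom_Ex: "\<eta> \<in> Hom (Hom_Ex E D) F G \<longleftrightarrow> \<eta> \<in> Hom (Fun E D) F G \<and> exact_functor E D F \<and> exact_functor E D G"
  and Hom_Hom_ExL: "\<eta> \<in> Hom (Hom_ExL E D) F G \<longleftrightarrow>
    \<eta> \<in> Hom (Fun E D) F G \<and> left_exact_functor E D F \<and> left_exact_functor E D G"
  unfolding Hom_Ex_def Hom_ExL_def by (simp_all add: Hom_full)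

lemma Ob_Hom_Ex: "F \<in> Ob (Hom_Ex E D) \<longleftrightarrow> exact_functor E D F"
  and Ob_Hom_ExL: "F \<in> Ob (Hom_ExL E D) \<longleftrightarrow> left_exact_functor E D F"
  by (auto simp: Hom_Ex_simps Hom_ExL_simps Fun_simps left_exact_functor
      dest: exact_functor_additive additive_functorD(1))

lemma exact_pairI:
  assumes "exact_category E" "exact_category D" "exact_functor (\<A> E) D G" "exact_functor (\<A> E) D H"
  shows "exact_pair_on_mod_adm E D G H"
  using assms unfolding exact_pair_on_mod_adm_def exact_on_mod_adm_def exact_on_mod_adm_axioms_def by blast

text \<open>\<open>extn_yoneda\<close> gives an isomorphism from \<open>F\<close> to the restriction
  of \<open>extn\<close>; its inverse is recorded, since essential surjectivity and the structure
  cells \<theta> both start at the restricted functor.\<close>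

lemma left_exact_extension:
  assumes E: "exact_category E" and D: "exact_category D" and F: "left_exact_functor E D F"
  obtains G \<theta> where "exact_functor (\<A> E) D G" "\<theta> \<in> Hom (Fun E D) (fcomp E G (\<Upsilon> E)) F" "is_iso (Fun E D) \<theta>"
proof -
  interpret F: left_exact_pair E D F by (rule left_exact_pairI[OF E D F])
  interpret Fun: category "Fun E D" by (rule category_Fun) unfold_locales
  let ?G = "F.extn"
  define \<eta> where "\<eta> = \<lparr>src = F, tgt = fcomp E ?G (\<Upsilon> E), at = (\<lambda>X\<in>Ob E. F.e (\<Y> E X) X (Idn E X))\<rparr>"
  have n: "is_nt E D \<eta>"
  proof (rule ntI)
    show "is_functor E D (src \<eta>)" "is_functor E D (tgt \<eta>)" "at \<eta> \<in> extensional (Ob E)"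
      using F.F_functor fcomp_functor[OF F.E.yoneda_functor additive_functorD(1)[OF F.extn_additive]]
      by (simp_all add: \<eta>_def)
    show "at \<eta> X \<in> Hom D (Fob (src \<eta>) X) (Fob (tgt \<eta>) X)" if "X \<in> Ob E" for X
      using that F.extn_yoneda(1)[OF that] F.extn_ob[OF F.E.yoneda_adm[OF that]]
      by (simp add: \<eta>_def fcomp_simps F.E.yoneda_simps)
    show "at \<eta> Y \<cdot>[D] Far (src \<eta>) f = Far (tgt \<eta>) f \<cdot>[D] at \<eta> X" if "f \<in> Hom E X Y" for f X Y
      using F.extn_yoneda_natural[OF that] F.E.hom_ob[OF that] that
      by (simp add: \<eta>_def fcomp_simps F.E.yoneda_simps hom_iff[of f])
  qed
  have h: "\<eta> \<in> Hom (Fun E D) F (fcomp E ?G (\<Upsilon> E))" using n by (simp add: Hom_Fun) (simp add: \<eta>_def)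
  have "is_iso (Fun E D) \<eta>" by (rule nt_isoI[OF n]) (use F.extn_yoneda(2) in \<open>simp add: \<eta>_def\<close>)
  then obtain \<theta> where "\<theta> \<in> Hom (Fun E D) (fcomp E ?G (\<Upsilon> E)) F" "is_iso (Fun E D) \<theta>"
    using Fun.iso_inverse[OF _ h] by metis
  thus thesis using that F.extn_exact by blast
qed

lemma category_Hom_Ex: "\<lbrakk>category E; category D\<rbrakk> \<Longrightarrow> category (Hom_Ex E D)"
  and category_Hom_ExL: "\<lbrakk>category E; category D\<rbrakk> \<Longrightarrow> category (Hom_ExL E D)"
  unfolding Hom_Ex_def Hom_ExL_def by (simp_all add: category_full_subcat category_Fun)

lemma exact_cat_category: "exact_category E \<Longrightarrow> category E"
  by (simp add: exact_category_def additive_category_def preadditive_category_def)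

lemma restriction_functor: assumes E: "exact_category E" and D: "exact_category D"
  shows "is_functor (Hom_Ex (\<A> E) D) (Hom_ExL E D) (yoneda_restriction E D)"
proof -
  interpret E: exact_category E by fact interpret D: exact_category D by fact
  interpret MA: exact_category "\<A> E" by (rule E.exact_mod_adm)
  let ?R = "yoneda_restriction E D"
  have lex: "left_exact_functor E D (fcomp E G (\<Upsilon> E))" if "exact_functor (\<A> E) D G" for G
    using left_exact_cmp[OF E E.exact_mod_adm D yoneda_left_exact[OF E] exact_imp_left_exact[OF E.exact_mod_adm D that]] .
  show ?thesis
  proof (rule functorI)
    show "category (Hom_Ex (\<A> E) D)" "category (Hom_ExL E D)"
      using category_Hom_Ex category_Hom_ExL MA.category_axioms E.category_axioms D.category_axioms by auto
    show "Fob ?R \<in> extensional (Ob (Hom_Ex (\<A> E) D))" "Far ?R \<in> extensional (Ar (Hom_Ex (\<A> E) D))"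
      by (simp_all add: yoneda_restriction_def)
    show "Fob ?R G \<in> Ob (Hom_ExL E D)" if "G \<in> Ob (Hom_Ex (\<A> E) D)" for G
      using that lex by (simp add: yoneda_restriction_def Ob_Hom_Ex Ob_Hom_ExL)
    have Fob: "Fob ?R G = fcomp E G (\<Upsilon> E)" if "exact_functor (\<A> E) D G" for G
      using that by (simp add: yoneda_restriction_def Ob_Hom_Ex)
    have Far: "Far ?R \<eta> = \<lparr>src = fcomp E G (\<Upsilon> E), tgt = fcomp E H (\<Upsilon> E), at = (\<lambda>X\<in>Ob E. at \<eta> (Fob (\<Upsilon> E) X))\<rparr>"
      if "\<eta> \<in> Hom (Hom_Ex (\<A> E) D) G H" for \<eta> G H
      using that by (auto simp: yoneda_restriction_def hom_iff Hom_Ex_simps Fun_simps)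
    have Y: "Fob (\<Upsilon> E) X \<in> Ob (\<A> E)" if "X \<in> Ob E" for X using that E.yoneda_Ob by (simp add: E.mod_adm_simps)
    show "Far ?R \<eta> \<in> Hom (Hom_ExL E D) (Fob ?R G) (Fob ?R H)" if eta: "\<eta> \<in> Hom (Hom_Ex (\<A> E) D) G H" for \<eta> G H
    proof -
      let ?n = "\<lparr>src = fcomp E G (\<Upsilon> E), tgt = fcomp E H (\<Upsilon> E), at = (\<lambda>X\<in>Ob E. at \<eta> (Fob (\<Upsilon> E) X))\<rparr>"
      have ex: "exact_functor (\<A> E) D G" "exact_functor (\<A> E) D H" and n: "is_nt (\<A> E) D \<eta>" "src \<eta> = G" "tgt \<eta> = H"
        using eta by (auto simp: Hom_Hom_Ex Hom_Fun)
      have "is_nt E D (Far ?R \<eta>)" unfolding Far[OF eta]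
      proof (rule ntI)
        show "is_functor E D (src ?n)" "is_functor E D (tgt ?n)"
          using left_exact_functor[OF lex[OF ex(1)]] left_exact_functor[OF lex[OF ex(2)]] by simp_all
      next
        fix X assume "X \<in> Ob E"
        thus "at ?n X \<in> Hom D (Fob (src ?n) X) (Fob (tgt ?n) X)"
          using nt_hom[OF n(1) Y] n by (simp add: fcomp_simps)
      next
        fix f X Z assume f: "f \<in> Hom E X Z"
        show "at ?n Z \<cdot>[D] Far (src ?n) f = Far (tgt ?n) f \<cdot>[D] at ?n X"
          using nt_natural[OF n(1) functor_hom[OF E.yoneda_functor f]] E.hom_ob[OF f] f n
          by (simp add: fcomp_simps hom_iff[of f])
      qed simp
      thus ?thesis using lex ex Fob Far[OF eta] by (simp add: Hom_Hom_ExL Hom_Fun)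
    qed
    show "Far ?R (Idn (Hom_Ex (\<A> E) D) G) = Idn (Hom_ExL E D) (Fob ?R G)" if G: "G \<in> Ob (Hom_Ex (\<A> E) D)" for G
    proof -
      interpret HE: category "Hom_Ex (\<A> E) D" using category_Hom_Ex MA.category_axioms D.category_axioms by blast
      show ?thesis using G Far[OF HE.id_hom[OF G]] Fob[of G] Y
        by (simp add: Hom_Ex_simps Hom_ExL_simps Fun_simps fcomp_simps fun_eq_iff)
    qed
    show "Far ?R (\<nu> \<cdot>[Hom_Ex (\<A> E) D] \<eta>) = Far ?R \<nu> \<cdot>[Hom_ExL E D] Far ?R \<eta>"
      if en: "\<eta> \<in> Hom (Hom_Ex (\<A> E) D) G H" "\<nu> \<in> Hom (Hom_Ex (\<A> E) D) H K" for \<eta> \<nu> G H K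
    proof -
      interpret HE: category "Hom_Ex (\<A> E) D" using category_Hom_Ex MA.category_axioms D.category_axioms by blast
      show ?thesis using Far[OF en(1)] Far[OF en(2)] Far[OF HE.cmp_hom[OF en]] Y
        by (simp add: Hom_Ex_simps Hom_ExL_simps Fun_simps fun_eq_iff)
    qed
  qed
qed

text \<open>Full faithfulness is the existence and uniqueness of extensions of transformations from
  representables; essential surjectivity is the extension of left exact functors.\<close>

theorem restriction_equivalence: assumes E: "exact_category E" and D: "exact_category D"
  shows "cat_equivalence (Hom_Ex (\<A> E) D) (Hom_ExL E D) (yoneda_restriction E D)"
proof (rule cat_equivalenceI[OF restriction_functor[OF E D]])
  interpret E: exact_category E by fact interpret D: exact_category D by fact
  let ?R = "yoneda_restriction E D"
  have Fob: "Fob ?R G = fcomp E G (\<Upsilon> E)" if "exact_functor (\<A> E) D G" for G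
    using that by (simp add: yoneda_restriction_def Ob_Hom_Ex)
  {
    fix G H \<sigma> assume GH: "G \<in> Ob (Hom_Ex (\<A> E) D)" "H \<in> Ob (Hom_Ex (\<A> E) D)"
      and s: "\<sigma> \<in> Hom (Hom_ExL E D) (Fob ?R G) (Fob ?R H)"
    hence ex: "exact_functor (\<A> E) D G" "exact_functor (\<A> E) D H" by (auto simp: Ob_Hom_Ex)
    interpret P: exact_pair_on_mod_adm E D G H by (rule exact_pairI[OF E D ex])
    have n: "is_nt E D \<sigma>" "src \<sigma> = fcomp E G (\<Upsilon> E)" "tgt \<sigma> = fcomp E H (\<Upsilon> E)"
      using s ex Fob by (auto simp: Hom_Hom_ExL Hom_Fun)
    have Far: "Far ?R \<tau> = \<lparr>src = fcomp E G (\<Upsilon> E), tgt = fcomp E H (\<Upsilon> E), at = (\<lambda>X\<in>Ob E. at \<tau> (\<Y> E X))\<rparr>"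
      if "\<tau> \<in> Hom (Hom_Ex (\<A> E) D) G H" for \<tau>
      using that by (auto simp: yoneda_restriction_def hom_iff Hom_Ex_simps Fun_simps E.yoneda_simps cong: restrict_cong)
    have s1: "at \<sigma> X \<in> Hom D (Fob G (\<Y> E X)) (Fob H (\<Y> E X))" if "X \<in> Ob E" for X
      using nt_hom[OF n(1) that] n P.G.restr_simps(1)[OF that] P.H.restr_simps(1)[OF that] by simp
    have s2: "at \<sigma> Y \<cdot>[D] Far G (\<y> E f) = Far H (\<y> E f) \<cdot>[D] at \<sigma> X" if "f \<in> Hom E X Y" for f X Y
      using nt_natural[OF n(1) that] n that P.G.restr_simps(2)[of f] P.H.restr_simps(2)[of f] by (simp add: hom_iff)
    obtain \<tau> where t: "\<tau> \<in> Hom (Fun (\<A> E) D) G H" "\<And>X. X \<in> Ob E \<Longrightarrow> at \<tau> (\<Y> E X) = at \<sigma> X"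
      by (rule P.restriction_full[of "at \<sigma>", OF s1 s2]) (assumption, assumption, rule that)
    have th: "\<tau> \<in> Hom (Hom_Ex (\<A> E) D) G H" using t(1) ex by (simp add: Hom_Hom_Ex)
    have "Far ?R \<tau> = \<sigma>"
      unfolding Far[OF th] by (rule nt_eqI[of _ _ "Ob E"]) (use n t(2) nt_extensional[OF n(1)] in simp_all)
    moreover have "\<tau>' = \<tau>" if "\<tau>' \<in> Hom (Hom_Ex (\<A> E) D) G H" "Far ?R \<tau>' = \<sigma>" for \<tau>'
    proof (rule P.restriction_faithful[OF _ t(1)])
      show "\<tau>' \<in> Hom (Fun (\<A> E) D) G H" using that by (simp add: Hom_Hom_Ex)
      fix X assume X: "X \<in> Ob E"
      have "at (Far ?R \<tau>') X = at \<sigma> X" using that by simp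
      thus "at \<tau>' (\<Y> E X) = at \<tau> (\<Y> E X)" unfolding Far[OF that(1)] using X t(2)[OF X] by simp
    qed
    ultimately show "\<exists>!\<tau>. \<tau> \<in> Hom (Hom_Ex (\<A> E) D) G H \<and> Far ?R \<tau> = \<sigma>" using th by blast
  }
  fix F assume "F \<in> Ob (Hom_ExL E D)"
  hence F: "left_exact_functor E D F" by (simp add: Ob_Hom_ExL)
  obtain G \<theta> where G: "exact_functor (\<A> E) D G" "\<theta> \<in> Hom (Fun E D) (fcomp E G (\<Upsilon> E)) F" "is_iso (Fun E D) \<theta>"
    by (rule left_exact_extension[OF E D F]) (rule that)
  have GO: "G \<in> Ob (Hom_Ex (\<A> E) D)" using G(1) by (simp add: Ob_Hom_Ex)
  have lex: "left_exact_functor E D (fcomp E G (\<Upsilon> E))"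
    using functor_ob[OF restriction_functor[OF E D] GO] Fob[OF G(1)] by (simp add: Ob_Hom_ExL)
  have "\<theta> \<in> Hom (Hom_ExL E D) (Fob ?R G) F" using G Fob lex F by (simp add: Hom_Hom_ExL)
  moreover have "is_iso (Hom_ExL E D) \<theta>" unfolding Hom_ExL_def
    by (rule is_iso_full[OF category_Fun[OF E.category_axioms D.category_axioms] G(3,2)]) (use lex F in simp_all)
  ultimately show "\<exists>G\<in>Ob (Hom_Ex (\<A> E) D). \<exists>\<theta>\<in>Hom (Hom_ExL E D) (Fob ?R G) F. is_iso (Hom_ExL E D) \<theta>"
    using GO by blast
qed

section \<open>The 2-categories of exact categories\<close>

lemma nt_hcomp_simps:
  "src (nt_hcomp C D \<tau> \<sigma>) = fcomp C (src \<tau>) (src \<sigma>)" "tgt (nt_hcomp C D \<tau> \<sigma>) = fcomp C (tgt \<tau>) (tgt \<sigma>)"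
  "X \<in> Ob C \<Longrightarrow> at (nt_hcomp C D \<tau> \<sigma>) X = at \<tau> (Fob (tgt \<sigma>) X) \<cdot>[D] Far (src \<tau>) (at \<sigma> X)"
  "at (nt_hcomp C D \<tau> \<sigma>) \<in> extensional (Ob C)" by (simp_all add: nt_hcomp_def)

lemma nt_hcomp_hom: assumes s: "\<sigma> \<in> Hom (Fun C D) F F'" and t: "\<tau> \<in> Hom (Fun D K) G G'"
  shows "nt_hcomp C K \<tau> \<sigma> \<in> Hom (Fun C K) (fcomp C G F) (fcomp C G' F')"
proof -
  have n: "is_nt C D \<sigma>" "src \<sigma> = F" "tgt \<sigma> = F'" "is_nt D K \<tau>" "src \<tau> = G" "tgt \<tau> = G'"
    using s t by (auto simp: Hom_Fun)
  have f: "is_functor C D F" "is_functor C D F'" "is_functor D K G" "is_functor D K G'"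
    using nt_src nt_tgt n by metis+ interpret C: category C using functor_dom_cat[OF f(1)] .
  interpret K: category K using functor_cod_cat[OF f(3)] .
  have sh: "at \<sigma> X \<in> Hom D (Fob F X) (Fob F' X)" if "X \<in> Ob C" for X using nt_hom[OF n(1) that] n by simp
  have th: "at \<tau> X \<in> Hom K (Fob G X) (Fob G' X)" if "X \<in> Ob D" for X using nt_hom[OF n(4) that] n by simp
  have "is_nt C K (nt_hcomp C K \<tau> \<sigma>)"
  proof (rule ntI)
    show "is_functor C K (src (nt_hcomp C K \<tau> \<sigma>))" "is_functor C K (tgt (nt_hcomp C K \<tau> \<sigma>))"
      using fcomp_functor[OF f(1,3)] fcomp_functor[OF f(2,4)] n by (simp_all add: nt_hcomp_simps)
    show "at (nt_hcomp C K \<tau> \<sigma>) \<in> extensional (Ob C)" by (rule nt_hcomp_simps)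
    show "at (nt_hcomp C K \<tau> \<sigma>) X \<in> Hom K (Fob (src (nt_hcomp C K \<tau> \<sigma>)) X) (Fob (tgt (nt_hcomp C K \<tau> \<sigma>)) X)"
      if "X \<in> Ob C" for X
      using K.cmp_hom[OF functor_hom[OF f(3) sh[OF that]] th[OF functor_ob[OF f(2) that]]] n that
      by (simp add: nt_hcomp_simps fcomp_simps)
    fix g X Y assume g: "g \<in> Hom C X Y"
    have ob: "X \<in> Ob C" "Y \<in> Ob C" "g \<in> Ar C" using g by (auto simp: hom_iff)
    note Fg = functor_hom[OF f(1) g] and F'g = functor_hom[OF f(2) g]
    note t = th[OF functor_ob[OF f(2) ob(1)]] th[OF functor_ob[OF f(2) ob(2)]]
    note s = sh[OF ob(1)] sh[OF ob(2)]
    have "(at \<tau> (Fob F' Y) \<cdot>[K] Far G (at \<sigma> Y)) \<cdot>[K] Far G (Far F g) = at \<tau> (Fob F' Y) \<cdot>[K] (Far G (Far F' g) \<cdot>[K] Far G (at \<sigma> X))"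
      using K.cmp_assoc[OF functor_hom[OF f(3) Fg] functor_hom[OF f(3) s(2)] t(2)] functor_cmp[OF f(3) Fg s(2)]
        functor_cmp[OF f(3) s(1) F'g] nt_natural[OF n(1) g] n by simp
    also have "\<dots> = (Far G' (Far F' g) \<cdot>[K] at \<tau> (Fob F' X)) \<cdot>[K] Far G (at \<sigma> X)"
      using K.cmp_assoc[OF functor_hom[OF f(3) s(1)] functor_hom[OF f(3) F'g] t(2)] nt_natural[OF n(4) F'g] n by simp
    also have "\<dots> = Far G' (Far F' g) \<cdot>[K] (at \<tau> (Fob F' X) \<cdot>[K] Far G (at \<sigma> X))"
      by (rule K.cmp_assoc[OF functor_hom[OF f(3) s(1)] t(1) functor_hom[OF f(4) F'g]])
    finally show "at (nt_hcomp C K \<tau> \<sigma>) Y \<cdot>[K] Far (src (nt_hcomp C K \<tau> \<sigma>)) g =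
      Far (tgt (nt_hcomp C K \<tau> \<sigma>)) g \<cdot>[K] at (nt_hcomp C K \<tau> \<sigma>) X"
      using ob n by (simp add: nt_hcomp_simps fcomp_simps)
  qed
  thus ?thesis using n by (simp add: Hom_Fun nt_hcomp_simps)
qed

text \<open>Horizontal composition with an identity is whiskering; this formula and the next reduce
  the coherence laws to equations between components.\<close>

lemma hcomp_idn_right: assumes t: "\<tau> \<in> Hom (Fun D K) G G'" and F: "is_functor C D F" and X: "X \<in> Ob C"
  shows "at (nt_hcomp C K \<tau> (Idn (Fun C D) F)) X = at \<tau> (Fob F X)"
proof -
  have n: "is_nt D K \<tau>" "src \<tau> = G" "tgt \<tau> = G'" using t by (auto simp: Hom_Fun)
  have G: "is_functor D K G" using nt_src n by metis interpret K: category K using functor_cod_cat[OF G] .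
  have O: "Fob F X \<in> Ob D" using functor_ob[OF F X] .
  have "at \<tau> (Fob F X) \<in> Hom K (Fob G (Fob F X)) (Fob G' (Fob F X))" using nt_hom[OF n(1) O] n by simp
  thus ?thesis using X n functor_idn[OF G O] K.cmp_id_right by (simp add: nt_hcomp_simps Fun_simps)
qed

lemma hcomp_idn_left: assumes s: "\<sigma> \<in> Hom (Fun C D) F F'" and G: "is_functor D K G" and X: "X \<in> Ob C"
  shows "at (nt_hcomp C K (Idn (Fun D K) G) \<sigma>) X = Far G (at \<sigma> X)"
proof -
  have n: "is_nt C D \<sigma>" "src \<sigma> = F" "tgt \<sigma> = F'" using s by (auto simp: Hom_Fun)
  interpret K: category K using functor_cod_cat[OF G] .
  have h: "at \<sigma> X \<in> Hom D (Fob F X) (Fob F' X)" using nt_hom[OF n(1) X] n by simp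
  have "Fob F' X \<in> Ob D" using functor_ob[OF nt_tgt[OF n(1)] X] n by simp
  thus ?thesis using X n K.cmp_id_left[OF functor_hom[OF G h]] by (simp add: nt_hcomp_simps Fun_simps)
qed

lemma fcomp_assoc: assumes "is_functor C D F" shows "fcomp C (fcomp D H G) F = fcomp C H (fcomp C G F)"
  using functor_ob[OF assms] functor_hom[OF assms]
  by (auto simp: fcomp_def compose_def hom_iff)

lemma fcomp_fid: assumes "is_functor C D F" shows "fcomp C (fid D) F = F" "fcomp C F (fid C) = F"
proof -
  interpret C: category C using functor_dom_cat[OF assms] .
  interpret D: category D using functor_cod_cat[OF assms] .
  have ar: "Far F f \<in> Ar D" if "f \<in> Ar C" for f
    using functor_hom[OF assms, of f "Dom C f" "Cod C f"] that by (simp add: hom_iff)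
  show "fcomp C (fid D) F = F"
    by (rule functor_eqI[OF fcomp_functor[OF assms fid_functor[OF D.category_axioms]] assms])
      (use functor_ob[OF assms] ar in \<open>simp_all add: fcomp_simps fid_simps\<close>)
  show "fcomp C F (fid C) = F"
    by (rule functor_eqI[OF fcomp_functor[OF fid_functor[OF C.category_axioms] assms] assms])
      (simp_all add: fcomp_simps fid_simps)
qed

lemma category_prod: assumes "category C" "category D" shows "category (prod_cat C D)"
proof -
  interpret C: category C by fact interpret D: category D by fact
  show ?thesis by unfold_locales (auto simp: prod_cat_def hom_iff C.assoc D.assoc)
qed

lemma prod_cat_simps: "Ob (prod_cat C D) = Ob C \<times> Ob D" "Ar (prod_cat C D) = Ar C \<times> Ar D"
  "Hom (prod_cat C D) (X, Y) (X', Y') = Hom C X X' \<times> Hom D Y Y'"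
  "Idn (prod_cat C D) (X, Y) = (Idn C X, Idn D Y)" "(f', g') \<cdot>[prod_cat C D] (f, g) = (f' \<cdot>[C] f, g' \<cdot>[D] g)"
  by (auto simp: prod_cat_def hom_iff)

lemma exact_twocat_simps:
  "Cells0 (exact_twocat H) = {E. exact_category E}" "HomC (exact_twocat H) = H" "Id1 (exact_twocat H) = fid"
  "\<lbrakk>G \<in> Ob (H E' E''); F \<in> Ob (H E E')\<rbrakk> \<Longrightarrow> hc1 (exact_twocat H) E E' E'' G F = fcomp E G F"
  "\<lbrakk>\<tau> \<in> Ar (H E' E''); \<sigma> \<in> Ar (H E E')\<rbrakk> \<Longrightarrow> hc2 (exact_twocat H) E E' E'' \<tau> \<sigma> = nt_hcomp E E'' \<tau> \<sigma>"
  by (simp_all add: exact_twocat_def)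

text \<open>Exact and left exact functors are treated together: all laws are those of functors and
  transformations, and the class \<open>Q\<close> has to contain identities and be closed under
  composition.\<close>

lemma exact_two_category:
  fixes Q :: "('o, 'm) ecat \<Rightarrow> ('o, 'm) ecat \<Rightarrow> ('o, 'm, 'o, 'm) ftr \<Rightarrow> bool"
  assumes H: "\<And>E E'. H E E' = full_subcat (Fun E E') {F. Q E E' F}"
    and ident: "\<And>E. exact_category E \<Longrightarrow> Q E E (fid E)"
    and comp: "\<And>E E' E'' F G. \<lbrakk>exact_category E; exact_category E'; exact_category E''; Q E E' F; Q E' E'' G\<rbrakk> \<Longrightarrow>
      Q E E'' (fcomp E G F)" shows "two_category (exact_twocat H)"
proof -
  have cat: "category (H x y)" if "exact_category x" "exact_category y" for x y
    unfolding H using category_full_subcat category_Fun exact_cat_category that by blast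
  have Ob: "F \<in> Ob (H x y) \<longleftrightarrow> is_functor x y F \<and> Q x y F" for F x y by (simp add: H full_subcat_simps Fun_simps)
  have Hm: "\<eta> \<in> Hom (H x y) F G \<longleftrightarrow> \<eta> \<in> Hom (Fun x y) F G \<and> Q x y F \<and> Q x y G" for \<eta> x y F G by (simp add: H Hom_full)
  have ArE: "\<exists>F G. \<eta> \<in> Hom (Fun x y) F G \<and> Q x y F \<and> Q x y G" if "\<eta> \<in> Ar (H x y)" for \<eta> x y
    using that by (auto simp: H full_subcat_simps Fun_simps Hom_Fun)
  have IC: "Idn (H x y) = Idn (Fun x y)" "Cmp (H x y) = Cmp (Fun x y)" for x y by (simp_all add: H full_subcat_simps)
  have HomAr: "\<eta> \<in> Hom C X Y \<Longrightarrow> \<eta> \<in> Ar C" for \<eta> C X Y by (simp add: hom_iff)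
  have hcQ: "nt_hcomp x z \<tau> \<sigma> \<in> Hom (H x z) (fcomp x G F) (fcomp x G' F')"
    if "exact_category x" "exact_category y" "exact_category z" "\<sigma> \<in> Hom (H x y) F F'" "\<tau> \<in> Hom (H y z) G G'"
    for x y z \<sigma> \<tau> F F' G G' using that nt_hcomp_hom[of \<sigma> x y F F' \<tau> z G G'] comp by (auto simp: Hm)
  have hcid: "nt_hcomp x y \<sigma> (Idn (Fun x x) (fid x)) = \<sigma>" "nt_hcomp x y (Idn (Fun y y) (fid y)) \<sigma> = \<sigma>"
    if xy: "exact_category x" "exact_category y" "\<sigma> \<in> Ar (H x y)" for x y \<sigma>
  proof -
    obtain F F' where s: "\<sigma> \<in> Hom (Fun x y) F F'" using ArE[OF xy(3)] by blast
    have n: "is_nt x y \<sigma>" "src \<sigma> = F" "tgt \<sigma> = F'" using s by (auto simp: Hom_Fun)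
    have f: "is_functor x y F" "is_functor x y F'" using nt_src[OF n(1)] nt_tgt[OF n(1)] n by simp_all
    have i: "is_functor x x (fid x)" "is_functor y y (fid y)" using fid_functor exact_cat_category xy by blast+
    have "at \<sigma> W \<in> Ar y" if W: "W \<in> Ob x" for W using nt_hom[OF n(1) W] by (simp add: hom_iff)
    note at = hcomp_idn_right[OF s i(1)] hcomp_idn_left[OF s i(2)] this
    show "nt_hcomp x y \<sigma> (Idn (Fun x x) (fid x)) = \<sigma>" "nt_hcomp x y (Idn (Fun y y) (fid y)) \<sigma> = \<sigma>"
      by (rule nt_eqI[of _ _ "Ob x"]; use at in \<open>simp add: nt_hcomp_simps n Fun_simps fid_simps fcomp_fid[OF f(1)]
        fcomp_fid[OF f(2)] nt_extensional[OF n(1)]\<close>)+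
  qed
  show ?thesis
  proof (intro two_category.intro conjI, unfold exact_twocat_simps(1-3) mem_Collect_eq, goal_cases)
    case (1 x y) thus ?case using cat by blast
  next
    case (2 x) thus ?case using ident fid_functor exact_cat_category by (auto simp: Ob)
  next
    case (3 x y z)
    note ex = 3
    have c: "category x" "category y" "category z" using ex exact_cat_category by auto
    interpret Z: category z using c by blast interpret Hyz: category "H y z" using cat ex by blast
    interpret Hxy: category "H x y" using cat ex by blast
    let ?T = "HComp (exact_twocat H) x y z"
    have Tob: "Fob ?T (G, F) = fcomp x G F" if "G \<in> Ob (H y z)" "F \<in> Ob (H x y)" for G F
      using exact_twocat_simps(4)[where H = H, OF that] .
    have Tar: "Far ?T (\<tau>, \<sigma>) = nt_hcomp x z \<tau> \<sigma>" if "\<tau> \<in> Ar (H y z)" "\<sigma> \<in> Ar (H x y)" for \<tau> \<sigma>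
      using exact_twocat_simps(5)[where H = H, OF that] .
    show ?case
    proof (rule functorI)
      show "category (prod_cat (H y z) (H x y))" "category (H x z)" using category_prod cat ex by auto
      show "Fob ?T \<in> extensional (Ob (prod_cat (H y z) (H x y)))" "Far ?T \<in> extensional (Ar (prod_cat (H y z) (H x y)))"
        by (simp_all add: exact_twocat_def prod_cat_simps)
      show "Fob ?T GF \<in> Ob (H x z)" if GF: "GF \<in> Ob (prod_cat (H y z) (H x y))" for GF
      proof -
        obtain G F where gf: "GF = (G, F)" "G \<in> Ob (H y z)" "F \<in> Ob (H x y)" using GF by (auto simp: prod_cat_simps)
        thus ?thesis using Tob[OF gf(2,3)] fcomp_functor comp ex by (auto simp: Ob)
      qed
      show "Far ?T f \<in> Hom (H x z) (Fob ?T X) (Fob ?T Y)" if f: "f \<in> Hom (prod_cat (H y z) (H x y)) X Y" for f X Y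
      proof -
        obtain \<tau> \<sigma> G F G' F' where e: "f = (\<tau>, \<sigma>)" "X = (G, F)" "Y = (G', F')" by (metis surj_pair)
        hence h: "\<tau> \<in> Hom (H y z) G G'" "\<sigma> \<in> Hom (H x y) F F'" using f by (auto simp: prod_cat_simps)
        show ?thesis
          using hcQ[OF ex h(2,1)] Tar[OF HomAr[OF h(1)] HomAr[OF h(2)]] Tob[OF Hyz.hom_ob(1)[OF h(1)] Hxy.hom_ob(1)[OF h(2)]]
            Tob[OF Hyz.hom_ob(2)[OF h(1)] Hxy.hom_ob(2)[OF h(2)]] e by simp
      qed
      show "Far ?T (Idn (prod_cat (H y z) (H x y)) X) = Idn (H x z) (Fob ?T X)" if X: "X \<in> Ob (prod_cat (H y z) (H x y))" for X
      proof -
        obtain G F where gf: "X = (G, F)" "G \<in> Ob (H y z)" "F \<in> Ob (H x y)" using X by (auto simp: prod_cat_simps)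
        have f: "is_functor y z G" "is_functor x y F" using gf by (auto simp: Ob)
        note i = Hyz.id_hom[OF gf(2)] Hxy.id_hom[OF gf(3)]
        have it: "Idn (Fun y z) G \<in> Hom (Fun y z) G G" using i(1) by (auto simp: Hm IC)
        have "nt_hcomp x z (Idn (Fun y z) G) (Idn (Fun x y) F) = Idn (Fun x z) (fcomp x G F)"
        proof (rule nt_eqI[of _ _ "Ob x"])
          fix W assume W: "W \<in> Ob x"
          show "at (nt_hcomp x z (Idn (Fun y z) G) (Idn (Fun x y) F)) W = at (Idn (Fun x z) (fcomp x G F)) W"
            unfolding hcomp_idn_right[OF it f(2) W] using W functor_ob[OF f(2) W] by (simp add: Fun_simps fcomp_simps)
        qed (simp_all add: nt_hcomp_simps Fun_simps)
        thus ?thesis using Tar[OF HomAr[OF i(1)] HomAr[OF i(2)]] Tob[OF gf(2,3)] gf(1) by (simp add: prod_cat_simps IC)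
      qed
      show "Far ?T (g \<cdot>[prod_cat (H y z) (H x y)] f) = Far ?T g \<cdot>[H x z] Far ?T f"
        if fg: "f \<in> Hom (prod_cat (H y z) (H x y)) X Y" "g \<in> Hom (prod_cat (H y z) (H x y)) Y Z" for f g X Y Z
      proof -
        obtain \<tau> \<sigma> \<tau>' \<sigma>' G F G' F' G'' F'' where e: "f = (\<tau>, \<sigma>)" "g = (\<tau>', \<sigma>')" "X = (G, F)" "Y = (G', F')" "Z = (G'', F'')"
          by (metis surj_pair)
        hence h: "\<tau> \<in> Hom (H y z) G G'" "\<sigma> \<in> Hom (H x y) F F'" "\<tau>' \<in> Hom (H y z) G' G''" "\<sigma>' \<in> Hom (H x y) F' F''"
          using fg by (auto simp: prod_cat_simps)
        hence n: "is_nt y z \<tau>" "src \<tau> = G" "tgt \<tau> = G'" "is_nt x y \<sigma>" "src \<sigma> = F" "tgt \<sigma> = F'"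
          "is_nt y z \<tau>'" "src \<tau>' = G'" "tgt \<tau>' = G''" "is_nt x y \<sigma>'" "src \<sigma>' = F'" "tgt \<sigma>' = F''"
          by (auto simp: Hm Hom_Fun)
        have f: "is_functor y z G" "is_functor y z G'" "is_functor y z G''" "is_functor x y F" "is_functor x y F'" "is_functor x y F''"
          using nt_src[OF n(1)] nt_tgt[OF n(1)] nt_tgt[OF n(7)] nt_src[OF n(4)] nt_tgt[OF n(4)] nt_tgt[OF n(10)] n by simp_all
        \<comment> \<open>The interchange law, which rests on naturality of \<tau> at the components
          of \<open>\<sigma>'\<close>.\<close>
        have "nt_hcomp x z (\<tau>' \<cdot>[Fun y z] \<tau>) (\<sigma>' \<cdot>[Fun x y] \<sigma>) = nt_hcomp x z \<tau>' \<sigma>' \<cdot>[Fun x z] nt_hcomp x z \<tau> \<sigma>"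
        proof (rule nt_eqI[of _ _ "Ob x"])
          fix W assume W: "W \<in> Ob x"
          have s: "at \<sigma> W \<in> Hom y (Fob F W) (Fob F' W)" "at \<sigma>' W \<in> Hom y (Fob F' W) (Fob F'' W)"
            using nt_hom[OF n(4) W] nt_hom[OF n(10) W] n by simp_all
          have O: "Fob F' W \<in> Ob y" "Fob F'' W \<in> Ob y" using functor_ob[OF f(5) W] functor_ob[OF f(6) W] by auto
          have t: "at \<tau> (Fob F' W) \<in> Hom z (Fob G (Fob F' W)) (Fob G' (Fob F' W))"
            "at \<tau> (Fob F'' W) \<in> Hom z (Fob G (Fob F'' W)) (Fob G' (Fob F'' W))"
            "at \<tau>' (Fob F'' W) \<in> Hom z (Fob G' (Fob F'' W)) (Fob G'' (Fob F'' W))"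
            using nt_hom[OF n(1) O(1)] nt_hom[OF n(1) O(2)] nt_hom[OF n(7) O(2)] n by simp_all
          note g = functor_hom[OF f(1) s(1)] functor_hom[OF f(1) s(2)] functor_hom[OF f(2) s(2)]
          have nat: "at \<tau> (Fob F'' W) \<cdot>[z] Far G (at \<sigma>' W) = Far G' (at \<sigma>' W) \<cdot>[z] at \<tau> (Fob F' W)"
            using nt_natural[OF n(1) s(2)] n by simp
          have "(at \<tau>' (Fob F'' W) \<cdot>[z] at \<tau> (Fob F'' W)) \<cdot>[z] (Far G (at \<sigma>' W) \<cdot>[z] Far G (at \<sigma> W)) =
            at \<tau>' (Fob F'' W) \<cdot>[z] ((at \<tau> (Fob F'' W) \<cdot>[z] Far G (at \<sigma>' W)) \<cdot>[z] Far G (at \<sigma> W))"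
            using g t by (simp add: hom_iff Z.assoc)
          also have "\<dots> = (at \<tau>' (Fob F'' W) \<cdot>[z] Far G' (at \<sigma>' W)) \<cdot>[z] (at \<tau> (Fob F' W) \<cdot>[z] Far G (at \<sigma> W))"
            unfolding nat using g t by (simp add: hom_iff Z.assoc)
          finally show "at (nt_hcomp x z (\<tau>' \<cdot>[Fun y z] \<tau>) (\<sigma>' \<cdot>[Fun x y] \<sigma>)) W =
              at (nt_hcomp x z \<tau>' \<sigma>' \<cdot>[Fun x z] nt_hcomp x z \<tau> \<sigma>) W"
            using W O n functor_cmp[OF f(1) s] by (simp add: nt_hcomp_simps Fun_simps)
        qed (simp_all add: nt_hcomp_simps Fun_simps n)
        thus ?thesis using e Tar[OF HomAr[OF h(1)] HomAr[OF h(2)]] Tar[OF HomAr[OF h(3)] HomAr[OF h(4)]]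
            Tar[OF HomAr[OF Hyz.cmp_hom[OF h(1,3)]] HomAr[OF Hxy.cmp_hom[OF h(2,4)]]] by (simp add: prod_cat_simps IC)
      qed
    qed
  next
    case (4 w x y z f g h)
    hence ob: "fcomp x h g \<in> Ob (H x z)" "fcomp w g f \<in> Ob (H w y)" using fcomp_functor comp by (auto simp: Ob)
    have f: "is_functor w x f" using 4 by (simp add: Ob)
    show ?case using exact_twocat_simps(4)[where H = H] 4 ob fcomp_assoc[OF f] by simp
  next
    case (5 w x y z \<rho> \<sigma> \<tau>)
    obtain F F' where r: "\<rho> \<in> Hom (H w x) F F'" using ArE[OF 5(5)] by (auto simp: Hm)
    obtain G G' where s: "\<sigma> \<in> Hom (H x y) G G'" using ArE[OF 5(6)] by (auto simp: Hm)
    obtain K K' where t: "\<tau> \<in> Hom (H y z) K K'" using ArE[OF 5(7)] by (auto simp: Hm)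
    note a1 = HomAr[OF hcQ[OF 5(2,3,4) s t]] and a2 = HomAr[OF hcQ[OF 5(1,2,3) r s]]
    have n: "is_nt y z \<tau>" "src \<tau> = K" "tgt \<tau> = K'" "is_nt x y \<sigma>" "src \<sigma> = G" "tgt \<sigma> = G'"
      "is_nt w x \<rho>" "src \<rho> = F" "tgt \<rho> = F'" using r s t by (auto simp: Hm Hom_Fun)
    have f: "is_functor y z K" "is_functor y z K'" "is_functor x y G" "is_functor x y G'" "is_functor w x F" "is_functor w x F'"
      using nt_src[OF n(1)] nt_tgt[OF n(1)] nt_src[OF n(4)] nt_tgt[OF n(4)] nt_src[OF n(7)] nt_tgt[OF n(7)] n by simp_all
    interpret Z: category z using functor_cod_cat[OF f(1)] .
    have "nt_hcomp w z (nt_hcomp x z \<tau> \<sigma>) \<rho> = nt_hcomp w z \<tau> (nt_hcomp w y \<sigma> \<rho>)"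
    proof (rule nt_eqI[of _ _ "Ob w"])
      fix W assume W: "W \<in> Ob w"
      have rh: "at \<rho> W \<in> Hom x (Fob F W) (Fob F' W)" using nt_hom[OF n(7) W] n by simp
      have O: "Fob F' W \<in> Ob x" using functor_ob[OF f(6) W] .
      have sh: "at \<sigma> (Fob F' W) \<in> Hom y (Fob G (Fob F' W)) (Fob G' (Fob F' W))" using nt_hom[OF n(4) O] n by simp
      have O2: "Fob G' (Fob F' W) \<in> Ob y" using functor_ob[OF f(4) O] .
      have th: "at \<tau> (Fob G' (Fob F' W)) \<in> Hom z (Fob K (Fob G' (Fob F' W))) (Fob K' (Fob G' (Fob F' W)))"
        using nt_hom[OF n(1) O2] n by simp
      note gr = functor_hom[OF f(3) rh]
      have ra: "at \<rho> W \<in> Ar x" using rh by (simp add: hom_iff)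
      show "at (nt_hcomp w z (nt_hcomp x z \<tau> \<sigma>) \<rho>) W = at (nt_hcomp w z \<tau> (nt_hcomp w y \<sigma> \<rho>)) W"
        using W O n ra functor_cmp[OF f(1) gr sh] Z.cmp_assoc[OF functor_hom[OF f(1) gr] functor_hom[OF f(1) sh] th]
        by (simp add: nt_hcomp_simps fcomp_simps)
    qed (simp_all add: nt_hcomp_simps n fcomp_assoc[OF f(5)] fcomp_assoc[OF f(6)])
    thus ?case using exact_twocat_simps(5)[where H = H] 5 a1 a2 by simp
  next
    case (6 x y f)
    hence "fid y \<in> Ob (H y y)" using ident fid_functor exact_cat_category by (auto simp: Ob)
    thus ?case using exact_twocat_simps(4)[where H = H] 6 fcomp_fid[of x y f] by (simp add: Ob)
  next
    case (7 x y f)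
    hence "fid x \<in> Ob (H x x)" using ident fid_functor exact_cat_category by (auto simp: Ob)
    thus ?case using exact_twocat_simps(4)[where H = H] 7 fcomp_fid[of x y f] by (simp add: Ob)
  next
    case (8 x y \<sigma>) interpret Hyy: category "H y y" using cat 8 by blast
    have "fid y \<in> Ob (H y y)" using 8 ident fid_functor exact_cat_category by (auto simp: Ob)
    thus ?case using exact_twocat_simps(5)[where H = H, OF HomAr[OF Hyy.id_hom] 8(3)] hcid(2)[OF 8(1-3)] by (simp add: IC)
  next
    case (9 x y \<sigma>) interpret Hxx: category "H x x" using cat 9 by blast
    have "fid x \<in> Ob (H x x)" using 9 ident fid_functor exact_cat_category by (auto simp: Ob)
    thus ?case using exact_twocat_simps(5)[where H = H, OF 9(3) HomAr[OF Hxx.id_hom]] hcid(1)[OF 9(1-3)] by (simp add: IC)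
  qed
qed

lemma two_category_Ex2: "two_category Ex2"
  unfolding Ex2_def by (rule exact_two_category[where Q = exact_functor]) (auto simp: Hom_Ex_def fid_exact exact_cmp)

lemma two_category_ExL2: "two_category ExL2" unfolding ExL2_def
  by (rule exact_two_category[where Q = left_exact_functor])
    (auto simp: Hom_ExL_def fid_exact exact_imp_left_exact left_exact_cmp)

section \<open>Lifting transformations from representables\<close>

lemma exact_pairD: assumes "exact_pair_on_mod_adm E D G H"
  shows "exact_category E" "exact_category D" "exact_functor (\<A> E) D G" "exact_functor (\<A> E) D H"
  using assms unfolding exact_pair_on_mod_adm_def exact_on_mod_adm_def exact_on_mod_adm_axioms_def by blast+

context exact_pair_on_mod_adm
begin

text \<open>The source of \<open>mnt\<close>, \<open>mpc\<close> and \<open>mpu\<close>: a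
  transformation is prescribed on representables by an equation \<open>b \<cdot> \<tau> = c\<close>,
  where \<open>b\<close> and \<open>c\<close> compare both functors with a common \<open>K\<close>
  and \<open>b\<close> is invertible. The components on representables are the inverse of
  \<open>b\<close> after \<open>c\<close>; they are natural because \<open>b\<close> can be
  cancelled.\<close>

lemma lift_ex1: assumes K: "is_functor E D K" and c: "\<And>X. X \<in> Ob E \<Longrightarrow> c X \<in> Hom D (Fob G (\<Y> E X)) (Fob K X)"
    and cn: "\<And>f X Y. f \<in> Hom E X Y \<Longrightarrow> c Y \<cdot>[D] Far G (\<y> E f) = Far K f \<cdot>[D] c X"
    and b: "\<And>X. X \<in> Ob E \<Longrightarrow> b X \<in> Hom D (Fob H (\<Y> E X)) (Fob K X)"
    and bn: "\<And>f X Y. f \<in> Hom E X Y \<Longrightarrow> b Y \<cdot>[D] Far H (\<y> E f) = Far K f \<cdot>[D] b X"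
    and bi: "\<And>X. X \<in> Ob E \<Longrightarrow> is_iso D (b X)"
  shows "\<exists>!\<tau>. \<tau> \<in> Hom (Fun (\<A> E) D) G H \<and> (\<forall>X\<in>Ob E. b X \<cdot>[D] at \<tau> (\<Y> E X) = c X)"
proof -
  define s where "s X = (SOME u. u \<in> Hom D (Fob G (\<Y> E X)) (Fob H (\<Y> E X)) \<and> b X \<cdot>[D] u = c X)" for X
  have s: "s X \<in> Hom D (Fob G (\<Y> E X)) (Fob H (\<Y> E X))" "b X \<cdot>[D] s X = c X" if X: "X \<in> Ob E" for X
  proof -
    obtain i where i: "i \<in> Hom D (Fob K X) (Fob H (\<Y> E X))" "b X \<cdot>[D] i = Idn D (Fob K X)"
      using G.D.isoE[OF bi[OF X] b[OF X]] by metis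
    have "b X \<cdot>[D] (i \<cdot>[D] c X) = c X" using G.D.cmp_assoc[OF c[OF X] i(1) b[OF X]] i(2) G.D.cmp_id_left[OF c[OF X]] by simp
    hence "\<exists>u. u \<in> Hom D (Fob G (\<Y> E X)) (Fob H (\<Y> E X)) \<and> b X \<cdot>[D] u = c X"
      using G.D.cmp_hom[OF c[OF X] i(1)] by blast
    from someI_ex[OF this] show "s X \<in> Hom D (Fob G (\<Y> E X)) (Fob H (\<Y> E X))" "b X \<cdot>[D] s X = c X"
      unfolding s_def by blast+
  qed
  have yar: "\<y> E f \<in> Hom (\<A> E) (\<Y> E X) (\<Y> E Y)" if "f \<in> Hom E X Y" for f X Y
    using G.E.yoneda_ar(1)[OF that] G.E.yoneda_adm G.E.hom_ob[OF that] by (simp add: G.E.Hom_mod_adm)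
  have sn: "s Y \<cdot>[D] Far G (\<y> E f) = Far H (\<y> E f) \<cdot>[D] s X" if f: "f \<in> Hom E X Y" for f X Y
  proof -
    have ob: "X \<in> Ob E" "Y \<in> Ob E" using G.E.hom_ob[OF f] .
    note g = G.G_hom[OF yar[OF f]] H.G_hom[OF yar[OF f]] functor_hom[OF K f]
    have "b Y \<cdot>[D] (s Y \<cdot>[D] Far G (\<y> E f)) = Far K f \<cdot>[D] (b X \<cdot>[D] s X)"
      using G.D.cmp_assoc[OF g(1) s(1)[OF ob(2)] b[OF ob(2)]] s(2) ob cn[OF f] by simp
    also have "\<dots> = b Y \<cdot>[D] (Far H (\<y> E f) \<cdot>[D] s X)"
      using G.D.cmp_assoc[OF s(1)[OF ob(1)] b[OF ob(1)] g(3)] G.D.cmp_assoc[OF s(1)[OF ob(1)] g(2) b[OF ob(2)]] bn[OF f] by simp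
    finally show ?thesis
      by (rule G.D.iso_cancel_left[OF bi[OF ob(2)] b[OF ob(2)] G.D.cmp_hom[OF g(1) s(1)[OF ob(2)]] G.D.cmp_hom[OF s(1)[OF ob(1)] g(2)]])
  qed
  obtain \<tau> where t: "\<tau> \<in> Hom (Fun (\<A> E) D) G H" "\<And>X. X \<in> Ob E \<Longrightarrow> at \<tau> (\<Y> E X) = s X"
    by (rule restriction_full[of s, OF s(1) sn]) (assumption, assumption, rule that)
  show ?thesis
  proof (rule ex1I[of _ \<tau>])
    show "\<tau> \<in> Hom (Fun (\<A> E) D) G H \<and> (\<forall>X\<in>Ob E. b X \<cdot>[D] at \<tau> (\<Y> E X) = c X)" using t s(2) by simp
    fix \<tau>' assume t': "\<tau>' \<in> Hom (Fun (\<A> E) D) G H \<and> (\<forall>X\<in>Ob E. b X \<cdot>[D] at \<tau>' (\<Y> E X) = c X)"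
    show "\<tau>' = \<tau>"
    proof (rule restriction_faithful)
      fix X assume X: "X \<in> Ob E"
      have "at \<tau>' (\<Y> E X) \<in> Hom D (Fob G (\<Y> E X)) (Fob H (\<Y> E X))"
        using t' nt_hom[of "\<A> E" D \<tau>' "\<Y> E X"] G.E.yoneda_adm[OF X] by (auto simp: Hom_Fun G.E.mod_adm_simps)
      moreover have "b X \<cdot>[D] at \<tau>' (\<Y> E X) = b X \<cdot>[D] s X" using t' X s(2) by simp
      ultimately have "at \<tau>' (\<Y> E X) = s X" using G.D.iso_cancel_left[OF bi[OF X] b[OF X] _ s(1)[OF X]] by blast
      thus "at \<tau>' (\<Y> E X) = at \<tau> (\<Y> E X)" using t(2)[OF X] by simp
    qed (use t t' in auto)
  qed
qed

lemma lift_eqI: assumes t: "\<tau> \<in> Hom (Fun (\<A> E) D) G H" "\<tau>' \<in> Hom (Fun (\<A> E) D) G H"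
    and b: "\<And>X. X \<in> Ob E \<Longrightarrow> b X \<in> Hom D (Fob H (\<Y> E X)) (B X)" "\<And>X. X \<in> Ob E \<Longrightarrow> is_iso D (b X)"
    and eq: "\<And>X. X \<in> Ob E \<Longrightarrow> b X \<cdot>[D] at \<tau> (\<Y> E X) = b X \<cdot>[D] at \<tau>' (\<Y> E X)" shows "\<tau> = \<tau>'"
proof (rule restriction_faithful[OF t])
  fix X assume X: "X \<in> Ob E"
  have "at \<tau> (\<Y> E X) \<in> Hom D (Fob G (\<Y> E X)) (Fob H (\<Y> E X))"
    "at \<tau>' (\<Y> E X) \<in> Hom D (Fob G (\<Y> E X)) (Fob H (\<Y> E X))"
    using t nt_hom[of "\<A> E" D \<tau> "\<Y> E X"] nt_hom[of "\<A> E" D \<tau>' "\<Y> E X"] G.E.yoneda_adm[OF X]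
    by (auto simp: Hom_Fun G.E.mod_adm_simps)
  thus "at \<tau> (\<Y> E X) = at \<tau>' (\<Y> E X)"
    using G.D.iso_cancel_left[OF b(2)[OF X] b(1)[OF X] _ _ eq[OF X]] by blast
qed

end

text \<open>As \<open>c\<close> is invertible too, exchanging \<open>b\<close> and \<open>c\<close>
  gives a transformation in the other direction, and both composites agree with identities after
  cancelling \<open>c\<close> or \<open>b\<close>.\<close>

lemma lift_iso: assumes P: "exact_pair_on_mod_adm E D G H" and K: "is_functor E D K"
    and c: "\<And>X. X \<in> Ob E \<Longrightarrow> c X \<in> Hom D (Fob G (\<Y> E X)) (Fob K X)"
    and cn: "\<And>f X Y. f \<in> Hom E X Y \<Longrightarrow> c Y \<cdot>[D] Far G (\<y> E f) = Far K f \<cdot>[D] c X"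
    and ci: "\<And>X. X \<in> Ob E \<Longrightarrow> is_iso D (c X)" and b: "\<And>X. X \<in> Ob E \<Longrightarrow> b X \<in> Hom D (Fob H (\<Y> E X)) (Fob K X)"
    and bn: "\<And>f X Y. f \<in> Hom E X Y \<Longrightarrow> b Y \<cdot>[D] Far H (\<y> E f) = Far K f \<cdot>[D] b X"
    and bi: "\<And>X. X \<in> Ob E \<Longrightarrow> is_iso D (b X)"
    and t: "\<tau> \<in> Hom (Fun (\<A> E) D) G H" "\<And>X. X \<in> Ob E \<Longrightarrow> b X \<cdot>[D] at \<tau> (\<Y> E X) = c X"
  shows "is_iso (Fun (\<A> E) D) \<tau>"
proof -
  note ex = exact_pairD[OF P] interpret GH: exact_pair_on_mod_adm E D G H by (rule P)
  interpret HG: exact_pair_on_mod_adm E D H G by (rule exact_pairI[OF ex(1,2,4,3)])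
  interpret GG: exact_pair_on_mod_adm E D G G by (rule exact_pairI[OF ex(1,2,3,3)])
  interpret HH: exact_pair_on_mod_adm E D H H by (rule exact_pairI[OF ex(1,2,4,4)])
  interpret MA: exact_category "\<A> E" by (rule GH.G.E.exact_mod_adm)
  interpret Fun: category "Fun (\<A> E) D" by (rule category_Fun) unfold_locales
  obtain \<tau>' where t': "\<tau>' \<in> Hom (Fun (\<A> E) D) H G" "\<forall>X\<in>Ob E. c X \<cdot>[D] at \<tau>' (\<Y> E X) = b X"
    using HG.lift_ex1[OF K b bn c cn ci] by blast
  have Y: "\<Y> E X \<in> Ob (\<A> E)" if "X \<in> Ob E" for X
    using GH.G.E.yoneda_adm[OF that] by (simp add: GH.G.E.mod_adm_simps)
  have h: "at \<tau> (\<Y> E X) \<in> Hom D (Fob G (\<Y> E X)) (Fob H (\<Y> E X))"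
    "at \<tau>' (\<Y> E X) \<in> Hom D (Fob H (\<Y> E X)) (Fob G (\<Y> E X))" if "X \<in> Ob E" for X
  proof -
    have n: "is_nt (\<A> E) D \<tau>" "src \<tau> = G" "tgt \<tau> = H" "is_nt (\<A> E) D \<tau>'" "src \<tau>' = H" "tgt \<tau>' = G"
      using t(1) t'(1) by (auto simp: Hom_Fun)
    show "at \<tau> (\<Y> E X) \<in> Hom D (Fob G (\<Y> E X)) (Fob H (\<Y> E X))"
      "at \<tau>' (\<Y> E X) \<in> Hom D (Fob H (\<Y> E X)) (Fob G (\<Y> E X))"
      using nt_hom[OF n(1) Y[OF that]] nt_hom[OF n(4) Y[OF that]] n by simp_all
  qed
  have ob: "G \<in> Ob (Fun (\<A> E) D)" "H \<in> Ob (Fun (\<A> E) D)" using Fun.hom_ob[OF t(1)] .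
  have "\<tau>' \<cdot>[Fun (\<A> E) D] \<tau> = Idn (Fun (\<A> E) D) G"
  proof (rule GG.lift_eqI[OF Fun.cmp_hom[OF t(1) t'(1)] Fun.id_hom[OF ob(1)] c ci])
    fix X assume X: "X \<in> Ob E"
    show "c X \<cdot>[D] at (\<tau>' \<cdot>[Fun (\<A> E) D] \<tau>) (\<Y> E X) = c X \<cdot>[D] at (Idn (Fun (\<A> E) D) G) (\<Y> E X)"
      using X t(2)[OF X] t'(2) GH.G.D.cmp_assoc[OF h(1)[OF X] h(2)[OF X] c[OF X]] GH.G.D.cmp_id_right[OF c[OF X]]
      by (simp add: Fun_simps)
  qed
  moreover have "\<tau> \<cdot>[Fun (\<A> E) D] \<tau>' = Idn (Fun (\<A> E) D) H"
  proof (rule HH.lift_eqI[OF Fun.cmp_hom[OF t'(1) t(1)] Fun.id_hom[OF ob(2)] b bi])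
    fix X assume X: "X \<in> Ob E"
    show "b X \<cdot>[D] at (\<tau> \<cdot>[Fun (\<A> E) D] \<tau>') (\<Y> E X) = b X \<cdot>[D] at (Idn (Fun (\<A> E) D) H) (\<Y> E X)"
      using X t(2)[OF X] t'(2) GH.G.D.cmp_assoc[OF h(2)[OF X] h(1)[OF X] b[OF X]] GH.G.D.cmp_id_right[OF b[OF X]]
      by (simp add: Fun_simps)
  qed
  ultimately show ?thesis using Fun.isoI[OF t(1) t'(1)] by blast
qed

section \<open>The pseudofunctor\<close>

text \<open>\<open>mext E E' F\<close> is an exact functor on \<open>\<A> E\<close> with an isomorphism \<open>mth\<close> from its restriction along \<open>\<Upsilon>\<close>
  to \<open>\<Upsilon> \<circ> F\<close>; \<open>mnt\<close>, \<open>mpc\<close> and \<open>mpu\<close> are its effect on transformations, its compositor and its unitor.\<close>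

definition mext_pair :: "('o, 'm) ecat \<Rightarrow> ('o, 'm) ecat \<Rightarrow> ('o, 'm, 'o, 'm) ftr \<Rightarrow>
    (('o, 'm) md, ('o, 'm) md_hom, ('o, 'm) md, ('o, 'm) md_hom) ftr \<times> ('o, 'm, ('o, 'm) md, ('o, 'm) md_hom) nt" where
  "mext_pair E E' F = (SOME G\<theta>. exact_functor (\<A> E) (\<A> E') (fst G\<theta>) \<and>
     snd G\<theta> \<in> Hom (Fun E (\<A> E')) (fcomp E (fst G\<theta>) (\<Upsilon> E)) (fcomp E (\<Upsilon> E') F) \<and>
     is_iso (Fun E (\<A> E')) (snd G\<theta>))"

abbreviation "mext E E' F \<equiv> fst (mext_pair E E' F)"
abbreviation "mth E E' F \<equiv> snd (mext_pair E E' F)"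

definition mnt :: "('o, 'm) ecat \<Rightarrow> ('o, 'm) ecat \<Rightarrow> ('o, 'm, 'o, 'm) nt \<Rightarrow>
    (('o, 'm) md, ('o, 'm) md_hom, ('o, 'm) md, ('o, 'm) md_hom) nt" where
  "mnt E E' \<sigma> = (THE \<tau>. \<tau> \<in> Hom (Fun (\<A> E) (\<A> E')) (mext E E' (src \<sigma>)) (mext E E' (tgt \<sigma>)) \<and>
     (\<forall>X\<in>Ob E. at (mth E E' (tgt \<sigma>)) X \<cdot>[\<A> E'] at \<tau> (\<Y> E X) =
        \<y> E' (at \<sigma> X) \<cdot>[\<A> E'] at (mth E E' (src \<sigma>)) X))"

definition mpc :: "('o, 'm) ecat \<Rightarrow> ('o, 'm) ecat \<Rightarrow> ('o, 'm) ecat \<Rightarrow> ('o, 'm, 'o, 'm) ftr \<Rightarrow> ('o, 'm, 'o, 'm) ftr \<Rightarrow>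
    (('o, 'm) md, ('o, 'm) md_hom, ('o, 'm) md, ('o, 'm) md_hom) nt" where
  "mpc E E' E'' G F = (THE \<tau>. \<tau> \<in> Hom (Fun (\<A> E) (\<A> E''))
       (fcomp (\<A> E) (mext E' E'' G) (mext E E' F)) (mext E E'' (fcomp E G F)) \<and>
     (\<forall>X\<in>Ob E. at (mth E E'' (fcomp E G F)) X \<cdot>[\<A> E''] at \<tau> (\<Y> E X) =
        at (mth E' E'' G) (Fob F X) \<cdot>[\<A> E''] Far (mext E' E'' G) (at (mth E E' F) X)))"

definition mpu :: "('o, 'm) ecat \<Rightarrow> (('o, 'm) md, ('o, 'm) md_hom, ('o, 'm) md, ('o, 'm) md_hom) nt" where
  "mpu E = (THE \<tau>. \<tau> \<in> Hom (Fun (\<A> E) (\<A> E)) (fid (\<A> E)) (mext E E (fid E)) \<and>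
     (\<forall>X\<in>Ob E. at (mth E E (fid E)) X \<cdot>[\<A> E] at \<tau> (\<Y> E X) = Idn (\<A> E) (\<Y> E X)))"

definition mod_adm_pseudo :: "(('o, 'm) ecat, ('o, 'm, 'o, 'm) ftr, ('o, 'm, 'o, 'm) nt,
      (('o, 'm) md, ('o, 'm) md_hom) ecat, (('o, 'm) md, ('o, 'm) md_hom, ('o, 'm) md, ('o, 'm) md_hom) ftr,
      (('o, 'm) md, ('o, 'm) md_hom, ('o, 'm) md, ('o, 'm) md_hom) nt) pseudo" where
  "mod_adm_pseudo = \<lparr>P0 = \<A>,
     P1 = (\<lambda>E E'. \<lparr>Fob = (\<lambda>F\<in>Ob (Hom_ExL E E'). mext E E' F), Far = (\<lambda>\<sigma>\<in>Ar (Hom_ExL E E'). mnt E E' \<sigma>)\<rparr>),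
     PC = mpc, PU = mpu\<rparr>"

section \<open>Existence and characterization of the structure cells\<close>

lemma yoneda_ar_adm: assumes "exact_category E" "f \<in> Hom E X Y" shows "\<y> E f \<in> Hom (\<A> E) (\<Y> E X) (\<Y> E Y)"
proof -
  interpret exact_category E by fact
  show ?thesis using yoneda_ar(1)[OF assms(2)] yoneda_adm hom_ob[OF assms(2)] by (simp add: Hom_mod_adm)
qed

lemma yoneda_ar_cmp: assumes "exact_category E" "f \<in> Hom E X Y" "g \<in> Hom E Y Z"
  shows "\<y> E (g \<cdot>[E] f) = \<y> E g \<cdot>[\<A> E] \<y> E f"
proof -
  interpret exact_category E by fact
  show ?thesis using functor_cmp[OF yoneda_functor assms(2,3)] assms(2,3) by (simp add: yoneda_simps hom_iff)
qed

lemma yoneda_Ob_mod_adm: "\<lbrakk>exact_category E; X \<in> Ob E\<rbrakk> \<Longrightarrow> \<Y> E X \<in> Ob (\<A> E)"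
  using exact_category.yoneda_adm exact_category.mod_adm_simps(1) by metis

text \<open>The extension exists because \<open>\<Upsilon> E'\<close> after \<open>F\<close> is left
  exact as a composite. The last three facts spell out the isomorphism on representables.\<close>

lemma mext: assumes E: "exact_category E" and E': "exact_category E'" and F: "left_exact_functor E E' F"
  shows "exact_functor (\<A> E) (\<A> E') (mext E E' F)"
    "mth E E' F \<in> Hom (Fun E (\<A> E')) (fcomp E (mext E E' F) (\<Upsilon> E)) (fcomp E (\<Upsilon> E') F)"
    "is_iso (Fun E (\<A> E')) (mth E E' F)"
    "\<And>X. X \<in> Ob E \<Longrightarrow> at (mth E E' F) X \<in> Hom (\<A> E') (Fob (mext E E' F) (\<Y> E X)) (\<Y> E' (Fob F X))"
    "\<And>X. X \<in> Ob E \<Longrightarrow> is_iso (\<A> E') (at (mth E E' F) X)"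
    "\<And>f X Y. f \<in> Hom E X Y \<Longrightarrow> at (mth E E' F) Y \<cdot>[\<A> E'] Far (mext E E' F) (\<y> E f) =
       \<y> E' (Far F f) \<cdot>[\<A> E'] at (mth E E' F) X"
proof -
  interpret E: exact_category E by fact interpret E': exact_category E' by fact
  interpret MA': exact_category "\<A> E'" by (rule E'.exact_mod_adm)
  have lex: "left_exact_functor E (\<A> E') (fcomp E (\<Upsilon> E') F)"
    using left_exact_cmp[OF E E' E'.exact_mod_adm F yoneda_left_exact[OF E']] .
  obtain G \<theta> where "exact_functor (\<A> E) (\<A> E') G"
    "\<theta> \<in> Hom (Fun E (\<A> E')) (fcomp E G (\<Upsilon> E)) (fcomp E (\<Upsilon> E') F)" "is_iso (Fun E (\<A> E')) \<theta>"
    by (rule left_exact_extension[OF E E'.exact_mod_adm lex]) (rule that)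
  hence "\<exists>G\<theta>. exact_functor (\<A> E) (\<A> E') (fst G\<theta>) \<and>
     snd G\<theta> \<in> Hom (Fun E (\<A> E')) (fcomp E (fst G\<theta>) (\<Upsilon> E)) (fcomp E (\<Upsilon> E') F) \<and>
     is_iso (Fun E (\<A> E')) (snd G\<theta>)" by (intro exI[of _ "(G, \<theta>)"]) simp
  from someI_ex[OF this, folded mext_pair_def]
  show h: "exact_functor (\<A> E) (\<A> E') (mext E E' F)"
    "mth E E' F \<in> Hom (Fun E (\<A> E')) (fcomp E (mext E E' F) (\<Upsilon> E)) (fcomp E (\<Upsilon> E') F)"
    "is_iso (Fun E (\<A> E')) (mth E E' F)" by blast+
  have n: "is_nt E (\<A> E') (mth E E' F)" "src (mth E E' F) = fcomp E (mext E E' F) (\<Upsilon> E)"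
    "tgt (mth E E' F) = fcomp E (\<Upsilon> E') F" using h(2) by (auto simp: Hom_Fun)
  note Ff = left_exact_functor[OF F]
  show "at (mth E E' F) X \<in> Hom (\<A> E') (Fob (mext E E' F) (\<Y> E X)) (\<Y> E' (Fob F X))" if "X \<in> Ob E" for X
    using nt_hom[OF n(1) that] n(2,3) that functor_ob[OF Ff that] by (simp add: fcomp_simps E.yoneda_simps E'.yoneda_simps)
  show "is_iso (\<A> E') (at (mth E E' F) X)" if "X \<in> Ob E" for X
    by (rule nt_iso_at[OF h(3) that]) unfold_locales
  show "at (mth E E' F) Y \<cdot>[\<A> E'] Far (mext E E' F) (\<y> E f) =
       \<y> E' (Far F f) \<cdot>[\<A> E'] at (mth E E' F) X" if f: "f \<in> Hom E X Y" for f X Y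
    using nt_natural[OF n(1) f] n(2,3) f functor_hom[OF Ff f] by (simp add: fcomp_simps E.yoneda_simps E'.yoneda_simps hom_iff)
qed

lemma mext_functor: assumes "exact_category E" "exact_category E'" "left_exact_functor E E' F"
  shows "is_functor (\<A> E) (\<A> E') (mext E E' F)"
  using additive_functorD(1)[OF exact_functor_additive[OF mext(1)[OF assms]]] .

text \<open>An instance of \<open>lift_ex1\<close>: \<open>b\<close> is \<open>mth\<close> at
  \<open>F'\<close>, and \<open>c\<close> is the image of \<sigma> under the Yoneda functor after
  \<open>mth\<close> at \<open>F\<close>. Naturality of \<open>c\<close> combines that of
  \<open>mth\<close> with that of \<sigma>.\<close>

lemma mnt: assumes E: "exact_category E" and E': "exact_category E'" and s: "\<sigma> \<in> Hom (Hom_ExL E E') F F'"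
  shows "mnt E E' \<sigma> \<in> Hom (Fun (\<A> E) (\<A> E')) (mext E E' F) (mext E E' F')"
    "\<And>X. X \<in> Ob E \<Longrightarrow> at (mth E E' F') X \<cdot>[\<A> E'] at (mnt E E' \<sigma>) (\<Y> E X) =
        \<y> E' (at \<sigma> X) \<cdot>[\<A> E'] at (mth E E' F) X"
proof -
  interpret E: exact_category E by fact interpret E': exact_category E' by fact
  interpret MA': exact_category "\<A> E'" by (rule E'.exact_mod_adm)
  have F: "left_exact_functor E E' F" "left_exact_functor E E' F'" and n: "is_nt E E' \<sigma>" "src \<sigma> = F" "tgt \<sigma> = F'"
    using s by (auto simp: Hom_Hom_ExL Hom_Fun)
  note m = mext[OF E E' F(1)] and m' = mext[OF E E' F(2)]
  note Ff = left_exact_functor[OF F(1)] and Ff' = left_exact_functor[OF F(2)]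
  interpret P: exact_pair_on_mod_adm E "\<A> E'" "mext E E' F" "mext E E' F'"
    by (rule exact_pairI[OF E E'.exact_mod_adm m(1) m'(1)])
  have K: "is_functor E (\<A> E') (fcomp E (\<Upsilon> E') F')" using fcomp_functor[OF Ff' E'.yoneda_functor] .
  have Ks: "Fob (fcomp E (\<Upsilon> E') F') X = \<Y> E' (Fob F' X)" if "X \<in> Ob E" for X
    using that functor_ob[OF Ff' that] by (simp add: fcomp_simps E'.yoneda_simps)
  have Ka: "Far (fcomp E (\<Upsilon> E') F') f = \<y> E' (Far F' f)" if "f \<in> Hom E X Y" for f X Y
    using that functor_hom[OF Ff' that] by (simp add: fcomp_simps E'.yoneda_simps hom_iff)
  have sh: "at \<sigma> X \<in> Hom E' (Fob F X) (Fob F' X)" if "X \<in> Ob E" for X using nt_hom[OF n(1) that] n by simp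
  note ya = yoneda_ar_adm[OF E']
  have "\<exists>!\<tau>. \<tau> \<in> Hom (Fun (\<A> E) (\<A> E')) (mext E E' F) (mext E E' F') \<and>
     (\<forall>X\<in>Ob E. at (mth E E' F') X \<cdot>[\<A> E'] at \<tau> (\<Y> E X) =
        \<y> E' (at \<sigma> X) \<cdot>[\<A> E'] at (mth E E' F) X)"
  proof (rule P.lift_ex1[OF K])
    fix X assume X: "X \<in> Ob E"
    show "\<y> E' (at \<sigma> X) \<cdot>[\<A> E'] at (mth E E' F) X \<in>
      Hom (\<A> E') (Fob (mext E E' F) (\<Y> E X)) (Fob (fcomp E (\<Upsilon> E') F') X)"
      unfolding Ks[OF X] using MA'.cmp_hom[OF m(4)[OF X] ya[OF sh[OF X]]] .
    show "at (mth E E' F') X \<in> Hom (\<A> E') (Fob (mext E E' F') (\<Y> E X)) (Fob (fcomp E (\<Upsilon> E') F') X)"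
      unfolding Ks[OF X] using m'(4)[OF X] .
    show "is_iso (\<A> E') (at (mth E E' F') X)" using m'(5)[OF X] .
  next
    fix f X Y assume f: "f \<in> Hom E X Y"
    have ob: "X \<in> Ob E" "Y \<in> Ob E" using E.hom_ob[OF f] .
    show "at (mth E E' F') Y \<cdot>[\<A> E'] Far (mext E E' F') (\<y> E f) =
      Far (fcomp E (\<Upsilon> E') F') f \<cdot>[\<A> E'] at (mth E E' F') X" unfolding Ka[OF f] using m'(6)[OF f] .
    note h1 = functor_hom[OF Ff f] and h1' = functor_hom[OF Ff' f]
    note g = functor_hom[OF mext_functor[OF E E' F(1)] yoneda_ar_adm[OF E f]]
    have "\<y> E' (at \<sigma> Y) \<cdot>[\<A> E'] at (mth E E' F) Y \<cdot>[\<A> E'] Far (mext E E' F) (\<y> E f) =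
      \<y> E' (at \<sigma> Y) \<cdot>[\<A> E'] (\<y> E' (Far F f) \<cdot>[\<A> E'] at (mth E E' F) X)"
      using MA'.cmp_assoc[OF g m(4)[OF ob(2)] ya[OF sh[OF ob(2)]]] m(6)[OF f] by simp
    also have "\<dots> = \<y> E' (at \<sigma> Y \<cdot>[E'] Far F f) \<cdot>[\<A> E'] at (mth E E' F) X"
      using MA'.cmp_assoc[OF m(4)[OF ob(1)] ya[OF h1] ya[OF sh[OF ob(2)]]] yoneda_ar_cmp[OF E' h1 sh[OF ob(2)]] by simp
    also have "at \<sigma> Y \<cdot>[E'] Far F f = Far F' f \<cdot>[E'] at \<sigma> X" using nt_natural[OF n(1) f] n by simp
    also have "\<y> E' (Far F' f \<cdot>[E'] at \<sigma> X) \<cdot>[\<A> E'] at (mth E E' F) X =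
      \<y> E' (Far F' f) \<cdot>[\<A> E'] (\<y> E' (at \<sigma> X) \<cdot>[\<A> E'] at (mth E E' F) X)"
      using MA'.cmp_assoc[OF m(4)[OF ob(1)] ya[OF sh[OF ob(1)]] ya[OF h1']] yoneda_ar_cmp[OF E' sh[OF ob(1)] h1'] by simp
    finally show "\<y> E' (at \<sigma> Y) \<cdot>[\<A> E'] at (mth E E' F) Y \<cdot>[\<A> E'] Far (mext E E' F) (\<y> E f) =
      Far (fcomp E (\<Upsilon> E') F') f \<cdot>[\<A> E'] (\<y> E' (at \<sigma> X) \<cdot>[\<A> E'] at (mth E E' F) X)" unfolding Ka[OF f] .
  qed
  from theI'[OF this] show "mnt E E' \<sigma> \<in> Hom (Fun (\<A> E) (\<A> E')) (mext E E' F) (mext E E' F')"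
    "\<And>X. X \<in> Ob E \<Longrightarrow> at (mth E E' F') X \<cdot>[\<A> E'] at (mnt E E' \<sigma>) (\<Y> E X) =
        \<y> E' (at \<sigma> X) \<cdot>[\<A> E'] at (mth E E' F) X" unfolding mnt_def n(2,3) by blast+
qed

lemma functor_iso: assumes "is_functor C D F" "is_iso C f" "f \<in> Hom C X Y" shows "is_iso D (Far F f)"
proof -
  interpret C: category C using functor_dom_cat[OF assms(1)] .
  interpret D: category D using functor_cod_cat[OF assms(1)] .
  obtain g where g: "g \<in> Hom C Y X" "g \<cdot>[C] f = Idn C X" "f \<cdot>[C] g = Idn C Y" using C.isoE[OF assms(2,3)] by metis
  note F = assms(1)
  show ?thesis by (rule D.isoI[OF functor_hom[OF F assms(3)] functor_hom[OF F g(1)]])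
      (use functor_cmp[OF F assms(3) g(1)] functor_cmp[OF F g(1) assms(3)] g(2,3) functor_idn[OF F] C.hom_ob[OF g(1)] in simp_all)
qed

text \<open>The compositor is determined by requiring that \<open>mth\<close> of the composite
  correspond to \<open>mth\<close> of \<open>G\<close> pasted with \<open>mth\<close> of
  \<open>F\<close>, which is the compatibility demanded by pseudonaturality; it is invertible
  because each \<open>mth\<close> is.\<close>

lemma mpc: assumes E: "exact_category E" and E': "exact_category E'" and E'': "exact_category E''"
    and F: "left_exact_functor E E' F" and G: "left_exact_functor E' E'' G"
  shows "mpc E E' E'' G F \<in> Hom (Fun (\<A> E) (\<A> E''))
       (fcomp (\<A> E) (mext E' E'' G) (mext E E' F)) (mext E E'' (fcomp E G F))"
    "\<And>X. X \<in> Ob E \<Longrightarrow> at (mth E E'' (fcomp E G F)) X \<cdot>[\<A> E''] at (mpc E E' E'' G F) (\<Y> E X) =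
        at (mth E' E'' G) (Fob F X) \<cdot>[\<A> E''] Far (mext E' E'' G) (at (mth E E' F) X)"
    "is_iso (Fun (\<A> E) (\<A> E'')) (mpc E E' E'' G F)"
proof -
  interpret E: exact_category E by fact interpret E': exact_category E' by fact
  interpret E'': exact_category E'' by fact interpret MA: exact_category "\<A> E" by (rule E.exact_mod_adm)
  interpret MA': exact_category "\<A> E'" by (rule E'.exact_mod_adm)
  interpret K: exact_category "\<A> E''" by (rule E''.exact_mod_adm)
  have GF: "left_exact_functor E E'' (fcomp E G F)" using left_exact_cmp[OF E E' E'' F G] .
  note mF = mext[OF E E' F] and mG = mext[OF E' E'' G] and mGF = mext[OF E E'' GF]
  note Ff = left_exact_functor[OF F] and Gf = left_exact_functor[OF G] and GFf = left_exact_functor[OF GF]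
  note eF = mext_functor[OF E E' F] and eG = mext_functor[OF E' E'' G]
  let ?S = "fcomp (\<A> E) (mext E' E'' G) (mext E E' F)"
  have P: "exact_pair_on_mod_adm E (\<A> E'') ?S (mext E E'' (fcomp E G F))"
    by (rule exact_pairI[OF E E''.exact_mod_adm exact_cmp[OF E.exact_mod_adm mF(1) mG(1)] mGF(1)])
  interpret P: exact_pair_on_mod_adm E "\<A> E''" ?S "mext E E'' (fcomp E G F)" by (rule P)
  have Kf: "is_functor E (\<A> E'') (fcomp E (\<Upsilon> E'') (fcomp E G F))" using fcomp_functor[OF GFf E''.yoneda_functor] .
  have Ks: "Fob (fcomp E (\<Upsilon> E'') (fcomp E G F)) X = \<Y> E'' (Fob G (Fob F X))" if "X \<in> Ob E" for X
    using that functor_ob[OF Gf functor_ob[OF Ff that]] by (simp add: fcomp_simps E''.yoneda_simps)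
  have Ka: "Far (fcomp E (\<Upsilon> E'') (fcomp E G F)) f = \<y> E'' (Far G (Far F f))" if "f \<in> Hom E X Y" for f X Y
    using that functor_hom[OF Gf functor_hom[OF Ff that]] by (simp add: fcomp_simps E''.yoneda_simps hom_iff)
  have Ss: "Fob ?S (\<Y> E X) = Fob (mext E' E'' G) (Fob (mext E E' F) (\<Y> E X))" if "X \<in> Ob E" for X
    using yoneda_Ob_mod_adm[OF E that] by (simp add: fcomp_simps)
  have Sa: "Far ?S (\<y> E f) = Far (mext E' E'' G) (Far (mext E E' F) (\<y> E f))" if "f \<in> Hom E X Y" for f X Y
    using yoneda_ar_adm[OF E that] by (simp add: fcomp_simps hom_iff)
  let ?c = "\<lambda>X. at (mth E' E'' G) (Fob F X) \<cdot>[\<A> E''] Far (mext E' E'' G) (at (mth E E' F) X)"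
  let ?b = "\<lambda>X. at (mth E E'' (fcomp E G F)) X"
  have ch: "Far (mext E' E'' G) (at (mth E E' F) X) \<in> Hom (\<A> E'') (Fob (mext E' E'' G) (Fob (mext E E' F) (\<Y> E X)))
        (Fob (mext E' E'' G) (\<Y> E' (Fob F X)))"
    "at (mth E' E'' G) (Fob F X) \<in> Hom (\<A> E'') (Fob (mext E' E'' G) (\<Y> E' (Fob F X))) (\<Y> E'' (Fob G (Fob F X)))"
    if "X \<in> Ob E" for X using functor_hom[OF eG mF(4)[OF that]] mG(4)[OF functor_ob[OF Ff that]] .
  have c: "?c X \<in> Hom (\<A> E'') (Fob ?S (\<Y> E X)) (Fob (fcomp E (\<Upsilon> E'') (fcomp E G F)) X)" if "X \<in> Ob E" for X
    unfolding Ks[OF that] Ss[OF that] using K.cmp_hom[OF ch[OF that]] .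
  have ci: "is_iso (\<A> E'') (?c X)" if "X \<in> Ob E" for X
    using K.is_iso_cmp[OF functor_iso[OF eG mF(5)[OF that] mF(4)[OF that]] mG(5)[OF functor_ob[OF Ff that]] ch[OF that]] .
  \<comment> \<open>Two naturality squares side by side: that of \<open>mth\<close> for
    \<open>F\<close>, under the extension of \<open>G\<close>, and that of \<open>mth\<close> for
    \<open>G\<close>.\<close>
  have cn: "?c Y \<cdot>[\<A> E''] Far ?S (\<y> E f) = Far (fcomp E (\<Upsilon> E'') (fcomp E G F)) f \<cdot>[\<A> E''] ?c X"
    if f: "f \<in> Hom E X Y" for f X Y
  proof -
    have ob: "X \<in> Ob E" "Y \<in> Ob E" using E.hom_ob[OF f] .
    note y = yoneda_ar_adm[OF E f] and Fh = functor_hom[OF Ff f]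
    note y' = yoneda_ar_adm[OF E' Fh] and y'' = yoneda_ar_adm[OF E'' functor_hom[OF Gf Fh]]
    note m1 = functor_hom[OF eF y] note m2 = functor_hom[OF eG m1] and m3 = functor_hom[OF eG y']
    have "?c Y \<cdot>[\<A> E''] Far (mext E' E'' G) (Far (mext E E' F) (\<y> E f)) =
      at (mth E' E'' G) (Fob F Y) \<cdot>[\<A> E''] Far (mext E' E'' G) (at (mth E E' F) Y \<cdot>[\<A> E'] Far (mext E E' F) (\<y> E f))"
      using K.cmp_assoc[OF m2 ch[OF ob(2)]] functor_cmp[OF eG m1 mF(4)[OF ob(2)]] by simp
    also have "\<dots> = (at (mth E' E'' G) (Fob F Y) \<cdot>[\<A> E''] Far (mext E' E'' G) (\<y> E' (Far F f)))
        \<cdot>[\<A> E''] Far (mext E' E'' G) (at (mth E E' F) X)"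
      unfolding mF(6)[OF f] functor_cmp[OF eG mF(4)[OF ob(1)] y'] using K.cmp_assoc[OF ch(1)[OF ob(1)] m3 ch(2)[OF ob(2)]] by simp
    also have "\<dots> = \<y> E'' (Far G (Far F f)) \<cdot>[\<A> E''] ?c X"
      unfolding mG(6)[OF Fh] using K.cmp_assoc[OF ch[OF ob(1)] y''] .
    finally show ?thesis unfolding Ka[OF f] Sa[OF f] .
  qed
  have b: "?b X \<in> Hom (\<A> E'') (Fob (mext E E'' (fcomp E G F)) (\<Y> E X)) (Fob (fcomp E (\<Upsilon> E'') (fcomp E G F)) X)"
    if "X \<in> Ob E" for X using mGF(4)[OF that] that Ks[OF that] by (simp add: fcomp_simps)
  have bn: "?b Y \<cdot>[\<A> E''] Far (mext E E'' (fcomp E G F)) (\<y> E f) =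
     Far (fcomp E (\<Upsilon> E'') (fcomp E G F)) f \<cdot>[\<A> E''] ?b X" if f: "f \<in> Hom E X Y" for f X Y
    using mGF(6)[OF f] Ka[OF f] f by (simp add: fcomp_simps hom_iff[of f])
  have bi: "is_iso (\<A> E'') (?b X)" if "X \<in> Ob E" for X using mGF(5)[OF that] .
  from theI'[OF P.lift_ex1[OF Kf c cn b bn bi], folded mpc_def]
  show h: "mpc E E' E'' G F \<in> Hom (Fun (\<A> E) (\<A> E'')) ?S (mext E E'' (fcomp E G F))"
    "\<And>X. X \<in> Ob E \<Longrightarrow> ?b X \<cdot>[\<A> E''] at (mpc E E' E'' G F) (\<Y> E X) = ?c X" by blast+
  show "is_iso (Fun (\<A> E) (\<A> E'')) (mpc E E' E'' G F)" by (rule lift_iso[OF P Kf c cn ci b bn bi h])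
qed

lemma mpu: assumes E: "exact_category E" shows "mpu E \<in> Hom (Fun (\<A> E) (\<A> E)) (fid (\<A> E)) (mext E E (fid E))"
    "\<And>X. X \<in> Ob E \<Longrightarrow> at (mth E E (fid E)) X \<cdot>[\<A> E] at (mpu E) (\<Y> E X) = Idn (\<A> E) (\<Y> E X)"
    "is_iso (Fun (\<A> E) (\<A> E)) (mpu E)"
proof -
  interpret E: exact_category E by fact interpret MA: exact_category "\<A> E" by (rule E.exact_mod_adm)
  have I: "left_exact_functor E E (fid E)" using exact_imp_left_exact[OF E E fid_exact[OF E]] .
  note m = mext[OF E E I]
  have P: "exact_pair_on_mod_adm E (\<A> E) (fid (\<A> E)) (mext E E (fid E))"
    by (rule exact_pairI[OF E E.exact_mod_adm fid_exact[OF E.exact_mod_adm] m(1)])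
  interpret P: exact_pair_on_mod_adm E "\<A> E" "fid (\<A> E)" "mext E E (fid E)" by (rule P)
  let ?c = "\<lambda>X. Idn (\<A> E) (\<Y> E X)" and ?b = "\<lambda>X. at (mth E E (fid E)) X"
  note Yo = yoneda_Ob_mod_adm[OF E]
  have c: "?c X \<in> Hom (\<A> E) (Fob (fid (\<A> E)) (\<Y> E X)) (Fob (\<Upsilon> E) X)" if "X \<in> Ob E" for X
    using MA.id_hom[OF Yo[OF that]] that Yo[OF that] by (simp add: fid_simps E.yoneda_simps)
  have cn: "?c Y \<cdot>[\<A> E] Far (fid (\<A> E)) (\<y> E f) = Far (\<Upsilon> E) f \<cdot>[\<A> E] ?c X" if f: "f \<in> Hom E X Y" for f X Y
    using yoneda_ar_adm[OF E f] f
    by (simp add: fid_simps E.yoneda_simps hom_iff)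
  have ci: "is_iso (\<A> E) (?c X)" if "X \<in> Ob E" for X using MA.is_iso_idn[OF Yo[OF that]] .
  have b: "?b X \<in> Hom (\<A> E) (Fob (mext E E (fid E)) (\<Y> E X)) (Fob (\<Upsilon> E) X)" if "X \<in> Ob E" for X
    using m(4)[OF that] that by (simp add: fid_simps E.yoneda_simps)
  have bn: "?b Y \<cdot>[\<A> E] Far (mext E E (fid E)) (\<y> E f) = Far (\<Upsilon> E) f \<cdot>[\<A> E] ?b X" if f: "f \<in> Hom E X Y" for f X Y
    using m(6)[OF f] f by (simp add: fid_simps E.yoneda_simps hom_iff)
  have bi: "is_iso (\<A> E) (?b X)" if "X \<in> Ob E" for X using m(5)[OF that] .
  from theI'[OF P.lift_ex1[OF E.yoneda_functor c cn b bn bi], folded mpu_def]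
  show h: "mpu E \<in> Hom (Fun (\<A> E) (\<A> E)) (fid (\<A> E)) (mext E E (fid E))"
    "\<And>X. X \<in> Ob E \<Longrightarrow> ?b X \<cdot>[\<A> E] at (mpu E) (\<Y> E X) = ?c X" by blast+
  show "is_iso (Fun (\<A> E) (\<A> E)) (mpu E)" by (rule lift_iso[OF P E.yoneda_functor c cn ci b bn bi h])
qed

section \<open>Coherence laws\<close>

lemma (in category) cmp_square:
  assumes "a \<cdot> b = c \<cdot> d" "x \<in> Hom C V W" "b \<in> Hom C W X" "a \<in> Hom C X Z" "d \<in> Hom C W Y" "c \<in> Hom C Y Z"
  shows "a \<cdot> (b \<cdot> x) = c \<cdot> (d \<cdot> x)"
  using cmp_assoc[OF assms(2,3,4)] cmp_assoc[OF assms(2,5,6)] assms(1) by simp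

lemma nt_at: "\<lbrakk>\<tau> \<in> Hom (Fun C D) F G; X \<in> Ob C\<rbrakk> \<Longrightarrow> at \<tau> X \<in> Hom D (Fob F X) (Fob G X)"
  and nt_square: "\<lbrakk>\<tau> \<in> Hom (Fun C D) F G; f \<in> Hom C X Y\<rbrakk> \<Longrightarrow>
    at \<tau> Y \<cdot>[D] Far F f = Far G f \<cdot>[D] at \<tau> X" by (auto simp: Hom_Fun dest: nt_hom nt_natural)

lemma Fun_at: "X \<in> Ob C \<Longrightarrow> at (\<nu> \<cdot>[Fun C D] \<eta>) X = at \<nu> X \<cdot>[D] at \<eta> X"
  "X \<in> Ob C \<Longrightarrow> at (Idn (Fun C D) F) X = Idn D (Fob F X)" by (simp_all add: Fun_simps)

text \<open>Cells into \<open>mext E E' F\<close> are equal if they agree on representables after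
  composition with the invertible \<open>mth\<close>. The coherence laws are proved this way: both
  sides are expanded by defining equations, with \<open>cmp_square\<close> replacing one side of a
  commutative square by the other.\<close>

lemma mext_eqI: assumes E: "exact_category E" and E': "exact_category E'" and F: "left_exact_functor E E' F"
    and G: "exact_functor (\<A> E) (\<A> E') G"
    and t: "\<tau> \<in> Hom (Fun (\<A> E) (\<A> E')) G (mext E E' F)" "\<tau>' \<in> Hom (Fun (\<A> E) (\<A> E')) G (mext E E' F)"
    and eq: "\<And>X. X \<in> Ob E \<Longrightarrow> at (mth E E' F) X \<cdot>[\<A> E'] at \<tau> (\<Y> E X) =
      at (mth E E' F) X \<cdot>[\<A> E'] at \<tau>' (\<Y> E X)" shows "\<tau> = \<tau>'"
proof -
  note m = mext[OF E E' F] interpret exact_pair_on_mod_adm E "\<A> E'" G "mext E E' F"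
    by (rule exact_pairI[OF E exact_category.exact_mod_adm[OF E'] G m(1)])
  show ?thesis by (rule lift_eqI[OF t m(4,5) eq])
qed

text \<open>After composition with \<open>mth\<close> of the target composite, the left side unfolds
  by the definition of the compositor, naturality of \<open>mnt\<close> of \<tau>, the definitions
  of both \<open>mnt\<close> and naturality of \<open>mth\<close> for \<open>G\<close>. This reaches
  the Yoneda image of the horizontal composite after \<open>mth\<close> of the source composite,
  where the right side arrives as well.\<close>

lemma mpc_natural: assumes E: "exact_category E" and E': "exact_category E'" and E'': "exact_category E''"
    and s: "\<sigma> \<in> Hom (Hom_ExL E E') F F'" and t: "\<tau> \<in> Hom (Hom_ExL E' E'') G G'"
  shows "mpc E E' E'' G' F' \<cdot>[Fun (\<A> E) (\<A> E'')] nt_hcomp (\<A> E) (\<A> E'') (mnt E' E'' \<tau>) (mnt E E' \<sigma>) =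
    mnt E E'' (nt_hcomp E E'' \<tau> \<sigma>) \<cdot>[Fun (\<A> E) (\<A> E'')] mpc E E' E'' G F" (is "?l = ?r")
proof -
  interpret E: exact_category E by fact interpret E': exact_category E' by fact
  interpret E'': exact_category E'' by fact interpret MA: exact_category "\<A> E" by (rule E.exact_mod_adm)
  interpret MA': exact_category "\<A> E'" by (rule E'.exact_mod_adm)
  interpret K: exact_category "\<A> E''" by (rule E''.exact_mod_adm)
  interpret FK: category "Fun (\<A> E) (\<A> E'')" by (rule category_Fun) unfold_locales
  have F: "left_exact_functor E E' F" "left_exact_functor E E' F'" and sF: "\<sigma> \<in> Hom (Fun E E') F F'"
    and G: "left_exact_functor E' E'' G" "left_exact_functor E' E'' G'" and tF: "\<tau> \<in> Hom (Fun E' E'') G G'"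
    using s t by (auto simp: Hom_Hom_ExL)
  have GF: "left_exact_functor E E'' (fcomp E G F)" "left_exact_functor E E'' (fcomp E G' F')"
    using left_exact_cmp[OF E E' E''] F G by blast+
  have st: "nt_hcomp E E'' \<tau> \<sigma> \<in> Hom (Hom_ExL E E'') (fcomp E G F) (fcomp E G' F')"
    using nt_hcomp_hom[OF sF tF] GF by (simp add: Hom_Hom_ExL)
  note Gf = left_exact_functor[OF G(1)] and Ff = left_exact_functor[OF F(1)] left_exact_functor[OF F(2)]
  note mF = mext[OF E E' F(1)] and mF' = mext[OF E E' F(2)] and mG = mext[OF E' E'' G(1)] and mG' = mext[OF E' E'' G(2)]
  note eG = mext_functor[OF E' E'' G(1)] and eG' = mext_functor[OF E' E'' G(2)] and eF' = mext_functor[OF E E' F(2)]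
  note p = mpc[OF E E' E'' F(1) G(1)] and p' = mpc[OF E E' E'' F(2) G(2)]
  note ms = mnt[OF E E' s] and mt = mnt[OF E' E'' t] and mst = mnt[OF E E'' st]
  show ?thesis
  proof (rule mext_eqI[OF E E'' GF(2) exact_cmp[OF E.exact_mod_adm mF(1) mG(1)]
        FK.cmp_hom[OF nt_hcomp_hom[OF ms(1) mt(1)] p'(1)] FK.cmp_hom[OF p(1) mst(1)]])
    fix X assume X: "X \<in> Ob E"
    note Y = yoneda_Ob_mod_adm[OF E X]
    note FX = functor_ob[OF Ff(1) X] and F'X = functor_ob[OF Ff(2) X]
    note Y' = yoneda_Ob_mod_adm[OF E' F'X]
    note sX = nt_at[OF sF X] and tX = nt_at[OF tF F'X]
    note sY = nt_at[OF ms(1) Y] and ysX = yoneda_ar_adm[OF E' sX]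
    let ?th = "at (mth E E'' (fcomp E G' F')) X" and ?thh = "at (mth E E'' (fcomp E G F)) X"
    let ?p = "at (mpc E E' E'' G F) (\<Y> E X)" and ?p' = "at (mpc E E' E'' G' F') (\<Y> E X)"
    let ?a = "at (mth E' E'' G') (Fob F' X)" and ?b = "Far (mext E' E'' G') (at (mth E E' F') X)"
    let ?s = "Far (mext E' E'' G) (at (mnt E E' \<sigma>) (\<Y> E X))"
    let ?t = "at (mnt E' E'' \<tau>) (Fob (mext E E' F') (\<Y> E X))"
    let ?t' = "at (mnt E' E'' \<tau>) (\<Y> E' (Fob F' X))" and ?b' = "Far (mext E' E'' G) (at (mth E E' F') X)"
    let ?u = "Far (mext E' E'' G) (\<y> E' (at \<sigma> X))" and ?v = "Far (mext E' E'' G) (at (mth E E' F) X)"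
    let ?a' = "at (mth E' E'' G) (Fob F' X)" and ?aa = "at (mth E' E'' G) (Fob F X)"
    let ?w = "\<y> E'' (at \<tau> (Fob F' X))" and ?u' = "\<y> E'' (Far G (at \<sigma> X))"
    let ?c = "\<lambda>g f. g \<cdot>[\<A> E''] f"
    note h = mext(4)[OF E E'' GF(2) X] mext(4)[OF E E'' GF(1) X]
    have fc: "Fob (fcomp (\<A> E) A B) (\<Y> E X) = Fob A (Fob B (\<Y> E X))"
      "Fob (fcomp E A' B') X = Fob A' (Fob B' X)" for A B A' B' using Y X by (simp_all add: fcomp_simps)
    note hp = nt_at[OF p(1) Y, unfolded fc] and hp' = nt_at[OF p'(1) Y, unfolded fc]
    note h = h[unfolded fc]
    note ha = mG'(4)[OF F'X] and hb = functor_hom[OF eG' mF'(4)[OF X]] and hs = functor_hom[OF eG sY]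
    note ht = nt_at[OF mt(1) functor_ob[OF eF' Y]] and ht' = nt_at[OF mt(1) Y']
    note hb' = functor_hom[OF eG mF'(4)[OF X]] and hu = functor_hom[OF eG ysX] and hv = functor_hom[OF eG mF(4)[OF X]]
    note ha' = mG(4)[OF F'X] and ha0 = mG(4)[OF FX]
    note hw = yoneda_ar_adm[OF E'' tX] and Gs = functor_hom[OF Gf sX]
    note hu' = yoneda_ar_adm[OF E'' Gs]
    have "?c ?th (?c ?p' (?c ?t ?s)) = ?c ?a (?c ?b (?c ?t ?s))"
      by (rule K.cmp_square[OF p'(2)[OF X] K.cmp_hom[OF hs ht] hp' h(1) hb ha])
    \<comment> \<open>The defining equation of \<open>mnt\<close> covers representables; naturality
      at \<open>mth\<close> of \<open>F'\<close> moves the component to one.\<close>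
    also have "?c ?b (?c ?t ?s) = ?c ?t' (?c ?b' ?s)"
      by (rule K.cmp_square[OF nt_square[OF mt(1) mF'(4)[OF X], symmetric] hs ht hb hb' ht'])
    also have "?c ?b' ?s = ?c ?u ?v"
      using functor_cmp[OF eG sY mF'(4)[OF X]] functor_cmp[OF eG mF(4)[OF X] ysX] ms(2)[OF X] by simp
    also have "?c ?a (?c ?t' (?c ?u ?v)) = ?c ?w (?c ?a' (?c ?u ?v))"
      by (rule K.cmp_square[OF mt(2)[OF F'X] K.cmp_hom[OF hv hu] ht' ha ha' hw])
    also have "?c ?a' (?c ?u ?v) = ?c ?u' (?c ?aa ?v)"
      by (rule K.cmp_square[OF mG(6)[OF sX] hv hu ha' ha0 hu'])
    also have "?c ?aa ?v = ?c ?thh ?p" using p(2)[OF X] by simp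
    also have "?c ?w (?c ?u' (?c ?thh ?p)) = ?c (?c ?w ?u') (?c ?thh ?p)"
      using K.cmp_assoc[OF K.cmp_hom[OF hp h(2)] hu' hw] by simp
    also have "?c ?w ?u' = \<y> E'' (at (nt_hcomp E E'' \<tau> \<sigma>) X)"
      using yoneda_ar_cmp[OF E'' Gs tX] X sF tF by (simp add: nt_hcomp_simps Hom_Fun)
    also have "?c (\<y> E'' (at (nt_hcomp E E'' \<tau> \<sigma>) X)) (?c ?thh ?p) =
        ?c ?th (?c (at (mnt E E'' (nt_hcomp E E'' \<tau> \<sigma>)) (\<Y> E X)) ?p)"
      by (rule K.cmp_square[OF mst(2)[OF X, symmetric] hp h(2) yoneda_ar_adm[OF E'' nt_at[OF nt_hcomp_hom[OF sF tF] X, unfolded fc]]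
            nt_at[OF mst(1) Y] h(1)])
    finally show "?c ?th (at ?l (\<Y> E X)) = ?c ?th (at ?r (\<Y> E X))"
      using Y ms(1) mt(1) by (simp add: Fun_at nt_hcomp_simps Hom_Fun)
  qed
qed

text \<open>Both bracketings, composed with \<open>mth\<close> of the triple composite, equal the
  pasting of \<open>mth\<close> for \<open>H\<close>, \<open>G\<close> and \<open>F\<close>.
  Composition of functors is strictly associative, so both sides end in the same functor.\<close>

lemma mpc_assoc:
  assumes E: "exact_category E" and E': "exact_category E'" and E2: "exact_category E2" and E3: "exact_category E3"
    and F: "left_exact_functor E E' F" and G: "left_exact_functor E' E2 G" and H: "left_exact_functor E2 E3 H"
  shows "mpc E E' E3 (fcomp E' H G) F \<cdot>[Fun (\<A> E) (\<A> E3)]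
      nt_hcomp (\<A> E) (\<A> E3) (mpc E' E2 E3 H G) (Idn (Fun (\<A> E) (\<A> E')) (mext E E' F)) =
    mpc E E2 E3 H (fcomp E G F) \<cdot>[Fun (\<A> E) (\<A> E3)]
      nt_hcomp (\<A> E) (\<A> E3) (Idn (Fun (\<A> E2) (\<A> E3)) (mext E2 E3 H)) (mpc E E' E2 G F)" (is "?l = ?r")
proof -
  interpret E: exact_category E by fact interpret E': exact_category E' by fact
  interpret E2: exact_category E2 by fact interpret E3: exact_category E3 by fact
  interpret MA: exact_category "\<A> E" by (rule E.exact_mod_adm)
  interpret MA': exact_category "\<A> E'" by (rule E'.exact_mod_adm)
  interpret MA2: exact_category "\<A> E2" by (rule E2.exact_mod_adm)
  interpret K: exact_category "\<A> E3" by (rule E3.exact_mod_adm)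
  interpret FK: category "Fun (\<A> E) (\<A> E3)" by (rule category_Fun) unfold_locales
  interpret F1: category "Fun (\<A> E) (\<A> E')" by (rule category_Fun) unfold_locales
  interpret F2: category "Fun (\<A> E2) (\<A> E3)" by (rule category_Fun) unfold_locales
  have HG: "left_exact_functor E' E3 (fcomp E' H G)" using left_exact_cmp[OF E' E2 E3 G H] .
  have GF: "left_exact_functor E E2 (fcomp E G F)" using left_exact_cmp[OF E E' E2 F G] .
  have HGF: "left_exact_functor E E3 (fcomp E H (fcomp E G F))" using left_exact_cmp[OF E E2 E3 GF H] .
  note Ff = left_exact_functor[OF F] and Gf = left_exact_functor[OF G]
  note a = fcomp_assoc[OF Ff, of H G]
  note eF = mext_functor[OF E E' F] and eG = mext_functor[OF E' E2 G] and eH = mext_functor[OF E2 E3 H]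
    and eHG = mext_functor[OF E' E3 HG]
  note mF = mext[OF E E' F] and mG = mext[OF E' E2 G] and mH = mext[OF E2 E3 H] and mHG = mext[OF E' E3 HG]
    and mGF = mext[OF E E2 GF] and m = mext[OF E E3 HGF]
  note p1 = mpc[OF E E' E3 F HG, unfolded a] and p2 = mpc[OF E E2 E3 GF H]
    and pHG = mpc[OF E' E2 E3 G H] and pGF = mpc[OF E E' E2 F G]
  have i: "Idn (Fun (\<A> E) (\<A> E')) (mext E E' F) \<in> Hom (Fun (\<A> E) (\<A> E')) (mext E E' F) (mext E E' F)"
    "Idn (Fun (\<A> E2) (\<A> E3)) (mext E2 E3 H) \<in> Hom (Fun (\<A> E2) (\<A> E3)) (mext E2 E3 H) (mext E2 E3 H)"
    using F1.id_hom[of "mext E E' F"] F2.id_hom[of "mext E2 E3 H"] eF eH by (simp_all add: Fun_simps)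
  note l = FK.cmp_hom[OF nt_hcomp_hom[OF i(1) pHG(1)] p1(1), unfolded fcomp_assoc[OF eF]]
    and r = FK.cmp_hom[OF nt_hcomp_hom[OF pGF(1) i(2)] p2(1)]
  show ?thesis
  proof (rule mext_eqI[OF E E3 HGF exact_cmp[OF E.exact_mod_adm exact_cmp[OF E.exact_mod_adm mF(1) mG(1)] mH(1)] l r])
    fix X assume X: "X \<in> Ob E"
    note Y = yoneda_Ob_mod_adm[OF E X]
    note FX = functor_ob[OF Ff X]
    note Y' = yoneda_Ob_mod_adm[OF E' FX] and GFX = functor_ob[OF Gf FX]
    note FY = functor_ob[OF eF Y]
    have fc: "Fob (fcomp (\<A> E) A B) (\<Y> E X) = Fob A (Fob B (\<Y> E X))"
      "Fob (fcomp E A' B') X = Fob A' (Fob B' X)" for A B A' B' using Y X by (simp_all add: fcomp_simps)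
    have fc': "Fob (fcomp (\<A> E') A B) (\<Y> E' (Fob F X)) = Fob A (Fob B (\<Y> E' (Fob F X)))"
      "Fob (fcomp (\<A> E') A B) (Fob (mext E E' F) (\<Y> E X)) = Fob A (Fob B (Fob (mext E E' F) (\<Y> E X)))"
      "Fob (fcomp E' A' B') (Fob F X) = Fob A' (Fob B' (Fob F X))" for A B A' B'
      using FX Y' FY by (simp_all add: fcomp_simps)
    let ?c = "\<lambda>g f. g \<cdot>[\<A> E3] f"
    let ?th = "at (mth E E3 (fcomp E H (fcomp E G F))) X"
    let ?p1 = "at (mpc E E' E3 (fcomp E' H G) F) (\<Y> E X)" and ?p2 = "at (mpc E E2 E3 H (fcomp E G F)) (\<Y> E X)"
    let ?p = "at (mpc E' E2 E3 H G) (Fob (mext E E' F) (\<Y> E X))" and ?p' = "at (mpc E' E2 E3 H G) (\<Y> E' (Fob F X))"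
    let ?a = "at (mth E' E3 (fcomp E' H G)) (Fob F X)" and ?b = "Far (mext E' E3 (fcomp E' H G)) (at (mth E E' F) X)"
    let ?b' = "Far (mext E2 E3 H) (Far (mext E' E2 G) (at (mth E E' F) X))"
    let ?h = "at (mth E2 E3 H) (Fob G (Fob F X))" and ?d = "Far (mext E2 E3 H) (at (mth E' E2 G) (Fob F X))"
    let ?e = "Far (mext E2 E3 H) (at (mth E E2 (fcomp E G F)) X)"
    let ?q = "Far (mext E2 E3 H) (at (mpc E E' E2 G F) (\<Y> E X))"
    note hth = m(4)[OF X, unfolded fc]
    note hp1 = nt_at[OF p1(1) Y, unfolded fc] and hp2 = nt_at[OF p2(1) Y, unfolded fc]
    note hp = nt_at[OF pHG(1) FY, unfolded fc'] and hp' = nt_at[OF pHG(1) Y', unfolded fc']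
    note ha = mHG(4)[OF FX, unfolded fc'] and hb = functor_hom[OF eHG mF(4)[OF X]]
    note hb0 = functor_hom[OF eG mF(4)[OF X]] note hb' = functor_hom[OF eH hb0]
    note hh = mH(4)[OF GFX] and hd = functor_hom[OF eH mG(4)[OF FX]]
    note he = functor_hom[OF eH mGF(4)[OF X], unfolded fc] and hq = functor_hom[OF eH nt_at[OF pGF(1) Y], unfolded fc]
    \<comment> \<open>The compositor of \<open>H\<close> and \<open>G\<close> is described at
      representables; its naturality at \<open>mth\<close> of \<open>F\<close> moves it to
      one.\<close>
    have sq: "?c ?b ?p = ?c ?p' ?b'"
      using nt_square[OF pHG(1) mF(4)[OF X], symmetric] mF(4)[OF X] by (simp add: fcomp_simps hom_iff)
    have "?c ?th (?c ?p1 ?p) = ?c ?a (?c ?b ?p)" by (rule K.cmp_square[OF p1(2)[OF X] hp hp1 hth hb ha])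
    also have "?c ?b ?p = ?c ?p' ?b'" by (rule sq)
    also have "?c ?a (?c ?p' ?b') = ?c ?h (?c ?d ?b')"
      by (rule K.cmp_square[OF pHG(2)[OF FX] hb' hp' ha hd hh])
    also have "?c ?d ?b' = ?c ?e ?q"
      using functor_cmp[OF eH hb0 mG(4)[OF FX]] functor_cmp[OF eH nt_at[OF pGF(1) Y] mGF(4)[OF X]] pGF(2)[OF X] by simp
    also have "?c ?h (?c ?e ?q) = ?c ?th (?c ?p2 ?q)"
      by (rule K.cmp_square[OF p2(2)[OF X, symmetric, unfolded fc] hq he hh hp2 hth])
    finally show "?c ?th (at ?l (\<Y> E X)) = ?c ?th (at ?r (\<Y> E X))"
      using Y hcomp_idn_right[OF pHG(1) eF Y] hcomp_idn_left[OF pGF(1) eH Y] by (simp add: Fun_at)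
  qed
qed

text \<open>On the left, naturality of \<open>mpu E'\<close> at \<open>mth\<close> of
  \<open>F\<close> leads to the defining equation of \<open>mpu\<close>; on the right that equation
  is used directly, under the extension of \<open>F\<close>.\<close>

lemma mpc_unit: assumes E: "exact_category E" and E': "exact_category E'" and F: "left_exact_functor E E' F"
  shows "mpc E E' E' (fid E') F \<cdot>[Fun (\<A> E) (\<A> E')]
      nt_hcomp (\<A> E) (\<A> E') (mpu E') (Idn (Fun (\<A> E) (\<A> E')) (mext E E' F)) =
    Idn (Fun (\<A> E) (\<A> E')) (mext E E' F)" (is "?l = ?i") "mpc E E E' F (fid E) \<cdot>[Fun (\<A> E) (\<A> E')]
      nt_hcomp (\<A> E) (\<A> E') (Idn (Fun (\<A> E) (\<A> E')) (mext E E' F)) (mpu E) =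
    Idn (Fun (\<A> E) (\<A> E')) (mext E E' F)" (is "?r = ?i")
proof -
  interpret E: exact_category E by fact interpret E': exact_category E' by fact
  interpret MA: exact_category "\<A> E" by (rule E.exact_mod_adm)
  interpret K: exact_category "\<A> E'" by (rule E'.exact_mod_adm)
  interpret FK: category "Fun (\<A> E) (\<A> E')" by (rule category_Fun) unfold_locales
  note I = exact_imp_left_exact[OF E E fid_exact[OF E]] and I' = exact_imp_left_exact[OF E' E' fid_exact[OF E']]
  note Ff = left_exact_functor[OF F]
  note fi = fcomp_fid[OF Ff]
  note m = mext[OF E E' F] and mI = mext[OF E E I] and mI' = mext[OF E' E' I']
  note e = mext_functor[OF E E' F] and eI' = mext_functor[OF E' E' I']
  note p = mpc[OF E E' E' F I', unfolded fi] and q = mpc[OF E E E' I F, unfolded fi]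
  note u = mpu[OF E] and u' = mpu[OF E']
  have i: "?i \<in> Hom (Fun (\<A> E) (\<A> E')) (mext E E' F) (mext E E' F)"
    using FK.id_hom[of "mext E E' F"] e by (simp add: Fun_simps)
  note l = FK.cmp_hom[OF nt_hcomp_hom[OF i u'(1)] p(1), unfolded fcomp_fid[OF e]]
    and r = FK.cmp_hom[OF nt_hcomp_hom[OF u(1) i] q(1), unfolded fcomp_fid[OF e]]
  let ?c = "\<lambda>g f. g \<cdot>[\<A> E'] f"
  show "?l = ?i"
  proof (rule mext_eqI[OF E E' F m(1) l i])
    fix X assume X: "X \<in> Ob E"
    note Y = yoneda_Ob_mod_adm[OF E X] and FX = functor_ob[OF Ff X]
    note FY = functor_ob[OF e Y] and Y' = yoneda_Ob_mod_adm[OF E' FX]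
    have fc: "Fob (fcomp (\<A> E) A B) (\<Y> E X) = Fob A (Fob B (\<Y> E X))" for A B
      using Y by (simp add: fcomp_simps)
    have fc': "Fob (fid (\<A> E')) (\<Y> E' (Fob F X)) = \<Y> E' (Fob F X)"
      "Fob (fid (\<A> E')) (Fob (mext E E' F) (\<Y> E X)) = Fob (mext E E' F) (\<Y> E X)"
      "Fob (fid E') (Fob F X) = Fob F X" using FX FY Y' by (simp_all add: fid_simps)
    let ?th = "at (mth E E' F) X" and ?p = "at (mpc E E' E' (fid E') F) (\<Y> E X)"
    let ?u = "at (mpu E') (Fob (mext E E' F) (\<Y> E X))" and ?u' = "at (mpu E') (\<Y> E' (Fob F X))"
    let ?a = "at (mth E' E' (fid E')) (Fob F X)" and ?b = "Far (mext E' E' (fid E')) (at (mth E E' F) X)"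
    note hp = nt_at[OF p(1) Y, unfolded fc] and hu = nt_at[OF u'(1) FY, unfolded fc'] and hu' = nt_at[OF u'(1) Y', unfolded fc']
    note ha = mI'(4)[OF FX, unfolded fc'] and hb = functor_hom[OF eI' m(4)[OF X]]
    have "?c ?th (?c ?p ?u) = ?c ?a (?c ?b ?u)" by (rule K.cmp_square[OF p(2)[OF X] hu hp m(4)[OF X] hb ha])
    also have "?c ?b ?u = ?c ?u' ?th"
      using nt_square[OF u'(1) m(4)[OF X], symmetric] m(4)[OF X] by (simp add: fid_simps hom_iff)
    also have "?c ?a (?c ?u' ?th) = ?th"
      using K.cmp_assoc[OF m(4)[OF X] hu' ha] u'(2)[OF FX] K.cmp_id_left[OF m(4)[OF X]] by simp
    also have "?th = ?c ?th (at ?i (\<Y> E X))" using K.cmp_id_right[OF m(4)[OF X]] Y by (simp add: Fun_at)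
    finally show "?c ?th (at ?l (\<Y> E X)) = ?c ?th (at ?i (\<Y> E X))"
      using Y hcomp_idn_right[OF u'(1) e Y] by (simp add: Fun_at)
  qed
  show "?r = ?i"
  proof (rule mext_eqI[OF E E' F m(1) r i])
    fix X assume X: "X \<in> Ob E"
    note Y = yoneda_Ob_mod_adm[OF E X]
    have fc: "Fob (fcomp (\<A> E) A B) (\<Y> E X) = Fob A (Fob B (\<Y> E X))" for A B
      using Y by (simp add: fcomp_simps)
    have fc': "Fob (fid (\<A> E)) (\<Y> E X) = \<Y> E X" "Fob (fid E) X = X" using X Y by (simp_all add: fid_simps)
    let ?th = "at (mth E E' F) X" and ?q = "at (mpc E E E' F (fid E)) (\<Y> E X)"
    let ?u = "Far (mext E E' F) (at (mpu E) (\<Y> E X))" and ?b = "Far (mext E E' F) (at (mth E E (fid E)) X)"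
    note hq = nt_at[OF q(1) Y, unfolded fc] and hu0 = nt_at[OF u(1) Y, unfolded fc']
    note hu = functor_hom[OF e hu0] and hb0 = mI(4)[OF X, unfolded fc']
    note hb = functor_hom[OF e hb0]
    have "?c ?th (?c ?q ?u) = ?c ?th (?c ?b ?u)"
      by (rule K.cmp_square[OF q(2)[OF X, unfolded fc'] hu hq m(4)[OF X] hb m(4)[OF X]])
    also have "?c ?b ?u = at ?i (\<Y> E X)"
      using functor_cmp[OF e hu0 hb0] u(2)[OF X] functor_idn[OF e Y] Y by (simp add: Fun_at)
    finally show "?c ?th (at ?r (\<Y> E X)) = ?c ?th (at ?i (\<Y> E X))"
      using Y hcomp_idn_left[OF u(1) e Y] by (simp add: Fun_at)
  qed
qed

section \<open>Assembly of the pseudofunctor and pseudonaturality\<close>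

lemma mnt_functor: assumes E: "exact_category E" and E': "exact_category E'"
  shows "is_functor (Hom_ExL E E') (Hom_Ex (\<A> E) (\<A> E')) (P1 mod_adm_pseudo E E')"
proof -
  interpret E: exact_category E by fact interpret E': exact_category E' by fact
  interpret MA: exact_category "\<A> E" by (rule E.exact_mod_adm)
  interpret K: exact_category "\<A> E'" by (rule E'.exact_mod_adm)
  interpret FK: category "Fun (\<A> E) (\<A> E')" by (rule category_Fun) unfold_locales
  interpret HL: category "Hom_ExL E E'" by (rule category_Hom_ExL) unfold_locales
  have ob: "Fob (P1 mod_adm_pseudo E E') F = mext E E' F" if "F \<in> Ob (Hom_ExL E E')" for F
    using that by (simp add: mod_adm_pseudo_def)
  have ar: "Far (P1 mod_adm_pseudo E E') f = mnt E E' f" if "f \<in> Hom (Hom_ExL E E') F G" for f F G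
    using that by (simp add: mod_adm_pseudo_def hom_iff)
  show ?thesis
  proof (rule functorI)
    show "category (Hom_ExL E E')" "category (Hom_Ex (\<A> E) (\<A> E'))"
      by (rule HL.category_axioms, rule category_Hom_Ex[OF MA.category_axioms K.category_axioms])
    show "Fob (P1 mod_adm_pseudo E E') \<in> extensional (Ob (Hom_ExL E E'))"
      "Far (P1 mod_adm_pseudo E E') \<in> extensional (Ar (Hom_ExL E E'))" by (simp_all add: mod_adm_pseudo_def)
    show "Fob (P1 mod_adm_pseudo E E') F \<in> Ob (Hom_Ex (\<A> E) (\<A> E'))" if "F \<in> Ob (Hom_ExL E E')" for F
      using ob[OF that] mext(1)[OF E E'] that by (simp add: Ob_Hom_Ex Ob_Hom_ExL)
    show "Far (P1 mod_adm_pseudo E E') f \<in> Hom (Hom_Ex (\<A> E) (\<A> E'))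
        (Fob (P1 mod_adm_pseudo E E') F) (Fob (P1 mod_adm_pseudo E E') G)" if "f \<in> Hom (Hom_ExL E E') F G" for f F G
      using ar[OF that] ob HL.hom_ob[OF that] mnt(1)[OF E E' that] mext(1)[OF E E'] by (simp add: Hom_Hom_Ex Ob_Hom_ExL)
  next
    fix F assume F: "F \<in> Ob (Hom_ExL E E')"
    hence lF: "left_exact_functor E E' F" by (simp add: Ob_Hom_ExL)
    note i = HL.id_hom[OF F] and e = mext_functor[OF E E' lF] and m = mext[OF E E' lF]
    have i': "Idn (Fun (\<A> E) (\<A> E')) (mext E E' F) \<in> Hom (Fun (\<A> E) (\<A> E')) (mext E E' F) (mext E E' F)"
      using FK.id_hom[of "mext E E' F"] e by (simp add: Fun_simps)
    have "mnt E E' (Idn (Hom_ExL E E') F) = Idn (Fun (\<A> E) (\<A> E')) (mext E E' F)"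
    proof (rule mext_eqI[OF E E' lF m(1) mnt(1)[OF E E' i] i'])
      fix X assume X: "X \<in> Ob E"
      note FX = functor_ob[OF left_exact_functor[OF lF] X]
      have "\<y> E' (at (Idn (Hom_ExL E E') F) X) = Idn (\<A> E') (\<Y> E' (Fob F X))"
        using functor_idn[OF E'.yoneda_functor FX] FX X
        by (simp add: Hom_ExL_simps Fun_at E'.yoneda_simps)
      thus "at (mth E E' F) X \<cdot>[\<A> E'] at (mnt E E' (Idn (Hom_ExL E E') F)) (\<Y> E X) =
        at (mth E E' F) X \<cdot>[\<A> E'] at (Idn (Fun (\<A> E) (\<A> E')) (mext E E' F)) (\<Y> E X)"
        using mnt(2)[OF E E' i X] K.cmp_id_left[OF m(4)[OF X]] K.cmp_id_right[OF m(4)[OF X]] yoneda_Ob_mod_adm[OF E X]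
        by (simp add: Fun_at)
    qed
    thus "Far (P1 mod_adm_pseudo E E') (Idn (Hom_ExL E E') F) =
        Idn (Hom_Ex (\<A> E) (\<A> E')) (Fob (P1 mod_adm_pseudo E E') F)"
      using ar[OF i] ob[OF F] by (simp add: Hom_Ex_simps)
  next
    fix f g F G H assume f: "f \<in> Hom (Hom_ExL E E') F G" and g: "g \<in> Hom (Hom_ExL E E') G H"
    have L: "left_exact_functor E E' F" "left_exact_functor E E' G" "left_exact_functor E E' H"
      and fF: "f \<in> Hom (Fun E E') F G" and gF: "g \<in> Hom (Fun E E') G H"
      using f g by (simp_all add: Hom_Hom_ExL)
    note gf = HL.cmp_hom[OF f g]
    note mf = mnt[OF E E' f] and mg = mnt[OF E E' g] and mgf = mnt[OF E E' gf]
    have "mnt E E' (g \<cdot>[Hom_ExL E E'] f) = mnt E E' g \<cdot>[Fun (\<A> E) (\<A> E')] mnt E E' f" (is "?l = ?r")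
    proof (rule mext_eqI[OF E E' L(3) mext(1)[OF E E' L(1)] mgf(1) FK.cmp_hom[OF mf(1) mg(1)]])
      fix X assume X: "X \<in> Ob E"
      note Y = yoneda_Ob_mod_adm[OF E X]
      note hf = nt_at[OF fF X] and hg = nt_at[OF gF X]
      note yf = yoneda_ar_adm[OF E' hf] and yg = yoneda_ar_adm[OF E' hg]
      note mF = mext(4)[OF E E' L(1) X] and mG = mext(4)[OF E E' L(2) X] and mH = mext(4)[OF E E' L(3) X]
      let ?c = "\<lambda>g f. g \<cdot>[\<A> E'] f" and ?Y = "\<Y> E X"
      have "?c (at (mth E E' H) X) (at ?r ?Y) = ?c (\<y> E' (at g X)) (?c (at (mth E E' G) X) (at (mnt E E' f) ?Y))"
        using K.cmp_square[OF mg(2)[OF X] nt_at[OF mf(1) Y] nt_at[OF mg(1) Y] mH mG yg] Y by (simp add: Fun_at)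
      also have "\<dots> = ?c (?c (\<y> E' (at g X)) (\<y> E' (at f X))) (at (mth E E' F) X)"
        using mf(2)[OF X] K.cmp_assoc[OF mF yf yg] by simp
      also have "?c (\<y> E' (at g X)) (\<y> E' (at f X)) = \<y> E' (at (g \<cdot>[Hom_ExL E E'] f) X)"
        using yoneda_ar_cmp[OF E' hf hg] X by (simp add: Hom_ExL_simps Fun_at)
      finally show "?c (at (mth E E' H) X) (at ?l ?Y) = ?c (at (mth E E' H) X) (at ?r ?Y)"
        using mgf(2)[OF X] by simp
    qed
    thus "Far (P1 mod_adm_pseudo E E') (g \<cdot>[Hom_ExL E E'] f) =
        Far (P1 mod_adm_pseudo E E') g \<cdot>[Hom_Ex (\<A> E) (\<A> E')] Far (P1 mod_adm_pseudo E E') f"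
      using ar[OF f] ar[OF g] ar[OF gf] by (simp add: Hom_Ex_simps)
  qed
qed

lemma mod_adm_pseudo_simps: "P0 mod_adm_pseudo = \<A>" "PC mod_adm_pseudo = mpc" "PU mod_adm_pseudo = mpu"
  "F \<in> Ob (Hom_ExL E E') \<Longrightarrow> Fob (P1 mod_adm_pseudo E E') F = mext E E' F"
  "\<sigma> \<in> Ar (Hom_ExL E E') \<Longrightarrow> Far (P1 mod_adm_pseudo E E') \<sigma> = mnt E E' \<sigma>" by (simp_all add: mod_adm_pseudo_def)

text \<open>The equations are already established in \<open>Fun\<close>; it remains to see that all
  cells lie in the hom categories of the two 2-categories, since the horizontal composition of
  \<open>exact_twocat\<close> takes its values only there.\<close>

lemma pseudofunctor_mod_adm:
  "pseudofunctor ExL2 Ex2 (mod_adm_pseudo :: (('o, 'm) ecat, ('o, 'm, 'o, 'm) ftr, ('o, 'm, 'o, 'm) nt,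
      (('o, 'm) md, ('o, 'm) md_hom) ecat, (('o, 'm) md, ('o, 'm) md_hom, ('o, 'm) md, ('o, 'm) md_hom) ftr,
      (('o, 'm) md, ('o, 'm) md_hom, ('o, 'm) md, ('o, 'm) md_hom) nt) pseudo)"
proof -
  have ex: "exact_category (\<A> E)" if "exact_category E" for E :: "('o, 'm) ecat"
    using exact_category.exact_mod_adm[OF that] .
  have cF: "category (Fun (\<A> E) (\<A> E'))" if "exact_category E" "exact_category E'" for E E' :: "('o, 'm) ecat"
    using category_Fun exact_cat_category ex that by blast
  have HomAr: "\<eta> \<in> Hom C X Y \<Longrightarrow> \<eta> \<in> Ar C" for \<eta> C X Y by (simp add: hom_iff)
  have mE: "mext E E' F \<in> Ob (Hom_Ex (\<A> E) (\<A> E'))"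
    if "exact_category E" "exact_category E'" "F \<in> Ob (Hom_ExL E E')" for E E' :: "('o, 'm) ecat" and F
    using mext(1)[OF that(1,2)] that(3) by (simp add: Ob_Hom_Ex Ob_Hom_ExL)
  have mI: "Idn (Hom_Ex (\<A> E) (\<A> E')) (mext E E' F) \<in> Ar (Hom_Ex (\<A> E) (\<A> E'))"
    if "exact_category E" "exact_category E'" "F \<in> Ob (Hom_ExL E E')" for E E' :: "('o, 'm) ecat" and F
    using HomAr[OF category.id_hom[OF category_Hom_Ex[OF exact_cat_category[OF ex[OF that(1)]] exact_cat_category[OF ex[OF that(2)]]] mE[OF that]]] .
  have mN: "mnt E E' \<sigma> \<in> Ar (Hom_Ex (\<A> E) (\<A> E'))"
    if "exact_category E" "exact_category E'" "\<sigma> \<in> Hom (Hom_ExL E E') F F'" for E E' :: "('o, 'm) ecat" and \<sigma> F F'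
    using mnt(1)[OF that] mext(1)[OF that(1,2)] that(3) by (auto simp: Hom_Hom_ExL Hom_Ex_simps Fun_simps Hom_Fun)
  have lc: "fcomp E G F \<in> Ob (Hom_ExL E E'')"
    if "exact_category E" "exact_category E'" "exact_category E''" "F \<in> Ob (Hom_ExL E E')" "G \<in> Ob (Hom_ExL E' E'')"
    for E E' E'' :: "('o, 'm) ecat" and F G
    using left_exact_cmp[OF that(1-3)] that(4,5) by (simp add: Ob_Hom_ExL)
  have lf: "fid E \<in> Ob (Hom_ExL E E)" if "exact_category E" for E :: "('o, 'm) ecat"
    using exact_imp_left_exact[OF that that fid_exact[OF that]] by (simp add: Ob_Hom_ExL)
  have pH: "mpc E E' E'' G F \<in> Hom (Hom_Ex (\<A> E) (\<A> E''))
      (fcomp (\<A> E) (mext E' E'' G) (mext E E' F)) (mext E E'' (fcomp E G F))"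
    if "exact_category E" "exact_category E'" "exact_category E''" "F \<in> Ob (Hom_ExL E E')" "G \<in> Ob (Hom_ExL E' E'')"
    for E E' E'' :: "('o, 'm) ecat" and F G
    using mpc(1)[OF that(1-3)] mE[OF that(1,2,4)] mE[OF that(2,3,5)] mE[OF that(1,3) lc[OF that]]
      exact_cmp[OF ex[OF that(1)]] that(4,5) by (simp add: Ob_Hom_ExL Ob_Hom_Ex Hom_Hom_Ex)
  have uH: "mpu E \<in> Hom (Hom_Ex (\<A> E) (\<A> E)) (fid (\<A> E)) (mext E E (fid E))"
    if "exact_category E" for E :: "('o, 'm) ecat"
    using mpu(1)[OF that] mE[OF that that lf[OF that]] fid_exact[OF ex[OF that]] by (simp add: Ob_Hom_Ex Hom_Hom_Ex)
  note simps = exact_twocat_simps(1-3) mod_adm_pseudo_simps mem_Collect_eq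
  show ?thesis
  proof (intro pseudofunctor.intro pseudofunctor_axioms.intro two_category_Ex2 two_category_ExL2,
      unfold ExL2_def Ex2_def simps(1-6) mem_Collect_eq, goal_cases)
    case (1 x) thus ?case using ex by blast
  next
    case (2 x y) thus ?case using mnt_functor by blast
  next
    case (3 x y z f g)
    thus ?case using pH[OF 3] mE[of x y f] mE[of y z g] lc[OF 3]
      by (simp add: exact_twocat_simps mod_adm_pseudo_simps)
  next
    case (4 x y z f g)
    have "is_iso (Fun (\<A> x) (\<A> z)) (mpc x y z g f)" using mpc(3)[OF 4(1-3)] 4(4,5) by (simp add: Ob_Hom_ExL)
    from is_iso_full[OF cF[OF 4(1,3)] this conjunct1[OF pH[OF 4, unfolded Hom_Hom_Ex]]] show ?case
      using pH[OF 4] unfolding Hom_Ex_def by (simp add: Hom_full)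
  next
    case (5 x y z \<sigma> f f' \<tau> g g')
    have L: "left_exact_functor x y f" "left_exact_functor x y f'" "left_exact_functor y z g" "left_exact_functor y z g'"
      "\<sigma> \<in> Hom (Fun x y) f f'" "\<tau> \<in> Hom (Fun y z) g g'" using 5(4,5) by (auto simp: Hom_Hom_ExL)
    have "nt_hcomp x z \<tau> \<sigma> \<in> Hom (Hom_ExL x z) (fcomp x g f) (fcomp x g' f')"
      using nt_hcomp_hom[OF L(5,6)] left_exact_cmp[OF 5(1-3)] L by (simp add: Hom_Hom_ExL)
    from HomAr[OF this] show ?case
      using mpc_natural[OF 5] HomAr[OF 5(4)] HomAr[OF 5(5)] mN[OF 5(1,2,4)] mN[OF 5(2,3,5)]
      by (simp add: exact_twocat_simps mod_adm_pseudo_simps Hom_Ex_simps(6))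
  next
    case (6 x) thus ?case using uH[OF 6] lf[OF 6] by (simp add: mod_adm_pseudo_simps)
  next
    case (7 x)
    from is_iso_full[OF cF[OF 7 7] mpu(3)[OF 7] conjunct1[OF uH[OF 7, unfolded Hom_Hom_Ex]]] show ?case
      using uH[OF 7] unfolding Hom_Ex_def by (simp add: Hom_full)
  next
    case (8 w x y z f g h)
    note hg = lc[OF 8(2-4,6,7)] and gf = lc[OF 8(1-3,5,6)]
    show ?case using mpc_assoc[OF 8(1-4)] 8(5-7) HomAr[OF pH[OF 8(2-4,6,7)]] HomAr[OF pH[OF 8(1-3,5,6)]]
        mI[OF 8(1,2,5)] mI[OF 8(3,4,7)]
      by (simp add: exact_twocat_simps mod_adm_pseudo_simps Hom_Ex_simps(5,6) Ob_Hom_ExL[symmetric])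
  next
    case (9 x y f)
    thus ?case using mpc_unit(1)[OF 9(1,2)] 9(3) HomAr[OF uH[OF 9(2)]] mI[OF 9]
      by (simp add: exact_twocat_simps mod_adm_pseudo_simps Hom_Ex_simps(5,6)) (simp add: Ob_Hom_ExL)
  next
    case (10 x y f)
    thus ?case using mpc_unit(2)[OF 10(1,2)] 10(3) HomAr[OF uH[OF 10(1)]] mI[OF 10]
      by (simp add: exact_twocat_simps mod_adm_pseudo_simps Hom_Ex_simps(5,6)) (simp add: Ob_Hom_ExL)
  qed
qed

text \<open>Whiskering with the Yoneda functor evaluates a transformation at representables, so the
  pseudonaturality conditions are, componentwise, the equations that define \<open>mnt\<close>,
  \<open>mpc\<close> and \<open>mpu\<close>.\<close>

lemma yoneda_pseudonatural_mod_adm: "yoneda_pseudonatural mod_adm_pseudo (mth :: ('o, 'm) ecat \<Rightarrow> _)"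
proof (rule yoneda_pseudonatural.intro)
  fix E :: "('o, 'm) ecat" assume "exact_category E"
  thus "left_exact_functor E (\<A> E) (\<Upsilon> E)" by (rule yoneda_left_exact)
next
  fix E E' :: "('o, 'm) ecat" and F assume E: "exact_category E" and E': "exact_category E'" and F: "left_exact_functor E E' F"
  have ex: "exact_category (\<A> E)" "exact_category (\<A> E')" using E E' exact_category.exact_mod_adm by blast+
  note m = mext[OF E E' F]
  have lex: "left_exact_functor E (\<A> E') (fcomp E (mext E E' F) (\<Upsilon> E))"
    "left_exact_functor E (\<A> E') (fcomp E (\<Upsilon> E') F)"
    using left_exact_cmp[OF E ex yoneda_left_exact[OF E] exact_imp_left_exact[OF ex m(1)]]
      left_exact_cmp[OF E E' ex(2) F yoneda_left_exact[OF E']] .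
  show "mth E E' F \<in> Hom (Hom_ExL E (\<A> E')) (fcomp E (Fob (P1 mod_adm_pseudo E E') F) (\<Upsilon> E)) (fcomp E (\<Upsilon> E') F)"
    using m(2) lex F by (simp add: Hom_Hom_ExL mod_adm_pseudo_simps Ob_Hom_ExL)
  show "is_iso (Hom_ExL E (\<A> E')) (mth E E' F)" unfolding Hom_ExL_def
    by (rule is_iso_full[OF category_Fun m(3,2)]) (use lex exact_cat_category E ex in auto)
next
  fix E E' :: "('o, 'm) ecat" and \<sigma> F F'
  assume E: "exact_category E" and E': "exact_category E'" and s: "\<sigma> \<in> Hom (Hom_ExL E E') F F'"
  have F: "left_exact_functor E E' F" "left_exact_functor E E' F'" and sF: "\<sigma> \<in> Hom (Fun E E') F F'"
    using s by (auto simp: Hom_Hom_ExL)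
  note Y = left_exact_functor[OF yoneda_left_exact[OF E]] and Y' = left_exact_functor[OF yoneda_left_exact[OF E']]
  note m = mnt[OF E E' s]
  have "mth E E' F' \<cdot>[Hom_ExL E (\<A> E')] nt_hcomp E (\<A> E') (mnt E E' \<sigma>) (Idn (Fun E (\<A> E)) (\<Upsilon> E))
    = nt_hcomp E (\<A> E') (Idn (Fun E' (\<A> E')) (\<Upsilon> E')) \<sigma> \<cdot>[Hom_ExL E (\<A> E')] mth E E' F"
  proof (rule nt_eqI[of _ _ "Ob E"])
    fix X assume X: "X \<in> Ob E"
    note h = nt_at[OF sF X]
    show "at (mth E E' F' \<cdot>[Hom_ExL E (\<A> E')] nt_hcomp E (\<A> E') (mnt E E' \<sigma>) (Idn (Fun E (\<A> E)) (\<Upsilon> E))) X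
      = at (nt_hcomp E (\<A> E') (Idn (Fun E' (\<A> E')) (\<Upsilon> E')) \<sigma> \<cdot>[Hom_ExL E (\<A> E')] mth E E' F) X"
      using m(2)[OF X] X h hcomp_idn_right[OF m(1) Y X] hcomp_idn_left[OF sF Y' X]
      by (simp add: Hom_ExL_simps Fun_at yoneda_def hom_iff)
  qed (use m(1) mext(2)[OF E E' F(1)] mext(2)[OF E E' F(2)] sF in \<open>simp_all add: Hom_ExL_simps Fun_simps nt_hcomp_simps Hom_Fun\<close>)
  thus "mth E E' F' \<cdot>[Hom_ExL E (\<A> E')]
      nt_hcomp E (\<A> E') (Far (P1 mod_adm_pseudo E E') \<sigma>) (Idn (Fun E (\<A> E)) (\<Upsilon> E))
    = nt_hcomp E (\<A> E') (Idn (Fun E' (\<A> E')) (\<Upsilon> E')) \<sigma> \<cdot>[Hom_ExL E (\<A> E')] mth E E' F"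
    using s by (simp add: mod_adm_pseudo_simps hom_iff)
next
  fix E E' E'' :: "('o, 'm) ecat" and F G
  assume E: "exact_category E" and E': "exact_category E'" and E'': "exact_category E''"
    and F: "left_exact_functor E E' F" and G: "left_exact_functor E' E'' G"
  note Y = left_exact_functor[OF yoneda_left_exact[OF E]] and Ff = left_exact_functor[OF F] and eG = mext_functor[OF E' E'' G]
  note p = mpc[OF E E' E'' F G] and mF = mext[OF E E' F] and mG = mext[OF E' E'' G]
    and mGF = mext[OF E E'' left_exact_cmp[OF E E' E'' F G]]
  have "mth E E'' (fcomp E G F) \<cdot>[Hom_ExL E (\<A> E'')]
      nt_hcomp E (\<A> E'') (mpc E E' E'' G F) (Idn (Fun E (\<A> E)) (\<Upsilon> E)) =
    nt_hcomp E (\<A> E'') (mth E' E'' G) (Idn (Fun E E') F) \<cdot>[Hom_ExL E (\<A> E'')]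
      nt_hcomp E (\<A> E'') (Idn (Fun (\<A> E') (\<A> E'')) (mext E' E'' G)) (mth E E' F)" (is "?l = ?r")
  proof (rule nt_eqI[of _ _ "Ob E"])
    fix X assume X: "X \<in> Ob E"
    show "at ?l X = at ?r X"
      using p(2)[OF X] X hcomp_idn_right[OF p(1) Y X] hcomp_idn_right[OF mG(2) Ff X] hcomp_idn_left[OF mF(2) eG X]
      by (simp add: Hom_ExL_simps Fun_at yoneda_def)
  qed (use p(1) mF(2) mG(2) mGF(2)
      in \<open>simp_all add: fcomp_assoc[OF Y] fcomp_assoc[OF Ff] Hom_ExL_simps Fun_simps nt_hcomp_simps Hom_Fun\<close>)
  thus "mth E E'' (fcomp E G F) \<cdot>[Hom_ExL E (\<A> E'')]
      nt_hcomp E (\<A> E'') (PC mod_adm_pseudo E E' E'' G F) (Idn (Fun E (\<A> E)) (\<Upsilon> E)) =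
    nt_hcomp E (\<A> E'') (mth E' E'' G) (Idn (Fun E E') F) \<cdot>[Hom_ExL E (\<A> E'')]
      nt_hcomp E (\<A> E'') (Idn (Fun (\<A> E') (\<A> E'')) (Fob (P1 mod_adm_pseudo E' E'') G)) (mth E E' F)"
    using G by (simp add: mod_adm_pseudo_simps Ob_Hom_ExL)
next
  fix E :: "('o, 'm) ecat" assume E: "exact_category E"
  note Y = left_exact_functor[OF yoneda_left_exact[OF E]] and u = mpu[OF E]
    and m = mext[OF E E exact_imp_left_exact[OF E E fid_exact[OF E]]]
  show "mth E E (fid E) \<cdot>[Hom_ExL E (\<A> E)]
      nt_hcomp E (\<A> E) (PU mod_adm_pseudo E) (Idn (Fun E (\<A> E)) (\<Upsilon> E)) = Idn (Fun E (\<A> E)) (\<Upsilon> E)"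
    (is "?l = ?r")
  proof (rule nt_eqI[of _ _ "Ob E"])
    fix X assume X: "X \<in> Ob E"
    show "at ?l X = at ?r X"
      using u(2)[OF X] X hcomp_idn_right[OF u(1) Y X] by (simp add: mod_adm_pseudo_simps Hom_ExL_simps Fun_at yoneda_def)
  qed (use u(1) m(2) fcomp_fid[OF Y] in \<open>simp_all add: mod_adm_pseudo_simps Hom_ExL_simps Fun_simps nt_hcomp_simps Hom_Fun\<close>)
qed

theorem corollary3p15: shows "\<exists>(P :: (('o, 'm) ecat, ('o, 'm, 'o, 'm) ftr, ('o, 'm, 'o, 'm) nt,
              (('o, 'm) md, ('o, 'm) md_hom) ecat,
              (('o, 'm) md, ('o, 'm) md_hom, ('o, 'm) md, ('o, 'm) md_hom) ftr,
              (('o, 'm) md, ('o, 'm) md_hom, ('o, 'm) md, ('o, 'm) md_hom) nt) pseudo) \<theta>.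
     pseudofunctor ExL2 Ex2 P \<and> (\<forall>E. exact_category E \<longrightarrow> P0 P E = mod_adm E) \<and>
     yoneda_pseudonatural P \<theta> \<and> (\<forall>(E :: ('o, 'm) ecat) (E' :: ('p, 'n) ecat).
        exact_category E \<longrightarrow> exact_category E' \<longrightarrow>
        cat_equivalence (Hom_Ex (mod_adm E) E') (Hom_ExL E E') (yoneda_restriction E E'))"
  using pseudofunctor_mod_adm yoneda_pseudonatural_mod_adm restriction_equivalence
  by (intro exI[of _ mod_adm_pseudo] exI[of _ mth] conjI allI impI) (simp_all add: mod_adm_pseudo_simps)

end
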